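(* Let $s\ge 0$. There exists $C_1>0$ such that the following holds. Let $T_0>0$ and let $U\in C([0,T_0],H^{3+s}(\mathbb{R}))$ be a real-valued solution of the Whitham system $$\partial_T^2U=\partial_X^2U+\partial_X^2(U^2),\qquad X\in\mathbb{R},\ T\in[0,T_0],$$ with $$\sup_{T\in[0,T_0]}\|U(\cdot,T)\|_{H^{3+s}(\mathbb{R})}\le C_1.$$ Then there exist $\varepsilon_0>0$ and $C>0$ such that for all $\varepsilon\in(0,\varepsilon_0)$ there are solutions $u=u(x,t)$ of the Boussinesq equation $$\partial_t^2u=\partial_x^2u-\partial_x^4u+\partial_x^2(u^2),\qquad x\in\mathbb{R},$$ with $$\sup_{t\in[0,T_0/\varepsilon]}\big\|u(\cdot,t)-U(\varepsilon\,\cdot,\varepsilon t)\big\|_{H^{1+s}(\mathbb{R})}\le C\,\varepsilon^{3/2}.$$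
   Context: $u(x,t)\in\mathbb{R}$. $H^r(\mathbb{R})$ is the $L^2$-based Sobolev space with norm $\|u\|_{H^r}^2=\int|\widehat u(k)|^2(1+k^2)^r\,dk$. Constants such as $C$ are independent of the small parameter $\varepsilon$. *)

theory Defs
  imports "HOL-Analysis.Analysis"
begin

definition square_integrable :: "(real \<Rightarrow> 'a::{real_normed_vector, second_countable_topology}) \<Rightarrow> bool"
  where "square_integrable f \<longleftrightarrow>
    f \<in> borel_measurable lborel \<and> integrable lborel (\<lambda>x. (norm (f x))\<^sup>2)"

definition truncated_fourier :: "nat \<Rightarrow> (real \<Rightarrow> real) \<Rightarrow> real \<Rightarrow> complex"
  where "truncated_fourier N u k =
    complex_of_real (1 / sqrt (2 * pi)) *
      (LBINT x:{- real N..real N}. cis (- (k * x)) * complex_of_real (u x))"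

text \<open>Plancherel's definition: the Fourier transform of a square integrable function is the
  mean-square limit of the truncated Fourier integrals, in the unitary normalization. The
  convergence is stated with the nonnegative integral, because the Bochner integral of a
  non-integrable function is \<open>0\<close>.\<close>

definition is_fourier_transform :: "(real \<Rightarrow> real) \<Rightarrow> (real \<Rightarrow> complex) \<Rightarrow> bool"
  where "is_fourier_transform u v \<longleftrightarrow> square_integrable v \<and>
    (\<lambda>N. \<integral>\<^sup>+ k. ennreal ((cmod (truncated_fourier N u k - v k))\<^sup>2) \<partial>lborel) \<longlonglongrightarrow> 0"

text \<open>The limit is unique up to null sets, and only integrals of the chosen representative occur
  below.\<close>

definition fourier :: "(real \<Rightarrow> real) \<Rightarrow> real \<Rightarrow> complex"
  where "fourier u = (SOME v. is_fourier_transform u v)"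

text \<open>The space \<open>H\<^sup>r\<close> for \<open>r \<ge> 0\<close>, as a space of Borel functions instead of classes modulo null
  sets (every class has a Borel representative); thus \<open>sobolev_norm r\<close> is a seminorm that vanishes
  exactly on the functions that are zero almost everywhere.\<close>

definition sobolev :: "real \<Rightarrow> (real \<Rightarrow> real) set"
  where "sobolev r = {u. square_integrable u \<and>
    integrable lborel (\<lambda>k. (cmod (fourier u k))\<^sup>2 * (1 + k\<^sup>2) powr r)}"

definition sobolev_norm :: "real \<Rightarrow> (real \<Rightarrow> real) \<Rightarrow> real"
  where "sobolev_norm r u =
    sqrt (\<integral>k. (cmod (fourier u k))\<^sup>2 * (1 + k\<^sup>2) powr r \<partial>lborel)"

text \<open>\<open>u \<in> C([0,T], H\<^sup>r)\<close>, where \<open>u x t\<close> has the space variable first.\<close>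

definition continuous_in_sobolev :: "real \<Rightarrow> real \<Rightarrow> (real \<Rightarrow> real \<Rightarrow> real) \<Rightarrow> bool"
  where "continuous_in_sobolev r T u \<longleftrightarrow>
    (\<forall>t\<in>{0..T}. (\<lambda>x. u x t) \<in> sobolev r) \<and>
    (\<forall>t\<in>{0..T}. ((\<lambda>t'. sobolev_norm r (\<lambda>x. u x t' - u x t)) \<longlongrightarrow> 0) (at t within {0..T}))"

definition test_function :: "(real \<Rightarrow> real) \<Rightarrow> bool"
  where "test_function \<phi> \<longleftrightarrow>
    (\<forall>n x. (deriv ^^ n) \<phi> field_differentiable at x) \<and> bounded {x. \<phi> x \<noteq> 0}"

definition has_second_derivative_on ::
    "(real \<Rightarrow> real) \<Rightarrow> (real \<Rightarrow> real) \<Rightarrow> real set \<Rightarrow> bool"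
  where "has_second_derivative_on f f'' S \<longleftrightarrow>
    (\<exists>f'. \<forall>t\<in>S. (f has_real_derivative f' t) (at t within S) \<and>
                (f' has_real_derivative f'' t) (at t within S))"

text \<open>Solutions are taken in the sense of distributions: the equation is paired with a test
  function \<open>\<phi>\<close> of the space variable, the spatial derivatives are moved to \<open>\<phi>\<close> (all of even
  order, hence no sign changes), and the time derivatives (one-sided at \<open>0\<close> and \<open>T\<close>) are those
  of the pairing. For \<open>u \<in> C([0,T], L\<^sup>2)\<close> this is the same as the equation holding in the
  distributions on the open strip. A pointwise fourth derivative would not be available for the
  Boussinesq equation in \<open>H\<^sup>r\<close> with \<open>r\<close> close to \<open>1\<close>.\<close>

definition whitham_solution :: "real \<Rightarrow> (real \<Rightarrow> real \<Rightarrow> real) \<Rightarrow> bool"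
  where "whitham_solution T u \<longleftrightarrow>
    (\<forall>\<phi>. test_function \<phi> \<longrightarrow>
      has_second_derivative_on
        (\<lambda>t. \<integral>x. u x t * \<phi> x \<partial>lborel)
        (\<lambda>t. (\<integral>x. u x t * (deriv ^^ 2) \<phi> x \<partial>lborel)
           + (\<integral>x. (u x t)\<^sup>2 * (deriv ^^ 2) \<phi> x \<partial>lborel))
        {0..T})"

definition boussinesq_solution :: "real \<Rightarrow> (real \<Rightarrow> real \<Rightarrow> real) \<Rightarrow> bool"
  where "boussinesq_solution T u \<longleftrightarrow>
    (\<forall>\<phi>. test_function \<phi> \<longrightarrow>
      has_second_derivative_on
        (\<lambda>t. \<integral>x. u x t * \<phi> x \<partial>lborel)
        (\<lambda>t. (\<integral>x. u x t * (deriv ^^ 2) \<phi> x \<partial>lborel)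
           - (\<integral>x. u x t * (deriv ^^ 4) \<phi> x \<partial>lborel)
           + (\<integral>x. (u x t)\<^sup>2 * (deriv ^^ 2) \<phi> x \<partial>lborel))
        {0..T})"

end

theory Submission
  imports Defs "HOL-Probability.Probability"
begin

text \<open>On the slow scales and in frequency space, let \<open>p\<close> be the error of the Whitham approximation
  multiplied by the Sobolev weight \<open>wt (1 + s) (eps * k)\<close>. It solves \<open>p'' = - om\<^sup>2 p + om h\<close> with
  \<open>om k = \<bar>k\<bar> (1 + eps\<^sup>2 k\<^sup>2)\<^sup>1\<^sup>/\<^sup>2\<close>, where \<open>h\<close> is the sum of a term linear in \<open>p\<close> with the transform \<open>V\<close> of
  the profile as coefficient, a quadratic term, and the residual \<open>eps\<^sup>2 k\<^sup>2 V\<close>. For fixed \<open>eps\<close> all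
  of these are bounded operators, and replacing \<open>p\<close> in the quadratic term by its radial retraction
  onto a ball makes \<open>h\<close> globally Lipschitz, so that Picard iteration in Duhamel's formula gives \<open>p\<close>.

  The linear term is not bounded uniformly in \<open>eps\<close>. Up to a commutator it is however the time
  derivative of the quadratic form \<open>\<integral>\<integral> cnj (a k) V (k - l) a l\<close> with \<open>a k = p k / wt 1 (eps * k)\<close>.
  Adding this form to the energy \<open>\<parallel>p\<parallel>\<^sup>2 + \<parallel>q\<parallel>\<^sup>2\<close>, where \<open>p' = om q\<close>, yields a quantity that is equivalent
  to the energy because \<open>\<integral>\<bar>V\<bar>\<close> is small (this is the role of \<open>C\<^sub>1\<close>) and that grows at a rate independent
  of \<open>eps\<close>. Hence \<open>\<parallel>p\<parallel> = O(eps\<^sup>2)\<close>, the retraction is inactive for small \<open>eps\<close>, and undoing the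
  scaling costs \<open>eps\<^sup>1\<^sup>/\<^sup>2\<close>.\<close>

text \<open>Two difficulties shape the construction. The Whitham equation is given only against test
  functions, and \<open>fourier\<close> is an arbitrary choice at each time, so an energy can be
  differentiated only after the transform has been replaced by a jointly measurable version that is
  twice differentiable in time at almost every frequency. That requires the Plancherel theory and
  the separation property of test functions. The weight \<open>wt (1 + s) (eps * k)\<close> is the
  weight of \<open>H\<close> of order \<open>1 + s\<close> in the fast variable, seen at the slow
  frequency. The radius of the ball is \<open>eps powr (3 / 2)\<close>: the product estimate in this
  weight costs the power \<open>- 1 / 2\<close> of \<open>eps\<close> and the frequency multiplier
  costs another factor \<open>1 / eps\<close>, so on this ball the quadratic term contributes
  \<open>O(1)\<close> to the growth rate, while an error of size \<open>eps\<^sup>2\<close> lies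
  inside the ball for small \<open>eps\<close>. The commutator is harmless because a difference of
  weights at \<open>eps * k\<close> and \<open>eps * l\<close> gains the factor \<open>eps\<close>
  that a bare \<open>\<bar>k\<bar>\<close> costs. The three derivatives beyond order
  \<open>s\<close> are those of the residual, \<open>\<bar>k\<bar>\<close> from the multiplier and
  \<open>k\<^sup>2\<close> from the dispersion. The error starts from rest, hence all Duhamel
  formulas begin at zero.\<close>

abbreviation L2 :: "(real \<Rightarrow> 'a::{real_normed_vector, second_countable_topology}) \<Rightarrow> bool"
  where "L2 \<equiv> square_integrable"
abbreviation cx :: "real \<Rightarrow> complex"
  where "cx \<equiv> complex_of_real"
abbreviation jointly_measurable :: "(real \<Rightarrow> real \<Rightarrow> 'a::topological_space) \<Rightarrow> bool"
  where "jointly_measurable f \<equiv> case_prod f \<in> borel_measurable (borel \<Otimes>\<^sub>M borel)"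

section \<open>The seminorm of square integrable functions\<close>

definition l2norm :: "(real \<Rightarrow> 'a::{real_normed_vector, second_countable_topology}) \<Rightarrow> real"
  where "l2norm f = sqrt (LBINT x. (norm (f x))\<^sup>2)"

lemma L2_measurable [measurable_dest]:
  "L2 f \<Longrightarrow> f \<in> borel_measurable borel"
  by (simp add: square_integrable_def)

lemma l2norm_nonneg [simp]: "l2norm f \<ge> 0"
  by (simp add: l2norm_def)

lemma l2norm_sq: "(l2norm f)\<^sup>2 = (LBINT x. (norm (f x))\<^sup>2)"
  by (simp add: l2norm_def)

lemma L2_iff_nn:
  assumes [measurable]: "f \<in> borel_measurable borel"
  shows "L2 f \<longleftrightarrow> (\<integral>\<^sup>+ x. ennreal ((norm (f x))\<^sup>2) \<partial>lborel) < \<infinity>"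
  by (auto simp: square_integrable_def integrable_iff_bounded)

lemma nn_integral_square:
  assumes "L2 f"
  shows "(\<integral>\<^sup>+ x. ennreal ((norm (f x))\<^sup>2) \<partial>lborel) = ennreal ((l2norm f)\<^sup>2)"
  unfolding l2norm_sq using assms
  by (subst nn_integral_eq_integral) (auto simp: square_integrable_def)

text \<open>A Bochner integral is \<open>0\<close> when the integrand is not integrable, so a bound
  on \<open>l2norm\<close> alone says nothing about membership. The nonnegative integral settles
  both at once.\<close>

lemma L2_leI:
  assumes [measurable]: "f \<in> borel_measurable borel"
    and "(\<integral>\<^sup>+ x. ennreal ((norm (f x))\<^sup>2) \<partial>lborel) \<le> ennreal (c\<^sup>2)" "c \<ge> 0"
  shows "L2 f" "l2norm f \<le> c"
proof -
  show sq: "L2 f"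
    using assms(2) by (simp add: L2_iff_nn order_le_less_trans)
  have "(l2norm f)\<^sup>2 \<le> c\<^sup>2"
    using assms nn_integral_square[OF sq] by simp
  then show "l2norm f \<le> c" using assms(3) by (rule power2_le_imp_le)
qed

lemma L2_mono:
  assumes g: "L2 g" and [measurable]: "f \<in> borel_measurable borel"
    and le: "AE x in lborel. norm (f x) \<le> norm (g x)"
  shows "L2 f" "l2norm f \<le> l2norm g"
proof -
  have "(\<integral>\<^sup>+ x. ennreal ((norm (f x))\<^sup>2) \<partial>lborel) \<le> (\<integral>\<^sup>+ x. ennreal ((norm (g x))\<^sup>2) \<partial>lborel)"
    using le by (intro nn_integral_mono_AE) (auto intro!: ennreal_leI power_mono)
  also have "\<dots> = ennreal ((l2norm g)\<^sup>2)" by (rule nn_integral_square[OF g])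
  finally have *: "(\<integral>\<^sup>+ x. ennreal ((norm (f x))\<^sup>2) \<partial>lborel) \<le> ennreal ((l2norm g)\<^sup>2)" .
  from L2_leI[OF assms(2) *] show "L2 f" "l2norm f \<le> l2norm g" by auto
qed

lemma l2norm_cong_AE:
  assumes "AE x in lborel. norm (f x) = norm (g x)"
    "f \<in> borel_measurable borel" "g \<in> borel_measurable borel"
  shows "l2norm f = l2norm g"
  unfolding l2norm_def using assms by (intro arg_cong[where f=sqrt] integral_cong_AE) auto

lemma L2_cong_AE:
  assumes "AE x in lborel. norm (f x) = norm (g x)"
    "f \<in> borel_measurable borel" "L2 g"
  shows "L2 f"
  using assms by (intro L2_mono(1)[of g f]) auto

lemma L2_norm:
  "L2 f \<Longrightarrow> L2 (\<lambda>x. norm (f x))" "l2norm (\<lambda>x. norm (f x)) = l2norm f"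
  by (auto simp: square_integrable_def l2norm_def)

lemma L2_of_real:
  "L2 (\<lambda>x. cx (f x)) \<longleftrightarrow> L2 f"
  "l2norm (\<lambda>x. cx (f x)) = l2norm f"
proof -
  have "f \<in> borel_measurable borel" if "(\<lambda>x. cx (f x)) \<in> borel_measurable borel"
  proof -
    have "(\<lambda>x. Re (cx (f x))) \<in> borel_measurable borel" using that by measurable
    then show ?thesis by simp
  qed
  then have "(\<lambda>x. cx (f x)) \<in> borel_measurable borel \<longleftrightarrow> f \<in> borel_measurable borel"
    by (metis borel_measurable_of_real measurable_compose)
  then show "L2 (\<lambda>x. cx (f x)) \<longleftrightarrow> L2 f"
    by (simp add: square_integrable_def)
qed (auto simp: l2norm_def)

lemma L2_cmult:
  fixes f :: "real \<Rightarrow> 'a::{real_normed_field, second_countable_topology}"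
  assumes "L2 f"
  shows "L2 (\<lambda>x. c * f x)" "l2norm (\<lambda>x. c * f x) = norm c * l2norm f"
  using assms by (auto simp: square_integrable_def l2norm_def norm_mult power_mult_distrib real_sqrt_mult)

lemma L2_cmult_mono:
  fixes f :: "real \<Rightarrow> 'a::{real_normed_vector, second_countable_topology}"
    and g :: "real \<Rightarrow> 'b::{real_normed_vector, second_countable_topology}"
  assumes g: "L2 g" and [measurable]: "f \<in> borel_measurable borel"
    and le: "AE x in lborel. norm (f x) \<le> c * norm (g x)" and "c \<ge> 0"
  shows "L2 f" "l2norm f \<le> c * l2norm g"
proof -
  have g': "L2 (\<lambda>x. c * norm (g x))" "l2norm (\<lambda>x. c * norm (g x)) = c * l2norm g"
    using L2_cmult[OF L2_norm(1)[OF g], of c]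
    by (auto simp: L2_norm(2) \<open>c \<ge> 0\<close>)
  have "AE x in lborel. norm (f x) \<le> norm (c * norm (g x))" using le \<open>c \<ge> 0\<close> by simp
  from L2_mono[OF g'(1) assms(2) this] g'(2)
  show "L2 f" "l2norm f \<le> c * l2norm g" by auto
qed

lemma cauchy_schwarz:
  assumes f: "L2 f" and g: "L2 g"
  shows "integrable lborel (\<lambda>x. norm (f x) * norm (g x))"
    "(LBINT x. norm (f x) * norm (g x)) \<le> l2norm f * l2norm g"
proof -
  have [measurable]: "f \<in> borel_measurable borel" "g \<in> borel_measurable borel"
    using f g by auto
  have sq: "(\<integral>\<^sup>+ x. ennreal (norm (f x) * norm (g x)) \<partial>lborel)\<^sup>2 \<le> ennreal ((l2norm f * l2norm g)\<^sup>2)"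
  proof -
    have "(\<integral>\<^sup>+ x. ennreal (norm (f x)) * ennreal (norm (g x)) \<partial>lborel)\<^sup>2
      \<le> (\<integral>\<^sup>+ x. (ennreal (norm (f x)))\<^sup>2 \<partial>lborel) * (\<integral>\<^sup>+ x. (ennreal (norm (g x)))\<^sup>2 \<partial>lborel)"
      by (rule Cauchy_Schwarz_nn_integral) auto
    then show ?thesis using nn_integral_square[OF f] nn_integral_square[OF g]
      by (simp add: ennreal_mult ennreal_power power_mult_distrib)
  qed
  show I: "integrable lborel (\<lambda>x. norm (f x) * norm (g x))"
  proof (rule Bochner_Integration.integrable_bound[where f="\<lambda>x. (norm (f x))\<^sup>2 + (norm (g x))\<^sup>2"])
    show "integrable lborel (\<lambda>x. (norm (f x))\<^sup>2 + (norm (g x))\<^sup>2)"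
      using f g by (auto simp: square_integrable_def)
    have "a * b \<le> a\<^sup>2 + b\<^sup>2" if "a \<ge> 0" "b \<ge> 0" for a b :: real
      using sum_squares_bound[of a b] mult_nonneg_nonneg[OF that] by linarith
    then show "AE x in lborel. norm (norm (f x) * norm (g x)) \<le> norm ((norm (f x))\<^sup>2 + (norm (g x))\<^sup>2)"
      by simp
  qed auto
  have "(\<integral>\<^sup>+ x. ennreal (norm (f x) * norm (g x)) \<partial>lborel) = ennreal (LBINT x. norm (f x) * norm (g x))"
    using I by (intro nn_integral_eq_integral) auto
  with sq have "(LBINT x. norm (f x) * norm (g x))\<^sup>2 \<le> (l2norm f * l2norm g)\<^sup>2"
    by (simp add: ennreal_power)
  then show "(LBINT x. norm (f x) * norm (g x)) \<le> l2norm f * l2norm g"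
    by (rule power2_le_imp_le) simp
qed

lemma cauchy_schwarz_mult:
  fixes f g :: "real \<Rightarrow> 'a::{real_normed_field, banach, second_countable_topology}"
  assumes f: "L2 f" and g: "L2 g"
  shows "integrable lborel (\<lambda>x. f x * g x)"
    "norm (LBINT x. f x * g x) \<le> l2norm f * l2norm g"
proof -
  have [measurable]: "f \<in> borel_measurable borel" "g \<in> borel_measurable borel"
    using f g by auto
  show "integrable lborel (\<lambda>x. f x * g x)"
    by (rule Bochner_Integration.integrable_bound[OF cauchy_schwarz(1)[OF f g]]) (auto simp: norm_mult)
  have "norm (LBINT x. f x * g x) \<le> (LBINT x. norm (f x * g x))" by (rule integral_norm_bound)
  also have "\<dots> \<le> l2norm f * l2norm g" using cauchy_schwarz(2)[OF f g] by (simp add: norm_mult)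
  finally show "norm (LBINT x. f x * g x) \<le> l2norm f * l2norm g" .
qed

lemma L2_add:
  assumes f: "L2 f" and g: "L2 g"
  shows "L2 (\<lambda>x. f x + g x)" "l2norm (\<lambda>x. f x + g x) \<le> l2norm f + l2norm g"
proof -
  have [measurable]: "f \<in> borel_measurable borel" "g \<in> borel_measurable borel"
    using f g by auto
  have le: "(norm (f x + g x))\<^sup>2 \<le> (norm (f x))\<^sup>2 + 2 * (norm (f x) * norm (g x)) + (norm (g x))\<^sup>2" for x
    using power_mono[OF norm_triangle_ineq[of "f x" "g x"], of 2] by (simp add: power2_sum)
  have I: "integrable lborel (\<lambda>x. (norm (f x))\<^sup>2 + 2 * (norm (f x) * norm (g x)) + (norm (g x))\<^sup>2)"
    using f g cauchy_schwarz(1)[OF f g] by (auto simp: square_integrable_def)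
  show s: "L2 (\<lambda>x. f x + g x)"
    unfolding square_integrable_def
  proof
    show "integrable lborel (\<lambda>x. (norm (f x + g x))\<^sup>2)"
    proof (rule Bochner_Integration.integrable_bound[OF I])
      have "norm ((norm (f x + g x))\<^sup>2)
        \<le> norm ((norm (f x))\<^sup>2 + 2 * (norm (f x) * norm (g x)) + (norm (g x))\<^sup>2)" for x
        using order_trans[OF le abs_ge_self] by simp
      then show "AE x in lborel. norm ((norm (f x + g x))\<^sup>2)
        \<le> norm ((norm (f x))\<^sup>2 + 2 * (norm (f x) * norm (g x)) + (norm (g x))\<^sup>2)" by blast
    qed simp
  qed simp
  have "(l2norm (\<lambda>x. f x + g x))\<^sup>2 \<le> (LBINT x. (norm (f x))\<^sup>2 + 2 * (norm (f x) * norm (g x)) + (norm (g x))\<^sup>2)"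
    unfolding l2norm_sq using s by (intro integral_mono I le) (simp add: square_integrable_def)
  also have "\<dots> = (l2norm f)\<^sup>2 + 2 * (LBINT x. norm (f x) * norm (g x)) + (l2norm g)\<^sup>2"
    using f g cauchy_schwarz(1)[OF f g] by (auto simp: square_integrable_def l2norm_sq)
  also have "\<dots> \<le> (l2norm f + l2norm g)\<^sup>2" using cauchy_schwarz(2)[OF f g] by (simp add: power2_sum)
  finally show "l2norm (\<lambda>x. f x + g x) \<le> l2norm f + l2norm g"
    by (rule power2_le_imp_le) simp
qed

lemma L2_uminus:
  "L2 f \<Longrightarrow> L2 (\<lambda>x. - f x)" "l2norm (\<lambda>x. - f x) = l2norm f"
  by (auto simp: square_integrable_def l2norm_def)

lemma L2_diff:
  assumes f: "L2 f" and g: "L2 g"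
  shows "L2 (\<lambda>x. f x - g x)" "l2norm (\<lambda>x. f x - g x) \<le> l2norm f + l2norm g"
  using L2_add[OF f L2_uminus(1)[OF g]]
  by (auto simp: L2_uminus(2))

lemma l2norm_diff_abs:
  assumes f: "L2 f" and g: "L2 g"
  shows "\<bar>l2norm f - l2norm g\<bar> \<le> l2norm (\<lambda>x. f x - g x)"
proof -
  have 1: "l2norm f \<le> l2norm (\<lambda>x. f x - g x) + l2norm g"
    using L2_add(2)[OF L2_diff(1)[OF f g] g] by simp
  have "l2norm g \<le> l2norm (\<lambda>x. g x - f x) + l2norm f"
    using L2_add(2)[OF L2_diff(1)[OF g f] f] by simp
  moreover have "l2norm (\<lambda>x. g x - f x) = l2norm (\<lambda>x. f x - g x)"
    by (simp add: l2norm_def norm_minus_commute)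
  ultimately show ?thesis using 1 by linarith
qed

lemma l2norm_minus_commute: "l2norm (\<lambda>x. f x - g x) = l2norm (\<lambda>x. g x - f x)"
  by (simp add: l2norm_def norm_minus_commute)

lemma l2norm_triangle:
  assumes f: "L2 f" and g: "L2 g" and h: "L2 h"
  shows "l2norm (\<lambda>x. f x - h x) \<le> l2norm (\<lambda>x. f x - g x) + l2norm (\<lambda>x. g x - h x)"
  using L2_add(2)[OF L2_diff(1)[OF f g] L2_diff(1)[OF g h]]
  by simp

lemma L2_sum:
  assumes "finite I" "\<And>i. i \<in> I \<Longrightarrow> L2 (f i)"
  shows "L2 (\<lambda>x. \<Sum>i\<in>I. f i x) \<and> l2norm (\<lambda>x. \<Sum>i\<in>I. f i x) \<le> (\<Sum>i\<in>I. l2norm (f i))"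
  using assms
proof (induction I rule: finite_induct)
  case empty
  then show ?case by (simp add: square_integrable_def l2norm_def)
next
  case (insert i I)
  then show ?case
    using L2_add[of "f i" "\<lambda>x. \<Sum>i\<in>I. f i x"] by fastforce
qed

lemma l2norm_zero_iff:
  assumes f: "L2 f"
  shows "l2norm f = 0 \<longleftrightarrow> (AE x in lborel. f x = 0)"
  using f unfolding l2norm_def square_integrable_def
  by (simp add: integral_nonneg_eq_0_iff_AE)

lemma L2_affine:
  fixes f :: "real \<Rightarrow> 'a::{real_normed_vector, second_countable_topology}"
  assumes f: "L2 f" and c: "c \<noteq> 0"
  shows "L2 (\<lambda>x. f (t + c * x))" "l2norm (\<lambda>x. f (t + c * x)) = l2norm f / sqrt \<bar>c\<bar>"
proof -
  have [measurable]: "f \<in> borel_measurable borel" using f by auto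
  have *: "integrable lborel (\<lambda>x. (norm (f x))\<^sup>2)" using f by (simp add: square_integrable_def)
  from lborel_integrable_real_affine[OF this c, of t]
  show "L2 (\<lambda>x. f (t + c * x))"
    by (simp add: square_integrable_def)
  show "l2norm (\<lambda>x. f (t + c * x)) = l2norm f / sqrt \<bar>c\<bar>"
    unfolding l2norm_def using c
    by (subst (2) lborel_integral_real_affine[OF c, of _ t]) (simp add: real_sqrt_mult)
qed

subsection \<open>Young's inequality\<close>

text \<open>Cauchy-Schwarz in \<open>l\<close> puts the square on \<open>g\<close> alone; Tonelli
  then evaluates the remaining double integral exactly.\<close>

lemma young_nn:
  fixes f g :: "real \<Rightarrow> ennreal"
  assumes [measurable]: "f \<in> borel_measurable borel" "g \<in> borel_measurable borel"
  shows "(\<integral>\<^sup>+ k. (\<integral>\<^sup>+ l. f (k - l) * g l \<partial>lborel)\<^sup>2 \<partial>lborel) \<le>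
    (\<integral>\<^sup>+ x. f x \<partial>lborel)\<^sup>2 * (\<integral>\<^sup>+ x. (g x)\<^sup>2 \<partial>lborel)"
proof -
  let ?F = "\<integral>\<^sup>+ x. f x \<partial>lborel"
  have shift: "(\<integral>\<^sup>+ l. f (k - l) \<partial>lborel) = ?F" for k
    using nn_integral_real_affine[of f "-1" k] by simp
  have shift': "(\<integral>\<^sup>+ k. f (k - l) \<partial>lborel) = ?F" for l
    using nn_integral_real_affine[of f 1 "-l"] by simp
  have CS: "(\<integral>\<^sup>+ l. f (k - l) * g l \<partial>lborel)\<^sup>2 \<le> ?F * (\<integral>\<^sup>+ l. f (k - l) * (g l)\<^sup>2 \<partial>lborel)" for k
  proof -
    \<comment> \<open>With this density as the measure, whose total mass is \<open>?F\<close> for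
      every \<open>k\<close>, Cauchy-Schwarz is applied to the constant \<open>1\<close> and
      \<open>g\<close>.\<close>
    let ?M = "density lborel (\<lambda>l. f (k - l))"
    have "(\<integral>\<^sup>+ l. 1 * g l \<partial>?M)\<^sup>2 \<le> (\<integral>\<^sup>+ l. 1\<^sup>2 \<partial>?M) * (\<integral>\<^sup>+ l. (g l)\<^sup>2 \<partial>?M)"
      by (rule Cauchy_Schwarz_nn_integral) auto
    then show ?thesis by (simp add: nn_integral_density emeasure_density shift)
  qed
  have "(\<integral>\<^sup>+ k. (\<integral>\<^sup>+ l. f (k - l) * g l \<partial>lborel)\<^sup>2 \<partial>lborel) \<le>
     (\<integral>\<^sup>+ k. ?F * (\<integral>\<^sup>+ l. f (k - l) * (g l)\<^sup>2 \<partial>lborel) \<partial>lborel)"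
    by (intro nn_integral_mono CS)
  also have "\<dots> = ?F * (\<integral>\<^sup>+ k. (\<integral>\<^sup>+ l. f (k - l) * (g l)\<^sup>2 \<partial>lborel) \<partial>lborel)"
    by (rule nn_integral_cmult) measurable
  also have "(\<integral>\<^sup>+ k. (\<integral>\<^sup>+ l. f (k - l) * (g l)\<^sup>2 \<partial>lborel) \<partial>lborel)
      = (\<integral>\<^sup>+ l. (\<integral>\<^sup>+ k. f (k - l) * (g l)\<^sup>2 \<partial>lborel) \<partial>lborel)"
    by (rule lborel_pair.Fubini') measurable
  also have "\<dots> = (\<integral>\<^sup>+ l. ?F * (g l)\<^sup>2 \<partial>lborel)"
    by (intro nn_integral_cong, subst nn_integral_multc) (auto simp: shift')
  also have "\<dots> = ?F * (\<integral>\<^sup>+ l. (g l)\<^sup>2 \<partial>lborel)" by (rule nn_integral_cmult) measurable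
  finally show ?thesis by (simp add: power2_eq_square mult.assoc)
qed

text \<open>The linear interaction with the profile and the commutator are both integral operators
  whose kernels, once the weights have been absorbed, are dominated by a function of
  \<open>k - l\<close> times a function of \<open>l\<close>. Integrability of almost every section
  is recorded as well, since the value of a Bochner integral does not imply it.\<close>

lemma young_kernel:
  fixes G :: "real \<Rightarrow> real \<Rightarrow> 'a::{banach, second_countable_topology}" and a b :: "real \<Rightarrow> real"
  assumes G [measurable]: "jointly_measurable G"
    and le: "\<And>k l. norm (G k l) \<le> a (k - l) * b l"
    and a: "integrable lborel a" "\<And>x. a x \<ge> 0" and b: "L2 b" "\<And>x. b x \<ge> 0"
  shows "L2 (\<lambda>k. LBINT l. G k l)"
    "l2norm (\<lambda>k. LBINT l. G k l) \<le> (LBINT x. a x) * l2norm b"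
    "AE k in lborel. integrable lborel (\<lambda>l. a (k - l) * b l)"
    "AE k in lborel. integrable lborel (G k)"
    "L2 (\<lambda>k. LBINT l. a (k - l) * b l)"
    "l2norm (\<lambda>k. LBINT l. a (k - l) * b l) \<le> (LBINT x. a x) * l2norm b"
proof -
  have [measurable]: "a \<in> borel_measurable borel" "b \<in> borel_measurable borel"
    using a b by (auto simp: square_integrable_def)
  let ?A = "LBINT x. a x"
  have A0: "?A \<ge> 0" using a by simp
  have bound: "(\<integral>\<^sup>+ k. (\<integral>\<^sup>+ l. ennreal (a (k - l) * b l) \<partial>lborel)\<^sup>2 \<partial>lborel) \<le> ennreal ((?A * l2norm b)\<^sup>2)"
  proof -
    have "(\<integral>\<^sup>+ k. (\<integral>\<^sup>+ l. ennreal (a (k - l)) * ennreal (b l) \<partial>lborel)\<^sup>2 \<partial>lborel) \<le>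
      (\<integral>\<^sup>+ x. ennreal (a x) \<partial>lborel)\<^sup>2 * (\<integral>\<^sup>+ x. (ennreal (b x))\<^sup>2 \<partial>lborel)"
      by (rule young_nn) auto
    also have "\<dots> = ennreal ((?A * l2norm b)\<^sup>2)"
      using nn_integral_square[OF b(1)] nn_integral_eq_integral[OF a(1)] a(2) b(2) A0
      by (simp add: ennreal_power power_mult_distrib ennreal_mult)
    finally show ?thesis using a b by (simp add: ennreal_mult)
  qed
  have "AE k in lborel. (\<integral>\<^sup>+ l. ennreal (a (k - l) * b l) \<partial>lborel)\<^sup>2 \<noteq> \<infinity>"
    using bound by (intro nn_integral_PInf_AE) (auto simp: top_unique)
  then have AE: "AE k in lborel. (\<integral>\<^sup>+ l. ennreal (a (k - l) * b l) \<partial>lborel) \<noteq> \<infinity>"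
    by eventually_elim (auto simp: power2_eq_square ennreal_top_mult)
  then show int: "AE k in lborel. integrable lborel (\<lambda>l. a (k - l) * b l)"
    by eventually_elim (auto simp: integrable_iff_bounded a b less_top)
  show intG: "AE k in lborel. integrable lborel (G k)"
    using int
  proof eventually_elim
    case (elim k)
    have [measurable]: "G k \<in> borel_measurable borel"
      using measurable_Pair2[OF G, of k] by simp
    show ?case
      by (rule Bochner_Integration.integrable_bound[OF elim]) (auto intro!: AE_I2 order_trans[OF le] simp: a b)
  qed
  \<comment> \<open>This holds at every \<open>k\<close>: where the section is not integrable, the
    Bochner integral is \<open>0\<close>.\<close>
  have n: "ennreal (norm (LBINT l. G k l)) \<le> (\<integral>\<^sup>+ l. ennreal (a (k - l) * b l) \<partial>lborel)" for k
  proof (cases "integrable lborel (G k)")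
    case True
    then have "ennreal (norm (LBINT l. G k l)) \<le> (\<integral>\<^sup>+ l. ennreal (norm (G k l)) \<partial>lborel)"
      by (rule integral_norm_bound_ennreal)
    also have "\<dots> \<le> (\<integral>\<^sup>+ l. ennreal (a (k - l) * b l) \<partial>lborel)"
      by (intro nn_integral_mono ennreal_leI le)
    finally show ?thesis .
  qed (simp add: not_integrable_integral_eq)
  have n': "ennreal (norm (LBINT l. a (k - l) * b l)) \<le> (\<integral>\<^sup>+ l. ennreal (a (k - l) * b l) \<partial>lborel)" for k
  proof (cases "integrable lborel (\<lambda>l. a (k - l) * b l)")
    case True
    then have "ennreal (norm (LBINT l. a (k - l) * b l)) \<le> (\<integral>\<^sup>+ l. ennreal (norm (a (k - l) * b l)) \<partial>lborel)"
      by (rule integral_norm_bound_ennreal)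
    then show ?thesis using a b by simp
  qed (simp add: not_integrable_integral_eq)
  have nn: "(\<integral>\<^sup>+ k. ennreal ((norm (LBINT l. G k l))\<^sup>2) \<partial>lborel) \<le> ennreal ((?A * l2norm b)\<^sup>2)"
    by (rule order_trans[OF nn_integral_mono bound], simp add: ennreal_power[symmetric])
       (intro power_mono n, simp)
  have nn': "(\<integral>\<^sup>+ k. ennreal ((norm (LBINT l. a (k - l) * b l))\<^sup>2) \<partial>lborel) \<le> ennreal ((?A * l2norm b)\<^sup>2)"
    by (rule order_trans[OF nn_integral_mono bound], subst ennreal_power[symmetric], simp)
       (intro power_mono n', simp)
  have m: "(\<lambda>k. LBINT l. G k l) \<in> borel_measurable borel" by measurable
  have m': "(\<lambda>k. LBINT l. a (k - l) * b l) \<in> borel_measurable borel" by measurable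
  show "L2 (\<lambda>k. LBINT l. G k l)"
    "l2norm (\<lambda>k. LBINT l. G k l) \<le> ?A * l2norm b"
    using L2_leI[OF m nn] A0 by auto
  show "L2 (\<lambda>k. LBINT l. a (k - l) * b l)"
    "l2norm (\<lambda>k. LBINT l. a (k - l) * b l) \<le> ?A * l2norm b"
    using L2_leI[OF m' nn'] A0 by auto
qed

text \<open>Cauchy-Schwarz against the output of Young's inequality. The nonnegative integral over
  the plane is the form that later yields integrability there, the prerequisite for Fubini in the
  interaction form.\<close>

lemma trilinear:
  fixes u a b :: "real \<Rightarrow> real"
  assumes a: "integrable lborel a" "\<And>x. a x \<ge> 0" and b: "L2 b" "\<And>x. b x \<ge> 0"
    and u: "L2 u" "\<And>x. u x \<ge> 0"
  shows "(\<integral>\<^sup>+ z. ennreal (u (fst z) * a (fst z - snd z) * b (snd z)) \<partial>(lborel \<Otimes>\<^sub>M lborel))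
     \<le> ennreal (l2norm u * ((LBINT x. a x) * l2norm b))"
proof -
  have [measurable]: "a \<in> borel_measurable borel" "b \<in> borel_measurable borel" "u \<in> borel_measurable borel"
    using a b u by (auto simp: square_integrable_def)
  have G: "jointly_measurable (\<lambda>k l. a (k - l) * b l)" by measurable
  note Y = young_kernel[OF G _ a b, simplified abs_of_nonneg]
  have le: "\<And>k l. norm (a (k - l) * b l) \<le> a (k - l) * b l" using a b by simp
  have "(\<integral>\<^sup>+ z. ennreal (u (fst z) * a (fst z - snd z) * b (snd z)) \<partial>(lborel \<Otimes>\<^sub>M lborel)) =
     (\<integral>\<^sup>+ k. \<integral>\<^sup>+ l. ennreal (u k * a (k - l) * b l) \<partial>lborel \<partial>lborel)"
    by (subst lborel.nn_integral_fst[symmetric]) auto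
  also have "\<dots> = (\<integral>\<^sup>+ k. ennreal (u k) * (\<integral>\<^sup>+ l. ennreal (a (k - l) * b l) \<partial>lborel) \<partial>lborel)"
    using u(2) by (intro nn_integral_cong, subst nn_integral_cmult[symmetric])
       (auto simp: ennreal_mult'[symmetric] mult.assoc)
  also have "\<dots> = (\<integral>\<^sup>+ k. ennreal (u k * (LBINT l. a (k - l) * b l)) \<partial>lborel)"
  proof (rule nn_integral_cong_AE, use young_kernel(3)[OF G le a b] in eventually_elim)
    case (elim k)
    then show ?case using a b u by (subst nn_integral_eq_integral) (auto simp: ennreal_mult)
  qed
  also have "\<dots> = ennreal (LBINT k. norm (u k) * norm (LBINT l. a (k - l) * b l))"
    using a b u by (subst nn_integral_eq_integral[symmetric])
      (auto intro!: cauchy_schwarz(1) young_kernel(5)[OF G le a b] nn_integral_cong simp del: real_norm_def, simp)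
  also have "\<dots> \<le> ennreal (l2norm u * l2norm (\<lambda>k. LBINT l. a (k - l) * b l))"
    by (intro ennreal_leI cauchy_schwarz(2) u young_kernel(5)[OF G le a b])
  also have "\<dots> \<le> ennreal (l2norm u * ((LBINT x. a x) * l2norm b))"
    by (intro ennreal_leI mult_left_mono young_kernel(6)[OF G le a b]) auto
  finally show ?thesis .
qed

subsection \<open>Completeness\<close>

text \<open>Monotone convergence for the squares of the partial sums, whose seminorms stay below
  \<open>2 * A\<close>. This turns geometric convergence in mean into convergence almost
  everywhere.\<close>

lemma geometric_l2_summable:
  fixes d :: "nat \<Rightarrow> real \<Rightarrow> complex"
  assumes d: "\<And>j. L2 (d j)" and le: "\<And>j. l2norm (d j) \<le> A * (1/2) ^ j" and A: "A \<ge> 0"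
  shows "AE x in lborel. summable (\<lambda>j. norm (d j x))"
    "L2 (\<lambda>x. \<Sum>j. norm (d j x))"
proof -
  have [measurable]: "d j \<in> borel_measurable borel" for j using d[of j] by auto
  define S where "S = (\<lambda>N x. \<Sum>j<N. norm (d j x))"
  have [measurable]: "S N \<in> borel_measurable borel" for N by (simp add: S_def)
  have S0: "S N x \<ge> 0" for N x by (simp add: S_def sum_nonneg)
  have S: "L2 (S N)" "l2norm (S N) \<le> 2 * A" for N
  proof -
    have *: "L2 (S N) \<and> l2norm (S N) \<le> (\<Sum>j<N. l2norm (d j))"
      unfolding S_def using L2_sum[of "{..<N}" "\<lambda>j x. norm (d j x)"] d
      by (simp add: L2_norm)
    then show "L2 (S N)" by simp
    have "(\<Sum>j<N. l2norm (d j)) \<le> (\<Sum>j<N. A * (1/2) ^ j)" by (intro sum_mono le)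
    also have "\<dots> = A * (2 - 2 * (1/2) ^ N)" by (simp add: sum_distrib_left[symmetric] sum_gp_strict)
    also have "\<dots> \<le> 2 * A" using A by (simp add: algebra_simps)
    finally show "l2norm (S N) \<le> 2 * A" using * by simp
  qed
  have mono: "incseq (\<lambda>N x. ennreal ((S N x)\<^sup>2))"
    unfolding incseq_def le_fun_def S_def
    by (auto intro!: ennreal_leI power_mono sum_mono2 sum_nonneg)
  have "(\<integral>\<^sup>+ x. (SUP N. ennreal ((S N x)\<^sup>2)) \<partial>lborel) = (SUP N. \<integral>\<^sup>+ x. ennreal ((S N x)\<^sup>2) \<partial>lborel)"
    by (rule nn_integral_monotone_convergence_SUP[OF mono]) auto
  also have "\<dots> \<le> ennreal ((2 * A)\<^sup>2)"
  proof (rule SUP_least)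
    fix N
    have "(\<integral>\<^sup>+ x. ennreal ((S N x)\<^sup>2) \<partial>lborel) = ennreal ((l2norm (S N))\<^sup>2)"
      using nn_integral_square[OF S(1)[of N]] S0 by simp
    also have "\<dots> \<le> ennreal ((2 * A)\<^sup>2)" by (intro ennreal_leI power_mono S) auto
    finally show "(\<integral>\<^sup>+ x. ennreal ((S N x)\<^sup>2) \<partial>lborel) \<le> ennreal ((2 * A)\<^sup>2)" .
  qed
  finally have fin: "(\<integral>\<^sup>+ x. (SUP N. ennreal ((S N x)\<^sup>2)) \<partial>lborel) \<le> ennreal ((2 * A)\<^sup>2)" .
  have "AE x in lborel. (SUP N. ennreal ((S N x)\<^sup>2)) \<noteq> \<infinity>"
    using fin by (intro nn_integral_PInf_AE) (auto simp: top_unique)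
  then show AE: "AE x in lborel. summable (\<lambda>j. norm (d j x))"
  proof eventually_elim
    case (elim x)
    then obtain c where c: "(SUP N. ennreal ((S N x)\<^sup>2)) = ennreal c" "c \<ge> 0"
      by (metis ennreal_cases infinity_ennreal_def)
    have "S N x \<le> sqrt c" for N
    proof -
      have "ennreal ((S N x)\<^sup>2) \<le> ennreal c" unfolding c(1)[symmetric] by (rule SUP_upper) simp
      then show ?thesis using c(2) by (simp add: real_le_rsqrt)
    qed
    then show ?case unfolding S_def by (intro summableI_nonneg_bounded[where x="sqrt c"]) auto
  qed
  have m: "(\<lambda>x. \<Sum>j. norm (d j x)) \<in> borel_measurable borel" by measurable
  have "(\<integral>\<^sup>+ x. ennreal ((norm (\<Sum>j. norm (d j x)))\<^sup>2) \<partial>lborel) \<le> (\<integral>\<^sup>+ x. (SUP N. ennreal ((S N x)\<^sup>2)) \<partial>lborel)"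
  proof (rule nn_integral_mono_AE, use AE in eventually_elim)
    case (elim x)
    have "(\<lambda>N. S N x) \<longlonglongrightarrow> (\<Sum>j. norm (d j x))"
      using elim unfolding S_def by (rule summable_LIMSEQ)
    then have "(\<lambda>N. ennreal ((S N x)\<^sup>2)) \<longlonglongrightarrow> ennreal ((\<Sum>j. norm (d j x))\<^sup>2)"
      by (intro tendsto_intros)
    then have "ennreal ((\<Sum>j. norm (d j x))\<^sup>2) \<le> (SUP N. ennreal ((S N x)\<^sup>2))"
      by (rule LIMSEQ_le_const2) (auto intro!: SUP_upper)
    then show ?case by simp
  qed
  then show "L2 (\<lambda>x. \<Sum>j. norm (d j x))"
    using L2_leI(1)[OF m order_trans[OF _ fin]] A by simp
qed

text \<open>Fatou's lemma: a bound that holds uniformly against all later members of the sequence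
  survives in the pointwise limit.\<close>

lemma l2norm_AE_limit:
  fixes f :: "nat \<Rightarrow> real \<Rightarrow> complex"
  assumes f: "\<And>n. L2 (f n)" and v [measurable]: "v \<in> borel_measurable borel"
    and lim: "AE x in lborel. (\<lambda>i. f i x) \<longlonglongrightarrow> v x"
    and c: "\<And>i. i \<ge> n \<Longrightarrow> l2norm (\<lambda>x. f n x - f i x) \<le> c" and c0: "c \<ge> 0"
  shows "L2 (\<lambda>x. f n x - v x)" "l2norm (\<lambda>x. f n x - v x) \<le> c"
proof -
  have [measurable]: "f i \<in> borel_measurable borel" for i using f by auto
  have "(\<integral>\<^sup>+ x. ennreal ((norm (f n x - v x))\<^sup>2) \<partial>lborel)
     = (\<integral>\<^sup>+ x. liminf (\<lambda>i. ennreal ((norm (f n x - f i x))\<^sup>2)) \<partial>lborel)"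
  proof (rule nn_integral_cong_AE, use lim in eventually_elim)
    case (elim x)
    then have "(\<lambda>i. ennreal ((norm (f n x - f i x))\<^sup>2)) \<longlonglongrightarrow> ennreal ((norm (f n x - v x))\<^sup>2)"
      by (intro tendsto_intros)
    then show ?case using lim_imp_Liminf[OF sequentially_bot] by metis
  qed
  also have "\<dots> \<le> liminf (\<lambda>i. \<integral>\<^sup>+ x. ennreal ((norm (f n x - f i x))\<^sup>2) \<partial>lborel)"
    by (rule nn_integral_liminf) auto
  also have "\<dots> \<le> ennreal (c\<^sup>2)"
  proof (rule Liminf_le)
    show "\<forall>\<^sub>F i in sequentially. (\<integral>\<^sup>+ x. ennreal ((norm (f n x - f i x))\<^sup>2) \<partial>lborel) \<le> ennreal (c\<^sup>2)"
      using eventually_ge_at_top[of n]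
    proof eventually_elim
      case (elim i)
      have "(l2norm (\<lambda>x. f n x - f i x))\<^sup>2 \<le> c\<^sup>2" using c[OF elim] by (intro power_mono) auto
      then show ?case by (subst nn_integral_square) (auto intro: L2_diff f ennreal_leI)
    qed
  qed simp
  finally show "L2 (\<lambda>x. f n x - v x)" "l2norm (\<lambda>x. f n x - v x) \<le> c"
    using L2_leI[of "\<lambda>x. f n x - v x" c] c0 by auto
qed

lemma l2_cauchy_limit:
  fixes f :: "nat \<Rightarrow> real \<Rightarrow> complex"
  assumes f: "\<And>n. L2 (f n)"
    and cauchy: "\<And>e. e > 0 \<Longrightarrow> \<exists>N. \<forall>m\<ge>N. \<forall>n\<ge>N. l2norm (\<lambda>x. f m x - f n x) < e"
  shows "\<exists>v. L2 v \<and> (\<lambda>n. l2norm (\<lambda>x. f n x - v x)) \<longlonglongrightarrow> 0"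
proof -
  have "\<exists>N. \<forall>j. (\<forall>m\<ge>N j. \<forall>n\<ge>N j. l2norm (\<lambda>x. f m x - f n x) < (1/2)^j)"
    by (intro choice allI cauchy) simp
  then obtain N0 where N0: "\<And>j m n. m \<ge> N0 j \<Longrightarrow> n \<ge> N0 j \<Longrightarrow> l2norm (\<lambda>x. f m x - f n x) < (1/2)^j" by blast
  \<comment> \<open>Summing the thresholds makes \<open>N\<close> increasing, so it selects a
    subsequence whose increments are below \<open>(1/2)^j\<close>.\<close>
  define N where "N = (\<lambda>j. (\<Sum>i\<le>j. N0 i) + j)"
  have Nge: "N j \<ge> N0 j" for j unfolding N_def by (simp add: member_le_sum trans_le_add1)
  have N: "m \<ge> N j \<Longrightarrow> n \<ge> N j \<Longrightarrow> l2norm (\<lambda>x. f m x - f n x) < (1/2)^j" for j m n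
    using N0[of j m n] Nge[of j] by linarith
  have Nmono: "N j \<le> N (Suc j)" for j by (simp add: N_def)
  define d where "d = (\<lambda>j x. f (N (Suc j)) x - f (N j) x)"
  have [measurable]: "f j \<in> borel_measurable borel" for j using f[of j] by auto
  have d: "L2 (d j)" "l2norm (d j) \<le> 1 * (1/2)^j" for j
    unfolding d_def using f N[of j "N (Suc j)" "N j"] Nmono[of j] by (auto intro: L2_diff)
  have AE: "AE x in lborel. summable (\<lambda>j. norm (d j x))"
    by (rule geometric_l2_summable(1)[OF d]) auto
  define v where "v = (\<lambda>x. lim (\<lambda>j. f (N j) x))"
  have v [measurable]: "v \<in> borel_measurable borel" unfolding v_def by measurable
  have conv: "AE x in lborel. (\<lambda>j. f (N j) x) \<longlonglongrightarrow> v x"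
    using AE
  proof eventually_elim
    case (elim x)
    then have "summable (\<lambda>j. d j x)" by (rule summable_norm_cancel)
    then have "convergent (\<lambda>n. \<Sum>j<n. d j x)" by (simp add: summable_iff_convergent)
    then have "convergent (\<lambda>n. (\<Sum>j<n. d j x) + f (N 0) x)" by (intro convergent_add convergent_const)
    moreover have "(\<Sum>j<n. d j x) + f (N 0) x = f (N n) x" for n
      unfolding d_def by (induction n) (auto simp: algebra_simps)
    ultimately show ?case unfolding v_def by (simp add: convergent_LIMSEQ_iff)
  qed
  have bound: "L2 (\<lambda>x. f n x - v x) \<and> l2norm (\<lambda>x. f n x - v x) \<le> (1/2)^j" if n: "n \<ge> N j" for n j
  proof -
    \<comment> \<open>\<open>f n\<close> need not belong to the subsequence. Placing it at index
      \<open>0\<close> lets the Fatou bound compare it with the tail of the subsequence.\<close>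
    define g where "g = (\<lambda>i. if i = 0 then f n else f (N (i + j)))"
    have g: "L2 (g i)" for i by (simp add: g_def f)
    have lim: "AE x in lborel. (\<lambda>i. g i x) \<longlonglongrightarrow> v x"
      using conv
    proof eventually_elim
      case (elim x)
      have "eventually (\<lambda>i. f (N (i + j)) x = g i x) sequentially"
        using eventually_gt_at_top[of 0] by eventually_elim (simp add: g_def)
      with LIMSEQ_ignore_initial_segment[OF elim, of j] show ?case by (rule Lim_transform_eventually)
    qed
    have le: "l2norm (\<lambda>x. g 0 x - g i x) \<le> (1/2)^j" for i
    proof (cases "i = 0")
      case True
      then show ?thesis by (simp add: l2norm_def)
    next
      case False
      have "N j \<le> N (i + j)" by (rule lift_Suc_mono_le[of N]) (simp_all add: Nmono)
      then show ?thesis using N[of j n "N (i + j)"] n False by (simp add: g_def)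
    qed
    show ?thesis using l2norm_AE_limit[OF g v lim le] by (simp add: g_def)
  qed
  have "L2 v"
    using L2_diff(1)[OF f[of "N 0"] conjunct1[OF bound[of 0 "N 0"]]] by simp
  moreover have "(\<lambda>n. l2norm (\<lambda>x. f n x - v x)) \<longlonglongrightarrow> 0"
  proof (rule LIMSEQ_I)
    fix e :: real assume "e > 0"
    then obtain j where "(1/2)^j < e" using real_arch_pow_inv[of e "1/2"] by auto
    then show "\<exists>N. \<forall>n\<ge>N. norm (l2norm (\<lambda>x. f n x - v x) - 0) < e"
      using bound[of j] by (intro exI[of _ "N j"]) force
  qed
  ultimately show ?thesis by blast
qed

section \<open>The Fourier transform\<close>

lemma cis_measurable [measurable]: "cis \<in> borel_measurable borel"
  by (intro borel_measurable_continuous_onI continuous_intros)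

lemma integrable_bounded_mult:
  fixes f :: "'a \<Rightarrow> complex"
  assumes f: "integrable M f" and [measurable]: "g \<in> borel_measurable M"
    and le: "\<And>x. norm (g x) \<le> C"
  shows "integrable M (\<lambda>x. g x * f x)"
proof (rule Bochner_Integration.integrable_bound)
  show "integrable M (\<lambda>x. C * norm (f x))" using f by simp
  have "norm (g x * f x) \<le> norm (C * norm (f x))" for x
    using mult_right_mono[OF le[of x] norm_ge_zero[of "f x"]] abs_ge_self[of "C * norm (f x)"]
    by (simp only: norm_mult real_norm_def)
  then show "AE x in M. norm (g x * f x) \<le> norm (C * norm (f x))" by blast
qed (use f in measurable)

lemma integrable_prod_bounded:
  fixes f g :: "real \<Rightarrow> complex"
  assumes f: "integrable lborel f" and g: "integrable lborel g"
    and [measurable]: "jointly_measurable K" and le: "\<And>x y. norm (K x y) \<le> C"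
  shows "integrable (lborel \<Otimes>\<^sub>M lborel) (\<lambda>(x, y). K x y * (f x * g y))"
proof -
  have "integrable (lborel \<Otimes>\<^sub>M lborel) (\<lambda>z. f (fst z) * g (snd z))"
  proof -
    have [measurable]: "f \<in> borel_measurable borel" "g \<in> borel_measurable borel" using f g by auto
    show ?thesis
    proof (rule lborel_pair.Fubini_integrable)
      show "integrable lborel (\<lambda>x. LBINT y. norm (f (fst (x, y)) * g (snd (x, y))))"
        using f g by (simp add: norm_mult)
    qed (use f g in auto)
  qed
  then have "integrable (lborel \<Otimes>\<^sub>M lborel) (\<lambda>z. (case_prod K) z * (f (fst z) * g (snd z)))"
    by (rule integrable_bounded_mult[where C=C]) (auto simp: le split: prod.split)
  then show ?thesis by (simp add: case_prod_unfold)
qed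

text \<open>A bounded kernel between two integrable functions keeps the double integral absolutely
  convergent. With \<open>cis\<close> as the kernel this is the multiplication formula behind
  Plancherel, inversion and the pairing with test functions.\<close>

lemma Fubini_prod_bounded:
  fixes f g :: "real \<Rightarrow> complex"
  assumes f: "integrable lborel f" and g: "integrable lborel g"
    and K: "jointly_measurable K" and le: "\<And>x y. norm (K x y) \<le> C"
  shows "(LBINT x. f x * (LBINT y. K x y * g y)) = (LBINT y. g y * (LBINT x. K x y * f x))"
proof -
  have I: "integrable (lborel \<Otimes>\<^sub>M lborel) (\<lambda>(x, y). K x y * (f x * g y))"
    by (rule integrable_prod_bounded[OF f g K le])
  have "(LBINT x. f x * (LBINT y. K x y * g y)) = (LBINT x. (LBINT y. K x y * (f x * g y)))"
    by (simp add: mult.left_commute flip: integral_mult_right_zero)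
  also have "\<dots> = (LBINT y. (LBINT x. K x y * (f x * g y)))"
    using lborel_pair.Fubini_integral[OF I] by simp
  also have "\<dots> = (LBINT y. g y * (LBINT x. K x y * f x))"
    by (simp add: mult.commute mult.left_commute flip: integral_mult_right_zero)
  finally show ?thesis .
qed

text \<open>This is meaningful for integrable \<open>f\<close>. In this unitary normalization the
  inverse transform of \<open>p\<close> is \<open>\<lambda>x. ft p (- x)\<close>.\<close>

definition ft :: "(real \<Rightarrow> complex) \<Rightarrow> real \<Rightarrow> complex"
  where "ft f k = cx (1 / sqrt (2 * pi)) * (LBINT x. cis (- (k * x)) * f x)"

lemma ft_measurable [measurable]:
  assumes [measurable]: "f \<in> borel_measurable borel"
  shows "ft f \<in> borel_measurable borel"
  unfolding ft_def by measurable

lemma ft_bounded: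
  assumes "integrable lborel f"
  shows "norm (ft f k) \<le> (LBINT x. norm (f x)) / sqrt (2 * pi)"
proof -
  have "norm (LBINT x. cis (- (k * x)) * f x) \<le> (LBINT x. norm (cis (- (k * x)) * f x))"
    by (rule integral_norm_bound)
  then show ?thesis unfolding ft_def by (simp add: norm_mult norm_divide divide_right_mono)
qed

lemma ft_integrable_kernel:
  assumes f: "integrable lborel f"
  shows "integrable lborel (\<lambda>x. cis (a * x) * f x)" "integrable lborel (\<lambda>x. cis (- (a * x)) * f x)"
  by (rule integrable_bounded_mult[OF f, where C=1]; simp)+

lemma ft_diff:
  assumes "integrable lborel f" "integrable lborel g"
  shows "ft (\<lambda>x. f x - g x) k = ft f k - ft g k"
  unfolding ft_def using ft_integrable_kernel[OF assms(1)] ft_integrable_kernel[OF assms(2)]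
  by (simp add: right_diff_distrib Bochner_Integration.integral_diff)

lemma ft_cmult: "ft (\<lambda>x. c * f x) k = c * ft f k"
proof -
  have "(LBINT x. cis (- (k * x)) * (c * f x)) = (LBINT x. c * (cis (- (k * x)) * f x))"
    by (simp add: ac_simps)
  then show ?thesis unfolding ft_def by simp
qed

lemma ft_cong_AE:
  assumes "AE x in lborel. f x = g x" "f \<in> borel_measurable borel" "g \<in> borel_measurable borel"
  shows "ft f k = ft g k"
  unfolding ft_def using assms by (intro arg_cong2[where f="(*)"] refl integral_cong_AE) auto

subsection \<open>Continuity of translations\<close>

lemma translation_integrable:
  fixes f :: "real \<Rightarrow> 'a::{banach, second_countable_topology}"
  assumes "integrable lborel f"
  shows "integrable lborel (\<lambda>x. f (x + h))" "(LBINT x. f (x + h)) = (LBINT x. f x)"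
  using lborel_integrable_real_affine[OF assms, of 1 h] lborel_integral_real_affine[of 1 f h]
  by (simp_all add: add.commute)

text \<open>Openness controls only the points of \<open>U\<close>: there the translated indicator is
  eventually \<open>1\<close>. This suffices, because the modulus of the difference equals twice the
  loss on \<open>U\<close> plus the signed difference, and the latter has integral \<open>0\<close>
  by translation invariance.\<close>

lemma L1_translation_open:
  fixes h :: "nat \<Rightarrow> real"
  assumes U: "open U" "emeasure lborel U < \<infinity>" and h: "h \<longlonglongrightarrow> 0"
  shows "(\<lambda>n. LBINT x. \<bar>indicator U (x + h n) - indicat_real U x\<bar>) \<longlonglongrightarrow> 0"
proof -
  have [measurable]: "U \<in> sets borel" using U by auto
  have I: "integrable lborel (indicat_real U)" using U by (intro integrable_real_indicator) auto
  note It = translation_integrable[OF I]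
  have pw: "(\<lambda>n. indicat_real U x * (indicat_real U x - indicator U (x + h n))) \<longlonglongrightarrow> 0" for x
  proof (cases "x \<in> U")
    case True
    have "(\<lambda>n. x + h n) \<longlonglongrightarrow> x + 0" by (intro tendsto_intros h)
    then have "eventually (\<lambda>n. x + h n \<in> U) sequentially" using U(1) True topological_tendstoD by fastforce
    then have "eventually (\<lambda>n. indicat_real U x * (indicat_real U x - indicator U (x + h n)) = 0) sequentially"
      by eventually_elim (simp add: True)
    then show ?thesis by (rule tendsto_eventually)
  qed simp
  have "(\<lambda>n. LBINT x. indicat_real U x * (indicat_real U x - indicator U (x + h n))) \<longlonglongrightarrow> integral\<^sup>L lborel (\<lambda>x::real. 0::real)"
  proof (rule integral_dominated_convergence[where w="indicat_real U"])
    show "AE x in lborel. (\<lambda>n. indicat_real U x * (indicat_real U x - indicator U (x + h n))) \<longlonglongrightarrow> 0"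
      using pw by blast
  qed (use I in \<open>auto simp: indicator_def\<close>)
  then have lim: "(\<lambda>n. 2 * (LBINT x. indicat_real U x * (indicat_real U x - indicator U (x + h n)))) \<longlonglongrightarrow> 0"
    using tendsto_mult_left[of _ 0 _ 2] by simp
  have "(LBINT x. \<bar>indicator U (x + h n) - indicat_real U x\<bar>) =
     2 * (LBINT x. indicat_real U x * (indicat_real U x - indicator U (x + h n)))" for n
  proof -
    have J: "integrable lborel (\<lambda>x. indicat_real U x * (indicat_real U x - indicator U (x + h n)))"
      by (rule Bochner_Integration.integrable_bound[OF I]) (auto simp: indicator_def)
    have "(LBINT x. \<bar>indicator U (x + h n) - indicat_real U x\<bar>) =
      (LBINT x. 2 * (indicat_real U x * (indicat_real U x - indicator U (x + h n))) + (indicat_real U (x + h n) - indicat_real U x))"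
      by (intro Bochner_Integration.integral_cong) (auto simp: indicator_def)
    also have "\<dots> = 2 * (LBINT x. indicat_real U x * (indicat_real U x - indicator U (x + h n)))"
      using I It J by simp
    finally show ?thesis .
  qed
  then show ?thesis using lim by simp
qed

text \<open>Induction over integrable functions. For indicators, outer regularity replaces a Borel
  set of finite measure by an open one.\<close>

lemma L1_translation:
  fixes f :: "real \<Rightarrow> real" and h :: "nat \<Rightarrow> real"
  assumes f: "integrable lborel f" and h: "h \<longlonglongrightarrow> 0"
  shows "(\<lambda>n. LBINT x. \<bar>f (x + h n) - f x\<bar>) \<longlonglongrightarrow> 0"
proof -
  \<comment> \<open>The class of functions with this property is closed under approximation in mean:
    the translation error of \<open>f\<close> is at most that of \<open>g\<close> plus twice the
    distance, the latter because translation preserves integrals.\<close>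
  have approx: "(\<lambda>n. LBINT x. \<bar>f (x + h n) - f x\<bar>) \<longlonglongrightarrow> 0"
    if f: "integrable lborel f" and ex: "\<And>e. e > 0 \<Longrightarrow> \<exists>g. integrable lborel g \<and> (LBINT x. \<bar>f x - g x\<bar>) < e \<and>
         (\<lambda>n. LBINT x. \<bar>g (x + h n) - g x\<bar>) \<longlonglongrightarrow> 0" for f :: "real \<Rightarrow> real"
  proof (rule LIMSEQ_I)
    fix e :: real assume "e > 0"
    then obtain g where g: "integrable lborel g" "(LBINT x. \<bar>f x - g x\<bar>) < e / 3"
         "(\<lambda>n. LBINT x. \<bar>g (x + h n) - g x\<bar>) \<longlonglongrightarrow> 0" using ex[of "e/3"] by auto
    obtain N where N: "\<And>n. n \<ge> N \<Longrightarrow> (LBINT x. \<bar>g (x + h n) - g x\<bar>) < e / 3"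
      using LIMSEQ_D[OF g(3), of "e/3"] \<open>e > 0\<close> by fastforce
    have "norm ((LBINT x. \<bar>f (x + h n) - f x\<bar>) - 0) < e" if "n \<ge> N" for n
    proof -
      note If = translation_integrable[OF f, of "h n"] and Ig = translation_integrable[OF g(1), of "h n"]
      have Id: "integrable lborel (\<lambda>x. \<bar>f x - g x\<bar>)" using f g(1) by simp
      note Id' = translation_integrable[OF Id, of "h n"]
      have "(LBINT x. \<bar>f (x + h n) - f x\<bar>) \<le>
        (LBINT x. \<bar>f (x + h n) - g (x + h n)\<bar> + \<bar>g (x + h n) - g x\<bar> + \<bar>f x - g x\<bar>)"
        using f g If Ig Id Id' by (intro integral_mono) auto
      also have "\<dots> = (LBINT x. \<bar>f x - g x\<bar>) + (LBINT x. \<bar>g (x + h n) - g x\<bar>) + (LBINT x. \<bar>f x - g x\<bar>)"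
        using f g If Ig Id Id' by simp
      also have "\<dots> < e" using g(2) N[OF that] by simp
      finally show ?thesis using Bochner_Integration.integral_nonneg[of lborel "\<lambda>x. \<bar>f (x + h n) - f x\<bar>"] by simp
    qed
    then show "\<exists>N. \<forall>n\<ge>N. norm ((LBINT x. \<bar>f (x + h n) - f x\<bar>) - 0) < e" by blast
  qed
  show ?thesis
    using f
  proof (induction f rule: integrable_induct)
    case (base A c)
    then have A: "A \<in> sets borel" "emeasure lborel A < \<infinity>" by auto
    have IA: "integrable lborel (indicat_real A)" using A by (intro integrable_real_indicator) auto
    have "(\<lambda>n. LBINT x. \<bar>indicator A (x + h n) - indicat_real A x\<bar>) \<longlonglongrightarrow> 0"
    proof (rule approx[OF IA])
      fix e :: real assume "e > 0"
      then obtain U where U: "open U" "A \<subseteq> U" "emeasure lborel (U - A) < ennreal e"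
        using outer_regular_lborel[OF A(1)] by blast
      have [measurable]: "U \<in> sets borel" "A \<in> sets borel" using U A by auto
      have "emeasure lborel U \<le> emeasure lborel A + emeasure lborel (U - A)"
        using U(2) by (intro order_trans[OF emeasure_mono emeasure_subadditive]) auto
      also have "\<dots> < \<infinity>" using A(2) U(3) by (metis ennreal_add_eq_top infinity_ennreal_def not_less_iff_gr_or_eq top.not_eq_extremum)
      finally have fin: "emeasure lborel U < \<infinity>" .
      have IU: "integrable lborel (indicat_real U)" using fin by (intro integrable_real_indicator) auto
      have "(LBINT x. \<bar>indicat_real A x - indicat_real U x\<bar>) = (LBINT x. indicat_real (U - A) x)"
        using U(2) by (intro Bochner_Integration.integral_cong) (auto simp: indicator_def)
      also have "\<dots> = measure lborel (U - A)" by simp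
      also have "\<dots> < e" using U(3) \<open>e > 0\<close> by (metis Sigma_Algebra.measure_def enn2real_less_iff ennreal_less_top order_less_trans less_imp_le)
      finally show "\<exists>g. integrable lborel g \<and> (LBINT x. \<bar>indicat_real A x - g x\<bar>) < e \<and>
         (\<lambda>n. LBINT x. \<bar>g (x + h n) - g x\<bar>) \<longlonglongrightarrow> 0"
        using IU L1_translation_open[OF U(1) fin h] by blast
    qed
    then have "(\<lambda>n. \<bar>c\<bar> * (LBINT x. \<bar>indicator A (x + h n) - indicat_real A x\<bar>)) \<longlonglongrightarrow> \<bar>c\<bar> * 0"
      by (intro tendsto_intros)
    moreover have "\<bar>indicat_real A (x + h n) *\<^sub>R c - indicat_real A x *\<^sub>R c\<bar> = \<bar>c\<bar> * \<bar>indicator A (x + h n) - indicat_real A x\<bar>" for x n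
      by (simp add: abs_mult[symmetric] algebra_simps)
    ultimately show ?case by simp
  next
    case (add f g)
    show ?case
    proof (rule tendsto_sandwich[OF always_eventually always_eventually tendsto_const])
      show "(\<lambda>n. (LBINT x. \<bar>f (x + h n) - f x\<bar>) + (LBINT x. \<bar>g (x + h n) - g x\<bar>)) \<longlonglongrightarrow> 0"
        using tendsto_add[OF add(3,4)] by simp
      show "\<forall>n. (LBINT x. \<bar>f (x + h n) + g (x + h n) - (f x + g x)\<bar>) \<le>
        (LBINT x. \<bar>f (x + h n) - f x\<bar>) + (LBINT x. \<bar>g (x + h n) - g x\<bar>)"
      proof
        fix n
        note I = add(1,2) translation_integrable(1)[OF add(1), of "h n"] translation_integrable(1)[OF add(2), of "h n"]
        have "(LBINT x. \<bar>f (x + h n) + g (x + h n) - (f x + g x)\<bar>) \<le>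
          (LBINT x. \<bar>f (x + h n) - f x\<bar> + \<bar>g (x + h n) - g x\<bar>)"
          using I by (intro integral_mono) auto
        also have "\<dots> = (LBINT x. \<bar>f (x + h n) - f x\<bar>) + (LBINT x. \<bar>g (x + h n) - g x\<bar>)"
          using I by (intro Bochner_Integration.integral_add) auto
        finally show "(LBINT x. \<bar>f (x + h n) + g (x + h n) - (f x + g x)\<bar>) \<le>
          (LBINT x. \<bar>f (x + h n) - f x\<bar>) + (LBINT x. \<bar>g (x + h n) - g x\<bar>)" .
      qed
    qed (auto intro!: Bochner_Integration.integral_nonneg)
  next
    case (lim f s)
    show ?case
    proof (rule approx[OF lim(4)])
      fix e :: real assume "e > 0"
      have "(\<lambda>i. LBINT x. \<bar>f x - s i x\<bar>) \<longlonglongrightarrow> integral\<^sup>L lborel (\<lambda>x::real. 0::real)"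
      proof (rule integral_dominated_convergence[where w="\<lambda>x. 3 * \<bar>f x\<bar>"])
        show "AE x in lborel. (\<lambda>i. \<bar>f x - s i x\<bar>) \<longlonglongrightarrow> 0"
          using lim(2) by (auto intro!: AE_I2 tendsto_eq_intros)
        show "AE x in lborel. norm \<bar>f x - s i x\<bar> \<le> 3 * \<bar>f x\<bar>" for i
        proof (rule AE_I2)
          fix x :: real
          have "\<bar>s i x\<bar> \<le> 2 * \<bar>f x\<bar>" using lim(3)[of x i] by simp
          then show "norm \<bar>f x - s i x\<bar> \<le> 3 * \<bar>f x\<bar>" by simp
        qed
      qed (use lim in auto)
      then obtain i where "(LBINT x. \<bar>f x - s i x\<bar>) < e"
        using LIMSEQ_D[of _ 0 e] \<open>e > 0\<close> by fastforce
      then show "\<exists>g. integrable lborel g \<and> (LBINT x. \<bar>f x - g x\<bar>) < e \<and>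
         (\<lambda>n. LBINT x. \<bar>g (x + h n) - g x\<bar>) \<longlonglongrightarrow> 0"
        using lim(1,5) by blast
    qed
  qed
qed

text \<open>For nonnegative functions
  \<open>(a - b)\<^sup>2 \<le> \<bar>a\<^sup>2 - b\<^sup>2\<bar>\<close> reduces the claim to
  translations of the integrable function \<open>g\<^sup>2\<close>. A complex function is a
  combination of four nonnegative ones, the positive and negative parts of its real and imaginary
  parts.\<close>

lemma L2_translation:
  fixes f :: "real \<Rightarrow> complex" and h :: "nat \<Rightarrow> real"
  assumes f: "L2 f" and h: "h \<longlonglongrightarrow> 0"
  shows "(\<lambda>n. l2norm (\<lambda>x. f (x + h n) - f x)) \<longlonglongrightarrow> 0"
proof -
  have pos: "(\<lambda>n. l2norm (\<lambda>x. cx (g (x + h n)) - cx (g x))) \<longlonglongrightarrow> 0"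
    if g: "L2 g" "\<And>x. g x \<ge> 0" for g :: "real \<Rightarrow> real"
  proof -
    have [measurable]: "g \<in> borel_measurable borel" using g by auto
    have I: "integrable lborel (\<lambda>x. (g x)\<^sup>2)" using g by (simp add: square_integrable_def)
    have lim: "(\<lambda>n. sqrt (LBINT x. \<bar>(g (x + h n))\<^sup>2 - (g x)\<^sup>2\<bar>)) \<longlonglongrightarrow> sqrt 0"
      by (intro tendsto_real_sqrt L1_translation[OF I h])
    have sq: "(a - b)\<^sup>2 \<le> \<bar>a\<^sup>2 - b\<^sup>2\<bar>" if "a \<ge> 0" "b \<ge> 0" for a b :: real
    proof -
      have "(a - b)\<^sup>2 = \<bar>a - b\<bar> * \<bar>a - b\<bar>" by (simp add: power2_eq_square)
      also have "\<dots> \<le> \<bar>a - b\<bar> * \<bar>a + b\<bar>" using that by (intro mult_left_mono) auto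
      also have "\<dots> = \<bar>a\<^sup>2 - b\<^sup>2\<bar>" by (simp add: abs_mult[symmetric] power2_eq_square algebra_simps)
      finally show ?thesis .
    qed
    show ?thesis
    proof (rule tendsto_sandwich[OF always_eventually always_eventually tendsto_const])
      show "(\<lambda>n. sqrt (LBINT x. \<bar>(g (x + h n))\<^sup>2 - (g x)\<^sup>2\<bar>)) \<longlonglongrightarrow> 0" using lim by simp
      show "\<forall>n. l2norm (\<lambda>x. cx (g (x + h n)) - cx (g x)) \<le> sqrt (LBINT x. \<bar>(g (x + h n))\<^sup>2 - (g x)\<^sup>2\<bar>)"
      proof
        fix n
        have J: "integrable lborel (\<lambda>x. \<bar>(g (x + h n))\<^sup>2 - (g x)\<^sup>2\<bar>)"
          using I translation_integrable(1)[OF I, of "h n"] by simp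
        have "(LBINT x. (g (x + h n) - g x)\<^sup>2) \<le> (LBINT x. \<bar>(g (x + h n))\<^sup>2 - (g x)\<^sup>2\<bar>)"
        proof (rule integral_mono[OF Bochner_Integration.integrable_bound[OF J] J])
          show "AE x in lborel. norm ((g (x + h n) - g x)\<^sup>2) \<le> norm \<bar>(g (x + h n))\<^sup>2 - (g x)\<^sup>2\<bar>"
            using sq g(2) by auto
        qed (use sq g(2) in auto)
        then show "l2norm (\<lambda>x. cx (g (x + h n)) - cx (g x)) \<le> sqrt (LBINT x. \<bar>(g (x + h n))\<^sup>2 - (g x)\<^sup>2\<bar>)"
          unfolding l2norm_def of_real_diff[symmetric] norm_of_real by simp
      qed
    qed auto
  qed
  have [measurable]: "f \<in> borel_measurable borel" using f by auto
  have parts: "L2 (\<lambda>x. max 0 (Re (f x)))" "L2 (\<lambda>x. max 0 (- Re (f x)))"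
     "L2 (\<lambda>x. max 0 (Im (f x)))" "L2 (\<lambda>x. max 0 (- Im (f x)))"
    using abs_Re_le_cmod abs_Im_le_cmod
    by (intro L2_mono(1)[OF f]; force intro!: AE_I2 simp: max_def abs_le_iff intro: order_trans)+
  define gs where "gs = (\<lambda>j::nat. if j = 0 then (\<lambda>x. max 0 (Re (f x))) else if j = 1 then (\<lambda>x. max 0 (- Re (f x)))
      else if j = 2 then (\<lambda>x. max 0 (Im (f x))) else (\<lambda>x. max 0 (- Im (f x))))"
  define c where "c = (\<lambda>j::nat. if j = 0 then 1 else if j = 1 then -1 else if j = 2 then \<i> else - \<i>)"
  have gs: "L2 (gs j)" "gs j x \<ge> 0" for j x using parts unfolding gs_def by auto
  have nc: "norm (c j) = 1" for j by (simp add: c_def)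
  have max_diff: "max 0 a - max 0 (- a) = a" for a :: real by simp
  have feq: "f x = (\<Sum>j<4. c j * cx (gs j x))" for x
    by (rule complex_eqI) (auto simp: numeral_eq_Suc c_def gs_def max_diff)
  define G where "G = (\<lambda>n j x. c j * (cx (gs j (x + h n)) - cx (gs j x)))"
  have sh: "L2 (\<lambda>x. cx (gs j (x + h n)) - cx (gs j x))" for n j
    using L2_affine(1)[OF gs(1), where c=1 and t="h n"]
    by (intro L2_diff(1)) (auto simp: L2_of_real gs add.commute)
  have G: "L2 (G n j)" "l2norm (G n j) = l2norm (\<lambda>x. cx (gs j (x + h n)) - cx (gs j x))" for n j
    unfolding G_def using L2_cmult[OF sh, where c="c j"] nc by auto
  show ?thesis
  proof (rule tendsto_sandwich[OF always_eventually always_eventually tendsto_const])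
    show "(\<lambda>n. \<Sum>j<4. l2norm (G n j)) \<longlonglongrightarrow> 0"
      unfolding G(2) by (rule tendsto_eq_rhs[OF tendsto_sum[where a="\<lambda>_. 0"]]) (auto intro!: pos gs)
    show "\<forall>n. l2norm (\<lambda>x. f (x + h n) - f x) \<le> (\<Sum>j<4. l2norm (G n j))"
    proof
      fix n
      have "(\<lambda>x. f (x + h n) - f x) = (\<lambda>x. \<Sum>j<4. G n j x)"
        unfolding feq G_def by (simp add: sum_subtractf right_diff_distrib)
      then show "l2norm (\<lambda>x. f (x + h n) - f x) \<le> (\<Sum>j<4. l2norm (G n j))"
        using L2_sum[of "{..<4::nat}" "G n"] G(1) by simp
    qed
  qed auto
qed

subsection \<open>Plancherel's theorem\<close>

text \<open>Read off from the characteristic function of the standard normal distribution.\<close>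

lemma gaussian_transform:
  "(LBINT k. cis (a * k) * cx (exp (- (k\<^sup>2) / 2))) = cx (sqrt (2 * pi) * exp (- (a\<^sup>2) / 2))"
  "integrable lborel (\<lambda>k::real. exp (- (k\<^sup>2) / 2))"
proof -
  have "cx (exp (- (a\<^sup>2) / 2)) = char std_normal_distribution a"
    by (simp add: char_std_normal_distribution)
  also have "\<dots> = (LBINT k. std_normal_density k *\<^sub>R iexp (a * k))"
    unfolding char_def by (rule integral_density) auto
  also have "\<dots> = (LBINT k. cx (1 / sqrt (2 * pi)) * (cis (a * k) * cx (exp (- (k\<^sup>2) / 2))))"
    by (intro Bochner_Integration.integral_cong) (auto simp: std_normal_density_def cis_conv_exp scaleR_conv_of_real)
  also have "\<dots> = cx (1 / sqrt (2 * pi)) * (LBINT k. cis (a * k) * cx (exp (- (k\<^sup>2) / 2)))"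
    by simp
  finally show "(LBINT k. cis (a * k) * cx (exp (- (k\<^sup>2) / 2))) = cx (sqrt (2 * pi) * exp (- (a\<^sup>2) / 2))"
    by (simp add: field_simps)
  have "integrable lborel (\<lambda>k. sqrt (2 * pi) * std_normal_density k)"
    by (intro integrable_mult_right) (use integrable_std_normal_moment[of 0] in simp)
  then show "integrable lborel (\<lambda>k::real. exp (- (k\<^sup>2) / 2))"
    by (simp add: std_normal_density_def)
qed

lemma gaussian_transform_scaled:
  assumes d: "d > 0"
  shows "(LBINT k. cis (a * k) * cx (exp (- ((d * k)\<^sup>2) / 2))) = cx (2 * pi * (std_normal_density (a / d) / d))"
    "integrable lborel (\<lambda>k::real. exp (- ((d * k)\<^sup>2) / 2))"
proof -
  have "(LBINT k. cis ((a / d) * k) * cx (exp (- (k\<^sup>2) / 2))) =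
     d *\<^sub>R (LBINT k. cis ((a / d) * (0 + d * k)) * cx (exp (- ((0 + d * k)\<^sup>2) / 2)))"
    using d by (subst lborel_integral_real_affine[where c=d and t=0]) auto
  then have "cx d * (LBINT k. cis (a * k) * cx (exp (- ((d * k)\<^sup>2) / 2))) = cx (sqrt (2 * pi) * exp (- ((a / d)\<^sup>2) / 2))"
    using d unfolding gaussian_transform by (simp add: scaleR_conv_of_real)
  moreover have "sqrt (2 * pi) * exp (- ((a / d)\<^sup>2) / 2) = d * (2 * pi * (std_normal_density (a / d) / d))"
  proof -
    have "2 * pi / sqrt (2 * pi) = sqrt (2 * pi)" by (rule real_div_sqrt) simp
    then show ?thesis using d by (simp add: std_normal_density_def field_simps)
  qed
  ultimately show "(LBINT k. cis (a * k) * cx (exp (- ((d * k)\<^sup>2) / 2))) = cx (2 * pi * (std_normal_density (a / d) / d))"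
    using d by (simp only: of_real_mult mult_cancel_left) simp
  show "integrable lborel (\<lambda>k::real. exp (- ((d * k)\<^sup>2) / 2))"
    using lborel_integrable_real_affine[OF gaussian_transform(2), of d 0] d by simp
qed

lemma ft_cnj: "cnj (ft f k) = cx (1 / sqrt (2 * pi)) * (LBINT x. cis (k * x) * cnj (f x))"
proof -
  have "cnj (LBINT x. cis (- (k * x)) * f x) = (LBINT x. cnj (cis (- (k * x)) * f x))"
    by (rule Bochner_Integration.integral_cnj[symmetric])
  also have "\<dots> = (LBINT x. cis (k * x) * cnj (f x))" by (simp add: cis_cnj)
  finally show ?thesis unfolding ft_def by simp
qed

text \<open>The autocorrelation, whose Fourier transform is up to normalization the squared modulus
  of \<open>ft f\<close>, and whose value at \<open>0\<close> is the square of
  \<open>l2norm f\<close>.\<close>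

definition autocorr :: "(real \<Rightarrow> complex) \<Rightarrow> real \<Rightarrow> complex"
  where "autocorr f t = (LBINT x. cnj (f x) * f (x + t))"

lemma cnj_measurable [measurable]: "cnj \<in> borel_measurable borel"
  by (intro borel_measurable_continuous_onI continuous_intros)

lemma L2_cnj:
  "L2 f \<Longrightarrow> L2 (\<lambda>x. cnj (f x))" "l2norm (\<lambda>x. cnj (f x)) = l2norm f"
  by (auto simp: square_integrable_def l2norm_def)

lemma L2_translate:
  fixes f :: "real \<Rightarrow> 'a::{real_normed_vector, second_countable_topology}"
  assumes "L2 f"
  shows "L2 (\<lambda>x. f (x + t))" "l2norm (\<lambda>x. f (x + t)) = l2norm f"
  using L2_affine[OF assms, of 1 t] by (simp_all add: add.commute)

lemma autocorr_bound:
  assumes f: "L2 f"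
  shows "norm (autocorr f t) \<le> (l2norm f)\<^sup>2"
  unfolding autocorr_def
  using cauchy_schwarz_mult(2)[OF L2_cnj(1)[OF f] L2_translate(1)[OF f, of t]]
  by (simp add: L2_cnj L2_translate[OF f] power2_eq_square)

lemma autocorr_tendsto:
  assumes f: "L2 f" and h: "h \<longlonglongrightarrow> 0"
  shows "(\<lambda>n. autocorr f (h n)) \<longlonglongrightarrow> cx ((l2norm f)\<^sup>2)"
proof -
  have [measurable]: "f \<in> borel_measurable borel" using f by auto
  have 0: "autocorr f 0 = cx ((l2norm f)\<^sup>2)"
    unfolding autocorr_def l2norm_sq integral_complex_of_real[symmetric]
    by (intro Bochner_Integration.integral_cong) (auto simp: complex_norm_square mult.commute simp flip: of_real_power)
  have "(\<lambda>n. autocorr f (h n) - autocorr f 0) \<longlonglongrightarrow> 0"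
  proof (rule Lim_null_comparison[OF always_eventually])
    show "\<forall>n. norm (autocorr f (h n) - autocorr f 0) \<le> l2norm f * l2norm (\<lambda>x. f (x + h n) - f x)"
    proof
      fix n
      have "autocorr f (h n) - autocorr f 0 = (LBINT x. cnj (f x) * (f (x + h n) - f x))"
        unfolding autocorr_def using f
        by (subst Bochner_Integration.integral_diff[symmetric])
           (auto intro!: cauchy_schwarz_mult L2_cnj L2_translate simp: right_diff_distrib)
      also have "norm \<dots> \<le> l2norm f * l2norm (\<lambda>x. f (x + h n) - f x)"
        using cauchy_schwarz_mult(2)[OF L2_cnj(1)[OF f] L2_diff(1)[OF L2_translate(1)[OF f, of "h n"] f]]
        by (simp add: L2_cnj)
      finally show "norm (autocorr f (h n) - autocorr f 0) \<le> l2norm f * l2norm (\<lambda>x. f (x + h n) - f x)" .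
    qed
    show "(\<lambda>n. l2norm f * l2norm (\<lambda>x. f (x + h n) - f x)) \<longlonglongrightarrow> 0"
      using tendsto_mult_left[OF L2_translation[OF f h], of "l2norm f"] by simp
  qed
  then show ?thesis using 0 by (simp add: LIM_zero_iff)
qed

text \<open>The Gaussian factor makes every integral absolutely convergent, so the orders of
  integration may be exchanged. Its own transform is a Gaussian of width \<open>d\<close>, which
  averages the autocorrelation over lags of order \<open>d\<close>.\<close>

lemma plancherel_regularised:
  assumes f: "integrable lborel f" "L2 f" and d: "d > 0"
  shows "cx (LBINT k. (cmod (ft f k))\<^sup>2 * exp (- ((d * k)\<^sup>2) / 2)) =
     (LBINT h. cx (std_normal_density h) * autocorr f (d * h))"
proof -
  have [measurable]: "f \<in> borel_measurable borel" using f by auto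
  define e where "e = (\<lambda>k. cx (exp (- ((d * k)\<^sup>2) / 2)))"
  define c where "c = cx (1 / sqrt (2 * pi))"
  have e: "integrable lborel e" unfolding e_def using gaussian_transform_scaled(2)[OF d] by simp
  have [measurable]: "e \<in> borel_measurable borel" using e by auto
  have G: "integrable lborel (\<lambda>k. ft f k * e k)"
    by (rule integrable_bounded_mult[OF e _ ft_bounded[OF f(1)]]) auto
  have F: "integrable lborel (\<lambda>x. cnj (f x))" using f by simp
  \<comment> \<open>Inverting the damped transform of \<open>f\<close> returns \<open>f\<close>
    mollified at scale \<open>d\<close>.\<close>
  have inner: "(LBINT k. cis (k * x) * (ft f k * e k)) =
     c * (2 * pi) * (LBINT h. cx (std_normal_density h) * f (x + d * h))" for x
  proof -
    have I: "integrable lborel (\<lambda>k. cis (k * x) * e k)"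
      by (rule integrable_bounded_mult[OF e, where C=1]) auto
    have "(LBINT k. cis (k * x) * (ft f k * e k)) =
      c * (LBINT k. (cis (k * x) * e k) * (LBINT y. cis (- (k * y)) * f y))"
      unfolding ft_def c_def by (simp add: ac_simps flip: integral_mult_right_zero)
    also have "(LBINT k. (cis (k * x) * e k) * (LBINT y. cis (- (k * y)) * f y)) =
       (LBINT y. f y * (LBINT k. cis (- (k * y)) * (cis (k * x) * e k)))"
      by (rule Fubini_prod_bounded[OF I f(1), where C=1]) auto
    also have "\<dots> = (LBINT y. f y * cx (2 * pi * (std_normal_density ((x - y) / d) / d)))"
    proof (intro Bochner_Integration.integral_cong refl arg_cong2[where f="(*)"])
      fix y
      have "(LBINT k. cis (- (k * y)) * (cis (k * x) * e k)) = (LBINT k. cis ((x - y) * k) * e k)"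
      proof (intro Bochner_Integration.integral_cong refl)
        fix k
        have "cis (- (k * y)) * cis (k * x) = cis ((x - y) * k)" by (simp add: cis_mult algebra_simps)
        then show "cis (- (k * y)) * (cis (k * x) * e k) = cis ((x - y) * k) * e k"
          by (simp only: mult.assoc[symmetric])
      qed
      then show "(LBINT k. cis (- (k * y)) * (cis (k * x) * e k)) = cx (2 * pi * (std_normal_density ((x - y) / d) / d))"
        unfolding e_def gaussian_transform_scaled(1)[OF d] .
    qed
    also have "\<dots> = \<bar>d\<bar> *\<^sub>R (LBINT h. f (x + d * h) * cx (2 * pi * (std_normal_density ((x - (x + d * h)) / d) / d)))"
      using d by (intro lborel_integral_real_affine) auto
    also have "\<dots> = (2 * pi) * (LBINT h. cx (std_normal_density h) * f (x + d * h))"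
    proof -
      have "(LBINT h. f (x + d * h) * cx (2 * pi * (std_normal_density ((x - (x + d * h)) / d) / d))) =
        (LBINT h. cx (2 * pi / d) * (cx (std_normal_density h) * f (x + d * h)))"
        using d by (intro Bochner_Integration.integral_cong refl) (simp add: std_normal_density_def field_simps)
      also have "\<dots> = cx (2 * pi / d) * (LBINT h. cx (std_normal_density h) * f (x + d * h))"
        by (rule integral_mult_right_zero)
      finally show ?thesis using d by (simp add: scaleR_conv_of_real)
    qed
    finally show ?thesis by (simp add: mult.assoc)
  qed
  have "cx (LBINT k. (cmod (ft f k))\<^sup>2 * exp (- ((d * k)\<^sup>2) / 2)) =
    (LBINT k. (ft f k * e k) * cnj (ft f k))"
    unfolding integral_complex_of_real[symmetric] e_def
    by (intro Bochner_Integration.integral_cong refl) (simp add: complex_norm_square mult_ac del: of_real_power)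
  also have "\<dots> = c * (LBINT k. (ft f k * e k) * (LBINT x. cis (k * x) * cnj (f x)))"
    unfolding ft_cnj c_def by (simp add: ac_simps flip: integral_mult_right_zero)
  also have "(LBINT k. (ft f k * e k) * (LBINT x. cis (k * x) * cnj (f x))) =
     (LBINT x. cnj (f x) * (LBINT k. cis (k * x) * (ft f k * e k)))"
    by (rule Fubini_prod_bounded[OF G F, where C=1]) auto
  also have "\<dots> = (LBINT x. (c * (2 * pi)) * (cnj (f x) * (LBINT h. cx (std_normal_density h) * f (x + d * h))))"
    unfolding inner by (simp add: ac_simps)
  also have "\<dots> = (c * (2 * pi)) * (LBINT x. cnj (f x) * (LBINT h. cx (std_normal_density h) * f (x + d * h)))"
    by (rule integral_mult_right_zero)
  finally have 1: "cx (LBINT k. (cmod (ft f k))\<^sup>2 * exp (- ((d * k)\<^sup>2) / 2)) =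
      c * ((c * (2 * pi)) * (LBINT x. cnj (f x) * (LBINT h. cx (std_normal_density h) * f (x + d * h))))" .
  have cc: "c * (c * (2 * pi)) = 1"
  proof -
    have "(1 / sqrt (2 * pi)) * ((1 / sqrt (2 * pi)) * (2 * pi)) = 1" by (simp add: field_simps)
    then show ?thesis unfolding c_def by (metis of_real_mult of_real_1)
  qed
  have sn: "integrable lborel std_normal_density"
    using integrable_std_normal_moment[of 0] by simp
  have I: "integrable (lborel \<Otimes>\<^sub>M lborel) (\<lambda>(h, x). cx (std_normal_density h) * (cnj (f x) * f (x + d * h)))"
  proof (rule lborel_pair.Fubini_integrable)
    show "(\<lambda>(h, x). cx (std_normal_density h) * (cnj (f x) * f (x + d * h))) \<in> borel_measurable (lborel \<Otimes>\<^sub>M lborel)"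
      by measurable
    show "integrable lborel (\<lambda>h. LBINT x. norm (case (h, x) of (h, x) \<Rightarrow> cx (std_normal_density h) * (cnj (f x) * f (x + d * h))))"
    proof (rule Bochner_Integration.integrable_bound)
      show "integrable lborel (\<lambda>h. (l2norm f)\<^sup>2 * std_normal_density h)" using sn by simp
      have "norm (LBINT x. norm (case (h, x) of (h, x) \<Rightarrow> cx (std_normal_density h) * (cnj (f x) * f (x + d * h))))
         \<le> norm ((l2norm f)\<^sup>2 * std_normal_density h)" for h
      proof -
        have "(LBINT x. norm (f x) * norm (f (x + d * h))) \<le> (l2norm f)\<^sup>2"
          using cauchy_schwarz(2)[OF f(2) L2_translate(1)[OF f(2), of "d * h"]]
          by (simp add: L2_translate[OF f(2)] power2_eq_square)
        then have "(LBINT x. norm (f x) * norm (f (x + d * h))) * std_normal_density h \<le> (l2norm f)\<^sup>2 * std_normal_density h"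
          by (rule mult_right_mono) simp
        then show ?thesis by (simp add: norm_mult mult.commute)
      qed
      then show "AE h in lborel. norm (LBINT x. norm (case (h, x) of (h, x) \<Rightarrow> cx (std_normal_density h) * (cnj (f x) * f (x + d * h))))
         \<le> norm ((l2norm f)\<^sup>2 * std_normal_density h)" by blast
    qed measurable
    show "AE h in lborel. integrable lborel (\<lambda>x. case (h, x) of (h, x) \<Rightarrow> cx (std_normal_density h) * (cnj (f x) * f (x + d * h)))"
      using f(2) by (auto intro!: AE_I2 integrable_mult_right cauchy_schwarz_mult L2_cnj L2_translate)
  qed
  have "(LBINT x. cnj (f x) * (LBINT h. cx (std_normal_density h) * f (x + d * h))) =
     (LBINT x. (LBINT h. cx (std_normal_density h) * (cnj (f x) * f (x + d * h))))"
    by (simp add: ac_simps flip: integral_mult_right_zero)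
  also have "\<dots> = (LBINT h. (LBINT x. cx (std_normal_density h) * (cnj (f x) * f (x + d * h))))"
    by (rule lborel_pair.Fubini_integral[OF I])
  also have "\<dots> = (LBINT h. cx (std_normal_density h) * autocorr f (d * h))"
    unfolding autocorr_def by simp
  finally show ?thesis using 1 cc by (simp add: mult.assoc[symmetric])
qed

text \<open>The width tends to \<open>0\<close>. The Gaussian averages converge by continuity of
  translations in mean square, and the damped integrals increase to the full one; monotone
  convergence thereby also supplies the square integrability of \<open>ft f\<close>.\<close>

theorem plancherel:
  assumes f: "integrable lborel f" "L2 f"
  shows "L2 (ft f)" "l2norm (ft f) = l2norm f"
proof -
  have [measurable]: "f \<in> borel_measurable borel" using f by auto
  define d where "d = (\<lambda>n::nat. 1 / (real n + 1))"
  have d: "d n > 0" "d \<longlonglongrightarrow> 0" for n unfolding d_def using LIMSEQ_inverse_real_of_nat by (auto simp: inverse_eq_divide add.commute)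
  define J where "J = (\<lambda>n. LBINT k. (cmod (ft f k))\<^sup>2 * exp (- ((d n * k)\<^sup>2) / 2))"
  have sn: "integrable lborel std_normal_density"
    using integrable_std_normal_moment[of 0] by simp
  have [measurable]: "autocorr f \<in> borel_measurable borel" unfolding autocorr_def by measurable
  have "(\<lambda>n. LBINT h. cx (std_normal_density h) * autocorr f (d n * h)) \<longlonglongrightarrow>
     (LBINT h. cx (std_normal_density h) * cx ((l2norm f)\<^sup>2))"
  proof (rule integral_dominated_convergence[where w="\<lambda>h. std_normal_density h * (l2norm f)\<^sup>2"])
    show "AE h in lborel. (\<lambda>n. cx (std_normal_density h) * autocorr f (d n * h)) \<longlonglongrightarrow> cx (std_normal_density h) * cx ((l2norm f)\<^sup>2)"
    proof (rule AE_I2)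
      fix h :: real
      have "(\<lambda>n. d n * h) \<longlonglongrightarrow> 0" using tendsto_mult_right[OF d(2), of h] by simp
      from autocorr_tendsto[OF f(2) this]
      show "(\<lambda>n. cx (std_normal_density h) * autocorr f (d n * h)) \<longlonglongrightarrow> cx (std_normal_density h) * cx ((l2norm f)\<^sup>2)"
        by (rule tendsto_mult_left)
    qed
    show "AE h in lborel. norm (cx (std_normal_density h) * autocorr f (d n * h)) \<le> std_normal_density h * (l2norm f)\<^sup>2" for n
      using autocorr_bound[OF f(2)] by (auto simp: norm_mult intro!: mult_left_mono)
  qed (use sn in auto)
  also have "(LBINT h. cx (std_normal_density h) * cx ((l2norm f)\<^sup>2)) = cx ((l2norm f)\<^sup>2)"
    by simp
  finally have "(\<lambda>n. cx (J n)) \<longlonglongrightarrow> cx ((l2norm f)\<^sup>2)"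
    unfolding J_def plancherel_regularised[OF f d(1)] .
  then have J: "J \<longlonglongrightarrow> (l2norm f)\<^sup>2" by (simp only: tendsto_of_real_iff)
  have "(\<lambda>n. \<integral>\<^sup>+ k. ennreal ((cmod (ft f k))\<^sup>2 * exp (- ((d n * k)\<^sup>2) / 2)) \<partial>lborel) \<longlonglongrightarrow> (\<integral>\<^sup>+ k. ennreal ((cmod (ft f k))\<^sup>2) \<partial>lborel)"
  proof (rule nn_integral_LIMSEQ)
    have le: "d (Suc n) \<le> d n" for n unfolding d_def by (intro divide_left_mono) auto
    have "(d n * k)\<^sup>2 \<ge> (d (Suc n) * k)\<^sup>2" for n k
      using le[of n] d(1)[of "Suc n"] by (simp add: power_mult_distrib mult_right_mono power_mono)
    then show "incseq (\<lambda>n k. ennreal ((cmod (ft f k))\<^sup>2 * exp (- ((d n * k)\<^sup>2) / 2)))"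
      by (intro incseq_SucI le_funI ennreal_leI mult_left_mono) auto
    fix k :: real
    have "(\<lambda>n. ennreal ((cmod (ft f k))\<^sup>2 * exp (- ((d n * k)\<^sup>2) / 2))) \<longlonglongrightarrow> ennreal ((cmod (ft f k))\<^sup>2 * exp (- ((0 * k)\<^sup>2) / 2))"
      by (intro tendsto_intros d(2)) auto
    then show "(\<lambda>n. ennreal ((cmod (ft f k))\<^sup>2 * exp (- ((d n * k)\<^sup>2) / 2))) \<longlonglongrightarrow> ennreal ((cmod (ft f k))\<^sup>2)" by simp
  qed measurable
  moreover have "(\<integral>\<^sup>+ k. ennreal ((cmod (ft f k))\<^sup>2 * exp (- ((d n * k)\<^sup>2) / 2)) \<partial>lborel) = ennreal (J n)" for n
  proof -
    let ?B = "(LBINT x. norm (f x)) / sqrt (2 * pi)"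
    have "integrable lborel (\<lambda>k. (cmod (ft f k))\<^sup>2 * exp (- ((d n * k)\<^sup>2) / 2))"
    proof (rule Bochner_Integration.integrable_bound)
      show "integrable lborel (\<lambda>k. ?B\<^sup>2 * exp (- ((d n * k)\<^sup>2) / 2))"
        using gaussian_transform_scaled(2)[OF d(1)] by (intro integrable_mult_right) auto
      show "AE k in lborel. norm ((cmod (ft f k))\<^sup>2 * exp (- ((d n * k)\<^sup>2) / 2)) \<le> norm (?B\<^sup>2 * exp (- ((d n * k)\<^sup>2) / 2))"
        using power_mono[OF ft_bounded[OF f(1)] norm_ge_zero, where n=2]
        by (auto simp: abs_mult intro!: AE_I2 mult_right_mono)
    qed measurable
    then show ?thesis unfolding J_def by (intro nn_integral_eq_integral) auto
  qed
  moreover have "(\<lambda>n. ennreal (J n)) \<longlonglongrightarrow> ennreal ((l2norm f)\<^sup>2)" by (intro tendsto_intros J)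
  ultimately have eq: "(\<integral>\<^sup>+ k. ennreal ((cmod (ft f k))\<^sup>2) \<partial>lborel) = ennreal ((l2norm f)\<^sup>2)"
    using LIMSEQ_unique by simp
  show sq: "L2 (ft f)" by (rule L2_leI(1)[where c="l2norm f"]) (auto simp: eq)
  have "(l2norm (ft f))\<^sup>2 = (l2norm f)\<^sup>2" using nn_integral_square[OF sq] eq by simp
  then show "l2norm (ft f) = l2norm f" by (simp add: power2_eq_iff_nonneg)
qed

subsection \<open>The transform of square integrable functions\<close>

definition cutoff :: "nat \<Rightarrow> (real \<Rightarrow> complex) \<Rightarrow> real \<Rightarrow> complex"
  where "cutoff N f x = cx (indicator {- real N..real N} x) * f x"

text \<open>The complex-valued counterpart of \<open>is_fourier_transform\<close>. A seminorm can be
  used here because, for square integrable \<open>f\<close>, every cutoff has a square integrable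
  transform, so no difference falls under the convention that divergent integrals are
  \<open>0\<close>.\<close>

definition L2FT :: "(real \<Rightarrow> complex) \<Rightarrow> (real \<Rightarrow> complex) \<Rightarrow> bool"
  where "L2FT f v \<longleftrightarrow> L2 v \<and> (\<lambda>N. l2norm (\<lambda>k. ft (cutoff N f) k - v k)) \<longlonglongrightarrow> 0"

lemma cutoff_measurable [measurable]:
  assumes [measurable]: "f \<in> borel_measurable borel"
  shows "cutoff N f \<in> borel_measurable borel"
  unfolding cutoff_def by measurable

lemma cutoff_square_integrable:
  assumes f: "L2 f"
  shows "integrable lborel (cutoff N f)" "L2 (cutoff N f)"
    "(\<lambda>N. l2norm (\<lambda>x. cutoff N f x - f x)) \<longlonglongrightarrow> 0"
proof -
  have [measurable]: "f \<in> borel_measurable borel" using f by auto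
  have "L2 (\<lambda>x. cx (indicator {- real N..real N} x))"
  proof -
    have "(\<lambda>x. (norm (indicat_real {- real N..real N} x))\<^sup>2) = indicat_real {- real N..real N}"
      by (auto simp: indicator_def)
    then show ?thesis
      unfolding L2_of_real square_integrable_def by (simp add: integrable_real_indicator)
  qed
  from cauchy_schwarz_mult(1)[OF this f]
  show "integrable lborel (cutoff N f)" unfolding cutoff_def[abs_def] .
  show "L2 (cutoff N f)"
    by (rule L2_mono(1)[OF f]) (auto simp: cutoff_def norm_mult indicator_def)
  have I: "integrable lborel (\<lambda>x. (norm (f x))\<^sup>2)" using f by (simp add: square_integrable_def)
  have "(\<lambda>N. LBINT x. (norm (cutoff N f x - f x))\<^sup>2) \<longlonglongrightarrow> integral\<^sup>L lborel (\<lambda>x::real. 0::real)"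
  proof (rule integral_dominated_convergence[OF _ _ I])
    show "AE x in lborel. (\<lambda>N. (norm (cutoff N f x - f x))\<^sup>2) \<longlonglongrightarrow> 0"
    proof (rule AE_I2)
      fix x :: real
      have "eventually (\<lambda>N. (norm (cutoff N f x - f x))\<^sup>2 = 0) sequentially"
        using eventually_ge_at_top[of "nat \<lceil>\<bar>x\<bar>\<rceil>"]
      proof eventually_elim
        case (elim N)
        then have "\<bar>x\<bar> \<le> real N" by linarith
        then show ?case by (auto simp: cutoff_def abs_le_iff)
      qed
      then show "(\<lambda>N. (norm (cutoff N f x - f x))\<^sup>2) \<longlonglongrightarrow> 0" by (rule tendsto_eventually)
    qed
    show "AE x in lborel. norm ((norm (cutoff N f x - f x))\<^sup>2) \<le> (norm (f x))\<^sup>2" for N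
      by (rule AE_I2) (auto simp: cutoff_def indicator_def)
  qed auto
  then have "(\<lambda>N. sqrt (LBINT x. (norm (cutoff N f x - f x))\<^sup>2)) \<longlonglongrightarrow> sqrt 0"
    by (intro tendsto_real_sqrt) simp
  then show "(\<lambda>N. l2norm (\<lambda>x. cutoff N f x - f x)) \<longlonglongrightarrow> 0" unfolding l2norm_def by simp
qed

lemma ft_cutoff:
  assumes f: "L2 f"
  shows "L2 (ft (cutoff N f))"
  using plancherel(1) cutoff_square_integrable[OF f] by blast

lemma ft_isometry_diff:
  assumes f: "integrable lborel f" "L2 f" and g: "integrable lborel g" "L2 g"
  shows "l2norm (\<lambda>k. ft f k - ft g k) = l2norm (\<lambda>x. f x - g x)"
proof -
  have "(\<lambda>k. ft f k - ft g k) = ft (\<lambda>x. f x - g x)" using ft_diff[OF f(1) g(1)] by auto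
  then show ?thesis using plancherel(2)[of "\<lambda>x. f x - g x"] f g L2_diff(1)[OF f(2) g(2)] by simp
qed

lemma L2FT_exists:
  assumes f: "L2 f"
  shows "\<exists>v. L2FT f v"
proof -
  note C = cutoff_square_integrable[OF f]
  have "\<exists>v. L2 v \<and> (\<lambda>N. l2norm (\<lambda>k. ft (cutoff N f) k - v k)) \<longlonglongrightarrow> 0"
  proof (rule l2_cauchy_limit[OF ft_cutoff[OF f]])
    fix e :: real assume "e > 0"
    then obtain N where N: "\<And>n. n \<ge> N \<Longrightarrow> l2norm (\<lambda>x. cutoff n f x - f x) < e / 2"
      using LIMSEQ_D[OF C(3), of "e/2"] by fastforce
    have "l2norm (\<lambda>k. ft (cutoff m f) k - ft (cutoff n f) k) < e" if "m \<ge> N" "n \<ge> N" for m n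
    proof -
      have "l2norm (\<lambda>k. ft (cutoff m f) k - ft (cutoff n f) k) = l2norm (\<lambda>x. cutoff m f x - cutoff n f x)"
        by (rule ft_isometry_diff[OF C(1,2) C(1,2)])
      also have "\<dots> \<le> l2norm (\<lambda>x. cutoff m f x - f x) + l2norm (\<lambda>x. f x - cutoff n f x)"
        by (rule l2norm_triangle[OF C(2) f C(2)])
      also have "\<dots> < e" using N[OF that(1)] N[OF that(2)] by (simp add: l2norm_minus_commute[of f])
      finally show ?thesis .
    qed
    then show "\<exists>N. \<forall>m\<ge>N. \<forall>n\<ge>N. l2norm (\<lambda>x. ft (cutoff m f) x - ft (cutoff n f) x) < e" by blast
  qed
  then show ?thesis unfolding L2FT_def .
qed

lemma l2norm_tendsto:
  assumes a: "\<And>n. L2 (a n)" and v: "L2 v"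
    and lim: "(\<lambda>n. l2norm (\<lambda>x. a n x - v x)) \<longlonglongrightarrow> 0"
  shows "(\<lambda>n. l2norm (a n)) \<longlonglongrightarrow> l2norm v"
proof -
  have "(\<lambda>n. l2norm (a n) - l2norm v) \<longlonglongrightarrow> 0"
    by (rule Lim_null_comparison[OF always_eventually lim]) (use l2norm_diff_abs[OF a v] in simp)
  then show ?thesis by (simp add: LIM_zero_iff)
qed

lemma L2FT_norm:
  assumes f: "L2 f" and v: "L2FT f v"
  shows "l2norm v = l2norm f"
proof -
  note C = cutoff_square_integrable[OF f]
  have "(\<lambda>N. l2norm (ft (cutoff N f))) \<longlonglongrightarrow> l2norm v"
    using v unfolding L2FT_def by (intro l2norm_tendsto ft_cutoff[OF f]) auto
  moreover have "(\<lambda>N. l2norm (cutoff N f)) \<longlonglongrightarrow> l2norm f"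
    by (rule l2norm_tendsto[OF C(2) f C(3)])
  ultimately show ?thesis unfolding plancherel(2)[OF C(1,2)] by (rule LIMSEQ_unique)
qed

lemma L2FT_unique:
  assumes f: "L2 f" and v: "L2FT f v" and w: "L2FT f w"
  shows "AE k in lborel. v k = w k"
proof -
  have sv: "L2 v" "L2 w" using v w by (auto simp: L2FT_def)
  have "l2norm (\<lambda>k. v k - w k) \<le> l2norm (\<lambda>k. ft (cutoff N f) k - v k) + l2norm (\<lambda>k. ft (cutoff N f) k - w k)" for N
    using l2norm_triangle[OF sv(1) ft_cutoff[OF f] sv(2), of N] by (simp add: l2norm_minus_commute[of v])
  moreover have "(\<lambda>N. l2norm (\<lambda>k. ft (cutoff N f) k - v k) + l2norm (\<lambda>k. ft (cutoff N f) k - w k)) \<longlonglongrightarrow> 0"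
    using v w by (intro tendsto_add_zero) (simp_all add: L2FT_def)
  ultimately have "l2norm (\<lambda>k. v k - w k) \<le> 0" by (intro LIMSEQ_le_const) auto
  then have "l2norm (\<lambda>k. v k - w k) = 0" using l2norm_nonneg[of "\<lambda>k. v k - w k"] by linarith
  then show ?thesis using l2norm_zero_iff[OF L2_diff(1)[OF sv]] by simp
qed

lemma L2FT_diff:
  assumes f: "L2 f" "L2FT f v" and g: "L2 g" "L2FT g w"
  shows "L2FT (\<lambda>x. f x - g x) (\<lambda>k. v k - w k)"
proof -
  have sv: "L2 v" "L2 w" using f g by (auto simp: L2FT_def)
  have eq: "ft (cutoff N (\<lambda>x. f x - g x)) k = ft (cutoff N f) k - ft (cutoff N g) k" for N k
    using ft_diff[OF cutoff_square_integrable(1)[OF f(1)] cutoff_square_integrable(1)[OF g(1)]]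
    by (simp add: cutoff_def[abs_def] right_diff_distrib)
  have "(\<lambda>N. l2norm (\<lambda>k. ft (cutoff N (\<lambda>x. f x - g x)) k - (v k - w k))) \<longlonglongrightarrow> 0"
  proof (rule tendsto_sandwich[OF always_eventually always_eventually tendsto_const])
    show "(\<lambda>N. l2norm (\<lambda>k. ft (cutoff N f) k - v k) + l2norm (\<lambda>k. ft (cutoff N g) k - w k)) \<longlonglongrightarrow> 0"
      using f g by (intro tendsto_add_zero) (simp_all add: L2FT_def)
    have "l2norm (\<lambda>k. (ft (cutoff N f) k - v k) - (ft (cutoff N g) k - w k)) \<le>
        l2norm (\<lambda>k. ft (cutoff N f) k - v k) + l2norm (\<lambda>k. ft (cutoff N g) k - w k)" for N
      by (intro L2_diff(2) L2_diff(1) ft_cutoff f g sv)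
    then show "\<forall>N. l2norm (\<lambda>k. ft (cutoff N (\<lambda>x. f x - g x)) k - (v k - w k)) \<le>
        l2norm (\<lambda>k. ft (cutoff N f) k - v k) + l2norm (\<lambda>k. ft (cutoff N g) k - w k)"
      unfolding eq by (simp add: algebra_simps)
  qed auto
  then show ?thesis using sv by (simp add: L2FT_def L2_diff)
qed

lemma L2FT_cong_AE:
  assumes "AE x in lborel. f x = g x" "f \<in> borel_measurable borel" "g \<in> borel_measurable borel"
  shows "L2FT f v \<longleftrightarrow> L2FT g v"
proof -
  have "ft (cutoff N f) k = ft (cutoff N g) k" for N k
    by (rule ft_cong_AE) (use assms in \<open>auto simp: cutoff_def\<close>)
  then show ?thesis by (simp add: L2FT_def)
qed

text \<open>The inverse transform is the adjoint of an isometry \<open>F\<close> and is itself isometric, whence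
  \<open>\<parallel>F F\<^sup>* p - p\<parallel>\<^sup>2 = 2 \<parallel>p\<parallel>\<^sup>2 - 2 Re \<langle>F F\<^sup>* p, p\<rangle> = 0\<close>.\<close>

lemma L2FT_inverse:
  assumes p: "integrable lborel p" "L2 p"
  shows "L2 (\<lambda>x. ft p (- x))" "L2FT (\<lambda>x. ft p (- x)) p"
proof -
  have [measurable]: "p \<in> borel_measurable borel" using p by auto
  define R where "R = (\<lambda>x. ft p (- x))"
  have R: "L2 R" "l2norm R = l2norm p"
    using L2_affine[OF plancherel(1)[OF p], of "-1" 0] plancherel(2)[OF p] by (auto simp: R_def)
  then show "L2 (\<lambda>x. ft p (- x))" by (simp add: R_def)
  note C = cutoff_square_integrable[OF R(1)]
  obtain v where v: "L2FT R v" using L2FT_exists[OF R(1)] by blast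
  have sv: "L2 v" and lim: "(\<lambda>N. l2norm (\<lambda>k. ft (cutoff N R) k - v k)) \<longlonglongrightarrow> 0"
    using v by (auto simp: L2FT_def)
  have nv: "l2norm v = l2norm p" using L2FT_norm[OF R(1) v] R(2) by simp
  \<comment> \<open>The adjoint relation, obtained by exchanging the integrals: \<open>R\<close> is
    the adjoint transform of \<open>p\<close>, and the cutoff of \<open>R\<close> paired with
    \<open>R\<close> is its own squared norm.\<close>
  have pair: "(LBINT k. ft (cutoff N R) k * cnj (p k)) = cx ((l2norm (cutoff N R))\<^sup>2)" for N
  proof -
    have P: "integrable lborel (\<lambda>k. cnj (p k))" using p by simp
    have "(LBINT k. ft (cutoff N R) k * cnj (p k)) =
      cx (1 / sqrt (2 * pi)) * (LBINT k. cnj (p k) * (LBINT x. cis (- (k * x)) * cutoff N R x))"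
      unfolding ft_def by (subst integral_mult_right_zero[symmetric]) (simp add: ac_simps)
    also have "(LBINT k. cnj (p k) * (LBINT x. cis (- (k * x)) * cutoff N R x)) =
      (LBINT x. cutoff N R x * (LBINT k. cis (- (k * x)) * cnj (p k)))"
      by (rule Fubini_prod_bounded[OF P C(1), where C=1]) auto
    also have "cx (1 / sqrt (2 * pi)) * \<dots> = (LBINT x. cutoff N R x * cnj (R x))"
      unfolding R_def ft_cnj by (subst integral_mult_right_zero[symmetric]) (simp add: ac_simps)
    also have "\<dots> = (LBINT x. cx ((norm (cutoff N R x))\<^sup>2))"
      unfolding complex_norm_square[symmetric] of_real_power
      by (intro Bochner_Integration.integral_cong refl) (auto simp: cutoff_def indicator_def complex_norm_square simp flip: of_real_power)
    finally show ?thesis unfolding l2norm_sq integral_complex_of_real .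
  qed
  have "(\<lambda>N. LBINT k. ft (cutoff N R) k * cnj (p k)) \<longlonglongrightarrow> (LBINT k. v k * cnj (p k))"
  proof (rule LIM_zero_cancel, rule Lim_null_comparison[OF always_eventually])
    show "\<forall>N. norm ((LBINT k. ft (cutoff N R) k * cnj (p k)) - (LBINT k. v k * cnj (p k)))
      \<le> l2norm (\<lambda>k. ft (cutoff N R) k - v k) * l2norm p"
    proof
      fix N
      have "(LBINT k. ft (cutoff N R) k * cnj (p k)) - (LBINT k. v k * cnj (p k)) =
        (LBINT k. (ft (cutoff N R) k - v k) * cnj (p k))"
        using p by (subst Bochner_Integration.integral_diff[symmetric])
          (auto intro!: cauchy_schwarz_mult ft_cutoff R sv L2_cnj simp: left_diff_distrib)
      then show "norm ((LBINT k. ft (cutoff N R) k * cnj (p k)) - (LBINT k. v k * cnj (p k)))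
        \<le> l2norm (\<lambda>k. ft (cutoff N R) k - v k) * l2norm p"
        using cauchy_schwarz_mult(2)[OF L2_diff(1)[OF ft_cutoff[OF R(1)] sv] L2_cnj(1)[OF p(2)]]
        by (simp add: L2_cnj)
    qed
    show "(\<lambda>N. l2norm (\<lambda>k. ft (cutoff N R) k - v k) * l2norm p) \<longlonglongrightarrow> 0"
      using tendsto_mult_right[OF lim, of "l2norm p"] by simp
  qed
  moreover have "(\<lambda>N. LBINT k. ft (cutoff N R) k * cnj (p k)) \<longlonglongrightarrow> cx ((l2norm p)\<^sup>2)"
    unfolding pair R(2)[symmetric] by (intro tendsto_intros l2norm_tendsto[OF C(2) R(1) C(3)])
  ultimately have ip: "(LBINT k. v k * cnj (p k)) = cx ((l2norm p)\<^sup>2)"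
    by (rule LIMSEQ_unique)
  have I: "integrable lborel (\<lambda>k. v k * cnj (p k))"
    by (intro cauchy_schwarz_mult sv L2_cnj p)
  have "(l2norm (\<lambda>k. v k - p k))\<^sup>2 = (LBINT k. (norm (v k))\<^sup>2 + (norm (p k))\<^sup>2 - 2 * Re (v k * cnj (p k)))"
    unfolding l2norm_sq
    by (intro Bochner_Integration.integral_cong refl, unfold cmod_power2) (simp add: power2_eq_square algebra_simps)
  also have "\<dots> = (l2norm v)\<^sup>2 + (l2norm p)\<^sup>2 - 2 * Re (LBINT k. v k * cnj (p k))"
  proof -
    define z where "z = (\<lambda>k. v k * cnj (p k))"
    have "integrable lborel z" using I by (simp add: z_def)
    then have "(LBINT k. (norm (v k))\<^sup>2 + (norm (p k))\<^sup>2 - 2 * Re (z k)) =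
       (LBINT k. (norm (v k))\<^sup>2) + (LBINT k. (norm (p k))\<^sup>2) - 2 * Re (LBINT k. z k)"
      using sv p(2) unfolding square_integrable_def by simp
    then show ?thesis unfolding l2norm_sq z_def .
  qed
  also have "\<dots> = 0" unfolding ip nv by simp
  finally have "l2norm (\<lambda>k. v k - p k) = 0" by simp
  then have AE: "AE k in lborel. v k = p k"
    using l2norm_zero_iff[OF L2_diff(1)[OF sv p(2)]] by simp
  have "l2norm (\<lambda>k. ft (cutoff N R) k - p k) = l2norm (\<lambda>k. ft (cutoff N R) k - v k)" for N
    using AE ft_cutoff[OF R(1), of N] sv p(2)
    by (intro l2norm_cong_AE) (auto intro!: L2_measurable L2_diff)
  then show "L2FT (\<lambda>x. ft p (- x)) p" using lim p(2) unfolding L2FT_def R_def by simp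
qed

text \<open>Both \<open>f\<close> and the inverse transform of \<open>v\<close> have
  \<open>v\<close> as their transform, so their difference has transform \<open>0\<close> and
  vanishes by isometry.\<close>

lemma L2FT_inversion:
  assumes f: "L2 f" "L2FT f v" and v: "integrable lborel v"
  shows "AE x in lborel. f x = ft v (- x)"
proof -
  have sv: "L2 v" using f by (simp add: L2FT_def)
  note I = L2FT_inverse[OF v sv]
  have "L2FT (\<lambda>x. f x - ft v (- x)) (\<lambda>k. v k - v k)" by (rule L2FT_diff[OF f I])
  from L2FT_norm[OF L2_diff(1)[OF f(1) I(1)] this]
  have "l2norm (\<lambda>x. f x - ft v (- x)) = 0" by (simp add: l2norm_def)
  then show ?thesis using l2norm_zero_iff[OF L2_diff(1)[OF f(1) I(1)]] by simp
qed

text \<open>Square integrability of all truncated transforms makes the nonnegative integral equal to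
  the square of the seminorm, and squaring does not affect convergence to \<open>0\<close>.\<close>

lemma is_fourier_transform_iff:
  assumes u: "L2 u"
  shows "is_fourier_transform u v \<longleftrightarrow> L2FT (\<lambda>x. cx (u x)) v"
proof (cases "L2 v")
  case True
  have cu: "L2 (\<lambda>x. cx (u x))" using u by (simp add: L2_of_real)
  have eq: "truncated_fourier N u = ft (cutoff N (\<lambda>x. cx (u x)))" for N
    unfolding truncated_fourier_def ft_def cutoff_def set_lebesgue_integral_def
    by (intro ext arg_cong2[where f="(*)"] refl Bochner_Integration.integral_cong) (auto simp: indicator_def)
  have nn: "(\<integral>\<^sup>+ k. ennreal ((cmod (truncated_fourier N u k - v k))\<^sup>2) \<partial>lborel) =
      ennreal ((l2norm (\<lambda>k. ft (cutoff N (\<lambda>x. cx (u x))) k - v k))\<^sup>2)" for N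
    unfolding eq by (rule nn_integral_square[OF L2_diff(1)[OF ft_cutoff[OF cu] True]])
  have "(\<lambda>N. ennreal ((a N)\<^sup>2)) \<longlonglongrightarrow> 0 \<longleftrightarrow> a \<longlonglongrightarrow> 0" if "\<And>N. a N \<ge> 0" for a :: "nat \<Rightarrow> real"
  proof -
    have "(\<lambda>N. ennreal ((a N)\<^sup>2)) \<longlonglongrightarrow> ennreal 0 \<longleftrightarrow> (\<lambda>N. (a N)\<^sup>2) \<longlonglongrightarrow> 0"
      by (rule tendsto_ennreal_iff) auto
    also have "\<dots> \<longleftrightarrow> a \<longlonglongrightarrow> 0"
    proof
      assume "(\<lambda>N. (a N)\<^sup>2) \<longlonglongrightarrow> 0"
      then have "(\<lambda>N. sqrt ((a N)\<^sup>2)) \<longlonglongrightarrow> sqrt 0" by (rule tendsto_real_sqrt)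
      then show "a \<longlonglongrightarrow> 0" using that by simp
    next
      assume "a \<longlonglongrightarrow> 0"
      then show "(\<lambda>N. (a N)\<^sup>2) \<longlonglongrightarrow> 0" using tendsto_power[of a 0 _ 2] by simp
    qed
    finally show ?thesis by simp
  qed
  from this[of "\<lambda>N. l2norm (\<lambda>k. ft (cutoff N (\<lambda>x. cx (u x))) k - v k)"]
  show ?thesis unfolding is_fourier_transform_def L2FT_def nn using True by simp
qed (simp add: is_fourier_transform_def L2FT_def)

lemma fourier_L2FT:
  assumes u: "L2 u"
  shows "L2FT (\<lambda>x. cx (u x)) (fourier u)" "L2 (fourier u)"
proof -
  have "\<exists>v. is_fourier_transform u v"
    using L2FT_exists[of "\<lambda>x. cx (u x)"] u by (simp add: is_fourier_transform_iff L2_of_real)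
  then have "is_fourier_transform u (fourier u)" unfolding fourier_def by (rule someI_ex)
  then show "L2FT (\<lambda>x. cx (u x)) (fourier u)" using is_fourier_transform_iff[OF u] by simp
  then show "L2 (fourier u)" by (simp add: L2FT_def)
qed

text \<open>The device for identifying the chosen representative \<open>fourier u\<close>: once
  \<open>u\<close> is exhibited as an inverse transform, uniqueness fixes \<open>fourier u\<close>
  up to a null set.\<close>

lemma fourier_inverse:
  assumes p: "integrable lborel p" "L2 p"
    and [measurable]: "u \<in> borel_measurable borel" and eq: "AE x in lborel. cx (u x) = ft p (- x)"
  shows "L2 u" "AE k in lborel. fourier u k = p k"
proof -
  have [measurable]: "p \<in> borel_measurable borel" using p by auto
  have "AE x in lborel. norm (cx (u x)) \<le> norm (ft p (- x))"
    using eq by eventually_elim (metis order_refl)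
  then have "L2 (\<lambda>x. cx (u x))"
    by (intro L2_mono(1)[OF L2FT_inverse(1)[OF p]]) auto
  then show u: "L2 u" by (simp add: L2_of_real)
  have "L2FT (\<lambda>x. cx (u x)) p"
    using L2FT_inverse(2)[OF p] L2FT_cong_AE[OF eq] by simp
  then show "AE k in lborel. fourier u k = p k"
    using L2FT_unique[OF _ fourier_L2FT(1)[OF u]] u by (simp add: L2_of_real)
qed

text \<open>The truncated transforms of a real function are Hermitian, and reflection with
  conjugation preserves the seminorm. Uniqueness of the limit gives the symmetry only almost
  everywhere.\<close>

lemma fourier_hermitian:
  assumes u: "L2 u"
  shows "AE k in lborel. fourier u (- k) = cnj (fourier u k)"
proof -
  let ?u = "\<lambda>x. cx (u x)" and ?v = "\<lambda>k. cnj (fourier u (- k))"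
  note v = fourier_L2FT[OF u]
  have [measurable]: "fourier u \<in> borel_measurable borel" using v by auto
  have cu: "L2 ?u" using u by (simp add: L2_of_real)
  have herm: "ft (cutoff N ?u) k = cnj (ft (cutoff N ?u) (- k))" for N k
    unfolding ft_cnj by (simp add: ft_def cutoff_def)
  have sq: "L2 (\<lambda>k. ft (cutoff N ?u) k - fourier u k)" for N
    by (intro L2_diff ft_cutoff cu v)
  have "l2norm (\<lambda>k. ft (cutoff N ?u) k - ?v k) = l2norm (\<lambda>k. ft (cutoff N ?u) k - fourier u k)" for N
  proof -
    have "l2norm (\<lambda>k. ft (cutoff N ?u) k - ?v k) = l2norm (\<lambda>k. ft (cutoff N ?u) (- k) - fourier u (- k))"
      unfolding l2norm_def by (subst herm) (simp flip: complex_cnj_diff)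
    also have "\<dots> = l2norm (\<lambda>k. ft (cutoff N ?u) k - fourier u k)"
      using L2_affine(2)[OF sq[of N], where c="-1" and t=0] by simp
    finally show ?thesis .
  qed
  moreover have "L2 ?v"
    using L2_cnj(1)[OF L2_affine(1)[OF v(2), of "-1" 0]] by simp
  ultimately have "L2FT ?u ?v" using v by (simp add: L2FT_def)
  from L2FT_unique[OF cu v(1) this]
  have "AE k in lborel. fourier u k = cnj (fourier u (- k))" .
  then show ?thesis by eventually_elim (metis complex_cnj_cnj)
qed

subsection \<open>Convolution and pairing\<close>

definition conv :: "(real \<Rightarrow> complex) \<Rightarrow> (real \<Rightarrow> complex) \<Rightarrow> real \<Rightarrow> complex"
  where "conv f g k = (LBINT l. f (k - l) * g l)"

lemma conv_measurable [measurable]: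
  assumes [measurable]: "f \<in> borel_measurable borel" "g \<in> borel_measurable borel"
  shows "conv f g \<in> borel_measurable borel"
  unfolding conv_def by measurable

text \<open>Parseval's relation in bilinear form: without a conjugate, the reflection appears in the
  argument of the second transform.\<close>

lemma ift_pairing:
  assumes p: "integrable lborel p" and f: "integrable lborel f"
  shows "(LBINT x. ft p (- x) * f x) = (LBINT k. p k * ft f (- k))"
proof -
  have "(LBINT x. ft p (- x) * f x) = cx (1 / sqrt (2 * pi)) * (LBINT x. f x * (LBINT k. cis (x * k) * p k))"
    unfolding ft_def by (subst integral_mult_right_zero[symmetric]) (simp add: ac_simps)
  also have "(LBINT x. f x * (LBINT k. cis (x * k) * p k)) = (LBINT k. p k * (LBINT x. cis (x * k) * f x))"
    by (rule Fubini_prod_bounded[OF f p, where C=1]) auto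
  also have "cx (1 / sqrt (2 * pi)) * \<dots> = (LBINT k. p k * ft f (- k))"
    unfolding ft_def by (subst integral_mult_right_zero[symmetric]) (simp add: ac_simps)
  finally show ?thesis .
qed

text \<open>The factor \<open>sqrt (2 * pi)\<close> is the price of the unitary normalization. It is
  the origin of the constant \<open>c0\<close> in front of every convolution that represents a
  product.\<close>

lemma ft_conv:
  assumes f: "integrable lborel f" and g: "integrable lborel g"
  shows "integrable lborel (conv f g)" "ft (conv f g) k = cx (sqrt (2 * pi)) * (ft f k * ft g k)"
proof -
  have [measurable]: "f \<in> borel_measurable borel" "g \<in> borel_measurable borel" using f g by auto
  have shift: "integrable lborel (\<lambda>k. f (k - l))" "(LBINT k. norm (f (k - l))) = (LBINT x. norm (f x))" for l
    using translation_integrable[OF f, of "-l"] translation_integrable(2)[of "\<lambda>x. norm (f x)" "-l"] f by auto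
  have I: "integrable (lborel \<Otimes>\<^sub>M lborel) (\<lambda>(l, k). f (k - l) * g l)"
  proof (rule lborel_pair.Fubini_integrable)
    show "integrable lborel (\<lambda>l. LBINT k. norm (case (l, k) of (l, k) \<Rightarrow> f (k - l) * g l))"
      using g by (simp add: norm_mult shift)
    show "AE l in lborel. integrable lborel (\<lambda>k. case (l, k) of (l, k) \<Rightarrow> f (k - l) * g l)"
      using shift by auto
  qed measurable
  show "integrable lborel (conv f g)"
    using lborel_pair.integrable_snd[OF I] by (simp add: conv_def[abs_def])
  have I': "integrable (lborel \<Otimes>\<^sub>M lborel) (\<lambda>(l, j). cis (- (k * j)) * (f (j - l) * g l))"
    using integrable_bounded_mult[OF I, of "\<lambda>(l, j). cis (- (k * j))" 1] by (simp add: case_prod_unfold)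
  have "(LBINT j. cis (- (k * j)) * conv f g j) = (LBINT j. (LBINT l. cis (- (k * j)) * (f (j - l) * g l)))"
    unfolding conv_def by simp
  also have "\<dots> = (LBINT l. (LBINT j. cis (- (k * j)) * (f (j - l) * g l)))"
    using lborel_pair.Fubini_integral[OF I'] by simp
  also have "\<dots> = (LBINT l. (LBINT m. cis (- (k * m)) * f m) * (cis (- (k * l)) * g l))"
  proof (intro Bochner_Integration.integral_cong refl)
    fix l
    have "(LBINT j. cis (- (k * j)) * (f (j - l) * g l)) = (LBINT m. cis (- (k * (l + 1 * m))) * (f ((l + 1 * m) - l) * g l))"
      by (subst lborel_integral_real_affine[where c=1 and t=l]) auto
    also have "\<dots> = (LBINT m. (cis (- (k * m)) * f m) * (cis (- (k * l)) * g l))"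
    proof (intro Bochner_Integration.integral_cong refl)
      fix m
      have "cis (- (k * (l + 1 * m))) = cis (- (k * m)) * cis (- (k * l))" by (simp add: cis_mult algebra_simps)
      then show "cis (- (k * (l + 1 * m))) * (f ((l + 1 * m) - l) * g l) = (cis (- (k * m)) * f m) * (cis (- (k * l)) * g l)"
        by simp
    qed
    also have "\<dots> = (LBINT m. cis (- (k * m)) * f m) * (cis (- (k * l)) * g l)"
      by (rule integral_mult_left_zero)
    finally show "(LBINT j. cis (- (k * j)) * (f (j - l) * g l)) = (LBINT m. cis (- (k * m)) * f m) * (cis (- (k * l)) * g l)" .
  qed
  also have "\<dots> = (LBINT m. cis (- (k * m)) * f m) * (LBINT l. cis (- (k * l)) * g l)" by simp
  finally have *: "(LBINT j. cis (- (k * j)) * conv f g j) = \<dots>" .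
  have "cx (sqrt (2 * pi)) \<noteq> 0" by simp
  then show "ft (conv f g) k = cx (sqrt (2 * pi)) * (ft f k * ft g k)"
    unfolding ft_def * by (simp add: field_simps)
qed

section \<open>Sobolev spaces\<close>

text \<open>Half the exponent, so that the square is the weight in the Sobolev norm;
  \<open>wt r k\<close> is the Japanese bracket of \<open>k\<close> to the power
  \<open>r\<close>.\<close>

definition wt :: "real \<Rightarrow> real \<Rightarrow> real"
  where "wt r k = (1 + k\<^sup>2) powr (r / 2)"

lemma wt_measurable [measurable]: "wt r \<in> borel_measurable borel"
  unfolding wt_def[abs_def] by measurable

lemma one_plus_square_pos: "0 < 1 + (x::real)\<^sup>2"
  by (simp add: add_pos_nonneg)

lemma wt_pos [simp]: "wt r k > 0"
  using one_plus_square_pos[of k] by (simp add: wt_def)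

lemma wt_nonneg [simp]: "wt r k \<ge> 0"
  using wt_pos[of r k] by linarith

lemma wt_nonzero [simp]: "wt r k \<noteq> 0"
  using wt_pos[of r k] by linarith

lemma wt_ge_1: "r \<ge> 0 \<Longrightarrow> wt r k \<ge> 1"
  by (simp add: wt_def ge_one_powr_ge_zero)

lemma wt_add: "wt (r + s) k = wt r k * wt s k"
  by (simp add: wt_def add_divide_distrib powr_add)

lemma wt_mono: "r \<le> s \<Longrightarrow> wt r k \<le> wt s k"
  unfolding wt_def by (rule powr_mono) auto

lemma wt_square: "(wt r k)\<^sup>2 = (1 + k\<^sup>2) powr r"
  by (simp add: wt_def powr_powr flip: powr_realpow power2_eq_square) (simp add: power2_eq_square flip: powr_add)

lemma wt_2: "wt 2 k = 1 + k\<^sup>2"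
  using one_plus_square_pos[of k] by (simp add: wt_def)

lemma wt_minus [simp]: "wt r (- k) = wt r k"
  by (simp add: wt_def)

lemma abs_le_wt_1: "\<bar>k\<bar> \<le> wt 1 k"
proof -
  have "\<bar>k\<bar> = sqrt (k\<^sup>2)" by simp
  also have "\<dots> \<le> sqrt (1 + k\<^sup>2)" by (intro real_sqrt_le_mono) auto
  also have "\<dots> = wt 1 k" by (simp add: wt_def powr_half_sqrt)
  finally show ?thesis .
qed

lemma sobolev_iff:
  assumes u: "L2 u"
  shows "u \<in> sobolev r \<longleftrightarrow> L2 (\<lambda>k. cx (wt r k) * fourier u k)"
    and sobolev_norm_eq: "sobolev_norm r u = l2norm (\<lambda>k. cx (wt r k) * fourier u k)"
proof -
  have [measurable]: "fourier u \<in> borel_measurable borel" using fourier_L2FT(2)[OF u] by auto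
  have "(norm (cx (wt r k) * fourier u k))\<^sup>2 = (cmod (fourier u k))\<^sup>2 * (1 + k\<^sup>2) powr r" for k
    by (simp add: norm_mult power_mult_distrib wt_square)
  then show "u \<in> sobolev r \<longleftrightarrow> L2 (\<lambda>k. cx (wt r k) * fourier u k)"
    "sobolev_norm r u = l2norm (\<lambda>k. cx (wt r k) * fourier u k)"
    using u by (simp_all add: sobolev_def square_integrable_def sobolev_norm_def l2norm_def)
qed

lemma sobolev_square_integrable: "u \<in> sobolev r \<Longrightarrow> L2 u"
  by (simp add: sobolev_def)

lemma inverse_weight: "L2 (\<lambda>k. 1 / wt 1 k)"
proof -
  have "integrable lborel (\<lambda>x::real. inverse (1 + x\<^sup>2))"
    using integrable_inverse_1_plus_square by (simp add: set_integrable_def)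
  moreover have "(norm (1 / wt 1 k))\<^sup>2 = inverse (1 + k\<^sup>2)" for k
    using one_plus_square_pos[of k] by (simp add: power_divide wt_square inverse_eq_divide)
  ultimately show ?thesis by (simp add: square_integrable_def)
qed

text \<open>The Cauchy-Schwarz constant of the embedding of \<open>H\<close> of order
  \<open>1\<close> into the functions with integrable transform; its value is
  \<open>sqrt pi\<close>. The smallness condition on the profile is expressed through it.\<close>

definition K0 :: real where "K0 = l2norm (\<lambda>k. 1 / wt 1 k)"

lemma K0_nonneg [simp]: "K0 \<ge> 0" by (simp add: K0_def)

lemma weight_integrable:
  fixes f :: "real \<Rightarrow> 'a::{banach, real_normed_field, second_countable_topology}"
  assumes f: "L2 (\<lambda>k. of_real (wt 1 k) * f k)" and [measurable]: "f \<in> borel_measurable borel"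
  shows "integrable lborel f" "(LBINT k. norm (f k)) \<le> K0 * l2norm (\<lambda>k. of_real (wt 1 k) * f k)"
    "L2 f"
proof -
  have eq: "norm (1 / wt 1 k) * norm (of_real (wt 1 k) * f k) = norm (f k)" for k
    by (simp add: norm_mult norm_divide)
  show "integrable lborel f"
    using cauchy_schwarz(1)[OF inverse_weight f] unfolding eq
    by (rule Bochner_Integration.integrable_bound) auto
  show "(LBINT k. norm (f k)) \<le> K0 * l2norm (\<lambda>k. of_real (wt 1 k) * f k)"
    using cauchy_schwarz(2)[OF inverse_weight f] unfolding eq K0_def .
  show "L2 f"
    by (rule L2_mono(1)[OF f])
       (use mult_right_mono[OF wt_ge_1[of 1] norm_ge_zero] in \<open>auto simp: norm_mult\<close>)
qed

lemma weight_square_integrable_mono: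
  fixes f :: "real \<Rightarrow> complex"
  assumes f: "L2 (\<lambda>k. cx (wt s k) * f k)" and [measurable]: "f \<in> borel_measurable borel"
    and rs: "r \<le> s"
  shows "L2 (\<lambda>k. cx (wt r k) * f k)"
    "l2norm (\<lambda>k. cx (wt r k) * f k) \<le> l2norm (\<lambda>k. cx (wt s k) * f k)"
proof -
  have "norm (cx (wt r k) * f k) \<le> norm (cx (wt s k) * f k)" for k
    using wt_mono[OF rs, of k] by (simp add: norm_mult mult_right_mono)
  then have AE: "AE k in lborel. norm (cx (wt r k) * f k) \<le> norm (cx (wt s k) * f k)" by blast
  show "L2 (\<lambda>k. cx (wt r k) * f k)"
    "l2norm (\<lambda>k. cx (wt r k) * f k) \<le> l2norm (\<lambda>k. cx (wt s k) * f k)"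
    using L2_mono[OF f _ AE] by auto
qed

text \<open>From order \<open>1\<close> on, the transform is integrable, so the function agrees
  almost everywhere with an absolutely convergent Fourier integral. Products and differences can
  then be computed pointwise.\<close>

lemma sobolev_inversion:
  assumes u: "u \<in> sobolev r" and r: "r \<ge> 1"
  shows "integrable lborel (fourier u)" "AE x in lborel. cx (u x) = ft (fourier u) (- x)"
proof -
  note su = sobolev_square_integrable[OF u]
  note v = fourier_L2FT[OF su]
  have [measurable]: "fourier u \<in> borel_measurable borel" using v by auto
  have "L2 (\<lambda>k. cx (wt 1 k) * fourier u k)"
    using u r sobolev_iff[OF su] weight_square_integrable_mono(1) by auto
  from weight_integrable(1)[OF this] show I: "integrable lborel (fourier u)" by simp
  show "AE x in lborel. cx (u x) = ft (fourier u) (- x)"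
    by (rule L2FT_inversion[OF _ v(1) I]) (use su in \<open>simp add: L2_of_real\<close>)
qed

section \<open>Test functions\<close>

text \<open>The standard flat function together with negative powers of \<open>y\<close>: the powers
  keep the derivatives within linear combinations of the same family.\<close>

definition flat :: "nat \<Rightarrow> real \<Rightarrow> real"
  where "flat j y = (if y > 0 then exp (- 1 / y) / y ^ j else 0)"

text \<open>A single term of the exponential series at \<open>1 / y\<close>. The spare factor
  \<open>y\<^sup>2\<close> makes the derivative at the origin vanish.\<close>

lemma flat_bound: "\<bar>flat j y\<bar> \<le> fact (j + 2) * y\<^sup>2"
proof (cases "y > 0")
  case True
  have "(1 / y) ^ (j + 2) / fact (j + 2) \<le> exp (1 / y)"
  proof -
    have s: "(\<lambda>n. (1 / y) ^ n /\<^sub>R fact n) sums exp (1 / y)" by (rule exp_converges)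
    have "(\<Sum>n\<in>{j + 2}. (1 / y) ^ n /\<^sub>R fact n) \<le> exp (1 / y)"
      unfolding sums_unique[OF s] using True s by (intro sum_le_suminf) (auto simp: sums_iff)
    then show ?thesis by (simp add: divide_inverse_commute)
  qed
  then have "exp (- (1 / y)) \<le> fact (j + 2) * y ^ (j + 2)"
  proof -
    have gen: "inverse e \<le> F * z" if "1 / z / F \<le> e" "z > 0" "F > 0" for e F z :: real
      using le_imp_inverse_le[OF that(1)] that by (simp add: mult.commute)
    show ?thesis
      using gen[of "y ^ (j + 2)" "fact (j + 2)" "exp (1 / y)"] True \<open>_ \<le> exp (1 / y)\<close>
      unfolding exp_minus by (simp add: power_one_over)
  qed
  then have "exp (- 1 / y) / y ^ j \<le> fact (j + 2) * y ^ (j + 2) / y ^ j"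
    using True by (intro divide_right_mono) auto
  also have "\<dots> = fact (j + 2) * y\<^sup>2" using True by (simp add: power_add power2_eq_square)
  finally show ?thesis using True by (simp add: flat_def)
qed (simp add: flat_def)

lemma flat_deriv: "(flat j has_real_derivative (flat (j + 2) y - real j * flat (j + 1) y)) (at y)"
proof -
  consider "y > 0" | "y < 0" | "y = 0" by linarith
  then show ?thesis
  proof cases
    case 1
    have "((\<lambda>y. exp (- 1 / y) / y ^ j) has_real_derivative (exp (- 1 / y) / y ^ (j + 2) - real j * (exp (- 1 / y) / y ^ (j + 1)))) (at y)"
    proof -
      have e: "((\<lambda>y. exp (- 1 / y)) has_real_derivative exp (- 1 / y) * (1 / y\<^sup>2)) (at y)"
        using 1 by (auto intro!: derivative_eq_intros simp: power2_eq_square)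
      have eq: "(E * (1 / y\<^sup>2) * y ^ j - E * (real j * y ^ (j - Suc 0))) / (y ^ j * y ^ j)
          = E / y ^ (j + 2) - real j * (E / y ^ (j + 1))" for E
        using 1 by (cases j) (simp_all add: field_simps power2_eq_square)
      show ?thesis
        by (rule DERIV_cong[OF DERIV_divide[OF e DERIV_pow[of j y]]]) (use 1 eq in auto)
    qed
    then have "((\<lambda>y. exp (- 1 / y) / y ^ j) has_real_derivative (flat (j + 2) y - real j * flat (j + 1) y)) (at y)"
      using 1 by (simp add: flat_def)
    moreover have ev: "eventually (\<lambda>y. flat j y = exp (- 1 / y) / y ^ j) (nhds y)"
      using eventually_nhds_in_open[of "{0<..}" y] 1 by (auto elim!: eventually_mono simp: flat_def)
    ultimately show ?thesis using DERIV_cong_ev[OF refl ev refl] by simp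
  next
    case 2
    have "((\<lambda>y. 0::real) has_real_derivative 0) (at y)" by simp
    moreover have ev: "eventually (\<lambda>y. flat j y = 0) (nhds y)"
      using eventually_nhds_in_open[of "{..<0}" y] 2 by (auto elim!: eventually_mono simp: flat_def)
    ultimately have "(flat j has_real_derivative 0) (at y)" using DERIV_cong_ev[OF refl ev refl] by simp
    then show ?thesis using 2 by (simp add: flat_def)
  next
    case 3
    have "(\<lambda>h. flat j h / h) \<midarrow>0\<rightarrow> 0"
    proof (rule Lim_null_comparison)
      show "\<forall>\<^sub>F h in at 0. norm (flat j h / h) \<le> fact (j + 2) * \<bar>h\<bar>"
      proof (rule eventually_mono[OF eventually_neq_at_within[of 0]])
        fix h :: real assume "h \<noteq> 0"
        then show "norm (flat j h / h) \<le> fact (j + 2) * \<bar>h\<bar>"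
          using flat_bound[of j h] by (simp add: abs_divide divide_le_eq power2_eq_square mult.assoc)
      qed
      show "((\<lambda>h. fact (j + 2) * \<bar>h\<bar>) \<longlongrightarrow> (0::real)) (at 0)"
        by (auto intro!: tendsto_eq_intros)
    qed
    then have "(flat j has_real_derivative 0) (at 0)" by (simp add: DERIV_def flat_def)
    then show ?thesis using 3 by (simp add: flat_def)
  qed
qed

text \<open>A class closed under differentiation, so that all iterated derivatives exist by
  induction without being computed. Cosines and sines are included in order to test against
  oscillating bumps.\<close>

inductive smooth_algebra :: "(real \<Rightarrow> real) \<Rightarrow> bool" where
  "smooth_algebra (\<lambda>x. flat j (a + b * x))"
| "smooth_algebra (\<lambda>x. cos (b * x))"
| "smooth_algebra (\<lambda>x. sin (b * x))"
| "smooth_algebra f \<Longrightarrow> smooth_algebra g \<Longrightarrow> smooth_algebra (\<lambda>x. f x + g x)"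
| "smooth_algebra f \<Longrightarrow> smooth_algebra g \<Longrightarrow> smooth_algebra (\<lambda>x. f x * g x)"
| "smooth_algebra f \<Longrightarrow> smooth_algebra (\<lambda>x. c * f x)"

lemma smooth_algebra_deriv:
  "smooth_algebra f \<Longrightarrow> \<exists>g. smooth_algebra g \<and> (\<forall>x. (f has_real_derivative g x) (at x))"
proof (induction rule: smooth_algebra.induct)
  case (1 j a b)
  have inner: "((\<lambda>x. a + b * x) has_real_derivative b) (at x)" for x
    by (auto intro!: derivative_eq_intros)
  have "((\<lambda>x. flat j (a + b * x)) has_real_derivative (b * flat (j + 2) (a + b * x) + (- real j * b) * flat (j + 1) (a + b * x))) (at x)" for x
    by (rule DERIV_cong[OF DERIV_chain2[OF flat_deriv inner]]) (simp add: algebra_simps)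
  then show ?case
    by (intro exI[of _ "\<lambda>x. b * flat (j + 2) (a + b * x) + (- real j * b) * flat (j + 1) (a + b * x)"] conjI allI smooth_algebra.intros)
next
  case (2 b)
  have "((\<lambda>x. cos (b * x)) has_real_derivative (- b) * sin (b * x)) (at x)" for x
    by (auto intro!: derivative_eq_intros)
  then show ?case
    by (intro exI[of _ "\<lambda>x. (- b) * sin (b * x)"] conjI allI smooth_algebra.intros)
next
  case (3 b)
  have "((\<lambda>x. sin (b * x)) has_real_derivative b * cos (b * x)) (at x)" for x
    by (auto intro!: derivative_eq_intros)
  then show ?case
    by (intro exI[of _ "\<lambda>x. b * cos (b * x)"] conjI allI smooth_algebra.intros)
next
  case (4 f g)
  then obtain f' g' where *: "smooth_algebra f'" "smooth_algebra g'" "\<And>x. (f has_real_derivative f' x) (at x)"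
    "\<And>x. (g has_real_derivative g' x) (at x)" by blast
  show ?case
    by (rule exI[of _ "\<lambda>x. f' x + g' x"]) (auto intro!: smooth_algebra.intros DERIV_add *)
next
  case (5 f g)
  then obtain f' g' where *: "smooth_algebra f'" "smooth_algebra g'" "\<And>x. (f has_real_derivative f' x) (at x)"
    "\<And>x. (g has_real_derivative g' x) (at x)" by blast
  show ?case
    by (rule exI[of _ "\<lambda>x. f' x * g x + g' x * f x"]) (auto intro!: smooth_algebra.intros DERIV_mult * 5)
next
  case (6 f c)
  then obtain f' where *: "smooth_algebra f'" "\<And>x. (f has_real_derivative f' x) (at x)" by blast
  show ?case
    by (rule exI[of _ "\<lambda>x. c * f' x"]) (auto intro!: smooth_algebra.intros DERIV_cmult *)
qed

lemma smooth_algebra_test: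
  assumes f: "smooth_algebra f" and b: "bounded {x. f x \<noteq> 0}"
  shows "test_function f"
proof -
  have d: "smooth_algebra (deriv g)" if sg: "smooth_algebra g" for g
  proof -
    obtain g' where g': "smooth_algebra g'" "\<And>x. (g has_real_derivative g' x) (at x)"
      using smooth_algebra_deriv[OF sg] by blast
    then have "deriv g = g'" using DERIV_imp_deriv by blast
    then show ?thesis using g' by simp
  qed
  have "smooth_algebra ((deriv ^^ n) f)" for n by (induction n) (auto intro: d f)
  then have "(deriv ^^ n) f field_differentiable at x" for n x
    using smooth_algebra_deriv field_differentiable_def by blast
  then show ?thesis using b by (simp add: test_function_def)
qed

lemma test_function_deriv:
  assumes "test_function f"
  shows "test_function (deriv f)"
proof -
  obtain M where M: "\<And>x. f x \<noteq> 0 \<Longrightarrow> \<bar>x\<bar> \<le> M"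
    using assms by (auto simp: test_function_def bounded_iff)
  have "deriv f x = 0" if "\<bar>x\<bar> > M" for x
  proof -
    have "eventually (\<lambda>y. y \<in> {y. \<bar>y\<bar> > M}) (nhds x)"
      by (rule eventually_nhds_in_open) (use that in \<open>auto intro!: open_Collect_less continuous_intros\<close>)
    then have "eventually (\<lambda>y. f y = 0) (nhds x)"
      by eventually_elim (use M in force)
    then have "deriv f x = deriv (\<lambda>_. 0) x" by (rule deriv_cong_ev) simp
    then show ?thesis by simp
  qed
  then have "bounded {x. deriv f x \<noteq> 0}" by (auto simp: bounded_iff intro!: exI[of _ M] leI)
  moreover have "(deriv ^^ n) (deriv f) = (deriv ^^ Suc n) f" for n by (simp add: funpow_swap1)
  ultimately show ?thesis using assms unfolding test_function_def by metis
qed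

lemma test_function_funpow: "test_function f \<Longrightarrow> test_function ((deriv ^^ n) f)"
  by (induction n) (auto intro: test_function_deriv)

lemma test_function_has_deriv:
  "test_function f \<Longrightarrow> (f has_real_derivative deriv f x) (at x)"
  unfolding test_function_def using field_differentiable_derivI by (metis funpow_0)

lemma test_function_continuous:
  "test_function f \<Longrightarrow> continuous_on UNIV f"
  using test_function_has_deriv DERIV_isCont continuous_at_imp_continuous_on by blast

lemma test_function_support:
  assumes "test_function f"
  obtains M where "M > 0" "\<And>x. \<bar>x\<bar> \<ge> M \<Longrightarrow> f x = 0"
proof -
  obtain M where M: "\<And>x. f x \<noteq> 0 \<Longrightarrow> \<bar>x\<bar> \<le> M"
    using assms by (auto simp: test_function_def bounded_iff)
  show ?thesis
    by (rule that[of "\<bar>M\<bar> + 1"]) (use M in \<open>force+\<close>)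
qed

lemma test_function_integrable:
  assumes f: "test_function f"
  shows "integrable lborel f" "L2 f"
    "integrable lborel (\<lambda>x. cx (f x))" "L2 (\<lambda>x. cx (f x))"
proof -
  obtain M where M: "M > 0" "\<And>x. \<bar>x\<bar> \<ge> M \<Longrightarrow> f x = 0" using test_function_support[OF f] by blast
  note cont = test_function_continuous[OF f]
  have [measurable]: "f \<in> borel_measurable borel" using cont by (rule borel_measurable_continuous_onI)
  have "integrable lborel (\<lambda>x. indicator {-M..M} x *\<^sub>R f x)"
    by (intro borel_integrable_compact continuous_on_subset[OF cont]) auto
  moreover have "(\<lambda>x. indicator {-M..M} x *\<^sub>R f x) = f"
  proof
    fix x show "indicator {-M..M} x *\<^sub>R f x = f x" by (cases "x \<in> {-M..M}") (use M(2)[of x] in auto)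
  qed
  ultimately show I: "integrable lborel f" by simp
  have "integrable lborel (\<lambda>x. indicator {-M..M} x *\<^sub>R (f x)\<^sup>2)"
    by (intro borel_integrable_compact continuous_on_power continuous_on_subset[OF cont]) auto
  moreover have "(\<lambda>x. indicator {-M..M} x *\<^sub>R (f x)\<^sup>2) = (\<lambda>x. (f x)\<^sup>2)"
  proof
    fix x show "indicator {-M..M} x *\<^sub>R (f x)\<^sup>2 = (f x)\<^sup>2" by (cases "x \<in> {-M..M}") (use M(2)[of x] in auto)
  qed
  ultimately show S: "L2 f" by (simp add: square_integrable_def)
  show "integrable lborel (\<lambda>x. cx (f x))" "L2 (\<lambda>x. cx (f x))"
    using I S by (auto simp: L2_of_real)
qed

text \<open>Integration by parts, written as the fundamental theorem for the product with
  \<open>cis\<close> on an interval whose endpoints lie outside the supports.\<close>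

lemma ft_deriv:
  assumes f: "test_function f"
  shows "ft (\<lambda>x. cx (deriv f x)) k = \<i> * k * ft (\<lambda>x. cx (f x)) k"
proof -
  obtain M1 where M1: "M1 > 0" "\<And>x. \<bar>x\<bar> \<ge> M1 \<Longrightarrow> f x = 0" using test_function_support[OF f] by blast
  obtain M2 where M2: "M2 > 0" "\<And>x. \<bar>x\<bar> \<ge> M2 \<Longrightarrow> deriv f x = 0"
    using test_function_support[OF test_function_deriv[OF f]] by blast
  define M where "M = max M1 M2"
  have M: "M > 0" "\<And>x. \<bar>x\<bar> \<ge> M \<Longrightarrow> f x = 0" "\<And>x. \<bar>x\<bar> \<ge> M \<Longrightarrow> deriv f x = 0"
    using M1 M2 by (auto simp: M_def)
  define F where "F = (\<lambda>x. cis (- (k * x)) * cx (f x))"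
  define F' where "F' = (\<lambda>x. cis (- (k * x)) * cx (deriv f x) - \<i> * k * (cis (- (k * x)) * cx (f x)))"
  have der: "(F has_vector_derivative F' x) (at x within {-M..M})" for x
  proof -
    have 1: "((\<lambda>x. cis (- (k * x))) has_vector_derivative (- k) *\<^sub>R (\<i> * cis (- (k * x)))) (at x)"
    proof -
      have "((\<lambda>x. - (k * x)) has_vector_derivative (- k)) (at x)"
        by (auto intro!: derivative_eq_intros simp: has_real_derivative_iff_has_vector_derivative[symmetric])
      moreover have "(cis has_vector_derivative (\<i> * cis (- (k * x)))) (at (- (k * x)))"
      proof -
        have "((\<lambda>z. exp (\<i> * z)) has_field_derivative \<i> * exp (\<i> * cx (- (k * x)))) (at (cx (- (k * x))))"
          by (auto intro!: derivative_eq_intros)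
        from has_vector_derivative_real_field[OF this]
        show ?thesis by (simp add: cis_conv_exp[abs_def] o_def)
      qed
      ultimately show ?thesis using vector_diff_chain_at[of "\<lambda>x. - (k * x)" "- k" x cis] by (simp add: o_def)
    qed
    have 2: "((\<lambda>x. cx (f x)) has_vector_derivative cx (deriv f x)) (at x)"
      using test_function_has_deriv[OF f]
      by (intro has_vector_derivative_of_real) (simp add: has_real_derivative_iff_has_vector_derivative)
    have "(F has_vector_derivative (cis (- (k * x)) * cx (deriv f x) + ((- k) *\<^sub>R (\<i> * cis (- (k * x)))) * cx (f x))) (at x)"
      unfolding F_def by (rule has_vector_derivative_mult[OF 1 2])
    moreover have "cis (- (k * x)) * cx (deriv f x) + ((- k) *\<^sub>R (\<i> * cis (- (k * x)))) * cx (f x) = F' x"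
      by (simp add: F'_def scaleR_conv_of_real)
    ultimately show ?thesis using has_vector_derivative_at_within by metis
  qed
  have cont: "continuous_on {-M..M} F'"
    unfolding F'_def
    by (intro continuous_intros continuous_on_subset[OF test_function_continuous[OF f]] continuous_on_subset[OF test_function_continuous[OF test_function_deriv[OF f]]]) auto
  have "(LBINT x. indicator {-M..M} x *\<^sub>R F' x) = F M - F (- M)"
    by (rule integral_FTC_Icc[OF _ der cont]) (use M in auto)
  also have "\<dots> = 0" using M by (simp add: F_def)
  also have "(\<lambda>x. indicator {-M..M} x *\<^sub>R F' x) = F'"
  proof
    fix x show "indicator {-M..M} x *\<^sub>R F' x = F' x"
    proof (cases "x \<in> {-M..M}")
      case False
      then have "\<bar>x\<bar> \<ge> M" by auto
      then show ?thesis using M(2,3)[of x] by (simp add: F'_def)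
    qed simp
  qed
  finally have "(LBINT x. F' x) = 0" .
  moreover have "(LBINT x. F' x) = (LBINT x. cis (- (k * x)) * cx (deriv f x)) - \<i> * k * (LBINT x. cis (- (k * x)) * cx (f x))"
    unfolding F'_def using ft_integrable_kernel(2)[OF test_function_integrable(3)[OF f], of k]
      ft_integrable_kernel(2)[OF test_function_integrable(3)[OF test_function_deriv[OF f]], of k]
    by (subst Bochner_Integration.integral_diff) auto
  ultimately show ?thesis unfolding ft_def by simp
qed

lemma ft_deriv_2:
  assumes f: "test_function f"
  shows "ft (\<lambda>x. cx ((deriv ^^ 2) f x)) k = - (k\<^sup>2) * ft (\<lambda>x. cx (f x)) k"
proof -
  have "(\<i> * c) * ((\<i> * c) * F) = \<i> * (\<i> * (c * c * F))" for c F by (simp only: mult_ac)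
  then have "(\<i> * c) * ((\<i> * c) * F) = - (c * c) * F" for c F by simp
  then show ?thesis
    using ft_deriv[OF test_function_deriv[OF f], of k] ft_deriv[OF f, of k]
    by (simp only: numeral_2_eq_2 funpow.simps o_apply id_apply) (simp add: power2_eq_square)
qed

lemma ft_deriv_4:
  assumes f: "test_function f"
  shows "ft (\<lambda>x. cx ((deriv ^^ 4) f x)) k = k ^ 4 * ft (\<lambda>x. cx (f x)) k"
proof -
  have "(deriv ^^ 4) f = (deriv ^^ 2) ((deriv ^^ 2) f)" by (simp add: numeral_eq_Suc)
  then show ?thesis using ft_deriv_2[OF test_function_funpow[OF f, of 2], of k] ft_deriv_2[OF f, of k]
    by (simp add: numeral_eq_Suc)
qed

text \<open>The product of the two flat functions is supported in \<open>{-a..a}\<close> and tends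
  to \<open>1\<close> in the interior as \<open>n\<close> grows. The arguments are kept in the
  affine form required by the generators of \<open>smooth_algebra\<close>.\<close>

lemma bump_test:
  fixes a :: real
  assumes "smooth_algebra g"
  shows "test_function (\<lambda>x. (flat 0 (real n * a + real n * x) * flat 0 (real n * a + (- real n) * x)) * g x)"
proof (rule smooth_algebra_test)
  show "bounded {x. (flat 0 (real n * a + real n * x) * flat 0 (real n * a + (- real n) * x)) * g x \<noteq> 0}"
  proof (rule bounded_subset[OF bounded_closed_interval[of "-a" a]], safe)
    fix x assume "(flat 0 (real n * a + real n * x) * flat 0 (real n * a + (- real n) * x)) * g x \<noteq> 0"
    then have "real n * (a + x) > 0" "real n * (a - x) > 0" by (auto simp: flat_def algebra_simps split: if_splits)
    then show "x \<in> {-a..a}" by (auto simp: zero_less_mult_iff)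
  qed
qed (intro smooth_algebra.intros assms)

text \<open>Multiplying the bumps by \<open>cos\<close> and \<open>sin\<close> shows that the Fourier transform of every
  restriction of \<open>h\<close> to a symmetric interval vanishes.\<close>

lemma test_functions_separate:
  fixes h :: "real \<Rightarrow> complex"
  assumes h: "L2 h" and zero: "\<And>\<phi>. test_function \<phi> \<Longrightarrow> (LBINT x. h x * cx (\<phi> x)) = 0"
  shows "AE x in lborel. h x = 0"
proof -
  have [measurable]: "h \<in> borel_measurable borel" using h by auto
  note C = cutoff_square_integrable[OF h]
  have Z: "(LBINT x. cutoff N h x * cx (g x)) = 0"
    if g: "smooth_algebra g" "\<And>x. \<bar>g x\<bar> \<le> 1" and gm [measurable]: "g \<in> borel_measurable borel" for g N
  proof -
    define b where "b = (\<lambda>n x. flat 0 (real n * real N + real n * x) * flat 0 (real n * real N + (- real n) * x))"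
    have fm [measurable]: "flat 0 \<in> borel_measurable borel" unfolding flat_def[abs_def] by measurable
    have bm [measurable]: "b n \<in> borel_measurable borel" for n unfolding b_def by measurable
    have flat01: "0 \<le> flat 0 y" "flat 0 y \<le> 1" for y by (auto simp: flat_def)
    have b01: "\<bar>b n x\<bar> \<le> indicator {-real N..real N} x" for n x
    proof (cases "x \<in> {-real N..real N}")
      case True
      then show ?thesis using flat01 by (simp add: b_def abs_mult mult_le_one)
    next
      case False
      then have "real N + x < 0 \<or> real N - x < 0" by auto
      then have "real n * (real N + x) \<le> 0 \<or> real n * (real N - x) \<le> 0" by (auto simp: mult_le_0_iff)
      then have "b n x = 0" by (auto simp: b_def flat_def algebra_simps)
      then show ?thesis by simp
    qed
    \<comment> \<open>The endpoints are excluded: there all bumps vanish while the indicator of the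
      closed interval is \<open>1\<close>.\<close>
    have lim: "(\<lambda>n. b n x) \<longlonglongrightarrow> indicator {-real N..real N} x" if x: "\<bar>x\<bar> \<noteq> real N" for x
    proof (cases "\<bar>x\<bar> < real N")
      case True
      have fl: "(\<lambda>n. flat 0 (real n * y)) \<longlonglongrightarrow> 1" if y: "y > 0" for y
      proof -
        have "(\<lambda>n. exp (- (inverse (real n) / y))) \<longlonglongrightarrow> exp (- (0 / y))"
          by (intro tendsto_intros lim_inverse_n) (use y in auto)
        moreover have "eventually (\<lambda>n. exp (- (inverse (real n) / y)) = flat 0 (real n * y)) sequentially"
          using eventually_gt_at_top[of 0] by eventually_elim (use y in \<open>auto simp: flat_def field_simps\<close>)
        ultimately show ?thesis using tendsto_cong by force
      qed
      have "(\<lambda>n. flat 0 (real n * (real N + x)) * flat 0 (real n * (real N - x))) \<longlonglongrightarrow> 1 * 1"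
        using True by (intro tendsto_mult fl) auto
      moreover have "b n x = flat 0 (real n * (real N + x)) * flat 0 (real n * (real N - x))" for n
        by (simp add: b_def algebra_simps)
      ultimately show ?thesis using True by (simp add: indicator_def abs_less_iff less_imp_le)
    next
      case False
      then have "x \<notin> {-real N..real N}" using x by auto
      then have "b n x = 0" for n using b01[of n x] by simp
      then show ?thesis using \<open>x \<notin> _\<close> by simp
    qed
    have "(\<lambda>n. LBINT x. h x * cx (b n x * g x)) \<longlonglongrightarrow> (LBINT x. cutoff N h x * cx (g x))"
    proof (rule integral_dominated_convergence[where w="\<lambda>x. norm (cutoff N h x)"])
      have "AE x in lborel. x \<noteq> real N" "AE x in lborel. x \<noteq> - real N" by (rule AE_lborel_singleton)+
      then show "AE x in lborel. (\<lambda>n. h x * cx (b n x * g x)) \<longlonglongrightarrow> cutoff N h x * cx (g x)"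
      proof eventually_elim
        case (elim x)
        then have "\<bar>x\<bar> \<noteq> real N" by auto
        from lim[OF this] have "(\<lambda>n. h x * cx (b n x * g x)) \<longlonglongrightarrow> h x * cx (indicator {-real N..real N} x * g x)"
          by (intro tendsto_intros)
        then show ?case by (simp add: cutoff_def ac_simps)
      qed
      show "AE x in lborel. norm (h x * cx (b n x * g x)) \<le> norm (cutoff N h x)" for n
      proof (rule AE_I2)
        fix x :: real
        have "\<bar>b n x\<bar> * \<bar>g x\<bar> \<le> indicator {-real N..real N} x * 1" by (intro mult_mono b01 g) auto
        then have "norm (h x) * (\<bar>b n x\<bar> * \<bar>g x\<bar>) \<le> norm (h x) * indicator {-real N..real N} x" by (intro mult_left_mono) auto
        then show "norm (h x * cx (b n x * g x)) \<le> norm (cutoff N h x)"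
          by (simp add: norm_mult abs_mult cutoff_def mult.commute)
      qed
      show "integrable lborel (\<lambda>x. norm (cutoff N h x))" using C(1) by simp
    qed measurable
    moreover have "(LBINT x. h x * cx (b n x * g x)) = 0" for n
      unfolding b_def by (rule zero, rule bump_test[OF g(1)])
    ultimately have "(\<lambda>n::nat. 0) \<longlonglongrightarrow> (LBINT x. cutoff N h x * cx (g x))" by simp
    from LIMSEQ_unique[OF this tendsto_const] show ?thesis .
  qed
  have I: "integrable lborel (\<lambda>x. cutoff N h x * cx (g x))"
    if "\<And>x. \<bar>g x\<bar> \<le> 1" and "g \<in> borel_measurable borel" for g N
    using integrable_bounded_mult[OF C(1), of "\<lambda>x. cx (g x)" 1] that by (simp add: mult.commute)
  have "ft (cutoff N h) k = 0" for N k
  proof -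
    have "(LBINT x. cis (- (k * x)) * cutoff N h x) = (LBINT x. cutoff N h x * cx (cos (k * x)) - \<i> * (cutoff N h x * cx (sin (k * x))))"
      by (intro Bochner_Integration.integral_cong refl) (simp add: cis_conv_exp exp_minus complex_eq_iff Re_exp Im_exp algebra_simps)
    also have "\<dots> = (LBINT x. cutoff N h x * cx (cos (k * x))) - \<i> * (LBINT x. cutoff N h x * cx (sin (k * x)))"
      by (subst Bochner_Integration.integral_diff) (auto intro!: integrable_mult_right I)
    also have "\<dots> = 0"
    proof -
      have "(LBINT x. cutoff N h x * cx (cos (k * x))) = 0"
        by (rule Z[OF smooth_algebra.intros(2)]) auto
      moreover have "(LBINT x. cutoff N h x * cx (sin (k * x))) = 0"
        by (rule Z[OF smooth_algebra.intros(3)]) auto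
      ultimately show ?thesis by simp
    qed
    finally show ?thesis by (simp add: ft_def)
  qed
  then have "l2norm (cutoff N h) = 0" for N using plancherel(2)[OF C(1,2), of N] by (simp add: l2norm_def)
  then have "AE x in lborel. cutoff N h x = 0" for N using l2norm_zero_iff[OF C(2)] by blast
  then have "AE x in lborel. \<forall>N. cutoff N h x = 0" by (simp add: AE_all_countable)
  then show ?thesis
  proof eventually_elim
    case (elim x)
    define n where "n = nat \<lceil>\<bar>x\<bar>\<rceil>"
    have "\<bar>x\<bar> \<le> real n" unfolding n_def by linarith
    then have "x \<in> {- real n..real n}" by auto
    then have "cutoff n h x = h x" by (simp only: cutoff_def indicator_simps) simp
    then show ?case using elim by metis
  qed
qed

text \<open>The pairing in frequency space is the pairing of the inverse transform with the test
  function, and the inverse transform loses nothing by isometry.\<close>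

lemma test_functions_separate_ft:
  assumes p: "integrable lborel p" "L2 p"
    and zero: "\<And>\<phi>. test_function \<phi> \<Longrightarrow> (LBINT k. p k * ft (\<lambda>x. cx (\<phi> x)) (- k)) = 0"
  shows "AE k in lborel. p k = 0"
proof -
  have "AE x in lborel. ft p (- x) = 0"
  proof (rule test_functions_separate[OF L2FT_inverse(1)[OF p]])
    fix \<phi> assume "test_function \<phi>"
    then show "(LBINT x. ft p (- x) * cx (\<phi> x)) = 0"
      using ift_pairing[OF p(1) test_function_integrable(3)] zero by simp
  qed
  then have "l2norm (\<lambda>x. ft p (- x)) = 0" using l2norm_zero_iff[OF L2FT_inverse(1)[OF p]] by simp
  then have "l2norm p = 0" using L2FT_norm[OF L2FT_inverse[OF p]] by simp
  then show ?thesis using l2norm_zero_iff[OF p(2)] by simp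
qed

lemma ft_test_decay:
  assumes f: "test_function f"
  shows "L2 (\<lambda>k. cx (wt 2 k) * ft (\<lambda>x. cx (f x)) k)"
    "integrable lborel (ft (\<lambda>x. cx (f x)))"
proof -
  let ?F = "ft (\<lambda>x. cx (f x))"
  have [measurable]: "(\<lambda>x. cx (f x)) \<in> borel_measurable borel"
    using test_function_integrable(3)[OF f] by auto
  have "L2 (\<lambda>k. ?F k - ft (\<lambda>x. cx ((deriv ^^ 2) f x)) k)"
    by (intro L2_diff plancherel test_function_integrable test_function_funpow f)
  then show s: "L2 (\<lambda>k. cx (wt 2 k) * ?F k)"
    unfolding ft_deriv_2[OF f] by (simp add: wt_2 algebra_simps)
  show "integrable lborel ?F"
    using weight_integrable(1)[of ?F] weight_square_integrable_mono(1)[OF s, of 1] by simp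
qed

section \<open>Functions of time and frequency\<close>

lemma AE_lborel_affine:
  fixes c :: real
  assumes "AE x in lborel. P x" and c: "c \<noteq> 0"
  shows "AE x in lborel. P (t + c * x)"
proof -
  from AE_E[OF assms(1)] obtain N where "{x \<in> space lborel. \<not> P x} \<subseteq> N" "emeasure lborel N = 0" "N \<in> sets lborel" .
  then have N: "{x \<in> space lborel. \<not> P x} \<subseteq> N" "N \<in> null_sets lborel" by (auto intro: null_setsI)
  have [measurable]: "N \<in> sets borel" using N by auto
  have "AE x in lborel. x \<notin> N" using N(2) by (rule AE_not_in)
  then have "AE x in density (distr lborel borel (\<lambda>x. t + c * x)) (\<lambda>_. ennreal \<bar>c\<bar>). x \<notin> N"
    by (subst (asm) lborel_real_affine[OF c, of t]) simp
  then have "AE x in distr lborel borel (\<lambda>x. t + c * x). x \<notin> N"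
    using c by (subst (asm) AE_density) auto
  then have "AE x in lborel. t + c * x \<notin> N"
    by (subst (asm) AE_distr_iff) auto
  then show ?thesis using N(1) by (auto elim!: eventually_mono)
qed

lemma AE_lborel_minus:
  "AE x::real in lborel. P x \<Longrightarrow> AE x in lborel. P (- x)"
  using AE_lborel_affine[of P "-1" 0] by simp

lemma set_integral_FTC1:
  fixes f :: "real \<Rightarrow> complex"
  assumes f: "continuous_on {0..T} f" and t: "t \<in> {0..T}"
  shows "((\<lambda>t. LBINT \<tau>:{0..t}. f \<tau>) has_vector_derivative f t) (at t within {0..T})"
proof -
  have "((\<lambda>t. integral {0..t} f) has_vector_derivative f t) (at t within {0..T})"
    by (rule integral_has_vector_derivative[OF f t])
  moreover have eq: "(LBINT \<tau>:{0..x}. f \<tau>) = integral {0..x} f" if "x \<in> {0..T}" for x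
  proof (rule set_borel_integral_eq_integral(2))
    show "set_integrable lborel {0..x} f"
      by (rule borel_integrable_atLeastAtMost') (use that f in \<open>auto intro: continuous_on_subset\<close>)
  qed
  ultimately show ?thesis by (intro has_vector_derivative_transform[OF t eq])
qed

lemma set_integral_FTC2:
  fixes F f :: "real \<Rightarrow> complex"
  assumes F: "\<And>t. t \<in> {0..T} \<Longrightarrow> (F has_vector_derivative f t) (at t within {0..T})"
    and f: "continuous_on {0..T} f" and t: "t \<in> {0..T}"
  shows "(LBINT \<tau>:{0..t}. f \<tau>) = F t - F 0"
  unfolding set_lebesgue_integral_def
proof (rule integral_FTC_Icc)
  show "(F has_vector_derivative f x) (at x within {0..t})" if "0 \<le> x" "x \<le> t" for x
    using F[of x] that t by (intro has_vector_derivative_within_subset[OF F]) auto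
  show "continuous_on {0..t} f" using f t by (rule_tac continuous_on_subset) auto
qed (use t in auto)

lemma continuous_on_integral_dominated:
  fixes h :: "real \<Rightarrow> real \<Rightarrow> complex"
  assumes m: "\<And>t. t \<in> S \<Longrightarrow> h t \<in> borel_measurable borel"
    and c: "AE k in lborel. continuous_on S (\<lambda>t. h t k)"
    and b: "AE k in lborel. \<forall>t\<in>S. norm (h t k) \<le> D k" and D: "integrable lborel D"
  shows "continuous_on S (\<lambda>t. LBINT k. h t k)"
  unfolding continuous_on_sequentially o_def
proof (intro allI ballI impI, elim conjE)
  fix x a assume a: "a \<in> S" and x: "\<forall>n. x n \<in> S" "x \<longlonglongrightarrow> a"
  show "(\<lambda>n. LBINT k. h (x n) k) \<longlonglongrightarrow> (LBINT k. h a k)"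
  proof (rule integral_dominated_convergence[OF _ _ D])
    show "AE k in lborel. (\<lambda>n. h (x n) k) \<longlonglongrightarrow> h a k"
      using c by eventually_elim (use a x in \<open>auto simp: continuous_on_sequentially o_def\<close>)
    show "AE k in lborel. norm (h (x n) k) \<le> D k" for n
      using b by eventually_elim (use x in auto)
  qed (use m a x in auto)
qed

lemma AE_derivative_continuous:
  fixes f :: "real \<Rightarrow> real \<Rightarrow> complex"
  assumes "AE k in lborel. \<forall>t\<in>S. ((\<lambda>t. f t k) has_vector_derivative f' t k) (at t within S)"
  shows "AE k in lborel. continuous_on S (\<lambda>t. f t k)"
  using assms
proof eventually_elim
  case (elim k)
  show ?case unfolding continuous_on_eq_continuous_within
  proof
    fix t assume "t \<in> S"
    then have "((\<lambda>t. f t k) has_vector_derivative f' t k) (at t within S)" using elim by blast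
    then show "continuous (at t within S) (\<lambda>t. f t k)" by (rule has_vector_derivative_continuous)
  qed
qed

lemma measurable_joint_sections:
  fixes y :: "real \<Rightarrow> real \<Rightarrow> 'a::topological_space"
  assumes "jointly_measurable y"
  shows "y t \<in> borel_measurable borel" "(\<lambda>t. y t k) \<in> borel_measurable borel"
  using measurable_Pair2[OF assms, of t] measurable_Pair1[OF assms, of k] by simp_all

text \<open>Differentiation under the integral by integrating instead: the fundamental theorem at
  almost every \<open>k\<close>, Fubini, and the fundamental theorem once more for the integral of
  \<open>y'\<close>, which is continuous by domination. The exceptional set of \<open>k\<close> must
  not depend on the time, hence the order of the quantifiers.\<close>

lemma integral_has_derivative:
  fixes y y' :: "real \<Rightarrow> real \<Rightarrow> complex"
  assumes y: "\<And>t. t \<in> {0..T} \<Longrightarrow> integrable lborel (y t)"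
    and m [measurable]: "jointly_measurable y'"
    and d: "AE k in lborel. \<forall>t\<in>{0..T}. ((\<lambda>t. y t k) has_vector_derivative y' t k) (at t within {0..T})"
    and c: "AE k in lborel. continuous_on {0..T} (\<lambda>t. y' t k)"
    and b: "AE k in lborel. \<forall>t\<in>{0..T}. norm (y' t k) \<le> D k" and D: "integrable lborel D"
    and t: "t \<in> {0..T}"
  shows "((\<lambda>t. LBINT k. y t k) has_vector_derivative (LBINT k. y' t k)) (at t within {0..T})"
proof -
  note ms = measurable_joint_sections[OF m]
  have [measurable]: "D \<in> borel_measurable borel" using D by auto
  have cont: "continuous_on {0..T} (\<lambda>t. LBINT k. y' t k)"
    by (rule continuous_on_integral_dominated[OF ms(1) c b D])
  have eq: "(LBINT k. y x k) = (LBINT \<tau>:{0..x}. (LBINT k. y' \<tau> k)) + (LBINT k. y 0 k)" if x: "x \<in> {0..T}" for x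
  proof -
    have T: "0 \<in> {0..T}" using x by auto
    have I: "integrable (lborel \<Otimes>\<^sub>M lborel) (\<lambda>(\<tau>, k). indicator {0..x} \<tau> *\<^sub>R y' \<tau> k)"
    proof (rule lborel_pair.Fubini_integrable)
      have B: "AE k in lborel. norm (indicator {0..x} \<tau> *\<^sub>R y' \<tau> k) \<le> norm (indicator {0..x} \<tau> * D k)" for \<tau>
        using b by eventually_elim (use x in \<open>auto simp: indicator_def intro: order_trans[OF _ abs_ge_self]\<close>)
      show "AE \<tau> in lborel. integrable lborel (\<lambda>k. case (\<tau>, k) of (\<tau>, k) \<Rightarrow> indicator {0..x} \<tau> *\<^sub>R y' \<tau> k)"
        using D ms by (auto intro!: AE_I2 Bochner_Integration.integrable_bound[OF _ _ B])
      show "integrable lborel (\<lambda>\<tau>. LBINT k. norm (case (\<tau>, k) of (\<tau>, k) \<Rightarrow> indicator {0..x} \<tau> *\<^sub>R y' \<tau> k))"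
      proof (rule Bochner_Integration.integrable_bound)
        show "integrable lborel (\<lambda>\<tau>. indicator {0..x} \<tau> * (LBINT k. \<bar>D k\<bar>))"
          by (intro integrable_mult_left integrable_real_indicator) (auto simp: emeasure_lborel_Icc_eq)
        have "norm (LBINT k. norm (indicator {0..x} \<tau> *\<^sub>R y' \<tau> k)) \<le> (LBINT k. norm (indicator {0..x} \<tau> * D k))" for \<tau>
        proof -
          have "(LBINT k. norm (indicator {0..x} \<tau> *\<^sub>R y' \<tau> k)) \<le> (LBINT k. norm (indicator {0..x} \<tau> * D k))"
            using D ms B by (intro integral_mono_AE Bochner_Integration.integrable_norm Bochner_Integration.integrable_bound[OF _ _ B]) auto
          then show ?thesis by (simp add: Bochner_Integration.integral_nonneg)
        qed
        then show "AE \<tau> in lborel. norm (LBINT k. norm (case (\<tau>, k) of (\<tau>, k) \<Rightarrow> indicator {0..x} \<tau> *\<^sub>R y' \<tau> k))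
          \<le> norm (indicator {0..x} \<tau> * (LBINT k. \<bar>D k\<bar>))"
          by (simp add: abs_mult Bochner_Integration.integral_nonneg)
      qed measurable
    qed measurable
    have "(LBINT \<tau>:{0..x}. (LBINT k. y' \<tau> k)) = (LBINT \<tau>. (LBINT k. indicator {0..x} \<tau> *\<^sub>R y' \<tau> k))"
      unfolding set_lebesgue_integral_def by simp
    also have "\<dots> = (LBINT k. (LBINT \<tau>. indicator {0..x} \<tau> *\<^sub>R y' \<tau> k))"
      using lborel_pair.Fubini_integral[OF I] by simp
    also have "\<dots> = (LBINT k. y x k - y 0 k)"
    proof (rule integral_cong_AE)
      show "AE k in lborel. (LBINT \<tau>. indicator {0..x} \<tau> *\<^sub>R y' \<tau> k) = y x k - y 0 k"
        using c d
      proof eventually_elim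
        case (elim k)
        then show ?case using set_integral_FTC2[of T "\<lambda>t. y t k" "\<lambda>t. y' t k" x] x
          by (simp add: set_lebesgue_integral_def)
      qed
      show "(\<lambda>k. y x k - y 0 k) \<in> borel_measurable lborel" using y[OF x] y[OF T] by auto
    qed measurable
    also have "\<dots> = (LBINT k. y x k) - (LBINT k. y 0 k)"
      using y[OF x] y[OF T] by simp
    finally show ?thesis by simp
  qed
  show ?thesis
  proof (rule has_vector_derivative_transform[OF t])
    show "((\<lambda>x. (LBINT \<tau>:{0..x}. (LBINT k. y' \<tau> k)) + (LBINT k. y 0 k)) has_vector_derivative (LBINT k. y' t k)) (at t within {0..T})"
      using has_vector_derivative_add[OF set_integral_FTC1[OF cont t] has_vector_derivative_const] by simp
  qed (rule eq)
qed

text \<open>Cauchy-Schwarz in time followed by Tonelli, in place of Minkowski's integral inequality.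
  The bound \<open>\<gamma>\<close> may depend on time, because the Picard contraction uses an
  exponential weight.\<close>

lemma minkowski_time_gen:
  fixes g :: "real \<Rightarrow> real \<Rightarrow> complex"
  assumes [measurable]: "jointly_measurable g"
    and g: "\<And>\<tau>. \<tau> \<in> {0..T} \<Longrightarrow> L2 (g \<tau>)"
    and \<gamma>: "\<And>\<tau>. \<tau> \<in> {0..T} \<Longrightarrow> (l2norm (g \<tau>))\<^sup>2 \<le> \<gamma> \<tau>"
    and \<Gamma>: "(\<integral>\<^sup>+ \<tau>. ennreal (\<gamma> \<tau>) * indicator {0..T} \<tau> \<partial>lborel) \<le> ennreal \<Gamma>" "\<Gamma> \<ge> 0" and T: "T \<ge> 0"
  shows "AE k in lborel. set_integrable lborel {0..T} (\<lambda>\<tau>. g \<tau> k)"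
    "L2 (\<lambda>k. LBINT \<tau>:{0..T}. norm (g \<tau> k))"
    "l2norm (\<lambda>k. LBINT \<tau>:{0..T}. norm (g \<tau> k)) \<le> sqrt (T * \<Gamma>)"
proof -
  define S where "S = (\<lambda>k. \<integral>\<^sup>+ \<tau>. ennreal (indicator {0..T} \<tau> * norm (g \<tau> k)) \<partial>lborel)"
  have S2: "(S k)\<^sup>2 \<le> ennreal T * (\<integral>\<^sup>+ \<tau>. indicator {0..T} \<tau> * ennreal ((norm (g \<tau> k))\<^sup>2) \<partial>lborel)" for k
  proof -
    have "(\<integral>\<^sup>+ \<tau>. indicator {0..T} \<tau> * ennreal (indicator {0..T} \<tau> * norm (g \<tau> k)) \<partial>lborel)\<^sup>2
      \<le> (\<integral>\<^sup>+ \<tau>. (indicator {0..T} \<tau>)\<^sup>2 \<partial>lborel) * (\<integral>\<^sup>+ \<tau>. (ennreal (indicator {0..T} \<tau> * norm (g \<tau> k)))\<^sup>2 \<partial>lborel)"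
      by (rule Cauchy_Schwarz_nn_integral) auto
    moreover have "(\<integral>\<^sup>+ \<tau>. indicator {0..T} \<tau> * ennreal (indicator {0..T} \<tau> * norm (g \<tau> k)) \<partial>lborel) = S k"
      unfolding S_def by (intro nn_integral_cong) (auto simp: indicator_def)
    moreover have "(\<integral>\<^sup>+ \<tau>. (indicator {0..T} \<tau>)\<^sup>2 \<partial>lborel) = (\<integral>\<^sup>+ \<tau>. indicator {0..T} \<tau> \<partial>lborel)"
      by (intro nn_integral_cong) (auto simp: indicator_def)
    moreover have "(\<integral>\<^sup>+ \<tau>. (ennreal (indicator {0..T} \<tau> * norm (g \<tau> k)))\<^sup>2 \<partial>lborel) =
        (\<integral>\<^sup>+ \<tau>. indicator {0..T} \<tau> * ennreal ((norm (g \<tau> k))\<^sup>2) \<partial>lborel)"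
      by (intro nn_integral_cong) (auto simp: indicator_def ennreal_power)
    ultimately show ?thesis using T by simp
  qed
  have "(\<integral>\<^sup>+ k. (S k)\<^sup>2 \<partial>lborel) \<le> (\<integral>\<^sup>+ k. ennreal T * (\<integral>\<^sup>+ \<tau>. indicator {0..T} \<tau> * ennreal ((norm (g \<tau> k))\<^sup>2) \<partial>lborel) \<partial>lborel)"
    by (intro nn_integral_mono S2)
  also have "\<dots> = ennreal T * (\<integral>\<^sup>+ k. (\<integral>\<^sup>+ \<tau>. indicator {0..T} \<tau> * ennreal ((norm (g \<tau> k))\<^sup>2) \<partial>lborel) \<partial>lborel)"
    by (rule nn_integral_cmult) measurable
  finally have fin1: "(\<integral>\<^sup>+ k. (S k)\<^sup>2 \<partial>lborel) \<le> ennreal T * (\<integral>\<^sup>+ k. (\<integral>\<^sup>+ \<tau>. indicator {0..T} \<tau> * ennreal ((norm (g \<tau> k))\<^sup>2) \<partial>lborel) \<partial>lborel)" .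
  have "(\<integral>\<^sup>+ k. (\<integral>\<^sup>+ \<tau>. indicator {0..T} \<tau> * ennreal ((norm (g \<tau> k))\<^sup>2) \<partial>lborel) \<partial>lborel)
     = (\<integral>\<^sup>+ \<tau>. (\<integral>\<^sup>+ k. indicator {0..T} \<tau> * ennreal ((norm (g \<tau> k))\<^sup>2) \<partial>lborel) \<partial>lborel)"
    by (rule lborel_pair.Fubini') measurable
  also have "\<dots> \<le> (\<integral>\<^sup>+ \<tau>. ennreal (\<gamma> \<tau>) * indicator {0..T} \<tau> \<partial>lborel)"
  proof (rule nn_integral_mono)
    fix \<tau> :: real
    show "(\<integral>\<^sup>+ k. indicator {0..T} \<tau> * ennreal ((norm (g \<tau> k))\<^sup>2) \<partial>lborel) \<le> ennreal (\<gamma> \<tau>) * indicator {0..T} \<tau>"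
    proof (cases "\<tau> \<in> {0..T}")
      case True
      then show ?thesis using nn_integral_square[OF g[OF True]] \<gamma>[OF True] by (simp add: ennreal_leI)
    qed simp
  qed
  finally have "(\<integral>\<^sup>+ k. (\<integral>\<^sup>+ \<tau>. indicator {0..T} \<tau> * ennreal ((norm (g \<tau> k))\<^sup>2) \<partial>lborel) \<partial>lborel) \<le> ennreal \<Gamma>"
    using \<Gamma>(1) by (rule order_trans)
  from order_trans[OF fin1 mult_left_mono[OF this]] have "(\<integral>\<^sup>+ k. (S k)\<^sup>2 \<partial>lborel) \<le> ennreal T * ennreal \<Gamma>"
    by simp
  then have fin: "(\<integral>\<^sup>+ k. (S k)\<^sup>2 \<partial>lborel) \<le> ennreal ((sqrt (T * \<Gamma>))\<^sup>2)"
    using T \<Gamma>(2) by (simp add: ennreal_mult[symmetric])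
  have [measurable]: "S \<in> borel_measurable borel" unfolding S_def by measurable
  have "AE k in lborel. (S k)\<^sup>2 \<noteq> \<infinity>"
    using fin by (intro nn_integral_PInf_AE) (auto simp: top_unique)
  then show AE: "AE k in lborel. set_integrable lborel {0..T} (\<lambda>\<tau>. g \<tau> k)"
  proof eventually_elim
    case (elim k)
    then have "S k \<noteq> \<top>" by (auto simp: power2_eq_square)
    then have "S k < \<infinity>" by (simp add: less_top)
    then show ?case unfolding S_def set_integrable_def integrable_iff_bounded by simp
  qed
  have le: "ennreal (norm (LBINT \<tau>:{0..T}. norm (g \<tau> k))) \<le> S k" for k
  proof (cases "set_integrable lborel {0..T} (\<lambda>\<tau>. norm (g \<tau> k))")
    case True
    then show ?thesis unfolding set_lebesgue_integral_def S_def set_integrable_def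
      using integral_norm_bound_ennreal[OF True[unfolded set_integrable_def]] by simp
  next
    case False
    then show ?thesis by (simp add: set_lebesgue_integral_def set_integrable_def not_integrable_integral_eq)
  qed
  have m: "(\<lambda>k. LBINT \<tau>:{0..T}. norm (g \<tau> k)) \<in> borel_measurable borel"
    unfolding set_lebesgue_integral_def by measurable
  have "(\<integral>\<^sup>+ k. ennreal ((norm (LBINT \<tau>:{0..T}. norm (g \<tau> k)))\<^sup>2) \<partial>lborel) \<le> ennreal ((sqrt (T * \<Gamma>))\<^sup>2)"
    by (rule order_trans[OF nn_integral_mono fin], subst ennreal_power[symmetric], simp)
       (intro power_mono le, simp)
  from L2_leI[OF m this]
  show "L2 (\<lambda>k. LBINT \<tau>:{0..T}. norm (g \<tau> k))"
    "l2norm (\<lambda>k. LBINT \<tau>:{0..T}. norm (g \<tau> k)) \<le> sqrt (T * \<Gamma>)" using T \<Gamma> by auto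
qed

lemma minkowski_time:
  fixes g :: "real \<Rightarrow> real \<Rightarrow> complex"
  assumes [measurable]: "jointly_measurable g"
    and g: "\<And>\<tau>. \<tau> \<in> {0..T} \<Longrightarrow> L2 (g \<tau>)" "\<And>\<tau>. \<tau> \<in> {0..T} \<Longrightarrow> l2norm (g \<tau>) \<le> C"
    and C: "C \<ge> 0" and T: "T \<ge> 0"
  shows "AE k in lborel. set_integrable lborel {0..T} (\<lambda>\<tau>. g \<tau> k)"
    "L2 (\<lambda>k. LBINT \<tau>:{0..T}. norm (g \<tau> k))"
    "l2norm (\<lambda>k. LBINT \<tau>:{0..T}. norm (g \<tau> k)) \<le> T * C"
proof -
  have \<Gamma>: "(\<integral>\<^sup>+ \<tau>. ennreal (C\<^sup>2) * indicator {0..T} \<tau> \<partial>lborel) \<le> ennreal (C\<^sup>2 * T)"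
    using T by (simp add: nn_integral_cmult ennreal_mult)
  have sq: "(l2norm (g \<tau>))\<^sup>2 \<le> C\<^sup>2" if "\<tau> \<in> {0..T}" for \<tau> using g(2)[OF that] by (rule power_mono) simp
  have T2: "T * (C\<^sup>2 * T) = (T * C)\<^sup>2" by (simp add: power2_eq_square)
  have \<Gamma>0: "C\<^sup>2 * T \<ge> 0" using T by simp
  show "AE k in lborel. set_integrable lborel {0..T} (\<lambda>\<tau>. g \<tau> k)"
    by (rule minkowski_time_gen(1)[OF assms(1) g(1) sq \<Gamma> \<Gamma>0 T])
  show "L2 (\<lambda>k. LBINT \<tau>:{0..T}. norm (g \<tau> k))"
    by (rule minkowski_time_gen(2)[OF assms(1) g(1) sq \<Gamma> \<Gamma>0 T])
  have "l2norm (\<lambda>k. LBINT \<tau>:{0..T}. norm (g \<tau> k)) \<le> sqrt (T * (C\<^sup>2 * T))"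
    by (rule minkowski_time_gen(3)[OF assms(1) g(1) sq \<Gamma> \<Gamma>0 T])
  then show "l2norm (\<lambda>k. LBINT \<tau>:{0..T}. norm (g \<tau> k)) \<le> T * C" unfolding T2 using T C by simp
qed

text \<open>The transforms at different times are unrelated choices, so nothing is known about joint
  measurability. It is restored by a limit of step functions in time, taken along grids so fine that
  the error at every fixed time is geometrically small and the convergence holds almost
  everywhere.\<close>

lemma measurable_version:
  fixes f :: "real \<Rightarrow> real \<Rightarrow> complex"
  assumes sq: "\<And>t. t \<in> {0..T} \<Longrightarrow> L2 (f t)"
    and cont: "\<And>t. t \<in> {0..T} \<Longrightarrow> ((\<lambda>t'. l2norm (\<lambda>k. f t' k - f t k)) \<longlongrightarrow> 0) (at t within {0..T})"
    and T: "T > 0"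
  shows "\<exists>V. jointly_measurable V \<and> (\<forall>t\<in>{0..T}. AE k in lborel. V t k = f t k)"
proof -
  \<comment> \<open>Uniform continuity in time, from compactness of \<open>{0..T}\<close> through a
    Lebesgue number of the cover by continuity balls.\<close>
  have unif: "\<exists>d>0. \<forall>t\<in>{0..T}. \<forall>t'\<in>{0..T}. \<bar>t' - t\<bar> < d \<longrightarrow> l2norm (\<lambda>k. f t' k - f t k) < e" if e: "e > 0" for e
  proof -
    have "\<exists>d>0. \<forall>t'\<in>{0..T}. \<bar>t' - t\<bar> < d \<longrightarrow> l2norm (\<lambda>k. f t' k - f t k) < e / 2" if t: "t \<in> {0..T}" for t
    proof -
      have "eventually (\<lambda>t'. l2norm (\<lambda>k. f t' k - f t k) < e / 2) (at t within {0..T})"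
        using cont[OF t] e by (intro order_tendstoD(2)[OF cont[OF t]]) auto
      then obtain d where d: "d > 0" "\<And>t'. t' \<in> {0..T} \<Longrightarrow> t' \<noteq> t \<Longrightarrow> dist t' t < d \<Longrightarrow> l2norm (\<lambda>k. f t' k - f t k) < e / 2"
        unfolding eventually_at by auto
      have "l2norm (\<lambda>k. f t k - f t k) = 0" by (simp add: l2norm_def)
      then have "l2norm (\<lambda>k. f t' k - f t k) < e / 2" if "t' \<in> {0..T}" "\<bar>t' - t\<bar> < d" for t'
        using d(2)[OF that(1)] that(2) e by (cases "t' = t") (auto simp: dist_real_def)
      then show ?thesis using d(1) by blast
    qed
    then have "\<forall>t\<in>{0..T}. \<exists>d. d > 0 \<and> (\<forall>t'\<in>{0..T}. \<bar>t' - t\<bar> < d \<longrightarrow> l2norm (\<lambda>k. f t' k - f t k) < e / 2)" by blast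
    from bchoice[OF this] obtain d where d: "\<And>t. t \<in> {0..T} \<Longrightarrow> d t > 0"
      "\<And>t t'. t \<in> {0..T} \<Longrightarrow> t' \<in> {0..T} \<Longrightarrow> \<bar>t' - t\<bar> < d t \<Longrightarrow> l2norm (\<lambda>k. f t' k - f t k) < e / 2"
      by blast
    obtain \<delta> where \<delta>: "\<delta> > 0" "\<And>x. x \<in> {0..T} \<Longrightarrow> \<exists>B\<in>(\<lambda>t. ball t (d t)) ` {0..T}. ball x \<delta> \<subseteq> B"
    proof (rule Heine_Borel_lemma[of "{0..T}" "(\<lambda>t. ball t (d t)) ` {0..T}"])
      show "{0..T} \<subseteq> \<Union> ((\<lambda>t. ball t (d t)) ` {0..T})" using d(1) by force
    qed auto
    have "l2norm (\<lambda>k. f t' k - f t k) < e" if t: "t \<in> {0..T}" "t' \<in> {0..T}" "\<bar>t' - t\<bar> < \<delta>" for t t'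
    proof -
      obtain c where c: "c \<in> {0..T}" "ball t \<delta> \<subseteq> ball c (d c)" using \<delta>(2)[OF t(1)] by blast
      have "t \<in> ball t \<delta>" "t' \<in> ball t \<delta>" using t(3) \<delta>(1) by (auto simp: dist_real_def)
      then have "t \<in> ball c (d c)" "t' \<in> ball c (d c)" using c(2) by blast+
      then have "\<bar>t - c\<bar> < d c" "\<bar>t' - c\<bar> < d c" by (auto simp: dist_real_def)
      then have "l2norm (\<lambda>k. f t k - f c k) < e / 2" "l2norm (\<lambda>k. f t' k - f c k) < e / 2" using d(2) c(1) t by auto
      moreover have "l2norm (\<lambda>k. f t' k - f t k) \<le> l2norm (\<lambda>k. f t' k - f c k) + l2norm (\<lambda>k. f c k - f t k)"
        by (rule l2norm_triangle) (use sq t c in auto)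
      ultimately show ?thesis by (simp add: l2norm_minus_commute[of "f c"])
    qed
    then show ?thesis using \<delta>(1) by blast
  qed
  then have "\<forall>j::nat. \<exists>d. d > 0 \<and> (\<forall>t\<in>{0..T}. \<forall>t'\<in>{0..T}. \<bar>t' - t\<bar> < d \<longrightarrow> l2norm (\<lambda>k. f t' k - f t k) < (1/2)^j)"
    by simp
  from choice[OF this] obtain d where d: "\<And>j. d j > 0"
    "\<And>j t t'. t \<in> {0..T} \<Longrightarrow> t' \<in> {0..T} \<Longrightarrow> \<bar>t' - t\<bar> < d j \<Longrightarrow> l2norm (\<lambda>k. f t' k - f t k) < (1/2::real)^j"
    by blast
  \<comment> \<open>Grid points of step \<open>d j / 2\<close>, clipped to \<open>{0..T}\<close>.
    Rounding a time down to the grid moves it by less than \<open>d j\<close>, and the integer index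
    makes the step function jointly measurable.\<close>
  define node where "node = (\<lambda>j (i::int). max 0 (min T (d j / 2 * of_int i)))"
  have node: "node j i \<in> {0..T}" for j i using T by (auto simp: node_def)
  define g where "g = (\<lambda>j t k. f (node j \<lfloor>t / (d j / 2)\<rfloor>) k)"
  have gm: "(\<lambda>(t, k). g j t k) \<in> borel_measurable (borel \<Otimes>\<^sub>M borel)" for j
  proof -
    have "(\<lambda>z. (\<lambda>i z. f (node j i) (snd z)) \<lfloor>fst z / (d j / 2)\<rfloor> z) \<in> borel_measurable (borel \<Otimes>\<^sub>M borel)"
    proof (rule measurable_compose_countable)
      fix i :: int
      have [measurable]: "f (node j i) \<in> borel_measurable borel" using sq[OF node] by auto
      show "(\<lambda>z. f (node j i) (snd z)) \<in> borel_measurable (borel \<Otimes>\<^sub>M borel)" by measurable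
    qed measurable
    then show ?thesis by (simp add: g_def case_prod_unfold)
  qed
  define V where "V = (\<lambda>t k. lim (\<lambda>j. g j t k))"
  have "jointly_measurable V"
    unfolding V_def case_prod_unfold by (rule borel_measurable_lim_metric) (use gm in \<open>simp add: case_prod_unfold\<close>)
  moreover have "AE k in lborel. V t k = f t k" if t: "t \<in> {0..T}" for t
  proof -
    have close: "\<bar>node j \<lfloor>t / (d j / 2)\<rfloor> - t\<bar> < d j" for j
    proof -
      define x where "x = d j / 2 * of_int \<lfloor>t / (d j / 2)\<rfloor>"
      have h: "d j / 2 > 0" using d(1)[of j] by simp
      have "of_int \<lfloor>t / (d j / 2)\<rfloor> \<le> t / (d j / 2)" "t / (d j / 2) - 1 < of_int \<lfloor>t / (d j / 2)\<rfloor>" by linarith+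
      then have "x \<le> t" "t - d j / 2 < x"
        using mult_left_mono[of "of_int \<lfloor>t / (d j / 2)\<rfloor>" "t / (d j / 2)" "d j / 2"]
          mult_strict_left_mono[of "t / (d j / 2) - 1" "of_int \<lfloor>t / (d j / 2)\<rfloor>" "d j / 2"] h
        by (auto simp: x_def right_diff_distrib)
      then show ?thesis using t h unfolding node_def x_def[symmetric] by auto
    qed
    have s: "L2 (\<lambda>k. g j t k - f t k)" "l2norm (\<lambda>k. g j t k - f t k) \<le> 1 * (1/2)^j" for j
      unfolding g_def using sq t node d(2)[OF t node close]
      by (auto intro!: L2_diff less_imp_le)
    have "AE k in lborel. summable (\<lambda>j. norm (g j t k - f t k))"
      by (rule geometric_l2_summable(1)[OF s]) auto
    then show ?thesis
    proof eventually_elim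
      case (elim k)
      then have "(\<lambda>j. norm (g j t k - f t k)) \<longlonglongrightarrow> 0" by (rule summable_LIMSEQ_zero)
      then have "(\<lambda>j. g j t k) \<longlonglongrightarrow> f t k" by (simp add: tendsto_norm_zero_iff LIM_zero_iff)
      then show ?case unfolding V_def by (rule limI)
    qed
  qed
  ultimately show ?thesis by blast
qed

section \<open>Convolutions and their weighted estimates\<close>

lemma conv_jointly_measurable [measurable]:
  assumes [measurable]: "jointly_measurable f" "jointly_measurable g"
  shows "(\<lambda>(t, k). conv (f t) (g t) k) \<in> borel_measurable (borel \<Otimes>\<^sub>M borel)"
  unfolding conv_def by measurable

lemma conv_commute: "conv f g k = conv g f k"
proof -
  have "conv f g k = (LBINT l. f (k - (k + (-1) * l)) * g (k + (-1) * l))"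
    unfolding conv_def by (subst lborel_integral_real_affine[where c="-1" and t=k]) auto
  then show ?thesis by (simp add: conv_def mult.commute)
qed

lemma conv_cong_AE:
  assumes f: "AE l in lborel. f l = f' l" and g: "AE l in lborel. g l = g' l"
    and [measurable]: "f \<in> borel_measurable borel" "g \<in> borel_measurable borel" "f' \<in> borel_measurable borel" "g' \<in> borel_measurable borel"
  shows "conv f g k = conv f' g' k"
  unfolding conv_def
proof (rule integral_cong_AE)
  have "AE l in lborel. f (k - l) = f' (k - l)" using AE_lborel_affine[OF f, of "-1" k] by simp
  then show "AE l in lborel. f (k - l) * g l = f' (k - l) * g' l" using g by eventually_elim simp
qed measurable

lemma conv_bound:
  assumes f: "L2 f" and g: "L2 g"
  shows "integrable lborel (\<lambda>l. f (k - l) * g l)" "norm (conv f g k) \<le> l2norm f * l2norm g"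
  using cauchy_schwarz_mult[OF L2_affine(1)[OF f, of "-1" k] g] L2_affine(2)[OF f, of "-1" k]
  by (simp_all add: conv_def)

lemma conv_norm_bound:
  "norm (conv f g k) \<le> (LBINT l. norm (f (k - l)) * norm (g l))"
  unfolding conv_def using integral_norm_bound[of lborel "\<lambda>l. f (k - l) * g l"] by (simp add: norm_mult)

lemma one_plus_square_sum: "1 + (a + b)\<^sup>2 \<le> 2 * ((1 + a\<^sup>2) + (1 + (b::real)\<^sup>2))"
  using sum_squares_bound[of a b] by (simp add: power2_sum)

lemma wt_sum_le:
  assumes r: "r \<ge> 0"
  shows "wt r (a + b) \<le> 2 powr r * (wt r a + wt r b)"
proof -
  define m where "m = max (1 + a\<^sup>2) (1 + b\<^sup>2)"
  have m: "m > 0" using one_plus_square_pos[of a] by (simp add: m_def less_max_iff_disj)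
  have "1 + a\<^sup>2 \<le> m" "1 + b\<^sup>2 \<le> m" by (auto simp: m_def)
  then have "2 * ((1 + a\<^sup>2) + (1 + b\<^sup>2)) \<le> 4 * m" by simp
  then have "1 + (a + b)\<^sup>2 \<le> 4 * m" by (rule order_trans[OF one_plus_square_sum])
  then have "wt r (a + b) \<le> (4 * m) powr (r / 2)"
    unfolding wt_def using r by (intro powr_mono2) (auto simp: add_nonneg_nonneg)
  also have "\<dots> = 2 powr r * m powr (r / 2)"
  proof -
    have "(4::real) powr (r / 2) = (2 powr 2) powr (r / 2)" by simp
    also have "\<dots> = 2 powr r" by (simp only: powr_powr) simp
    finally show ?thesis using m by (simp add: powr_mult)
  qed
  also have "m powr (r / 2) \<le> wt r a + wt r b"
    unfolding m_def max_def wt_def by auto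
  finally show ?thesis by simp
qed

text \<open>The hypothesis on \<open>W\<close> moves the weight of the output onto one of the two
  factors, while the other one enters through its integral. The weight is left abstract to cover
  both \<open>wt r\<close> and its version at scaled frequencies.\<close>

lemma conv_weighted:
  fixes W :: "real \<Rightarrow> real"
  assumes Wm [measurable]: "W \<in> borel_measurable borel" and W0: "\<And>k. W k \<ge> 0"
    and W: "\<And>a b. W (a + b) \<le> C * (W a + W b)" and C: "C \<ge> 0"
    and f: "integrable lborel f" "L2 (\<lambda>k. cx (W k) * f k)"
    and g: "integrable lborel g" "L2 (\<lambda>k. cx (W k) * g k)"
    and fg: "L2 f" "L2 g"
  shows "L2 (\<lambda>k. cx (W k) * conv f g k)"
    "l2norm (\<lambda>k. cx (W k) * conv f g k) \<le>
      C * ((LBINT k. norm (f k)) * l2norm (\<lambda>k. cx (W k) * g k) +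
           (LBINT k. norm (g k)) * l2norm (\<lambda>k. cx (W k) * f k))"
proof -
  have fm [measurable]: "f \<in> borel_measurable borel" and gm [measurable]: "g \<in> borel_measurable borel" using f g by auto
  define P :: "(real \<Rightarrow> complex) \<Rightarrow> (real \<Rightarrow> complex) \<Rightarrow> real \<Rightarrow> real" where "P = (\<lambda>f g k. LBINT l. norm (f (k - l)) * norm (cx (W l) * g l))"
  have Y: "AE k in lborel. integrable lborel (\<lambda>l. norm (f (k - l)) * norm (cx (W l) * g l))"
    "L2 (P f g)" "l2norm (P f g) \<le> (LBINT k. norm (f k)) * l2norm (\<lambda>k. cx (W k) * g k)"
    if f: "integrable lborel f" and g: "L2 (\<lambda>k. cx (W k) * g k)" and [measurable]: "g \<in> borel_measurable borel" for f g :: "real \<Rightarrow> complex"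
  proof -
    have [measurable]: "f \<in> borel_measurable borel" using f by auto
    have G: "jointly_measurable (\<lambda>k l. cx (norm (f (k - l)) * norm (cx (W l) * g l)))"
      by measurable
    have le: "norm (cx (norm (f (k - l)) * norm (cx (W l) * g l)))
        \<le> norm (f (k - l)) * norm (cx (W l) * g l)" for k l
      by (simp add: norm_mult)
    note Y = young_kernel[where a="\<lambda>k. norm (f k)", OF G le _ _ L2_norm(1)[OF g]]
    show "AE k in lborel. integrable lborel (\<lambda>l. norm (f (k - l)) * norm (cx (W l) * g l))"
      "L2 (P f g)" "l2norm (P f g) \<le> (LBINT k. norm (f k)) * l2norm (\<lambda>k. cx (W k) * g k)"
      unfolding P_def using Y(3,5,6) f by (auto simp: L2_norm(2))
  qed
  note Y1 = Y[OF f(1) g(2) gm] and Y2 = Y[OF g(1) f(2) fm]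
  have le: "AE k in lborel. norm (cx (W k) * conv f g k) \<le> norm (C * (P f g k + P g f k))"
    using Y1(1) Y2(1)
  proof eventually_elim
    case (elim k)
    have swapI: "integrable lborel (\<lambda>l. norm (cx (W (k - l)) * f (k - l)) * norm (g l))"
      using lborel_integrable_real_affine[OF elim(2), of "-1" k] by (simp add: mult.commute norm_mult)
    have swap: "(LBINT l. norm (cx (W (k - l)) * f (k - l)) * norm (g l)) = P g f k"
      unfolding P_def by (subst (2) lborel_integral_real_affine[where c="-1" and t=k]) (auto simp: mult.commute norm_mult)
    have I: "integrable lborel (\<lambda>l. norm (f (k - l)) * norm (cx (W l) * g l))"
      using elim(1) by (simp add: norm_mult)
    have "norm (cx (W k) * conv f g k) = W k * norm (conv f g k)" by (simp add: norm_mult W0)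
    also have "\<dots> \<le> W k * (LBINT l. norm (f (k - l)) * norm (g l))" by (intro mult_left_mono conv_norm_bound W0)
    also have "\<dots> = (LBINT l. W k * (norm (f (k - l)) * norm (g l)))" by simp
    also have "\<dots> \<le> (LBINT l. C * (norm (f (k - l)) * norm (cx (W l) * g l) + norm (cx (W (k - l)) * f (k - l)) * norm (g l)))"
    proof (rule integral_mono)
      show "integrable lborel (\<lambda>l. W k * (norm (f (k - l)) * norm (g l)))"
        using cauchy_schwarz(1)[OF L2_affine(1)[OF fg(1), of "-1" k] fg(2)] by simp
      show "integrable lborel (\<lambda>l. C * (norm (f (k - l)) * norm (cx (W l) * g l) + norm (cx (W (k - l)) * f (k - l)) * norm (g l)))"
        using I swapI by (intro integrable_mult_right Bochner_Integration.integrable_add)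
      fix l
      have "W k \<le> C * (W (k - l) + W l)" using W[of "k - l" l] by simp
      then have "W k * (norm (f (k - l)) * norm (g l)) \<le> (C * (W (k - l) + W l)) * (norm (f (k - l)) * norm (g l))"
        by (intro mult_right_mono) auto
      then show "W k * (norm (f (k - l)) * norm (g l)) \<le> C * (norm (f (k - l)) * norm (cx (W l) * g l) + norm (cx (W (k - l)) * f (k - l)) * norm (g l))"
        by (simp add: norm_mult W0 algebra_simps)
    qed
    also have "\<dots> = C * (P f g k + P g f k)"
      unfolding swap[symmetric] unfolding P_def using I swapI by (simp add: Bochner_Integration.integral_add)
    finally show ?case by simp
  qed
  have s: "L2 (\<lambda>k. C * (P f g k + P g f k))"
    by (intro L2_cmult L2_add Y1 Y2)
  have m: "(\<lambda>k. cx (W k) * conv f g k) \<in> borel_measurable borel" by measurable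
  show "L2 (\<lambda>k. cx (W k) * conv f g k)"
    by (rule L2_mono(1)[OF s m le])
  have "l2norm (\<lambda>k. cx (W k) * conv f g k) \<le> l2norm (\<lambda>k. C * (P f g k + P g f k))"
    by (rule L2_mono(2)[OF s m le])
  also have "\<dots> = C * l2norm (\<lambda>k. P f g k + P g f k)"
    using L2_cmult(2)[OF L2_add(1)[OF Y1(2) Y2(2)], of C] C by simp
  also have "\<dots> \<le> C * (l2norm (P f g) + l2norm (P g f))"
    by (intro mult_left_mono L2_add Y1 Y2 C)
  also have "\<dots> \<le> C * ((LBINT k. norm (f k)) * l2norm (\<lambda>k. cx (W k) * g k) +
           (LBINT k. norm (g k)) * l2norm (\<lambda>k. cx (W k) * f k))"
    by (intro mult_left_mono add_mono Y1 Y2 C)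
  finally show "l2norm (\<lambda>k. cx (W k) * conv f g k) \<le>
      C * ((LBINT k. norm (f k)) * l2norm (\<lambda>k. cx (W k) * g k) +
           (LBINT k. norm (g k)) * l2norm (\<lambda>k. cx (W k) * f k))" .
qed

section \<open>The Whitham profile in frequency space\<close>

text \<open>The transform of a square is \<open>c0\<close> times the convolution square of the
  transform.\<close>

abbreviation c0 :: complex where "c0 \<equiv> cx (1 / sqrt (2 * pi))"

abbreviation wmul :: "real \<Rightarrow> (real \<Rightarrow> complex) \<Rightarrow> real \<Rightarrow> complex"
  where "wmul r f \<equiv> \<lambda>k. cx (wt r k) * f k"

lemma norm_c0_le: "norm c0 \<le> 1"
proof -
  have "1 \<le> sqrt (2 * pi)" using pi_gt3 by simp
  then show ?thesis by (simp add: norm_divide)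
qed

lemma weighted_facts:
  assumes f: "L2 (wmul r f)" and r: "r \<ge> 1" and m: "f \<in> borel_measurable borel"
  shows "integrable lborel f" "L2 f" "(LBINT k. norm (f k)) \<le> K0 * l2norm (wmul r f)"
proof -
  note w = weight_square_integrable_mono[OF f m r]
  note I = weight_integrable[where f=f, simplified, OF w(1) m]
  show "integrable lborel f" "L2 f" using I by auto
  have "(LBINT k. norm (f k)) \<le> K0 * l2norm (wmul 1 f)" using I by auto
  also have "\<dots> \<le> K0 * l2norm (wmul r f)" using w(2) by (intro mult_left_mono) auto
  finally show "(LBINT k. norm (f k)) \<le> K0 * l2norm (wmul r f)" .
qed

lemma conv_wt:
  assumes f: "L2 (wmul r f)" "f \<in> borel_measurable borel"
    and g: "L2 (wmul r g)" "g \<in> borel_measurable borel" and r: "r \<ge> 1"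
  shows "L2 (wmul r (conv f g))"
    "l2norm (wmul r (conv f g)) \<le> 2 powr r * (2 * K0) * (l2norm (wmul r f) * l2norm (wmul r g))"
proof -
  note F = weighted_facts[OF f(1) r f(2)] and G = weighted_facts[OF g(1) r g(2)]
  have r0: "r \<ge> 0" using r by simp
  note C = conv_weighted[where W="wt r" and C="2 powr r", OF wt_measurable wt_nonneg wt_sum_le[OF r0] _ F(1) f(1) G(1) g(1) F(2) G(2)]
  show "L2 (wmul r (conv f g))" using C(1) by simp
  have "l2norm (wmul r (conv f g)) \<le> 2 powr r * ((LBINT k. norm (f k)) * l2norm (wmul r g) + (LBINT k. norm (g k)) * l2norm (wmul r f))"
    using C(2) by simp
  also have "\<dots> \<le> 2 powr r * ((K0 * l2norm (wmul r f)) * l2norm (wmul r g) + (K0 * l2norm (wmul r g)) * l2norm (wmul r f))"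
    by (intro mult_left_mono add_mono mult_right_mono F(3) G(3)) auto
  also have "\<dots> = 2 powr r * (2 * K0) * (l2norm (wmul r f) * l2norm (wmul r g))" by (simp add: algebra_simps)
  finally show "l2norm (wmul r (conv f g)) \<le> 2 powr r * (2 * K0) * (l2norm (wmul r f) * l2norm (wmul r g))" .
qed

lemma pairing_fourier:
  assumes u: "u \<in> sobolev r" and r: "r \<ge> 1" and f: "test_function f"
  shows "cx (LBINT x. u x * f x) = (LBINT k. fourier u k * ft (\<lambda>x. cx (f x)) (- k))"
    "cx (LBINT x. (u x)\<^sup>2 * f x) = (LBINT k. (c0 * conv (fourier u) (fourier u) k) * ft (\<lambda>x. cx (f x)) (- k))"
proof -
  note su = sobolev_square_integrable[OF u]
  note inv = sobolev_inversion[OF u r]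
  note tf = test_function_integrable[OF f]
  have [measurable]: "u \<in> borel_measurable borel" using su by auto
  have [measurable]: "fourier u \<in> borel_measurable borel" using fourier_L2FT[OF su] by auto
  have [measurable]: "f \<in> borel_measurable borel" using tf(1) by auto
  have "cx (LBINT x. u x * f x) = (LBINT x. ft (fourier u) (- x) * cx (f x))"
    unfolding integral_complex_of_real[symmetric]
    by (rule integral_cong_AE) (use inv(2) in auto)
  then show "cx (LBINT x. u x * f x) = (LBINT k. fourier u k * ft (\<lambda>x. cx (f x)) (- k))"
    using ift_pairing[OF inv(1) tf(3)] by simp
  note C = ft_conv[OF inv(1) inv(1)]
  have sq: "c0 * ft (conv (fourier u) (fourier u)) (- x) = ft (fourier u) (- x) * ft (fourier u) (- x)" for x
    unfolding C(2) by simp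
  have CI: "integrable lborel (\<lambda>k. c0 * conv (fourier u) (fourier u) k)" using C(1) by simp
  have "cx (LBINT x. (u x)\<^sup>2 * f x) = (LBINT x. (c0 * ft (conv (fourier u) (fourier u)) (- x)) * cx (f x))"
    unfolding integral_complex_of_real[symmetric] sq
    by (rule integral_cong_AE) (use inv(2) in \<open>auto simp: power2_eq_square\<close>)
  also have "\<dots> = (LBINT x. ft (\<lambda>k. c0 * conv (fourier u) (fourier u) k) (- x) * cx (f x))"
    by (simp only: ft_cmult)
  also have "\<dots> = (LBINT k. (c0 * conv (fourier u) (fourier u) k) * ft (\<lambda>x. cx (f x)) (- k))"
    by (rule ift_pairing[OF CI tf(3)])
  finally show "cx (LBINT x. (u x)\<^sup>2 * f x) = (LBINT k. (c0 * conv (fourier u) (fourier u) k) * ft (\<lambda>x. cx (f x)) (- k))" .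
qed

text \<open>\<open>fourier\<close> is chosen separately for each function, so it is linear only up
  to null sets. The difference is identified through its inverse transform.\<close>

lemma fourier_minus:
  assumes u: "u \<in> sobolev r" and v: "v \<in> sobolev r" and r: "r \<ge> 1"
  shows "AE k in lborel. fourier (\<lambda>x. u x - v x) k = fourier u k - fourier v k"
proof -
  note su = sobolev_square_integrable[OF u] and sv = sobolev_square_integrable[OF v]
  note iu = sobolev_inversion[OF u r] and iv = sobolev_inversion[OF v r]
  show ?thesis
  proof (rule fourier_inverse(2))
    show "(\<lambda>x. u x - v x) \<in> borel_measurable borel" using su sv by auto
    show "AE x in lborel. cx (u x - v x) = ft (\<lambda>k. fourier u k - fourier v k) (- x)"
      using iu(2) iv(2) by eventually_elim (simp add: ft_diff[OF iu(1) iv(1)])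
  qed (use iu iv fourier_L2FT(2)[OF su] fourier_L2FT(2)[OF sv] in \<open>auto intro: L2_diff\<close>)
qed

text \<open>Continuity in the Sobolev norm gives mean square continuity of the transforms, because
  the weight is at least \<open>1\<close>.\<close>

lemma sobolev_version:
  assumes U: "continuous_in_sobolev r T U" and r: "r \<ge> 1" and T: "T > 0"
  shows "\<exists>V. jointly_measurable V \<and> (\<forall>t k. V t (- k) = cnj (V t k)) \<and>
    (\<forall>t\<in>{0..T}. AE k in lborel. V t k = fourier (\<lambda>x. U x t) k)"
proof -
  define f where "f = (\<lambda>t. fourier (\<lambda>x. U x t))"
  have S: "(\<lambda>x. U x t) \<in> sobolev r" if "t \<in> {0..T}" for t
    using U that by (auto simp: continuous_in_sobolev_def)
  note sq = sobolev_square_integrable[OF S]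
  have f: "L2 (f t)" if "t \<in> {0..T}" for t
    unfolding f_def using fourier_L2FT(2)[OF sq[OF that]] .
  have cont: "((\<lambda>t'. l2norm (\<lambda>k. f t' k - f t k)) \<longlongrightarrow> 0) (at t within {0..T})" if t: "t \<in> {0..T}" for t
  proof (rule Lim_null_comparison)
    show "((\<lambda>t'. sobolev_norm r (\<lambda>x. U x t' - U x t)) \<longlongrightarrow> 0) (at t within {0..T})"
      using U t by (auto simp: continuous_in_sobolev_def)
    have "norm (l2norm (\<lambda>k. f t' k - f t k)) \<le> sobolev_norm r (\<lambda>x. U x t' - U x t)" if t': "t' \<in> {0..T}" for t'
    proof -
      note AE = fourier_minus[OF S[OF t'] S[OF t] r]
      have s: "L2 (\<lambda>x. U x t' - U x t)" by (intro L2_diff sq t t')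
      have [measurable]: "fourier (\<lambda>x. U x t' - U x t) \<in> borel_measurable borel" using fourier_L2FT(2)[OF s] by auto
      have m: "f t \<in> borel_measurable borel" "f t' \<in> borel_measurable borel" using f t t' by auto
      have w: "L2 (wmul r (\<lambda>k. f t' k - f t k))"
        using sobolev_iff[OF sq[OF t], of r] sobolev_iff[OF sq[OF t'], of r] S t t' L2_diff(1)
        unfolding right_diff_distrib f_def by blast
      have "sobolev_norm r (\<lambda>x. U x t' - U x t) = l2norm (wmul r (\<lambda>k. f t' k - f t k))"
        unfolding sobolev_norm_eq[OF s] by (rule l2norm_cong_AE) (use AE m in \<open>auto simp: f_def\<close>)
      moreover have "l2norm (wmul 0 (\<lambda>k. f t' k - f t k)) \<le> l2norm (wmul r (\<lambda>k. f t' k - f t k))"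
        by (rule weight_square_integrable_mono(2)[OF w]) (use m r in auto)
      moreover have "wt 0 k = 1" for k using one_plus_square_pos[of k] by (simp add: wt_def)
      ultimately show ?thesis by simp
    qed
    then show "\<forall>\<^sub>F t' in at t within {0..T}. norm (l2norm (\<lambda>k. f t' k - f t k)) \<le> sobolev_norm r (\<lambda>x. U x t' - U x t)"
      by (auto simp: eventually_at_filter)
  qed
  obtain V where V: "jointly_measurable V" "\<And>t. t \<in> {0..T} \<Longrightarrow> AE k in lborel. V t k = f t k"
    using measurable_version[OF f cont T] by blast
  \<comment> \<open>Symmetrizing makes the Hermitian symmetry hold at every frequency. The values
    change only on a null set, since the transform of a real function is already Hermitian almost
    everywhere.\<close>
  define V' where "V' = (\<lambda>t k. (V t k + cnj (V t (- k))) / 2)"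
  have [measurable]: "jointly_measurable V" by (rule V)
  have "jointly_measurable V'" unfolding V'_def by measurable
  moreover have "V' t (- k) = cnj (V' t k)" for t k by (simp add: V'_def)
  moreover have "AE k in lborel. V' t k = f t k" if t: "t \<in> {0..T}" for t
    using V(2)[OF t] AE_lborel_minus[OF V(2)[OF t]] fourier_hermitian[OF sq[OF t]]
    by eventually_elim (simp add: V'_def f_def)
  ultimately show ?thesis unfolding f_def by blast
qed

section \<open>From the weak Whitham equation to an integral equation in time\<close>

lemma second_order_taylor:
  fixes f :: "real \<Rightarrow> real"
  assumes "\<And>t. t \<in> {0..T} \<Longrightarrow> (f has_real_derivative f' t) (at t within {0..T})"
    "\<And>t. t \<in> {0..T} \<Longrightarrow> (f' has_real_derivative g t) (at t within {0..T})" and t: "t \<in> {0..T}"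
  shows "((\<lambda>\<tau>. (t - \<tau>) * g \<tau>) has_integral (f t - f 0 - t * f' 0)) {0..t}"
proof -
  \<comment> \<open>The first order Taylor polynomial of \<open>f\<close> at \<open>\<tau>\<close>,
    evaluated at \<open>t\<close>. The remainder is a gauge integral, since \<open>g\<close> is
    known only to be a derivative and need not be continuous.\<close>
  define F where "F = (\<lambda>\<tau>. f \<tau> + (t - \<tau>) * f' \<tau>)"
  have "((\<lambda>\<tau>. (t - \<tau>) * g \<tau>) has_integral (F t - F 0)) {0..t}"
  proof (rule fundamental_theorem_of_calculus)
    fix x assume x: "x \<in> {0..t}"
    then have x': "x \<in> {0..T}" using t by auto
    have "((\<lambda>\<tau>. f \<tau> + (t - \<tau>) * f' \<tau>) has_real_derivative (f' x + ((0 - 1) * f' x + g x * (t - x)))) (at x within {0..T})"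
      by (intro DERIV_add DERIV_mult DERIV_diff DERIV_const DERIV_ident assms x')
    then have "(F has_real_derivative (t - x) * g x) (at x within {0..T})" unfolding F_def by (simp add: mult.commute)
    then have "(F has_real_derivative (t - x) * g x) (at x within {0..t})" by (rule DERIV_subset) (use t in auto)
    then show "(F has_vector_derivative (t - x) * g x) (at x within {0..t})"
      by (simp add: has_real_derivative_iff_has_vector_derivative)
  qed (use t in auto)
  then show ?thesis by (simp add: F_def algebra_simps)
qed

text \<open>Integration by parts. The truncated factor \<open>max 0 (t - \<tau>)\<close> keeps the
  domain of integration independent of \<open>t\<close>, which suits measurability and
  domination.\<close>

lemma duhamel_double_integral:
  fixes G :: "real \<Rightarrow> complex"
  assumes G: "continuous_on {0..T} G" and t: "t \<in> {0..T}"
  shows "(LBINT \<tau>:{0..T}. cx (max 0 (t - \<tau>)) * G \<tau>) = (LBINT \<tau>:{0..t}. (LBINT \<sigma>:{0..\<tau>}. G \<sigma>))"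
proof -
  define I where "I = (\<lambda>\<tau>. LBINT \<sigma>:{0..\<tau>}. G \<sigma>)"
  have I: "(I has_vector_derivative G x) (at x within {0..T})" if "x \<in> {0..T}" for x
    unfolding I_def by (rule set_integral_FTC1[OF G that])
  have It: "(I has_vector_derivative G x) (at x within {0..t})" if "x \<in> {0..t}" for x
    using I[of x] that t by (auto intro: has_vector_derivative_within_subset)
  have Ic: "continuous_on {0..t} I"
    using It has_vector_derivative_continuous continuous_on_eq_continuous_within by blast
  have Gc: "continuous_on {0..t} G" using G t by (auto intro: continuous_on_subset)
  have I0: "I 0 = 0" by (simp add: I_def set_lebesgue_integral_def AE_lborel_singleton integral_eq_zero_AE indicator_def eventually_mono[OF AE_lborel_singleton[of 0]])
  have "(LBINT \<tau>:{0..t}. cx (t - \<tau>) * G \<tau> - I \<tau>) = cx (t - t) * I t - cx (t - 0) * I 0"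
  proof (rule set_integral_FTC2[where T=t])
    fix x assume x: "x \<in> {0..t}"
    have "((\<lambda>x. cx (t - x)) has_vector_derivative (- 1)) (at x within {0..t})"
      using has_vector_derivative_of_real[of "\<lambda>x. t - x" "-1" "at x within {0..t}"]
      by (auto intro!: derivative_eq_intros)
    from has_vector_derivative_mult[OF this It[OF x]]
    show "((\<lambda>\<tau>. cx (t - \<tau>) * I \<tau>) has_vector_derivative cx (t - x) * G x - I x) (at x within {0..t})"
      by simp
  qed (use t in \<open>auto intro!: continuous_intros Gc Ic\<close>)
  then have z: "(LBINT \<tau>:{0..t}. cx (t - \<tau>) * G \<tau> - I \<tau>) = 0" using I0 by simp
  have i1: "set_integrable lborel {0..t} (\<lambda>\<tau>. cx (t - \<tau>) * G \<tau>)"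
    by (rule borel_integrable_atLeastAtMost') (intro continuous_intros Gc)
  have i2: "set_integrable lborel {0..t} I" by (rule borel_integrable_atLeastAtMost'[OF Ic])
  have "(LBINT \<tau>:{0..T}. cx (max 0 (t - \<tau>)) * G \<tau>) = (LBINT \<tau>:{0..t}. cx (t - \<tau>) * G \<tau>)"
    unfolding set_lebesgue_integral_def using t
    by (intro Bochner_Integration.integral_cong refl) (auto simp: indicator_def max_def)
  also have "\<dots> = (LBINT \<tau>:{0..t}. I \<tau>)"
    using z set_integral_diff(2)[OF i1 i2] by simp
  finally show ?thesis by (simp add: I_def)
qed

text \<open>A null set of frequencies for each time becomes a null set of times for almost every
  frequency. This needs joint measurability and Fubini.\<close>

lemma AE_swap_time:
  fixes f g :: "real \<Rightarrow> real \<Rightarrow> complex"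
  assumes [measurable]: "jointly_measurable f" "jointly_measurable g"
    and AE: "\<And>\<tau>. \<tau> \<in> S \<Longrightarrow> AE k in lborel. f \<tau> k = g \<tau> k" and [measurable]: "S \<in> sets borel"
  shows "AE k in lborel. AE \<tau> in lborel. \<tau> \<in> S \<longrightarrow> f \<tau> k = g \<tau> k"
proof -
  have "AE \<tau> in lborel. AE k in lborel. \<tau> \<in> S \<longrightarrow> f \<tau> k = g \<tau> k" using AE by (auto intro!: AE_I2)
  moreover have "{x \<in> space (lborel \<Otimes>\<^sub>M lborel). fst x \<in> S \<longrightarrow> f (fst x) (snd x) = g (fst x) (snd x)} \<in> sets (lborel \<Otimes>\<^sub>M lborel)"
    by measurable
  ultimately show ?thesis using lborel_pair.AE_commute[of "\<lambda>\<tau> k. \<tau> \<in> S \<longrightarrow> f \<tau> k = g \<tau> k"] by simp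
qed

lemma conv_hermitian:
  assumes f: "\<And>k. f (- k) = cnj (f k)" and g: "\<And>k. g (- k) = cnj (g k)"
  shows "conv f g (- k) = cnj (conv f g k)"
proof -
  have "conv f g (- k) = (LBINT l. f (- k - (0 + (-1) * l)) * g (0 + (-1) * l))"
    unfolding conv_def by (subst lborel_integral_real_affine[where c="-1" and t=0]) auto
  also have "\<dots> = (LBINT l. cnj (f (k - l) * g l))"
  proof (intro Bochner_Integration.integral_cong refl)
    fix l show "f (- k - (0 + (-1) * l)) * g (0 + (-1) * l) = cnj (f (k - l) * g l)"
      using f[of "k - l"] g[of l] by simp
  qed
  finally show ?thesis unfolding conv_def Bochner_Integration.integral_cnj .
qed

lemma conv_time_continuous:
  fixes f g :: "real \<Rightarrow> real \<Rightarrow> complex"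
  assumes m: "\<And>t. t \<in> S \<Longrightarrow> f t \<in> borel_measurable borel" "\<And>t. t \<in> S \<Longrightarrow> g t \<in> borel_measurable borel"
    and c: "AE l in lborel. continuous_on S (\<lambda>t. f t l)" "AE l in lborel. continuous_on S (\<lambda>t. g t l)"
    and b: "AE l in lborel. \<forall>t\<in>S. norm (f t l) \<le> Bf l" "AE l in lborel. \<forall>t\<in>S. norm (g t l) \<le> Bg l"
    and B: "L2 Bf" "L2 (Bg :: real \<Rightarrow> real)"
  shows "continuous_on S (\<lambda>t. conv (f t) (g t) k)"
  unfolding conv_def
proof (rule continuous_on_integral_dominated)
  show "integrable lborel (\<lambda>l. Bf (k - l) * Bg l)"
    using cauchy_schwarz_mult(1)[OF L2_affine(1)[OF B(1), of "-1" k] B(2)] by simp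
  show "AE l in lborel. continuous_on S (\<lambda>t. f t (k - l) * g t l)"
    using AE_lborel_affine[OF c(1), of "-1" k, simplified] c(2) by eventually_elim (auto intro!: continuous_on_mult)
  show "AE l in lborel. \<forall>t\<in>S. norm (f t (k - l) * g t l) \<le> Bf (k - l) * Bg l"
    using AE_lborel_affine[OF b(1), of "-1" k, simplified] b(2)
  proof (eventually_elim, intro ballI)
    fix l t assume "\<forall>t\<in>S. norm (f t (k - l)) \<le> Bf (k - l)" "\<forall>t\<in>S. norm (g t l) \<le> Bg l" "t \<in> S"
    then have "norm (f t (k - l)) \<le> Bf (k - l)" "norm (g t l) \<le> Bg l" by auto
    then show "norm (f t (k - l) * g t l) \<le> Bf (k - l) * Bg l"
      unfolding norm_mult by (intro mult_mono) (auto intro: order_trans[OF norm_ge_zero])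
  qed
  fix t assume "t \<in> S"
  then have [measurable]: "f t \<in> borel_measurable borel" "g t \<in> borel_measurable borel" using m by auto
  show "(\<lambda>l. f t (k - l) * g t l) \<in> borel_measurable borel" by measurable
qed

text \<open>The right-hand side of the Whitham system in frequency space: the transform of the
  second derivative of \<open>U + U\<^sup>2\<close>.\<close>

definition whitham_rhs :: "(real \<Rightarrow> complex) \<Rightarrow> real \<Rightarrow> complex"
  where "whitham_rhs v k = - cx (k\<^sup>2) * (v k + c0 * conv v v k)"

text \<open>The second derivative lowers the order from \<open>3 + s\<close> to
  \<open>1 + s\<close>; the quadratic term is controlled at the higher order, where the space is an
  algebra.\<close>

lemma whitham_rhs_bound:
  assumes v: "L2 (wmul (3 + s) v)" "v \<in> borel_measurable borel" and s: "s \<ge> 0"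
  shows "L2 (wmul (1 + s) (whitham_rhs v))"
    "l2norm (wmul (1 + s) (whitham_rhs v)) \<le> l2norm (wmul (3 + s) v) + 2 powr (3 + s) * (2 * K0) * (l2norm (wmul (3 + s) v))\<^sup>2"
proof -
  have r: "3 + s \<ge> 1" using s by simp
  have [measurable]: "v \<in> borel_measurable borel" by (rule v)
  note C = conv_wt[OF v v r]
  have n0: "norm c0 \<le> 1"
  proof -
    have "1 \<le> sqrt (2 * pi)" using pi_gt3 by simp
    then show ?thesis by (simp add: norm_divide)
  qed
  have Cc: "L2 (\<lambda>k. c0 * wmul (3 + s) (conv v v) k)" "l2norm (\<lambda>k. c0 * wmul (3 + s) (conv v v) k) \<le> l2norm (wmul (3 + s) (conv v v))"
    using L2_cmult[OF C(1), of c0] mult_right_mono[OF n0 l2norm_nonneg, of "wmul (3 + s) (conv v v)"] by auto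
  note S = L2_add[OF v(1) Cc(1)]
  have m: "wmul (1 + s) (whitham_rhs v) \<in> borel_measurable borel" unfolding whitham_rhs_def[abs_def] by measurable
  have "norm (wmul (1 + s) (whitham_rhs v) k) \<le> norm (wmul (3 + s) v k + c0 * wmul (3 + s) (conv v v) k)" for k
  proof -
    have "wt (1 + s) k * k\<^sup>2 \<le> wt (1 + s) k * wt 2 k" by (intro mult_left_mono) (auto simp: wt_2)
    also have "\<dots> = wt (3 + s) k" using wt_add[of "1 + s" 2 k] by (simp add: add.commute)
    finally have le: "wt (1 + s) k * k\<^sup>2 \<le> wt (3 + s) k" .
    have "norm (wmul (1 + s) (whitham_rhs v) k) = (wt (1 + s) k * k\<^sup>2) * norm (v k + c0 * conv v v k)"
      by (simp add: whitham_rhs_def norm_mult norm_power)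
    also have "\<dots> \<le> wt (3 + s) k * norm (v k + c0 * conv v v k)" by (intro mult_right_mono le) auto
    also have "\<dots> = norm (cx (wt (3 + s) k) * (v k + c0 * conv v v k))" by (simp add: norm_mult)
    also have "cx (wt (3 + s) k) * (v k + c0 * conv v v k) = wmul (3 + s) v k + c0 * wmul (3 + s) (conv v v) k"
      by (simp add: algebra_simps)
    finally show ?thesis .
  qed
  then have le: "AE k in lborel. norm (wmul (1 + s) (whitham_rhs v) k) \<le> norm (wmul (3 + s) v k + c0 * wmul (3 + s) (conv v v) k)" by blast
  show "L2 (wmul (1 + s) (whitham_rhs v))" by (rule L2_mono(1)[OF S(1) m le])
  have "l2norm (wmul (1 + s) (whitham_rhs v)) \<le> l2norm (\<lambda>k. wmul (3 + s) v k + c0 * wmul (3 + s) (conv v v) k)"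
    by (rule L2_mono(2)[OF S(1) m le])
  also have "\<dots> \<le> l2norm (wmul (3 + s) v) + 2 powr (3 + s) * (2 * K0) * (l2norm (wmul (3 + s) v))\<^sup>2"
    using S(2) Cc(2) C(2) by (simp add: power2_eq_square)
  finally show "l2norm (wmul (1 + s) (whitham_rhs v)) \<le> l2norm (wmul (3 + s) v) + 2 powr (3 + s) * (2 * K0) * (l2norm (wmul (3 + s) v))\<^sup>2" .
qed

lemma whitham_rhs_measurable [measurable]:
  assumes [measurable]: "jointly_measurable V"
  shows "(\<lambda>(t, k). whitham_rhs (V t) k) \<in> borel_measurable (borel \<Otimes>\<^sub>M borel)"
proof -
  have [measurable]: "(\<lambda>x. conv (V (fst x)) (V (fst x)) (snd x)) \<in> borel_measurable (borel \<Otimes>\<^sub>M borel)"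
    using conv_jointly_measurable[OF assms assms] by (simp add: case_prod_unfold)
  show ?thesis unfolding whitham_rhs_def case_prod_unfold by measurable
qed

text \<open>Testing the equation shows that \<open>V\<close> is, up to an affine function of time, the double time
  integral of the right-hand side.\<close>

lemma whitham_integral_form:
  assumes T: "T > 0" and s: "s \<ge> 0" and U: "continuous_in_sobolev (3 + s) T U" "whitham_solution T U"
    and bound: "\<And>t. t \<in> {0..T} \<Longrightarrow> sobolev_norm (3 + s) (\<lambda>x. U x t) \<le> A" and A: "A \<ge> 0"
  shows "\<exists>V b. jointly_measurable V \<and> (\<forall>t k. V t (- k) = cnj (V t k)) \<and>
    (\<forall>t. t \<notin> {0..T} \<longrightarrow> V t = (\<lambda>k. 0)) \<and>
    (\<forall>t. L2 (wmul (3 + s) (V t)) \<and> l2norm (wmul (3 + s) (V t)) \<le> A) \<and>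
    (\<forall>t\<in>{0..T}. AE k in lborel. V t k = fourier (\<lambda>x. U x t) k) \<and>
    b \<in> borel_measurable borel \<and> L2 (wmul (1 + s) b) \<and> (\<forall>k. b (- k) = cnj (b k)) \<and>
    (\<forall>t\<in>{0..T}. AE k in lborel. V t k = V 0 k + (LBINT \<tau>:{0..T}. cx (max 0 (t - \<tau>)) * whitham_rhs (V \<tau>) k) + cx t * b k)"
proof -
  have r: "3 + s \<ge> 1" and r1: "1 + s \<ge> 1" using s by auto
  obtain V0 where V0: "jointly_measurable V0" "\<And>t k. V0 t (- k) = cnj (V0 t k)"
    "\<And>t. t \<in> {0..T} \<Longrightarrow> AE k in lborel. V0 t k = fourier (\<lambda>x. U x t) k"
    using sobolev_version[OF U(1) r T] by blast
  define V where "V = (\<lambda>t k. if t \<in> {0..T} then V0 t k else 0)"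
  have [measurable]: "jointly_measurable V0" by (rule V0)
  have Vm [measurable]: "jointly_measurable V" unfolding V_def by measurable
  note Vt = measurable_joint_sections(1)[OF Vm]
  have Vh: "V t (- k) = cnj (V t k)" for t k by (simp add: V_def V0)
  have Vout: "V t = (\<lambda>k. 0)" if "t \<notin> {0..T}" for t using that by (auto simp: V_def)
  have VU: "AE k in lborel. V t k = fourier (\<lambda>x. U x t) k" if "t \<in> {0..T}" for t
    using V0(3)[OF that] that by (simp add: V_def)
  have S: "(\<lambda>x. U x t) \<in> sobolev (3 + s)" if "t \<in> {0..T}" for t
    using U that by (auto simp: continuous_in_sobolev_def)
  note sq = sobolev_square_integrable[OF S]
  have Vsq: "L2 (wmul (3 + s) (V t)) \<and> l2norm (wmul (3 + s) (V t)) \<le> A" for t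
  proof (cases "t \<in> {0..T}")
    case True
    have f: "L2 (wmul (3 + s) (fourier (\<lambda>x. U x t)))" using S[OF True] sobolev_iff[OF sq[OF True]] by simp
    have "AE k in lborel. norm (wmul (3 + s) (V t) k) \<le> norm (wmul (3 + s) (fourier (\<lambda>x. U x t)) k)"
      using VU[OF True] by eventually_elim simp
    from L2_mono[OF f _ this] Vt[of t]
    show ?thesis using bound[OF True] sobolev_norm_eq[OF sq[OF True], of "3 + s"] by auto
  next
    case False
    then show ?thesis using A by (simp add: Vout square_integrable_def l2norm_def)
  qed
  define G where "G = (\<lambda>t. whitham_rhs (V t))"
  define CG where "CG = A + 2 powr (3 + s) * (2 * K0) * A\<^sup>2"
  have CG: "CG \<ge> 0" using A by (simp add: CG_def)
  have Gm [measurable]: "jointly_measurable G"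
    unfolding G_def using whitham_rhs_measurable[OF Vm] by simp
  note Gt = measurable_joint_sections[OF Gm]
  have G: "L2 (wmul (1 + s) (G t))" "l2norm (wmul (1 + s) (G t)) \<le> CG" for t
  proof -
    note B = whitham_rhs_bound[OF conjunct1[OF Vsq[of t]] Vt s]
    show "L2 (wmul (1 + s) (G t))" unfolding G_def by (rule B)
    have "(l2norm (wmul (3 + s) (V t)))\<^sup>2 \<le> A\<^sup>2" using Vsq[of t] by (intro power_mono) auto
    then have "2 powr (3 + s) * (2 * K0) * (l2norm (wmul (3 + s) (V t)))\<^sup>2 \<le> 2 powr (3 + s) * (2 * K0) * A\<^sup>2"
      by (intro mult_left_mono) auto
    then show "l2norm (wmul (1 + s) (G t)) \<le> CG" using B(2) Vsq[of t] unfolding G_def CG_def by linarith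
  qed
  have G2: "L2 (G t)" "integrable lborel (G t)" "l2norm (G t) \<le> CG" for t
  proof -
    show "L2 (G t)" "integrable lborel (G t)" using weighted_facts[OF G(1) r1 Gt(1)] by auto
    have "wt 0 k = 1" for k using one_plus_square_pos[of k] by (simp add: wt_def)
    then show "l2norm (G t) \<le> CG" using weight_square_integrable_mono(2)[OF G(1) Gt(1), of 0 t] G(2)[of t] s by simp
  qed
  define W where "W = (\<lambda>t k. LBINT \<tau>:{0..T}. cx (max 0 (t - \<tau>)) * G \<tau> k)"
  have Wm [measurable]: "jointly_measurable W"
    unfolding W_def set_lebesgue_integral_def by measurable
  note Wt = measurable_joint_sections(1)[OF Wm]
  have Wsq: "L2 (wmul (1 + s) (W t))" if t: "t \<in> {0..T}" for t
  proof -
    have gm: "jointly_measurable (\<lambda>\<tau> k. wmul (1 + s) (G \<tau>) k)" by measurable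
    note M = minkowski_time[OF gm G CG less_imp_le[OF T]]
    show ?thesis
    proof (rule L2_cmult_mono(1)[OF M(2), where c=T])
      show "AE k in lborel. norm (wmul (1 + s) (W t) k) \<le> T * norm (LBINT \<tau>:{0..T}. norm (wmul (1 + s) (G \<tau>) k))"
        using M(1)
      proof eventually_elim
        case (elim k)
        have i: "integrable lborel (\<lambda>\<tau>. indicator {0..T} \<tau> *\<^sub>R norm (wmul (1 + s) (G \<tau>) k))"
          using set_integrable_norm[OF elim] by (simp add: set_integrable_def)
        have "wmul (1 + s) (W t) k = (LBINT \<tau>. indicator {0..T} \<tau> *\<^sub>R (cx (max 0 (t - \<tau>)) * wmul (1 + s) (G \<tau>) k))"
          unfolding W_def set_lebesgue_integral_def by (subst integral_mult_right_zero[symmetric]) (simp add: mult_ac)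
        also have "norm \<dots> \<le> (LBINT \<tau>. T * (indicator {0..T} \<tau> *\<^sub>R norm (wmul (1 + s) (G \<tau>) k)))"
        proof (rule order_trans[OF integral_norm_bound])
          have le: "norm (indicator {0..T} \<tau> *\<^sub>R (cx (max 0 (t - \<tau>)) * wmul (1 + s) (G \<tau>) k)) \<le> T * (indicator {0..T} \<tau> *\<^sub>R norm (wmul (1 + s) (G \<tau>) k))" for \<tau>
          proof (cases "\<tau> \<in> {0..T}")
            case True
            then have "\<bar>max 0 (t - \<tau>)\<bar> \<le> T" using t by auto
            then show ?thesis using True mult_right_mono[of "\<bar>max 0 (t - \<tau>)\<bar>" T "norm (wmul (1 + s) (G \<tau>) k)"] by (simp add: norm_mult)
          qed simp
          have iT: "integrable lborel (\<lambda>\<tau>. T * (indicator {0..T} \<tau> *\<^sub>R norm (wmul (1 + s) (G \<tau>) k)))" using i by simp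
          show "(LBINT \<tau>. norm (indicator {0..T} \<tau> *\<^sub>R (cx (max 0 (t - \<tau>)) * wmul (1 + s) (G \<tau>) k)))
             \<le> (LBINT \<tau>. T * (indicator {0..T} \<tau> *\<^sub>R norm (wmul (1 + s) (G \<tau>) k)))"
            by (rule integral_mono'[OF iT le]) (use T in simp)
        qed
        also have "\<dots> = T * (LBINT \<tau>:{0..T}. norm (wmul (1 + s) (G \<tau>) k))"
          unfolding set_lebesgue_integral_def by simp
        also have "\<dots> \<le> T * norm (LBINT \<tau>:{0..T}. norm (wmul (1 + s) (G \<tau>) k))"
          using T by (intro mult_left_mono) auto
        finally show ?case .
      qed
    qed (use Wt T in auto)
  qed
  \<comment> \<open>The defect, expected to be the initial velocity times \<open>t\<close>.\<close>
  define D where "D = (\<lambda>t k. V t k - V 0 k - W t k)"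
  have Dm: "D t \<in> borel_measurable borel" for t unfolding D_def using Vt Wt by measurable
  have Dsq: "L2 (wmul (1 + s) (D t))" if t: "t \<in> {0..T}" for t
  proof -
    have "L2 (wmul (1 + s) (V t))" for t
      by (rule weight_square_integrable_mono(1)[OF conjunct1[OF Vsq] Vt]) simp
    then have "L2 (\<lambda>k. wmul (1 + s) (V t) k - wmul (1 + s) (V 0) k - wmul (1 + s) (W t) k)"
      by (intro L2_diff Wsq t)
    then show ?thesis by (simp add: D_def algebra_simps)
  qed
  \<comment> \<open>For a fixed test function the defect pairs to an exactly linear function of
    time, by Taylor's formula for the scalar pairing; the slope is the initial derivative of that
    pairing.\<close>
  have key: "\<exists>b. \<forall>t\<in>{0..T}. (LBINT k. D t k * ft (\<lambda>x. cx (\<phi> x)) (- k)) = cx t * b"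
    if \<phi>: "test_function \<phi>" for \<phi>
  proof -
    define F where "F = (\<lambda>k. ft (\<lambda>x. cx (\<phi> x)) (- k))"
    note tf = test_function_integrable[OF \<phi>]
    have Fs: "L2 F"
      unfolding F_def using L2_affine(1)[OF plancherel(1)[OF tf(3,4)], of "-1" 0] by simp
    have [measurable]: "F \<in> borel_measurable borel" using Fs by auto
    define f where "f = (\<lambda>t. LBINT x. U x t * \<phi> x)"
    define g where "g = (\<lambda>t. (LBINT x. U x t * (deriv ^^ 2) \<phi> x) + (LBINT x. (U x t)\<^sup>2 * (deriv ^^ 2) \<phi> x))"
    define gg where "gg = (\<lambda>t. LBINT k. G t k * F k)"
    have [measurable]: "gg \<in> borel_measurable borel" unfolding gg_def by measurable
    have ggb: "norm (gg t) \<le> CG * l2norm F" for t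
      unfolding gg_def using cauchy_schwarz_mult(2)[OF G2(1) Fs, of t] mult_right_mono[OF G2(3)[of t] l2norm_nonneg[of F]] by linarith
    have feq: "cx (f t) = (LBINT k. V t k * F k)" if t: "t \<in> {0..T}" for t
    proof -
      have [measurable]: "fourier (\<lambda>x. U x t) \<in> borel_measurable borel" using fourier_L2FT(2)[OF sq[OF t]] by auto
      have [measurable]: "V t \<in> borel_measurable borel" by (rule Vt)
      have "cx (f t) = (LBINT k. fourier (\<lambda>x. U x t) k * F k)"
        unfolding f_def F_def by (rule pairing_fourier(1)[OF S[OF t] r \<phi>])
      also have "\<dots> = (LBINT k. V t k * F k)"
        by (rule integral_cong_AE) (use VU[OF t] in auto)
      finally show ?thesis .
    qed
    have geq: "cx (g t) = gg t" if t: "t \<in> {0..T}" for t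
    proof -
      have [measurable]: "fourier (\<lambda>x. U x t) \<in> borel_measurable borel" using fourier_L2FT(2)[OF sq[OF t]] by auto
      have [measurable]: "V t \<in> borel_measurable borel" by (rule Vt)
      let ?u = "fourier (\<lambda>x. U x t)"
      have c: "conv ?u ?u k = conv (V t) (V t) k" for k
        by (rule conv_cong_AE) (use VU[OF t] in \<open>auto elim: eventually_mono\<close>)
      have F2: "ft (\<lambda>x. cx ((deriv ^^ 2) \<phi> x)) (- k) = - cx (k\<^sup>2) * F k" for k
        unfolding F_def using ft_deriv_2[OF \<phi>, of "- k"] by simp
      have tf2: "test_function ((deriv ^^ 2) \<phi>)" by (rule test_function_funpow[OF \<phi>])
      have F2s: "L2 (\<lambda>k. - cx (k\<^sup>2) * F k)"
        unfolding F2[symmetric] using L2_affine(1)[OF plancherel(1)[OF test_function_integrable(3,4)[OF tf2]], of "-1" 0] by simp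
      have "cx (g t) = (LBINT k. ?u k * (- cx (k\<^sup>2) * F k)) + (LBINT k. (c0 * conv ?u ?u k) * (- cx (k\<^sup>2) * F k))"
        unfolding g_def of_real_add pairing_fourier(1)[OF S[OF t] r tf2] pairing_fourier(2)[OF S[OF t] r tf2] F2 ..
      also have "(LBINT k. ?u k * (- cx (k\<^sup>2) * F k)) = (LBINT k. V t k * (- cx (k\<^sup>2) * F k))"
        by (rule integral_cong_AE) (use VU[OF t] in auto)
      also have "(LBINT k. (c0 * conv ?u ?u k) * (- cx (k\<^sup>2) * F k)) = (LBINT k. (c0 * conv (V t) (V t) k) * (- cx (k\<^sup>2) * F k))"
        unfolding c ..
      also have "(LBINT k. V t k * (- cx (k\<^sup>2) * F k)) + \<dots> = (LBINT k. V t k * (- cx (k\<^sup>2) * F k) + (c0 * conv (V t) (V t) k) * (- cx (k\<^sup>2) * F k))"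
      proof (rule Bochner_Integration.integral_add[symmetric])
        note Vf = weighted_facts[OF conjunct1[OF Vsq] r Vt]
        show "integrable lborel (\<lambda>k. V t k * (- cx (k\<^sup>2) * F k))"
          by (rule cauchy_schwarz_mult(1)[OF Vf(2) F2s])
        have "L2 (conv (V t) (V t))"
          using weighted_facts(2)[OF conv_wt(1)[OF conjunct1[OF Vsq] Vt conjunct1[OF Vsq] Vt r] r] Vt by simp
        from cauchy_schwarz_mult(1)[OF L2_cmult(1)[OF this, of c0] F2s]
        show "integrable lborel (\<lambda>k. (c0 * conv (V t) (V t) k) * (- cx (k\<^sup>2) * F k))" .
      qed
      also have "\<dots> = gg t" unfolding gg_def G_def whitham_rhs_def
        by (intro Bochner_Integration.integral_cong refl) (simp add: algebra_simps)
      finally show ?thesis .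
    qed
    have "has_second_derivative_on f g {0..T}"
      using U(2) \<phi> unfolding whitham_solution_def f_def g_def by blast
    then obtain f' where f': "\<And>t. t \<in> {0..T} \<Longrightarrow> (f has_real_derivative f' t) (at t within {0..T})"
      "\<And>t. t \<in> {0..T} \<Longrightarrow> (f' has_real_derivative g t) (at t within {0..T})"
      unfolding has_second_derivative_on_def by blast
    have "(LBINT k. D t k * F k) = cx t * cx (f' 0)" if t: "t \<in> {0..T}" for t
    proof -
      have T0: "0 \<in> {0..T}" using T by simp
      have hk: "((\<lambda>\<tau>. (t - \<tau>) * Re (gg \<tau>)) has_integral (f t - f 0 - t * f' 0)) {0..t}"
      proof (rule has_integral_eq[OF _ second_order_taylor[OF f' t]])
        fix \<tau> assume "\<tau> \<in> {0..t}"
        then have "\<tau> \<in> {0..T}" using t by auto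
        then show "(t - \<tau>) * g \<tau> = (t - \<tau>) * Re (gg \<tau>)" using geq by (metis Re_complex_of_real)
      qed auto
      have fin: "integrable lborel (\<lambda>\<tau>. indicator {0..T} \<tau> * (T * (CG * l2norm F)))"
        by (intro integrable_mult_left integrable_real_indicator) (auto simp: emeasure_lborel_Icc_eq)
      have si: "set_integrable lborel {0..t} (\<lambda>\<tau>. (t - \<tau>) * Re (gg \<tau>))"
        unfolding set_integrable_def
      proof (rule Bochner_Integration.integrable_bound[OF fin])
        show "AE \<tau> in lborel. norm (indicator {0..t} \<tau> *\<^sub>R ((t - \<tau>) * Re (gg \<tau>))) \<le> norm (indicator {0..T} \<tau> * (T * (CG * l2norm F)))"
        proof (rule AE_I2)
          fix \<tau> :: real
          show "norm (indicator {0..t} \<tau> *\<^sub>R ((t - \<tau>) * Re (gg \<tau>))) \<le> norm (indicator {0..T} \<tau> * (T * (CG * l2norm F)))"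
          proof (cases "\<tau> \<in> {0..t}")
            case True
            have "\<bar>t - \<tau>\<bar> * \<bar>Re (gg \<tau>)\<bar> \<le> T * (CG * l2norm F)"
              using True t ggb[of \<tau>] abs_Re_le_cmod[of "gg \<tau>"] by (intro mult_mono) auto
            then show ?thesis using True t CG T by (simp add: abs_mult)
          qed simp
        qed
      qed measurable
      have "cx (f t - f 0 - t * f' 0) = cx (LBINT \<tau>:{0..t}. (t - \<tau>) * Re (gg \<tau>))"
        using set_borel_integral_eq_integral(2)[OF si] integral_unique[OF hk] by simp
      also have "\<dots> = (LBINT \<tau>:{0..T}. cx (max 0 (t - \<tau>)) * gg \<tau>)"
        unfolding set_lebesgue_integral_def integral_complex_of_real[symmetric]
      proof (intro Bochner_Integration.integral_cong refl)
        fix \<tau>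
        have "cx (Re (gg \<tau>)) = gg \<tau>" if "\<tau> \<in> {0..T}" using geq[OF that] by (metis Re_complex_of_real)
        then show "cx (indicator {0..t} \<tau> *\<^sub>R ((t - \<tau>) * Re (gg \<tau>))) = indicator {0..T} \<tau> *\<^sub>R (cx (max 0 (t - \<tau>)) * gg \<tau>)"
          using t by (auto simp: indicator_def max_def)
      qed
      also have "\<dots> = (LBINT \<tau>. (LBINT k. (indicator {0..T} \<tau> *\<^sub>R (cx (max 0 (t - \<tau>)))) * (G \<tau> k * F k)))"
        unfolding set_lebesgue_integral_def gg_def by (simp add: mult.assoc)
      also have "\<dots> = (LBINT k. (LBINT \<tau>. (indicator {0..T} \<tau> *\<^sub>R (cx (max 0 (t - \<tau>)))) * (G \<tau> k * F k)))"
      proof (rule lborel_pair.Fubini_integral[symmetric], rule lborel_pair.Fubini_integrable)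
        show "AE \<tau> in lborel. integrable lborel (\<lambda>k. case (\<tau>, k) of (\<tau>, k) \<Rightarrow> (indicator {0..T} \<tau> *\<^sub>R (cx (max 0 (t - \<tau>)))) * (G \<tau> k * F k))"
          using cauchy_schwarz_mult(1)[OF G2(1) Fs] by (auto intro!: integrable_mult_right)
        show "integrable lborel (\<lambda>\<tau>. LBINT k. norm (case (\<tau>, k) of (\<tau>, k) \<Rightarrow> (indicator {0..T} \<tau> *\<^sub>R (cx (max 0 (t - \<tau>)))) * (G \<tau> k * F k)))"
        proof (rule Bochner_Integration.integrable_bound[OF fin])
          show "AE \<tau> in lborel. norm (LBINT k. norm (case (\<tau>, k) of (\<tau>, k) \<Rightarrow> (indicator {0..T} \<tau> *\<^sub>R (cx (max 0 (t - \<tau>)))) * (G \<tau> k * F k)))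
             \<le> norm (indicator {0..T} \<tau> * (T * (CG * l2norm F)))"
          proof (rule AE_I2)
            fix \<tau> :: real
            have GF: "(LBINT k. norm (G \<tau> k) * norm (F k)) \<le> CG * l2norm F"
              using cauchy_schwarz(2)[OF G2(1) Fs, of \<tau>] mult_right_mono[OF G2(3)[of \<tau>] l2norm_nonneg[of F]] by linarith
            have GF0: "0 \<le> (LBINT k. norm (G \<tau> k) * norm (F k))" by (intro Bochner_Integration.integral_nonneg) auto
            show "norm (LBINT k. norm (case (\<tau>, k) of (\<tau>, k) \<Rightarrow> (indicator {0..T} \<tau> *\<^sub>R (cx (max 0 (t - \<tau>)))) * (G \<tau> k * F k)))
               \<le> norm (indicator {0..T} \<tau> * (T * (CG * l2norm F)))"
            proof (cases "\<tau> \<in> {0..T}")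
              case True
              then have "\<bar>max 0 (t - \<tau>)\<bar> \<le> T" using t by auto
              then have "\<bar>max 0 (t - \<tau>)\<bar> * (LBINT k. norm (G \<tau> k) * norm (F k)) \<le> T * (CG * l2norm F)"
                using GF GF0 by (intro mult_mono) auto
              then show ?thesis using True GF0 CG T by (simp add: norm_mult abs_mult)
            qed simp
          qed
        qed measurable
      qed measurable
      also have "\<dots> = (LBINT k. W t k * F k)"
      proof (intro Bochner_Integration.integral_cong refl)
        fix k
        have "(LBINT \<tau>. (indicator {0..T} \<tau> *\<^sub>R (cx (max 0 (t - \<tau>)))) * (G \<tau> k * F k)) =
           (LBINT \<tau>. (indicator {0..T} \<tau> *\<^sub>R (cx (max 0 (t - \<tau>)) * G \<tau> k)) * F k)"
          by (simp add: mult_ac)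
        also have "\<dots> = W t k * F k" unfolding W_def set_lebesgue_integral_def by (rule integral_mult_left_zero)
        finally show "(LBINT \<tau>. (indicator {0..T} \<tau> *\<^sub>R (cx (max 0 (t - \<tau>)))) * (G \<tau> k * F k)) = W t k * F k" .
      qed
      finally have WF: "(LBINT k. W t k * F k) = cx (f t) - cx (f 0) - cx t * cx (f' 0)" by simp
      have i: "integrable lborel (\<lambda>k. V t k * F k)" "integrable lborel (\<lambda>k. V 0 k * F k)" "integrable lborel (\<lambda>k. W t k * F k)"
        using weighted_facts(2)[OF conjunct1[OF Vsq] r Vt] weighted_facts(2)[OF Wsq[OF t] r1 Wt]
        by (auto intro!: cauchy_schwarz_mult Fs)
      have "(LBINT k. D t k * F k) = (LBINT k. V t k * F k) - (LBINT k. V 0 k * F k) - (LBINT k. W t k * F k)"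
        unfolding D_def using i by (simp add: left_diff_distrib)
      then show ?thesis unfolding WF feq[OF t, symmetric] feq[OF T0, symmetric] by simp
    qed
    then show ?thesis unfolding F_def by blast
  qed
  have TT: "T \<in> {0..T}" using T by simp
  \<comment> \<open>Linearity against every test function becomes linearity of \<open>D\<close>
    itself, because test functions separate. The velocity can then be read off at the final time as
    \<open>D T / T\<close>.\<close>
  have AE: "AE k in lborel. D t k - cx (t / T) * D T k = 0" if t: "t \<in> {0..T}" for t
  proof (rule test_functions_separate_ft)
    note Dt = weighted_facts[OF Dsq[OF t] r1 Dm] and DT = weighted_facts[OF Dsq[OF TT] r1 Dm]
    show "integrable lborel (\<lambda>k. D t k - cx (t / T) * D T k)"
      using Dt(1) DT(1) by (intro Bochner_Integration.integrable_diff integrable_mult_right)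
    show "L2 (\<lambda>k. D t k - cx (t / T) * D T k)"
      by (intro L2_diff L2_cmult Dt DT)
    fix \<phi> assume \<phi>: "test_function \<phi>"
    let ?F = "\<lambda>k. ft (\<lambda>x. cx (\<phi> x)) (- k)"
    note tf = test_function_integrable[OF \<phi>]
    have Fs: "L2 ?F"
      using L2_affine(1)[OF plancherel(1)[OF tf(3,4)], of "-1" 0] by simp
    obtain b where b: "\<And>t. t \<in> {0..T} \<Longrightarrow> (LBINT k. D t k * ?F k) = cx t * b"
      using key[OF \<phi>] by blast
    have "(LBINT k. (D t k - cx (t / T) * D T k) * ?F k) = (LBINT k. D t k * ?F k - cx (t / T) * (D T k * ?F k))"
      by (intro Bochner_Integration.integral_cong refl) (simp add: algebra_simps)
    also have "\<dots> = (LBINT k. D t k * ?F k) - cx (t / T) * (LBINT k. D T k * ?F k)"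
      using cauchy_schwarz_mult(1)[OF Dt(2) Fs] cauchy_schwarz_mult(1)[OF DT(2) Fs]
      by (subst Bochner_Integration.integral_diff) auto
    also have "\<dots> = 0" unfolding b[OF t] b[OF TT] using T by simp
    finally show "(LBINT k. (D t k - cx (t / T) * D T k) * ?F k) = 0" .
  qed
  define b where "b = (\<lambda>k. D T k / cx T)"
  have Gh: "G \<tau> (- k) = cnj (G \<tau> k)" for \<tau> k
    unfolding G_def whitham_rhs_def using conv_hermitian[of "V \<tau>" "V \<tau>" k] Vh by simp
  have Wh: "W t (- k) = cnj (W t k)" for t k
    unfolding W_def set_lebesgue_integral_def
    by (subst Bochner_Integration.integral_cnj[symmetric]) (simp add: Gh)
  have "b \<in> borel_measurable borel" unfolding b_def using Dm[of T] by measurable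
  moreover have "L2 (wmul (1 + s) b)"
    using L2_cmult(1)[OF Dsq[OF TT], of "1 / cx T"] by (simp add: b_def)
  moreover have "b (- k) = cnj (b k)" for k by (simp add: b_def D_def Vh Wh)
  moreover have "AE k in lborel. V t k = V 0 k + (LBINT \<tau>:{0..T}. cx (max 0 (t - \<tau>)) * whitham_rhs (V \<tau>) k) + cx t * b k" if t: "t \<in> {0..T}" for t
    using AE[OF t]
  proof eventually_elim
    case (elim k)
    have 1: "cx t * b k = cx (t / T) * D T k" by (simp add: b_def)
    have "V t k - V 0 k - W t k = cx t * b k" using elim unfolding 1 by (simp add: D_def)
    then have "V t k = V 0 k + W t k + cx t * b k" by (simp add: algebra_simps)
    then show ?case unfolding W_def G_def .
  qed
  ultimately show ?thesis using Vm Vh Vout Vsq VU by (intro exI[of _ V] exI[of _ b]) blast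
qed

lemma L2_weighted_norm:
  "L2 (wmul r f) \<Longrightarrow> L2 (\<lambda>k. wt r k * norm (f k))"
  using L2_norm(1)[of "wmul r f"] by (simp add: norm_mult)

text \<open>A version of the transformed Whitham solution with enough pointwise regularity in time
  to differentiate energies: the first derivative exists at every frequency, the second at almost
  every one. The time-independent envelope \<open>B\<close> dominates both \<open>V\<close> and
  \<open>V'\<close>. It serves in dominated convergence, and its integral enters the growth rate
  through \<open>V'\<close>, which explains its order \<open>1 + s\<close>. The size bounds hold for
  all real times, so the operators below are defined without restricting the time.\<close>

locale profile =
  fixes s T A :: real and V V' :: "real \<Rightarrow> real \<Rightarrow> complex" and B :: "real \<Rightarrow> real"
  assumes s: "s \<ge> 0" and T: "T > 0" and A: "A \<ge> 0"
    and Vm: "jointly_measurable V" and V'm: "jointly_measurable V'"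
    and Bm: "B \<in> borel_measurable borel" and Bs: "L2 (\<lambda>k. wt (1 + s) k * B k)"
    and Vh: "\<And>t k. V t (- k) = cnj (V t k)"
    and Vb: "\<And>t k. norm (V t k) \<le> B k" and V'b: "\<And>t k. norm (V' t k) \<le> B k"
    and Vs: "\<And>t. L2 (wmul (3 + s) (V t))" and Vn: "\<And>t. l2norm (wmul (3 + s) (V t)) \<le> A"
    and Vd: "\<And>t k. t \<in> {0..T} \<Longrightarrow> ((\<lambda>t. V t k) has_vector_derivative V' t k) (at t within {0..T})"
    and V'c: "\<And>k. continuous_on {0..T} (\<lambda>t. V' t k)"
    and Vdd: "AE k in lborel. \<forall>t\<in>{0..T}. ((\<lambda>t. V' t k) has_vector_derivative whitham_rhs (V t) k) (at t within {0..T})"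
begin

lemmas Vt = measurable_joint_sections(1)[OF Vm]
lemmas V't = measurable_joint_sections(1)[OF V'm]

lemma B0: "B k \<ge> 0"
  using order_trans[OF norm_ge_zero Vb] .

lemma Bs0: "L2 B" "integrable lborel B"
proof -
  have "norm (wt 1 k * B k) \<le> norm (wt (1 + s) k * B k)" for k
    using mult_right_mono[OF wt_mono[of 1 "1 + s" k] B0[of k]] s B0[of k] by (simp add: abs_mult)
  then have "L2 (\<lambda>k. wt 1 k * B k)"
    using Bm by (intro L2_mono(1)[OF Bs]) auto
  from weight_integrable[where f=B, simplified, OF this Bm] show "L2 B" "integrable lborel B" by auto
qed

text \<open>One of the \<open>3 + s\<close> powers pays for integrability, which leaves weights up
  to order \<open>2 + s\<close> on the integral of \<open>V\<close>.\<close>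

lemma V_weighted:
  assumes r: "r \<le> 2 + s"
  shows "integrable lborel (\<lambda>k. wt r k * norm (V t k))" "(LBINT k. wt r k * norm (V t k)) \<le> K0 * A"
proof -
  have [measurable]: "V t \<in> borel_measurable borel" by (rule Vt)
  have "norm (cx (wt 1 k) * wmul r (V t) k) \<le> norm (wmul (3 + s) (V t) k)" for k
    using wt_mono[of "1 + r" "3 + s" k] r mult_right_mono[of "wt (1 + r) k" "wt (3 + s) k" "norm (V t k)"]
    by (simp add: norm_mult wt_add mult.assoc)
  then have AE: "AE k in lborel. norm (cx (wt 1 k) * wmul r (V t) k) \<le> norm (wmul (3 + s) (V t) k)" by blast
  note w = L2_mono[OF Vs _ AE]
  have m: "(\<lambda>k. cx (wt 1 k) * wmul r (V t) k) \<in> borel_measurable borel" by measurable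
  note I = weight_integrable[where f="wmul r (V t)", simplified, OF w(1)[OF m]]
  show "integrable lborel (\<lambda>k. wt r k * norm (V t k))"
    using I(1) integrable_norm[of lborel "wmul r (V t)"] by (simp add: norm_mult)
  have "(LBINT k. wt r k * norm (V t k)) \<le> K0 * l2norm (\<lambda>k. cx (wt 1 k) * wmul r (V t) k)"
    using I(2) by (simp add: norm_mult)
  also have "\<dots> \<le> K0 * A" using w(2)[OF m] Vn[of t] by (intro mult_left_mono) auto
  finally show "(LBINT k. wt r k * norm (V t k)) \<le> K0 * A" .
qed

lemma V_square_integrable: "L2 (V t)"
  using weighted_facts(2)[OF Vs _ Vt] s by simp

end

text \<open>The integral equation improves its own solution. The right side of the equation is a
  version \<open>V1\<close> that is continuous in time, hence its right-hand side \<open>G1\<close>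
  is continuous too, and since \<open>G0\<close> and \<open>G1\<close> agree for almost all pairs of
  time and frequency, \<open>V1\<close> is a double time integral of a continuous function.\<close>

lemma whitham_profile:
  assumes T: "T > 0" and s: "s \<ge> 0" and U: "continuous_in_sobolev (3 + s) T U" "whitham_solution T U"
    and bound: "\<And>t. t \<in> {0..T} \<Longrightarrow> sobolev_norm (3 + s) (\<lambda>x. U x t) \<le> A" and A: "A \<ge> 0"
  shows "\<exists>V V' B. profile s T A V V' B \<and> (\<forall>t\<in>{0..T}. AE k in lborel. V t k = fourier (\<lambda>x. U x t) k)"
proof -
  obtain V0 b where Vm [measurable]: "jointly_measurable V0" and Vh: "\<And>t k. V0 t (- k) = cnj (V0 t k)"
    and Vsq: "\<And>t. L2 (wmul (3 + s) (V0 t))" "\<And>t. l2norm (wmul (3 + s) (V0 t)) \<le> A"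
    and VU: "\<And>t. t \<in> {0..T} \<Longrightarrow> AE k in lborel. V0 t k = fourier (\<lambda>x. U x t) k"
    and b [measurable]: "b \<in> borel_measurable borel" and bs: "L2 (wmul (1 + s) b)" and bh: "\<And>k. b (- k) = cnj (b k)"
    and VI: "\<And>t. t \<in> {0..T} \<Longrightarrow> AE k in lborel. V0 t k = V0 0 k + (LBINT \<tau>:{0..T}. cx (max 0 (t - \<tau>)) * whitham_rhs (V0 \<tau>) k) + cx t * b k"
    using whitham_integral_form[OF T s U bound A] by blast
  note Vt = measurable_joint_sections(1)[OF Vm]
  define G0 where "G0 = (\<lambda>t. whitham_rhs (V0 t))"
  have G0m [measurable]: "jointly_measurable G0"
    unfolding G0_def using whitham_rhs_measurable[OF Vm] by simp
  define CG where "CG = A + 2 powr (3 + s) * (2 * K0) * A\<^sup>2"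
  have CG: "CG \<ge> 0" using A by (simp add: CG_def)
  have G: "L2 (wmul (1 + s) (G0 t))" "l2norm (wmul (1 + s) (G0 t)) \<le> CG" for t
  proof -
    note B = whitham_rhs_bound[OF Vsq(1)[of t] Vt s]
    show "L2 (wmul (1 + s) (G0 t))" unfolding G0_def by (rule B)
    have "(l2norm (wmul (3 + s) (V0 t)))\<^sup>2 \<le> A\<^sup>2" using Vsq(2)[of t] by (intro power_mono) auto
    then have "2 powr (3 + s) * (2 * K0) * (l2norm (wmul (3 + s) (V0 t)))\<^sup>2 \<le> 2 powr (3 + s) * (2 * K0) * A\<^sup>2"
      by (intro mult_left_mono) auto
    then show "l2norm (wmul (1 + s) (G0 t)) \<le> CG" using B(2) Vsq(2)[of t] unfolding G0_def CG_def by linarith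
  qed
  define M where "M = (\<lambda>k. LBINT \<tau>:{0..T}. norm (G0 \<tau> k))"
  have Mm [measurable]: "M \<in> borel_measurable borel" unfolding M_def set_lebesgue_integral_def by measurable
  have M0: "M k \<ge> 0" for k unfolding M_def set_lebesgue_integral_def by (intro Bochner_Integration.integral_nonneg) auto
  have gm: "jointly_measurable (\<lambda>\<tau> k. wmul (1 + s) (G0 \<tau>) k)" by measurable
  note Mk = minkowski_time[OF gm G CG less_imp_le[OF T]]
  have Mint: "AE k in lborel. set_integrable lborel {0..T} (\<lambda>\<tau>. G0 \<tau> k)"
    using Mk(1)
  proof eventually_elim
    case (elim k)
    have "integrable lborel (\<lambda>\<tau>. cx (1 / wt (1 + s) k) * (indicator {0..T} \<tau> *\<^sub>R wmul (1 + s) (G0 \<tau>) k))"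
      using elim unfolding set_integrable_def by (rule integrable_mult_right)
    moreover have "(\<lambda>\<tau>. cx (1 / wt (1 + s) k) * (indicator {0..T} \<tau> *\<^sub>R wmul (1 + s) (G0 \<tau>) k)) = (\<lambda>\<tau>. indicator {0..T} \<tau> *\<^sub>R G0 \<tau> k)"
      by (auto simp: scaleR_conv_of_real)
    ultimately show ?case unfolding set_integrable_def by simp
  qed
  have "(\<lambda>k. LBINT \<tau>:{0..T}. norm (wmul (1 + s) (G0 \<tau>) k)) = (\<lambda>k. wt (1 + s) k * M k)"
    unfolding M_def by (auto simp: norm_mult)
  with Mk(2) have Ms: "L2 (\<lambda>k. wt (1 + s) k * M k)" by simp
  \<comment> \<open>The factor \<open>T + 1\<close> covers both uses: \<open>V\<close> needs the
    factor \<open>T\<close> on \<open>M\<close> and on \<open>b\<close>, its time derivative needs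
    the factor \<open>1\<close>.\<close>
  define B where "B = (\<lambda>k. norm (V0 0 k) + (T + 1) * M k + (T + 1) * norm (b k))"
  have Bm [measurable]: "B \<in> borel_measurable borel" unfolding B_def using Vt by measurable
  have B0: "B k \<ge> 0" for k using M0[of k] T by (simp add: B_def)
  have Bs: "L2 (\<lambda>k. wt (1 + s) k * B k)"
  proof -
    have "L2 (wmul (1 + s) (V0 0))" by (rule weight_square_integrable_mono(1)[OF Vsq(1) Vt]) simp
    then have "L2 (\<lambda>k. wt (1 + s) k * norm (V0 0 k) + (T + 1) * (wt (1 + s) k * M k) + (T + 1) * (wt (1 + s) k * norm (b k)))"
      by (intro L2_add L2_cmult L2_weighted_norm Ms bs)
    then show ?thesis by (simp add: B_def algebra_simps)
  qed
  have Bs0: "L2 B"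
    by (rule L2_mono(1)[OF Bs Bm]) (use mult_right_mono[OF wt_ge_1[of "1 + s"] B0] s B0 in \<open>auto simp: abs_mult\<close>)
  define W where "W = (\<lambda>t k. LBINT \<tau>:{0..T}. cx (max 0 (t - \<tau>)) * G0 \<tau> k)"
  have Wm [measurable]: "jointly_measurable W"
    unfolding W_def set_lebesgue_integral_def by measurable
  define V1 where "V1 = (\<lambda>t k. V0 0 k + W t k + cx t * b k)"
  have V1m [measurable]: "jointly_measurable V1"
  proof -
    have [measurable]: "V0 0 \<in> borel_measurable borel" by (rule Vt)
    show ?thesis unfolding V1_def by measurable
  qed
  note V1t = measurable_joint_sections(1)[OF V1m]
  have V01: "AE k in lborel. V0 t k = V1 t k" if "t \<in> {0..T}" for t
    using VI[OF that] by eventually_elim (simp add: V1_def W_def G0_def)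
  define G1 where "G1 = (\<lambda>t. whitham_rhs (V1 t))"
  have G1m [measurable]: "jointly_measurable G1"
    unfolding G1_def using whitham_rhs_measurable[OF V1m] by simp
  have G01: "AE k in lborel. G0 t k = G1 t k" if t: "t \<in> {0..T}" for t
  proof -
    have "conv (V0 t) (V0 t) k = conv (V1 t) (V1 t) k" for k
      by (rule conv_cong_AE[OF V01[OF t] V01[OF t] Vt Vt V1t V1t])
    then show ?thesis using V01[OF t] by (auto elim!: eventually_mono simp: G0_def G1_def whitham_rhs_def)
  qed
  \<comment> \<open>The frequencies at which the integrands may be exchanged under the time integral
    and are integrable; everything below is proved at such a frequency.\<close>
  define Q where "Q = (\<lambda>k. set_integrable lborel {0..T} (\<lambda>\<tau>. G0 \<tau> k) \<and> (AE \<tau> in lborel. \<tau> \<in> {0..T} \<longrightarrow> G0 \<tau> k = G1 \<tau> k))"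
  have Q: "AE k in lborel. Q k"
  proof -
    have "AE k in lborel. AE \<tau> in lborel. \<tau> \<in> {0..T} \<longrightarrow> G0 \<tau> k = G1 \<tau> k"
      by (rule AE_swap_time[OF G0m G1m G01]) auto
    with Mint show ?thesis unfolding Q_def by eventually_elim blast
  qed
  have kern: "norm (indicator {0..T} \<tau> *\<^sub>R (cx (max 0 (t - \<tau>)) * G0 \<tau> k)) \<le> T * norm (indicator {0..T} \<tau> *\<^sub>R G0 \<tau> k)"
    if t: "t \<in> {0..T}" for t \<tau> k
  proof (cases "\<tau> \<in> {0..T}")
    case True
    then have "\<bar>max 0 (t - \<tau>)\<bar> \<le> T" using t by auto
    then show ?thesis using True mult_right_mono[of "\<bar>max 0 (t - \<tau>)\<bar>" T "norm (G0 \<tau> k)"] by (simp add: norm_mult)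
  qed simp
  have Wc: "continuous_on {0..T} (\<lambda>t. W t k)" if q: "Q k" for k
  proof -
    have [measurable]: "(\<lambda>\<tau>. G0 \<tau> k) \<in> borel_measurable borel" by (rule measurable_joint_sections(2)[OF G0m])
    show ?thesis
      unfolding W_def set_lebesgue_integral_def
    proof (rule continuous_on_integral_dominated)
      show "integrable lborel (\<lambda>\<tau>. T * norm (indicator {0..T} \<tau> *\<^sub>R G0 \<tau> k))"
        using q unfolding Q_def set_integrable_def by (intro integrable_mult_right Bochner_Integration.integrable_norm) auto
      show "AE \<tau> in lborel. \<forall>t\<in>{0..T}. norm (indicator {0..T} \<tau> *\<^sub>R (cx (max 0 (t - \<tau>)) * G0 \<tau> k)) \<le> T * norm (indicator {0..T} \<tau> *\<^sub>R G0 \<tau> k)"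
        using kern by blast
      show "AE \<tau> in lborel. continuous_on {0..T} (\<lambda>t. indicator {0..T} \<tau> *\<^sub>R (cx (max 0 (t - \<tau>)) * G0 \<tau> k))"
        by (intro AE_I2 continuous_intros)
    qed measurable
  qed
  have Wb: "norm (W t k) \<le> T * M k" if q: "Q k" and t: "t \<in> {0..T}" for t k
  proof -
    have i: "integrable lborel (\<lambda>\<tau>. T * norm (indicator {0..T} \<tau> *\<^sub>R G0 \<tau> k))"
      using q unfolding Q_def set_integrable_def by (intro integrable_mult_right Bochner_Integration.integrable_norm) auto
    have "norm (W t k) \<le> (LBINT \<tau>. norm (indicator {0..T} \<tau> *\<^sub>R (cx (max 0 (t - \<tau>)) * G0 \<tau> k)))"
      unfolding W_def set_lebesgue_integral_def by (rule integral_norm_bound)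
    also have "\<dots> \<le> (LBINT \<tau>. T * norm (indicator {0..T} \<tau> *\<^sub>R G0 \<tau> k))"
      by (rule integral_mono'[OF i kern[OF t]]) (use T in simp)
    also have "\<dots> = T * M k" unfolding M_def set_lebesgue_integral_def by simp
    finally show ?thesis .
  qed
  have V1b: "norm (V1 t k) \<le> B k" if q: "Q k" and t: "t \<in> {0..T}" for t k
  proof -
    have "norm (V1 t k) \<le> norm (V0 0 k) + norm (W t k) + norm (cx t * b k)"
      unfolding V1_def by (intro order_trans[OF norm_triangle_ineq] add_right_mono norm_triangle_ineq)
    also have "norm (cx t * b k) \<le> (T + 1) * norm (b k)"
      unfolding norm_mult using t by (intro mult_right_mono) auto
    also have "norm (W t k) \<le> (T + 1) * M k"
      using Wb[OF q t] M0[of k] by (simp add: algebra_simps)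
    finally show ?thesis unfolding B_def by simp
  qed
  have V1c: "continuous_on {0..T} (\<lambda>t. V1 t k)" if q: "Q k" for k
    unfolding V1_def by (intro continuous_intros Wc[OF q])
  have convc: "continuous_on {0..T} (\<lambda>t. conv (V1 t) (V1 t) k)" for k
  proof (rule conv_time_continuous[OF V1t V1t _ _ _ _ Bs0 Bs0])
    show "AE l in lborel. continuous_on {0..T} (\<lambda>t. V1 t l)" using Q by eventually_elim (rule V1c)
    then show "AE l in lborel. continuous_on {0..T} (\<lambda>t. V1 t l)" .
    show "AE l in lborel. \<forall>t\<in>{0..T}. norm (V1 t l) \<le> B l" using Q by eventually_elim (use V1b in blast)
    then show "AE l in lborel. \<forall>t\<in>{0..T}. norm (V1 t l) \<le> B l" .
  qed
  have G1c: "continuous_on {0..T} (\<lambda>t. G1 t k)" if q: "Q k" for k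
    unfolding G1_def whitham_rhs_def by (intro continuous_intros V1c[OF q] convc)
  define I where "I = (\<lambda>t k. LBINT \<tau>. (if 0 \<le> \<tau> \<and> \<tau> \<le> t then G1 \<tau> k else 0))"
  have Im [measurable]: "jointly_measurable I" unfolding I_def by measurable
  have I_eq: "I t k = (LBINT \<tau>:{0..t}. G1 \<tau> k)" for t k
    unfolding I_def set_lebesgue_integral_def by (intro Bochner_Integration.integral_cong) (auto simp: indicator_def)
  have Id: "((\<lambda>t. I t k) has_vector_derivative G1 t k) (at t within {0..T})" if "Q k" "t \<in> {0..T}" for k t
    unfolding I_eq by (rule set_integral_FTC1[OF G1c[OF that(1)] that(2)])
  have Ic: "continuous_on {0..T} (\<lambda>t. I t k)" if "Q k" for k
    using Id[OF that] has_vector_derivative_continuous continuous_on_eq_continuous_within by blast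
  have W_eq: "W t k = (LBINT \<tau>:{0..t}. I \<tau> k)" if q: "Q k" and t: "t \<in> {0..T}" for t k
  proof -
    have [measurable]: "(\<lambda>\<tau>. G0 \<tau> k) \<in> borel_measurable borel" "(\<lambda>\<tau>. G1 \<tau> k) \<in> borel_measurable borel"
      by (rule measurable_joint_sections(2)[OF G0m] measurable_joint_sections(2)[OF G1m])+
    have "W t k = (LBINT \<tau>:{0..T}. cx (max 0 (t - \<tau>)) * G1 \<tau> k)"
      unfolding W_def set_lebesgue_integral_def
    proof (rule integral_cong_AE)
      have "AE \<tau> in lborel. \<tau> \<in> {0..T} \<longrightarrow> G0 \<tau> k = G1 \<tau> k" using q by (simp add: Q_def)
      then show "AE \<tau> in lborel. indicator {0..T} \<tau> *\<^sub>R (cx (max 0 (t - \<tau>)) * G0 \<tau> k) = indicator {0..T} \<tau> *\<^sub>R (cx (max 0 (t - \<tau>)) * G1 \<tau> k)"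
        by eventually_elim (auto simp: indicator_def)
    qed measurable
    also have "\<dots> = (LBINT \<tau>:{0..t}. I \<tau> k)"
      unfolding I_eq by (rule duhamel_double_integral[OF G1c[OF q] t])
    finally show ?thesis .
  qed
  have Ib: "norm (I t k) \<le> M k" if q: "Q k" and t: "t \<in> {0..T}" for t k
  proof -
    have [measurable]: "(\<lambda>\<tau>. G0 \<tau> k) \<in> borel_measurable borel" "(\<lambda>\<tau>. G1 \<tau> k) \<in> borel_measurable borel"
      by (rule measurable_joint_sections(2)[OF G0m] measurable_joint_sections(2)[OF G1m])+
    have i: "integrable lborel (\<lambda>\<tau>. norm (indicator {0..T} \<tau> *\<^sub>R G0 \<tau> k))"
      using q unfolding Q_def set_integrable_def by (intro Bochner_Integration.integrable_norm) auto
    have le: "AE \<tau> in lborel. norm (indicator {0..t} \<tau> *\<^sub>R G1 \<tau> k) \<le> norm (indicator {0..T} \<tau> *\<^sub>R G0 \<tau> k)"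
    proof -
      have "AE \<tau> in lborel. \<tau> \<in> {0..T} \<longrightarrow> G0 \<tau> k = G1 \<tau> k" using q by (simp add: Q_def)
      then show ?thesis by eventually_elim (use t in \<open>auto simp: indicator_def\<close>)
    qed
    have i': "integrable lborel (\<lambda>\<tau>. norm (indicator {0..t} \<tau> *\<^sub>R G1 \<tau> k))"
      by (rule Bochner_Integration.integrable_bound[OF i]) (use le in auto)
    have "norm (I t k) \<le> (LBINT \<tau>. norm (indicator {0..t} \<tau> *\<^sub>R G1 \<tau> k))"
      unfolding I_eq set_lebesgue_integral_def by (rule integral_norm_bound)
    also have "\<dots> \<le> (LBINT \<tau>. norm (indicator {0..T} \<tau> *\<^sub>R G0 \<tau> k))" by (rule integral_mono_AE[OF i' i le])
    also have "\<dots> = M k" unfolding M_def set_lebesgue_integral_def by simp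
    finally show ?thesis .
  qed
  have V1d: "((\<lambda>t. V1 t k) has_vector_derivative I t k + b k) (at t within {0..T})" if q: "Q k" and t: "t \<in> {0..T}" for t k
  proof (rule has_vector_derivative_transform[OF t])
    show "V1 x k = V0 0 k + (LBINT \<tau>:{0..x}. I \<tau> k) + cx x * b k" if "x \<in> {0..T}" for x
      by (simp add: V1_def W_eq[OF q that])
    have "((\<lambda>x. cx x) has_vector_derivative 1) (at t within {0..T})"
      using has_vector_derivative_of_real[of "\<lambda>x. x" 1 "at t within {0..T}"] by simp
    from has_vector_derivative_mult[OF this has_vector_derivative_const]
    have "((\<lambda>x. cx x * b k) has_vector_derivative b k) (at t within {0..T})" by simp
    from has_vector_derivative_add[OF has_vector_derivative_add[OF has_vector_derivative_const set_integral_FTC1[OF Ic[OF q] t]] this]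
    show "((\<lambda>x. V0 0 k + (LBINT \<tau>:{0..x}. I \<tau> k) + cx x * b k) has_vector_derivative I t k + b k) (at t within {0..T})" by simp
  qed
  have "AE k in lborel. Q k \<and> Q (- k)" using Q AE_lborel_minus[OF Q] by eventually_elim simp
  from AE_E[OF this] obtain N where N: "{k \<in> space lborel. \<not> (Q k \<and> Q (- k))} \<subseteq> N" "emeasure lborel N = 0" "N \<in> sets lborel" .
  have Nm [measurable]: "N \<in> sets borel" using N by simp
  \<comment> \<open>\<open>N\<close> is a Borel null set that contains every bad frequency, so its
    complement intersected with the reflected complement is Borel and symmetric. Setting
    \<open>V\<close> to zero elsewhere preserves joint measurability and the Hermitian
    symmetry.\<close>
  define good where "good = (\<lambda>k. k \<notin> N \<and> - k \<notin> N)"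
  have good_Q: "Q k" if "good k" for k using that N(1) by (auto simp: good_def)
  have good_AE: "AE k in lborel. good k"
  proof -
    have "AE k in lborel. k \<notin> N" using N by (intro AE_not_in null_setsI) auto
    then show ?thesis using AE_lborel_minus[of "\<lambda>k. k \<notin> N"] unfolding good_def by auto
  qed
  have good_m [measurable]: "Measurable.pred borel good" unfolding good_def by measurable
  define V where "V = (\<lambda>t k. if good k \<and> t \<in> {0..T} then V1 t k else 0)"
  define V' where "V' = (\<lambda>t k. if good k \<and> t \<in> {0..T} then I t k + b k else 0)"
  have VV1: "AE k in lborel. V t k = V1 t k" if "t \<in> {0..T}" for t
    using good_AE by eventually_elim (use that in \<open>simp add: V_def\<close>)
  have m1 [measurable]: "jointly_measurable V" unfolding V_def by measurable
  have m2: "jointly_measurable V'" unfolding V'_def by measurable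
  note Vmt = measurable_joint_sections(1)[OF m1]
  have G0h: "G0 \<tau> (- k) = cnj (G0 \<tau> k)" for \<tau> k
    unfolding G0_def whitham_rhs_def using conv_hermitian[of "V0 \<tau>" "V0 \<tau>" k] Vh by simp
  have Wh: "W t (- k) = cnj (W t k)" for t k
    unfolding W_def set_lebesgue_integral_def
    by (subst Bochner_Integration.integral_cnj[symmetric]) (simp add: G0h)
  have herm: "V t (- k) = cnj (V t k)" for t k
    by (auto simp: V_def good_def V1_def Vh Wh bh)
  have bd: "norm (V t k) \<le> B k" "norm (V' t k) \<le> B k" for t k
  proof -
    show "norm (V t k) \<le> B k" using V1b[OF good_Q] B0 by (auto simp: V_def)
    have "norm (I t k + b k) \<le> B k" if "good k" "t \<in> {0..T}"
    proof -
      have "norm (I t k + b k) \<le> M k + norm (b k)"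
        using norm_triangle_ineq[of "I t k" "b k"] Ib[OF good_Q[OF that(1)] that(2)] by linarith
      moreover have "M k \<le> (T + 1) * M k" using M0[of k] T by (simp add: algebra_simps)
      moreover have "norm (b k) \<le> (T + 1) * norm (b k)" using T by (simp add: algebra_simps)
      ultimately show ?thesis unfolding B_def using norm_ge_zero[of "V0 0 k"] by linarith
    qed
    then show "norm (V' t k) \<le> B k" using B0 by (auto simp: V'_def)
  qed
  have Vs: "L2 (wmul (3 + s) (V t)) \<and> l2norm (wmul (3 + s) (V t)) \<le> A" for t
  proof (cases "t \<in> {0..T}")
    case True
    have "AE k in lborel. norm (wmul (3 + s) (V t) k) \<le> norm (wmul (3 + s) (V0 t) k)"
      using VV1[OF True] V01[OF True] by eventually_elim simp
    from L2_mono[OF Vsq(1) _ this] Vmt[of t] Vsq(2)[of t] show ?thesis by auto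
  next
    case False
    then have "V t = (\<lambda>k. 0)" by (auto simp: V_def)
    then show ?thesis using A by (simp add: square_integrable_def l2norm_def)
  qed
  have d1: "((\<lambda>t. V t k) has_vector_derivative V' t k) (at t within {0..T})" if t: "t \<in> {0..T}" for t k
  proof (cases "good k")
    case True
    show ?thesis
    proof (rule has_vector_derivative_transform[OF t])
      show "((\<lambda>t. V1 t k) has_vector_derivative V' t k) (at t within {0..T})"
        using V1d[OF good_Q[OF True] t] True t by (simp add: V'_def)
    qed (simp add: V_def True)
  qed (simp add: V_def V'_def)
  have c1: "continuous_on {0..T} (\<lambda>t. V' t k)" for k
  proof (cases "good k")
    case True
    then have "continuous_on {0..T} (\<lambda>t. I t k + b k)" by (intro continuous_intros Ic good_Q)
    then show ?thesis by (rule continuous_on_eq) (simp add: V'_def True)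
  qed (simp add: V'_def)
  have d2: "AE k in lborel. \<forall>t\<in>{0..T}. ((\<lambda>t. V' t k) has_vector_derivative whitham_rhs (V t) k) (at t within {0..T})"
    using good_AE
  proof (eventually_elim, intro ballI)
    fix k t assume k: "good k" and t: "t \<in> {0..T}"
    have "conv (V t) (V t) k = conv (V1 t) (V1 t) k"
      by (rule conv_cong_AE[OF VV1[OF t] VV1[OF t] Vmt Vmt V1t V1t])
    then have e: "whitham_rhs (V t) k = G1 t k" using k t by (simp add: whitham_rhs_def G1_def V_def)
    show "((\<lambda>t. V' t k) has_vector_derivative whitham_rhs (V t) k) (at t within {0..T})"
      unfolding e
    proof (rule has_vector_derivative_transform[OF t])
      show "((\<lambda>t. I t k + b k) has_vector_derivative G1 t k) (at t within {0..T})"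
        using has_vector_derivative_add[OF Id[OF good_Q[OF k] t] has_vector_derivative_const] by simp
    qed (simp add: V'_def k)
  qed
  have VF: "AE k in lborel. V t k = fourier (\<lambda>x. U x t) k" if t: "t \<in> {0..T}" for t
    using VV1[OF t] V01[OF t] VU[OF t] by eventually_elim simp
  have "profile s T A V V' B"
  proof
    show "L2 (wmul (3 + s) (V t))" "l2norm (wmul (3 + s) (V t)) \<le> A" for t using Vs[of t] by blast+
  qed (rule s T A m1 m2 Bm Bs herm bd c1 d2 | (rule d1, assumption))+
  then show ?thesis using VF by blast
qed

section \<open>Duhamel's formula and Picard iteration\<close>

text \<open>The condition on \<open>\<tau>\<close> is placed inside the integrand, so that joint
  measurability in \<open>t\<close> and \<open>k\<close> is that of a parameter integral over the
  whole line.\<close>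

definition duhamel :: "(real \<Rightarrow> real \<Rightarrow> complex) \<Rightarrow> (real \<Rightarrow> real \<Rightarrow> complex) \<Rightarrow> real \<Rightarrow> real \<Rightarrow> complex"
  where "duhamel \<kappa> h t k = (LBINT \<tau>. (if 0 \<le> \<tau> \<and> \<tau> \<le> t then \<kappa> (t - \<tau>) k * h \<tau> k else 0))"

lemma duhamel_measurable:
  assumes [measurable]: "jointly_measurable \<kappa>" "jointly_measurable h"
  shows "jointly_measurable (duhamel \<kappa> h)"
  unfolding duhamel_def by measurable

lemma duhamel_integrable:
  assumes \<kappa>m: "jointly_measurable \<kappa>" and hm: "jointly_measurable h"
    and \<kappa>: "\<And>t k. norm (\<kappa> t k) \<le> 1" and h: "set_integrable lborel {0..t} (\<lambda>\<tau>. h \<tau> k)"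
  shows "integrable lborel (\<lambda>\<tau>. if 0 \<le> \<tau> \<and> \<tau> \<le> t then \<kappa> (t - \<tau>) k * h \<tau> k else 0)"
    "norm (duhamel \<kappa> h t k) \<le> (LBINT \<tau>:{0..t}. norm (h \<tau> k))"
proof -
  have [measurable]: "(\<lambda>t. \<kappa> t k) \<in> borel_measurable borel" "(\<lambda>t. h t k) \<in> borel_measurable borel"
    using measurable_joint_sections(2) \<kappa>m hm by auto
  have le: "norm (if 0 \<le> \<tau> \<and> \<tau> \<le> t then \<kappa> (t - \<tau>) k * h \<tau> k else 0) \<le> indicator {0..t} \<tau> *\<^sub>R norm (h \<tau> k)" for \<tau>
    using mult_right_mono[OF \<kappa>[of "t - \<tau>" k] norm_ge_zero[of "h \<tau> k"]] by (auto simp: norm_mult)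
  have i: "integrable lborel (\<lambda>\<tau>. indicator {0..t} \<tau> *\<^sub>R norm (h \<tau> k))"
    using set_integrable_norm[OF h] by (simp add: set_integrable_def)
  show I: "integrable lborel (\<lambda>\<tau>. if 0 \<le> \<tau> \<and> \<tau> \<le> t then \<kappa> (t - \<tau>) k * h \<tau> k else 0)"
    by (rule Bochner_Integration.integrable_bound[OF i]) (use le in \<open>auto intro!: AE_I2 order_trans[OF le]\<close>)
  show "norm (duhamel \<kappa> h t k) \<le> (LBINT \<tau>:{0..t}. norm (h \<tau> k))"
    unfolding duhamel_def set_lebesgue_integral_def
    by (rule order_trans[OF integral_norm_bound integral_mono[OF Bochner_Integration.integrable_norm[OF I] i le]])
qed

lemma set_integrable_Icc_mono:
  fixes f :: "real \<Rightarrow> complex"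
  assumes "set_integrable lborel {0..T} f" "t \<le> T"
  shows "set_integrable lborel {0..t} f" "(LBINT \<tau>:{0..t}. norm (f \<tau>)) \<le> (LBINT \<tau>:{0..T}. norm (f \<tau>))"
proof -
  show s: "set_integrable lborel {0..t} f" using assms by (intro set_integrable_subset[OF assms(1)]) auto
  show "(LBINT \<tau>:{0..t}. norm (f \<tau>)) \<le> (LBINT \<tau>:{0..T}. norm (f \<tau>))"
    using set_integrable_norm[OF s] set_integrable_norm[OF assms(1)] assms(2)
    unfolding set_lebesgue_integral_def set_integrable_def by (intro integral_mono) (auto simp: indicator_def)
qed

lemma duhamel_diff:
  assumes \<kappa>m: "jointly_measurable \<kappa>"
    and gm: "jointly_measurable g" and hm: "jointly_measurable h"
    and \<kappa>: "\<And>t k. norm (\<kappa> t k) \<le> 1"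
    and g: "set_integrable lborel {0..t} (\<lambda>\<tau>. g \<tau> k)" and h: "set_integrable lborel {0..t} (\<lambda>\<tau>. h \<tau> k)"
  shows "duhamel \<kappa> g t k - duhamel \<kappa> h t k = duhamel \<kappa> (\<lambda>\<tau> k. g \<tau> k - h \<tau> k) t k"
  unfolding duhamel_def
  by (subst Bochner_Integration.integral_diff[symmetric, OF duhamel_integrable(1)[OF \<kappa>m gm \<kappa> g] duhamel_integrable(1)[OF \<kappa>m hm \<kappa> h]])
     (auto intro!: Bochner_Integration.integral_cong simp: right_diff_distrib)

lemma exp_weight_integral:
  fixes lam c t :: real
  assumes "lam > 0" "t \<ge> 0"
  shows "(\<integral>\<^sup>+ \<tau>. ennreal (c\<^sup>2 * exp (2 * lam * \<tau>)) * indicator {0..t} \<tau> \<partial>lborel) \<le> ennreal (c\<^sup>2 * exp (2 * lam * t) / (2 * lam))"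
proof -
  have "(\<integral>\<^sup>+ \<tau>. ennreal (c\<^sup>2 * exp (2 * lam * \<tau>)) * indicator {0..t} \<tau> \<partial>lborel)
     = ennreal (c\<^sup>2 * exp (2 * lam * t) / (2 * lam) - c\<^sup>2 * exp (2 * lam * 0) / (2 * lam))"
    by (rule nn_integral_FTC_Icc) (use assms in \<open>auto intro!: derivative_eq_intros\<close>)
  also have "\<dots> \<le> ennreal (c\<^sup>2 * exp (2 * lam * t) / (2 * lam))" using assms by (intro ennreal_leI) auto
  finally show ?thesis .
qed

text \<open>Abstract Picard iteration in mean square. The source \<open>h\<close> is returned
  separately from \<open>p\<close>: it agrees with \<open>H\<close> along \<open>p\<close> off a
  null set of frequencies and is zero where that source fails to be integrable in time, so that
  Duhamel's formula holds at every single frequency. \<open>Hcong\<close> is assumed with equality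
  at every \<open>k\<close>, as is natural for integral operators, which do not notice null
  sets.\<close>

lemma picard:
  fixes H :: "real \<Rightarrow> (real \<Rightarrow> complex) \<Rightarrow> real \<Rightarrow> complex" and \<kappa> :: "real \<Rightarrow> real \<Rightarrow> complex"
  assumes T: "T > 0"
    and \<kappa>m [measurable]: "jointly_measurable \<kappa>" and \<kappa>: "\<And>t k. norm (\<kappa> t k) \<le> 1"
    and \<kappa>h: "\<And>t k. \<kappa> t (- k) = cnj (\<kappa> t k)"
    and Hm: "\<And>p. jointly_measurable p \<Longrightarrow> jointly_measurable (\<lambda>t. H t (p t))"
    and Hs: "\<And>t f. L2 f \<Longrightarrow> L2 (H t f)"
    and HL: "\<And>t f g. L2 f \<Longrightarrow> L2 g \<Longrightarrow> l2norm (\<lambda>k. H t f k - H t g k) \<le> L * l2norm (\<lambda>k. f k - g k)"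
    and HB: "\<And>t. l2norm (H t (\<lambda>k. 0)) \<le> A" and L: "L \<ge> 0"
    and Hcong: "\<And>t f g k. L2 f \<Longrightarrow> L2 g \<Longrightarrow> AE k in lborel. f k = g k \<Longrightarrow> H t f k = H t g k"
    and Hh: "\<And>t f k. (\<And>k. f (- k) = cnj (f k)) \<Longrightarrow> H t f (- k) = cnj (H t f k)"
  shows "\<exists>p h. jointly_measurable p \<and> jointly_measurable h \<and>
    (\<forall>t k. h t (- k) = cnj (h t k)) \<and> (\<forall>t. L2 (p t)) \<and>
    (\<forall>k. set_integrable lborel {0..T} (\<lambda>\<tau>. h \<tau> k)) \<and>
    L2 (\<lambda>k. LBINT \<tau>:{0..T}. norm (h \<tau> k)) \<and>
    (\<forall>t\<in>{0..T}. \<forall>k. p t k = duhamel \<kappa> h t k) \<and>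
    (AE k in lborel. \<forall>t\<in>{0..T}. h t k = H t (p t) k)"
proof -
  have zs: "L2 (\<lambda>k::real. 0::complex)" by (simp add: square_integrable_def)
  have A: "A \<ge> 0" using order_trans[OF l2norm_nonneg HB] .
  have Hbd: "l2norm (H t f) \<le> A + L * l2norm f" if f: "L2 f" for t f
    using L2_add(2)[OF L2_diff(1)[OF Hs[OF f, of t] Hs[OF zs, of t]] Hs[OF zs, of t]] HL[OF f zs, of t] HB[of t] by simp
  define step :: "(real \<Rightarrow> real \<Rightarrow> complex) \<Rightarrow> real \<Rightarrow> real \<Rightarrow> complex" where "step = (\<lambda>p t k. if t \<in> {0..T} then duhamel \<kappa> (\<lambda>\<tau>. H \<tau> (p \<tau>)) t k else 0)"
  define good :: "(real \<Rightarrow> real \<Rightarrow> complex) \<Rightarrow> bool" where "good = (\<lambda>p. jointly_measurable p \<and> (\<forall>t. L2 (p t)) \<and>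
     (\<exists>R\<ge>0. \<forall>t. l2norm (p t) \<le> R) \<and> (\<forall>t k. p t (- k) = cnj (p t k)))"
  have HI: "AE k in lborel. set_integrable lborel {0..T} (\<lambda>\<tau>. H \<tau> (p \<tau>) k)"
    "L2 (\<lambda>k. LBINT \<tau>:{0..T}. norm (H \<tau> (p \<tau>) k))"
    "l2norm (\<lambda>k. LBINT \<tau>:{0..T}. norm (H \<tau> (p \<tau>) k)) \<le> T * (A + L * R)" if p: "good p" "R \<ge> 0" "\<And>t. l2norm (p t) \<le> R" for p :: "real \<Rightarrow> real \<Rightarrow> complex" and R
  proof -
    have pm: "jointly_measurable p" and ps: "\<And>t. L2 (p t)"
      using p(1) by (auto simp: good_def)
    have b: "l2norm (H t (p t)) \<le> A + L * R" for t
      using Hbd[OF ps, of t t] mult_left_mono[OF p(3)[of t] L] by linarith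
    have "A + L * R \<ge> 0" using A L p(2) by simp
    note M = minkowski_time[OF Hm[OF pm] Hs[OF ps] b this less_imp_le[OF T]]
    show "AE k in lborel. set_integrable lborel {0..T} (\<lambda>\<tau>. H \<tau> (p \<tau>) k)"
      "L2 (\<lambda>k. LBINT \<tau>:{0..T}. norm (H \<tau> (p \<tau>) k))"
      "l2norm (\<lambda>k. LBINT \<tau>:{0..T}. norm (H \<tau> (p \<tau>) k)) \<le> T * (A + L * R)" using M by auto
  qed
  have duh: "jointly_measurable (duhamel \<kappa> h)"
    if "jointly_measurable h" for h
    by (rule duhamel_measurable[OF \<kappa>m that])
  have duh_h: "duhamel \<kappa> h t (- k) = cnj (duhamel \<kappa> h t k)" if "\<And>t. h t (- k) = cnj (h t k)" for h t k
    unfolding duhamel_def Bochner_Integration.integral_cnj[symmetric]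
    by (intro Bochner_Integration.integral_cong refl) (simp add: that \<kappa>h)
  have stepg: "good (step p)" if p: "good p" for p
  proof -
    have pm: "jointly_measurable p" and ph: "\<And>t k. p t (- k) = cnj (p t k)"
      using p by (auto simp: good_def)
    obtain R where R: "R \<ge> 0" "\<And>t. l2norm (p t) \<le> R" using p by (auto simp: good_def)
    note I = HI[OF p R]
    have m [measurable]: "jointly_measurable (duhamel \<kappa> (\<lambda>\<tau>. H \<tau> (p \<tau>)))"
      by (rule duh[OF Hm[OF pm]])
    have m1: "jointly_measurable (step p)" unfolding step_def by measurable
    have "AE k in lborel. norm (step p t k) \<le> norm (LBINT \<tau>:{0..T}. norm (H \<tau> (p \<tau>) k))" for t
      using I(1)
    proof eventually_elim
      case (elim k)
      show ?case
      proof (cases "t \<in> {0..T}")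
        case True
        then have t: "t \<le> T" by simp
        note si = set_integrable_Icc_mono[OF elim t]
        from duhamel_integrable(2)[OF \<kappa>m Hm[OF pm] \<kappa> si(1)] si(2) show ?thesis using True by (simp add: step_def)
      qed (auto simp: step_def)
    qed
    from L2_mono[OF I(2) measurable_joint_sections(1)[OF m1] this]
    have s: "L2 (step p t)" "l2norm (step p t) \<le> T * (A + L * R)" for t using I(3) order_trans by blast+
    have "H t (p t) (- k) = cnj (H t (p t) k)" for t k by (rule Hh) (rule ph)
    then have "step p t (- k) = cnj (step p t k)" for t k
      using duh_h[of "\<lambda>\<tau>. H \<tau> (p \<tau>)", where t=t and k=k] by (simp add: step_def)
    then show ?thesis unfolding good_def using m1 s T A L R(1) by (auto intro!: exI[of _ "T * (A + L * R)"])
  qed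
  define it where "it = (\<lambda>n. (step ^^ n) (\<lambda>t k. 0))"
  have it0: "it 0 = (\<lambda>t k. 0)" and itS: "it (Suc n) = step (it n)" for n by (auto simp: it_def)
  have itg: "good (it n)" for n
  proof (induction n)
    case 0
    then show ?case unfolding it0 good_def by (auto simp: square_integrable_def l2norm_def)
  next
    case (Suc n)
    then show ?case unfolding itS by (rule stepg)
  qed
  have itm [measurable]: "jointly_measurable (it n)" and its: "L2 (it n t)" for n t
    using itg[of n] by (auto simp: good_def)
  \<comment> \<open>In the norm weighted by \<open>exp (lam * t)\<close> each step gains the factor
    \<open>1 / 2\<close>: the time integral of the squared weight produces
    \<open>T * L\<^sup>2 / (2 * lam)\<close>, which has to be at most \<open>1 / 4\<close>.\<close>
  define lam where "lam = 2 * T * L\<^sup>2 + 1"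
  have lam: "lam > 0" using T by (simp add: lam_def add_nonneg_pos)
  define C0 where "C0 = T * A"
  have C0: "C0 \<ge> 0" using T A by (simp add: C0_def)
  have cstep: "l2norm (\<lambda>k. step p t k - step q t k) \<le> c * exp (lam * t) / 2"
    if p: "good p" and q: "good q" and t: "t \<in> {0..T}" and c: "c \<ge> 0"
      and b: "\<And>\<tau>. \<tau> \<in> {0..T} \<Longrightarrow> l2norm (\<lambda>k. p \<tau> k - q \<tau> k) \<le> c * exp (lam * \<tau>)" for p q :: "real \<Rightarrow> real \<Rightarrow> complex" and t c
  proof -
    have pm: "jointly_measurable p" and ps: "\<And>t. L2 (p t)"
      and qm: "jointly_measurable q" and qs: "\<And>t. L2 (q t)"
      using p q by (auto simp: good_def)
    obtain R where R: "R \<ge> 0" "\<And>t. l2norm (p t) \<le> R" using p by (auto simp: good_def)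
    obtain R' where R': "R' \<ge> 0" "\<And>t. l2norm (q t) \<le> R'" using q by (auto simp: good_def)
    define g where "g = (\<lambda>\<tau> k. H \<tau> (p \<tau>) k - H \<tau> (q \<tau>) k)"
    have [measurable]: "jointly_measurable (\<lambda>t. H t (p t))" "jointly_measurable (\<lambda>t. H t (q t))"
      by (rule Hm[OF pm] Hm[OF qm])+
    have gm: "jointly_measurable g" unfolding g_def by measurable
    have gs: "L2 (g \<tau>)" for \<tau> unfolding g_def by (intro L2_diff Hs ps qs)
    have t0: "t \<ge> 0" "t \<le> T" using t by auto
    have g2: "(l2norm (g \<tau>))\<^sup>2 \<le> (L * c)\<^sup>2 * exp (2 * lam * \<tau>)" if "\<tau> \<in> {0..t}" for \<tau>
    proof -
      have "l2norm (g \<tau>) \<le> L * l2norm (\<lambda>k. p \<tau> k - q \<tau> k)" unfolding g_def by (rule HL[OF ps qs])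
      also have "\<dots> \<le> L * (c * exp (lam * \<tau>))" using that t0 by (intro mult_left_mono b L) auto
      finally have "(l2norm (g \<tau>))\<^sup>2 \<le> (L * (c * exp (lam * \<tau>)))\<^sup>2" by (intro power_mono) auto
      also have "\<dots> = (L * c)\<^sup>2 * exp (2 * lam * \<tau>)"
        by (simp add: power_mult_distrib mult.assoc exp_double[symmetric] flip: exp_of_nat_mult)
      finally show ?thesis .
    qed
    have G0: "(L * c)\<^sup>2 * exp (2 * lam * t) / (2 * lam) \<ge> 0" using lam by simp
    note M0 = minkowski_time_gen[OF gm gs g2 exp_weight_integral[OF lam t0(1)] G0 t0(1)]
    have M: "AE k in lborel. set_integrable lborel {0..t} (\<lambda>\<tau>. g \<tau> k)"
      "L2 (\<lambda>k. LBINT \<tau>:{0..t}. norm (g \<tau> k))"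
      "l2norm (\<lambda>k. LBINT \<tau>:{0..t}. norm (g \<tau> k)) \<le> sqrt (t * ((L * c)\<^sup>2 * exp (2 * lam * t) / (2 * lam)))"
      using M0 by blast+
    have sm: "(\<lambda>k. step p t k - step q t k) \<in> borel_measurable borel"
      using stepg[OF p] stepg[OF q] by (auto simp: good_def)
    have "AE k in lborel. norm (step p t k - step q t k) \<le> norm (LBINT \<tau>:{0..t}. norm (g \<tau> k))"
      using HI(1)[OF p R] HI(1)[OF q R'] M(1)
    proof eventually_elim
      case (elim k)
      have "step p t k - step q t k = duhamel \<kappa> g t k"
        using duhamel_diff[OF \<kappa>m Hm[OF pm] Hm[OF qm] \<kappa> set_integrable_Icc_mono(1)[OF elim(1) t0(2)] set_integrable_Icc_mono(1)[OF elim(2) t0(2)]] t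
        by (simp add: step_def g_def)
      then show ?case using duhamel_integrable(2)[OF \<kappa>m gm \<kappa> elim(3)] by simp
    qed
    from L2_mono(2)[OF M(2) sm this]
    have "l2norm (\<lambda>k. step p t k - step q t k) \<le> sqrt (t * ((L * c)\<^sup>2 * exp (2 * lam * t) / (2 * lam)))" using M(3) by linarith
    also have "\<dots> \<le> sqrt ((c * exp (lam * t) / 2)\<^sup>2)"
    proof (rule real_sqrt_le_mono)
      have e: "(c * exp (lam * t) / 2)\<^sup>2 = c\<^sup>2 * exp (2 * lam * t) / 4"
        by (simp add: power_mult_distrib power_divide mult.assoc exp_double[symmetric] flip: exp_of_nat_mult)
      have "t * L\<^sup>2 / (2 * lam) \<le> 1 / 4"
      proof -
        have "t * L\<^sup>2 \<le> T * L\<^sup>2" using t0 by (intro mult_right_mono) auto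
        then show ?thesis using lam by (simp add: divide_le_eq lam_def)
      qed
      then have "(t * L\<^sup>2 / (2 * lam)) * (c\<^sup>2 * exp (2 * lam * t)) \<le> 1 / 4 * (c\<^sup>2 * exp (2 * lam * t))" by (intro mult_right_mono) auto
      then show "t * ((L * c)\<^sup>2 * exp (2 * lam * t) / (2 * lam)) \<le> (c * exp (lam * t) / 2)\<^sup>2"
        unfolding e by (simp add: power_mult_distrib mult_ac)
    qed
    finally show ?thesis using c by simp
  qed
  have D: "l2norm (\<lambda>k. it (Suc n) t k - it n t k) \<le> C0 * (1/2)^n * exp (lam * t)" if t: "t \<in> {0..T}" for n t
    using t
  proof (induction n arbitrary: t)
    case 0
    have "l2norm (it 1 t) \<le> T * (A + L * 0)"
    proof -
      have z: "l2norm (it 0 t) \<le> 0" for t by (simp add: it0 l2norm_def)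
      note I = HI[OF itg[of 0] order_refl z]
      have m: "it 1 t \<in> borel_measurable borel" using its[of 1 t] by auto
      have "AE k in lborel. norm (it 1 t k) \<le> norm (LBINT \<tau>:{0..T}. norm (H \<tau> (it 0 \<tau>) k))"
        using I(1)
      proof eventually_elim
        case (elim k)
        have t': "t \<le> T" using 0 by simp
        note si = set_integrable_Icc_mono[OF elim t']
        from duhamel_integrable(2)[OF \<kappa>m Hm[OF itm] \<kappa> si(1)] si(2) show ?case using 0 itS[of 0] by (simp add: step_def)
      qed
      from L2_mono(2)[OF I(2) m this] I(3) show ?thesis by linarith
    qed
    moreover have "C0 * 1 \<le> C0 * exp (lam * t)" using 0 lam C0 by (intro mult_left_mono) auto
    ultimately show ?case by (simp add: it0 C0_def)
  next
    case (Suc n)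
    have "l2norm (\<lambda>k. step (it (Suc n)) t k - step (it n) t k) \<le> C0 * (1/2)^n * exp (lam * t) / 2"
      by (rule cstep[OF itg itg Suc(2)]) (use Suc C0 in auto)
    then show ?case unfolding itS[of "Suc n"] itS[of n, symmetric] by simp
  qed
  define C where "C = C0 * exp (lam * T)"
  have C: "C \<ge> 0" using C0 by (simp add: C_def)
  have D': "l2norm (\<lambda>k. it (Suc n) t k - it n t k) \<le> C * (1/2)^n" if t: "t \<in> {0..T}" for n t
  proof -
    have "C0 * (1/2)^n * exp (lam * t) \<le> C0 * (1/2)^n * exp (lam * T)" using t lam C0 by (intro mult_left_mono) auto
    then show ?thesis using D[OF t, of n] by (simp add: C_def mult_ac)
  qed
  have tele: "l2norm (\<lambda>k. it n t k - it (n + j) t k) \<le> 2 * C * (1/2)^n - 2 * C * (1/2)^(n + j)" if t: "t \<in> {0..T}" for n j t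
  proof (induction j)
    case 0
    then show ?case by (simp add: l2norm_def)
  next
    case (Suc j)
    have "l2norm (\<lambda>k. it n t k - it (n + Suc j) t k) \<le> l2norm (\<lambda>k. it n t k - it (n + j) t k) + l2norm (\<lambda>k. it (n + j) t k - it (n + Suc j) t k)"
      by (rule l2norm_triangle[OF its its its])
    also have "l2norm (\<lambda>k. it (n + j) t k - it (n + Suc j) t k) \<le> C * (1/2)^(n + j)"
      using D'[OF t, of "n + j"] by (simp add: l2norm_minus_commute[of "it (n + j) t"])
    finally show ?case using Suc by (simp add: algebra_simps)
  qed
  define p where "p = (\<lambda>t k. if t \<in> {0..T} then lim (\<lambda>n. it n t k) else 0)"
  have pm [measurable]: "jointly_measurable p"
  proof -
    have [measurable]: "(\<lambda>x. lim (\<lambda>n. it n (fst x) (snd x))) \<in> borel_measurable (borel \<Otimes>\<^sub>M borel)"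
      by (rule borel_measurable_lim_metric) (use itm in \<open>simp add: case_prod_unfold\<close>)
    show ?thesis unfolding p_def case_prod_unfold by measurable
  qed
  note pt = measurable_joint_sections(1)[OF pm]
  have pconv: "AE k in lborel. (\<lambda>j. it j t k) \<longlonglongrightarrow> p t k" if t: "t \<in> {0..T}" for t
  proof -
    have ds: "L2 (\<lambda>k. it (Suc j) t k - it j t k)" for j by (intro L2_diff its)
    show ?thesis
      using geometric_l2_summable(1)[OF ds D'[OF t] C]
    proof eventually_elim
      case (elim k)
      then have "summable (\<lambda>j. it (Suc j) t k - it j t k)" by (rule summable_norm_cancel)
      then have "convergent (\<lambda>n. \<Sum>j<n. it (Suc j) t k - it j t k)" by (simp add: summable_iff_convergent)
      moreover have "(\<Sum>j<n. it (Suc j) t k - it j t k) = it n t k" for n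
        by (induction n) (auto simp: it0)
      ultimately show ?case using t by (simp add: p_def convergent_LIMSEQ_iff)
    qed
  qed
  have plim: "L2 (\<lambda>k. it n t k - p t k) \<and> l2norm (\<lambda>k. it n t k - p t k) \<le> 2 * C * (1/2)^n" if t: "t \<in> {0..T}" for n t
  proof -
    note AE = pconv[OF t]
    have c: "l2norm (\<lambda>k. it n t k - it i t k) \<le> 2 * C * (1/2)^n" if "i \<ge> n" for i
    proof -
      have "2 * C * (1/2)^(n + (i - n)) \<ge> 0" using C by simp
      then show ?thesis using tele[OF t, of n "i - n"] that by simp
    qed
    have "2 * C * (1/2)^n \<ge> 0" using C by simp
    from l2norm_AE_limit[of "\<lambda>n. it n t", OF its pt AE c this] show ?thesis by blast
  qed
  have ps: "L2 (p t)" for t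
  proof (cases "t \<in> {0..T}")
    case True
    from L2_diff(1)[OF its[of 0 t] conjunct1[OF plim[OF True, of 0]]] show ?thesis by simp
  qed (use zs in \<open>auto simp: p_def\<close>)
  have pb: "l2norm (p t) \<le> 2 * C" for t
  proof (cases "t \<in> {0..T}")
    case True
    have "l2norm (p t) = l2norm (\<lambda>k. it 0 t k - p t k)" by (simp add: it0 l2norm_def)
    then show ?thesis using plim[OF True, of 0] by simp
  next
    case False
    then show ?thesis using C by (auto simp: p_def l2norm_def)
  qed
  \<comment> \<open>The pointwise limit is Hermitian only almost everywhere; symmetrization repairs
    this at every frequency and every time.\<close>
  define p2 where "p2 = (\<lambda>t k. (p t k + cnj (p t (- k))) / 2)"
  have p2m: "jointly_measurable p2" unfolding p2_def by measurable
  note p2t = measurable_joint_sections(1)[OF p2m]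
  have ith: "it n t (- k) = cnj (it n t k)" for n t k using itg[of n] by (simp add: good_def)
  have p2p: "AE k in lborel. p2 t k = p t k" for t
  proof (cases "t \<in> {0..T}")
    case True
    show ?thesis using pconv[OF True] AE_lborel_minus[OF pconv[OF True]]
    proof eventually_elim
      case (elim k)
      have "(\<lambda>j. it j t (- k)) \<longlonglongrightarrow> cnj (p t k)" unfolding ith by (intro tendsto_intros elim)
      then have "p t (- k) = cnj (p t k)" using elim(2) LIMSEQ_unique by blast
      then show ?case by (simp add: p2_def)
    qed
  qed (auto simp: p2_def p_def)
  have p2s: "L2 (p2 t)" "l2norm (p2 t) \<le> 2 * C" for t
  proof -
    have "AE k in lborel. norm (p2 t k) \<le> norm (p t k)" using p2p[of t] by eventually_elim simp
    from L2_mono[OF ps p2t this] show "L2 (p2 t)" "l2norm (p2 t) \<le> 2 * C"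
      using pb[of t] by auto
  qed
  have p2h: "p2 t (- k) = cnj (p2 t k)" for t k by (simp add: p2_def)
  have p2g: "good p2" unfolding good_def using p2m p2s p2h C by (auto intro!: exI[of _ "2 * C"])
  have C2: "2 * C \<ge> 0" using C by simp
  note HpI = HI[OF p2g C2 p2s(2)]
  have H2m [measurable]: "jointly_measurable (\<lambda>t. H t (p2 t))" by (rule Hm[OF p2m])
  have H2h: "H t (p2 t) (- k) = cnj (H t (p2 t) k)" for t k by (rule Hh) (rule p2h)
  \<comment> \<open>Frequencies with an integrable source, expressed by a nonnegative integral so
    that the set is visibly Borel. It is symmetric because the source is Hermitian.\<close>
  define gk where "gk = (\<lambda>k. (\<integral>\<^sup>+ \<tau>. ennreal (norm (indicator {0..T} \<tau> *\<^sub>R H \<tau> (p2 \<tau>) k)) \<partial>lborel) < \<infinity>)"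
  have gk_m [measurable]: "Measurable.pred borel gk" unfolding gk_def by measurable
  have gk_iff: "gk k \<longleftrightarrow> set_integrable lborel {0..T} (\<lambda>\<tau>. H \<tau> (p2 \<tau>) k)" for k
    using measurable_joint_sections(2)[OF H2m, of k] unfolding gk_def set_integrable_def integrable_iff_bounded by simp
  have gk_minus: "gk (- k) = gk k" for k unfolding gk_def by (simp add: H2h)
  have gk_AE: "AE k in lborel. gk k" using HpI(1) unfolding gk_iff .
  define h where "h = (\<lambda>t k. if gk k \<and> t \<in> {0..T} then H t (p2 t) k else 0)"
  have hm [measurable]: "jointly_measurable h" unfolding h_def by measurable
  have hh: "h t (- k) = cnj (h t k)" for t k by (simp add: h_def gk_minus H2h)
  have hi: "set_integrable lborel {0..T} (\<lambda>\<tau>. h \<tau> k)" for k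
  proof (cases "gk k")
    case True
    then have "(\<lambda>\<tau>. indicator {0..T} \<tau> *\<^sub>R h \<tau> k) = (\<lambda>\<tau>. indicator {0..T} \<tau> *\<^sub>R H \<tau> (p2 \<tau>) k)"
      by (auto simp: h_def indicator_def)
    then show ?thesis using True unfolding gk_iff set_integrable_def by simp
  qed (simp add: h_def set_integrable_def)
  have hb: "L2 (\<lambda>k. LBINT \<tau>:{0..T}. norm (h \<tau> k))"
  proof (rule L2_mono(1)[OF HpI(2)])
    show "(\<lambda>k. LBINT \<tau>:{0..T}. norm (h \<tau> k)) \<in> borel_measurable borel"
      unfolding set_lebesgue_integral_def by measurable
    show "AE k in lborel. norm (LBINT \<tau>:{0..T}. norm (h \<tau> k)) \<le> norm (LBINT \<tau>:{0..T}. norm (H \<tau> (p2 \<tau>) k))"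
      using gk_AE
    proof eventually_elim
      case (elim k)
      have "(LBINT \<tau>:{0..T}. norm (h \<tau> k)) = (LBINT \<tau>:{0..T}. norm (H \<tau> (p2 \<tau>) k))"
        using elim unfolding set_lebesgue_integral_def by (intro Bochner_Integration.integral_cong refl) (auto simp: h_def indicator_def)
      then show ?case by simp
    qed
  qed
  define P where "P = (\<lambda>t k. if t \<in> {0..T} then duhamel \<kappa> h t k else 0)"
  have [measurable]: "jointly_measurable (duhamel \<kappa> h)" by (rule duh[OF hm])
  have Pm: "jointly_measurable P" unfolding P_def by measurable
  have Ps: "L2 (P t)" for t
  proof (rule L2_mono(1)[OF hb measurable_joint_sections(1)[OF Pm]])
    have "norm (P t k) \<le> norm (LBINT \<tau>:{0..T}. norm (h \<tau> k))" for k
    proof (cases "t \<in> {0..T}")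
      case True
      then have t: "t \<le> T" by simp
      note si = set_integrable_Icc_mono[OF hi t]
      from duhamel_integrable(2)[OF \<kappa>m hm \<kappa> si(1), of k] si(2)[of k] show ?thesis using True by (simp add: P_def)
    qed (auto simp: P_def)
    then show "AE k in lborel. norm (P t k) \<le> norm (LBINT \<tau>:{0..T}. norm (h \<tau> k))" by blast
  qed
  have Pstep: "AE k in lborel. P t k = step p2 t k" for t
    using gk_AE
  proof eventually_elim
    case (elim k)
    have "duhamel \<kappa> h t k = duhamel \<kappa> (\<lambda>\<tau>. H \<tau> (p2 \<tau>)) t k" if "t \<le> T"
      unfolding duhamel_def using elim that by (intro Bochner_Integration.integral_cong refl) (auto simp: h_def)
    then show ?case by (simp add: P_def step_def)
  qed
  have fixp: "AE k in lborel. P t k = p2 t k" if t: "t \<in> {0..T}" for t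
  proof -
    have s1: "L2 (step p2 t)" using stepg[OF p2g] by (auto simp: good_def)
    have close: "l2norm (\<lambda>k. it n \<tau> k - p2 \<tau> k) \<le> 2 * C * (1/2)^n" if "\<tau> \<in> {0..T}" for n \<tau>
    proof -
      have "l2norm (\<lambda>k. it n \<tau> k - p2 \<tau> k) = l2norm (\<lambda>k. it n \<tau> k - p \<tau> k)"
        by (rule l2norm_cong_AE) (use p2p[of \<tau>] its p2s ps in \<open>auto intro!: L2_measurable L2_diff\<close>)
      then show ?thesis using plim[OF that, of n] by simp
    qed
    have bound: "l2norm (\<lambda>k. step p2 t k - p2 t k) \<le> (C * exp (lam * T) + C) * (1/2)^n" for n
    proof -
      have c0: "2 * C * (1/2)^n \<ge> 0" using C by simp
      have b: "l2norm (\<lambda>k. it n \<tau> k - p2 \<tau> k) \<le> 2 * C * (1/2)^n * exp (lam * \<tau>)" if "\<tau> \<in> {0..T}" for \<tau>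
        using close[OF that, of n] mult_left_mono[OF _ c0, of 1 "exp (lam * \<tau>)"] that lam by simp
      have 1: "l2norm (\<lambda>k. it (Suc n) t k - step p2 t k) \<le> 2 * C * (1/2)^n * exp (lam * t) / 2"
        unfolding itS by (rule cstep[OF itg p2g t c0 b])
      also have "\<dots> \<le> 2 * C * (1/2)^n * exp (lam * T) / 2" using t lam c0 by (intro divide_right_mono mult_left_mono) auto
      finally have 1: "l2norm (\<lambda>k. step p2 t k - it (Suc n) t k) \<le> C * exp (lam * T) * (1/2)^n"
        by (simp add: mult_ac l2norm_minus_commute[of "step p2 t"])
      have "l2norm (\<lambda>k. step p2 t k - p2 t k) \<le> l2norm (\<lambda>k. step p2 t k - it (Suc n) t k) + l2norm (\<lambda>k. it (Suc n) t k - p2 t k)"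
        by (rule l2norm_triangle[OF s1 its p2s(1)])
      also have "\<dots> \<le> C * exp (lam * T) * (1/2)^n + C * (1/2)^n" using 1 close[OF t, of "Suc n"] by simp
      finally show ?thesis by (simp add: algebra_simps)
    qed
    have "(\<lambda>n. (C * exp (lam * T) + C) * (1/2::real)^n) \<longlonglongrightarrow> (C * exp (lam * T) + C) * 0"
      by (intro tendsto_mult_left LIMSEQ_realpow_zero) auto
    then have "l2norm (\<lambda>k. step p2 t k - p2 t k) \<le> (C * exp (lam * T) + C) * 0"
      by (rule LIMSEQ_le_const) (use bound in auto)
    then have "l2norm (\<lambda>k. step p2 t k - p2 t k) = 0" using l2norm_nonneg[of "\<lambda>k. step p2 t k - p2 t k"] by simp
    then have "AE k in lborel. step p2 t k - p2 t k = 0"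
      using l2norm_zero_iff[OF L2_diff(1)[OF s1 p2s(1)]] by simp
    then show ?thesis using Pstep[of t] by eventually_elim simp
  qed
  have hH: "AE k in lborel. \<forall>t\<in>{0..T}. h t k = H t (P t) k"
    using gk_AE
  proof (eventually_elim, intro ballI)
    fix k t assume k: "gk k" and t: "t \<in> {0..T}"
    have "H t (P t) k = H t (p2 t) k" by (rule Hcong[OF Ps p2s(1) fixp[OF t]])
    then show "h t k = H t (P t) k" using k t by (simp add: h_def)
  qed
  show ?thesis
    by (rule exI[of _ P], rule exI[of _ h]) (use Pm hm hh Ps hi hb hH in \<open>auto simp: P_def\<close>)
qed

section \<open>The equation for the error\<close>

text \<open>Peetre's inequality. Unlike the bound by a sum of weights, this product form moves the
  whole weight onto the two factors at once; it is used when one factor, the profile, has regularity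
  to spare.\<close>

lemma wt_submult:
  assumes r: "r \<ge> 0"
  shows "wt r (a + b) \<le> 2 powr (r / 2) * (wt r a * wt r b)"
proof -
  have "1 + (a + b)\<^sup>2 \<le> 2 * ((1 + a\<^sup>2) + (1 + b\<^sup>2)) - 2"
    using sum_squares_bound[of a b] by (simp add: power2_sum)
  also have "\<dots> \<le> 2 * ((1 + a\<^sup>2) * (1 + b\<^sup>2))" by (simp add: algebra_simps)
  finally have "wt r (a + b) \<le> (2 * ((1 + a\<^sup>2) * (1 + b\<^sup>2))) powr (r / 2)"
    unfolding wt_def using r by (intro powr_mono2) (auto simp: add_nonneg_nonneg)
  also have "\<dots> = 2 powr (r / 2) * (wt r a * wt r b)"
    unfolding wt_def using one_plus_square_pos[of a] one_plus_square_pos[of b] by (simp add: powr_mult)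
  finally show ?thesis .
qed

lemma wt_scale_le:
  assumes e: "0 \<le> e" "e \<le> 1" and r: "r \<ge> 0"
  shows "wt r (e * k) \<le> wt r k"
proof -
  have "(e * k)\<^sup>2 \<le> 1 * k\<^sup>2" unfolding power_mult_distrib using e by (intro mult_right_mono) (auto simp: power_le_one)
  then show ?thesis unfolding wt_def using r by (intro powr_mono2) (auto simp: add_nonneg_nonneg)
qed

lemma abs_le_wt_scaled:
  assumes e: "e > 0"
  shows "\<bar>k\<bar> \<le> wt 1 (e * k) / e"
  using abs_le_wt_1[of "e * k"] e by (simp add: abs_mult le_divide_eq mult.commute)

lemma conv_diff:
  assumes f: "L2 f" and f': "L2 f'" and g: "L2 g" and g': "L2 g'"
  shows "conv f g k - conv f' g' k = conv f (\<lambda>l. g l - g' l) k + conv (\<lambda>l. f l - f' l) g' k"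
proof -
  note I = conv_bound(1)[OF f g, of k] conv_bound(1)[OF f g', of k] conv_bound(1)[OF f' g', of k]
  have "conv f (\<lambda>l. g l - g' l) k = conv f g k - conv f g' k"
    unfolding conv_def using I by (simp add: right_diff_distrib)
  moreover have "conv (\<lambda>l. f l - f' l) g' k = conv f g' k - conv f' g' k"
    unfolding conv_def using I by (simp add: left_diff_distrib)
  ultimately show ?thesis by simp
qed

text \<open>The radial retraction onto the ball of radius \<open>\<rho>\<close>, the identity
  inside.\<close>

definition ret :: "real \<Rightarrow> (real \<Rightarrow> complex) \<Rightarrow> real \<Rightarrow> complex"
  where "ret \<rho> f k = cx (1 / max 1 (l2norm f / \<rho>)) * f k"

lemma ret_props:
  assumes \<rho>: "\<rho> > 0" and f: "L2 f"
  shows "L2 (ret \<rho> f)" "l2norm (ret \<rho> f) \<le> \<rho>" "l2norm (ret \<rho> f) \<le> l2norm f"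
    "l2norm f \<le> \<rho> \<Longrightarrow> ret \<rho> f = f"
proof -
  define m where "m = max 1 (l2norm f / \<rho>)"
  have m: "m \<ge> 1" "m * \<rho> \<ge> l2norm f" using \<rho> by (auto simp: m_def le_max_iff_disj max_def field_simps)
  have S: "L2 (ret \<rho> f)" "l2norm (ret \<rho> f) = l2norm f / m"
    unfolding ret_def[abs_def] m_def[symmetric] using L2_cmult[OF f, of "cx (1 / m)"] m(1)
    by (auto simp: norm_divide)
  show "L2 (ret \<rho> f)" by (rule S)
  show "l2norm (ret \<rho> f) \<le> \<rho>" unfolding S(2) using m by (simp add: divide_le_eq mult.commute)
  have "l2norm f * 1 \<le> l2norm f * m" by (intro mult_left_mono m) auto
  then show "l2norm (ret \<rho> f) \<le> l2norm f" unfolding S(2) using m(1) by (simp add: divide_le_eq)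
  show "ret \<rho> f = f" if "l2norm f \<le> \<rho>"
  proof -
    have "l2norm f / \<rho> \<le> 1" using that \<rho> by simp
    then show ?thesis unfolding ret_def[abs_def] by (simp add: max_absorb1)
  qed
qed

lemma ret_factor_lipschitz:
  fixes a b :: real
  assumes \<rho>: "\<rho> > 0" and a: "a \<ge> 0" and b: "b \<ge> 0"
  shows "\<bar>1 / max 1 (a / \<rho>) - 1 / max 1 (b / \<rho>)\<bar> * b \<le> \<bar>a - b\<bar>"
proof -
  consider "a \<le> \<rho>" "b \<le> \<rho>" | "a \<le> \<rho>" "b > \<rho>" | "a > \<rho>" "b \<le> \<rho>" | "a > \<rho>" "b > \<rho>" by linarith
  then show ?thesis
  proof cases
    case 1
    then have "a / \<rho> \<le> 1" "b / \<rho> \<le> 1" using \<rho> by auto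
    then show ?thesis by (simp add: max_absorb1)
  next
    case 2
    then have "a / \<rho> \<le> 1" "b / \<rho> > 1" using \<rho> by auto
    then have "\<bar>1 / max 1 (a / \<rho>) - 1 / max 1 (b / \<rho>)\<bar> * b = (1 - \<rho> / b) * b"
      using 2 \<rho> by (simp add: max_def abs_if)
    also have "\<dots> = b - \<rho>" using 2 \<rho> by (simp add: field_simps)
    finally show ?thesis using 2 by simp
  next
    case 3
    then have "a / \<rho> > 1" "b / \<rho> \<le> 1" using \<rho> by auto
    then have "\<bar>1 / max 1 (a / \<rho>) - 1 / max 1 (b / \<rho>)\<bar> * b = (1 - \<rho> / a) * b"
      using 3 \<rho> by (simp add: max_def abs_if)
    also have "\<dots> \<le> (1 - \<rho> / a) * a" using 3 \<rho> by (intro mult_left_mono) auto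
    also have "\<dots> = a - \<rho>" using 3 \<rho> by (simp add: field_simps)
    finally show ?thesis using 3 by simp
  next
    case 4
    then have "a / \<rho> > 1" "b / \<rho> > 1" using \<rho> by auto
    then have "\<bar>1 / max 1 (a / \<rho>) - 1 / max 1 (b / \<rho>)\<bar> * b = \<bar>\<rho> / a - \<rho> / b\<bar> * b"
      by (simp add: max_def)
    also have "\<dots> = \<rho> / a * \<bar>b - a\<bar>"
    proof -
      have "\<rho> / a - \<rho> / b = \<rho> / a * (b - a) / b" using 4 \<rho> by (simp add: field_simps)
      then show ?thesis using 4 \<rho> by (simp add: abs_mult abs_divide)
    qed
    also have "\<dots> \<le> 1 * \<bar>b - a\<bar>" using 4 \<rho> by (intro mult_right_mono) auto
    finally show ?thesis by (simp add: abs_minus_commute)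
  qed
qed

text \<open>One copy of the distance comes from scaling the difference of the functions, the other
  from the change of the scaling factor.\<close>

lemma ret_lipschitz:
  assumes \<rho>: "\<rho> > 0" and f: "L2 f" and g: "L2 g"
  shows "l2norm (\<lambda>k. ret \<rho> f k - ret \<rho> g k) \<le> 2 * l2norm (\<lambda>k. f k - g k)"
proof -
  define x y where "x = 1 / max 1 (l2norm f / \<rho>)" and "y = 1 / max 1 (l2norm g / \<rho>)"
  have x: "0 \<le> x" "x \<le> 1" by (auto simp: x_def)
  note d = L2_diff(1)[OF f g]
  note c1 = L2_cmult[OF d, of "cx x"] and c2 = L2_cmult[OF g, of "cx (x - y)"]
  have "(\<lambda>k. ret \<rho> f k - ret \<rho> g k) = (\<lambda>k. cx x * (f k - g k) + cx (x - y) * g k)"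
    unfolding ret_def x_def[symmetric] y_def[symmetric] by (simp add: algebra_simps)
  then have "l2norm (\<lambda>k. ret \<rho> f k - ret \<rho> g k) \<le> norm (cx x) * l2norm (\<lambda>k. f k - g k) + norm (cx (x - y)) * l2norm g"
    using L2_add(2)[OF c1(1) c2(1)] unfolding c1(2) c2(2) by simp
  also have "norm (cx x) * l2norm (\<lambda>k. f k - g k) \<le> 1 * l2norm (\<lambda>k. f k - g k)"
    using x by (intro mult_right_mono) auto
  also have "norm (cx (x - y)) * l2norm g \<le> l2norm (\<lambda>k. f k - g k)"
    using ret_factor_lipschitz[OF \<rho> l2norm_nonneg[of f] l2norm_nonneg[of g]] l2norm_diff_abs[OF f g]
    unfolding norm_of_real x_def y_def by linarith
  finally show ?thesis by simp
qed

locale error_problem = profile +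
  fixes eps \<rho> :: real
  assumes eps: "eps > 0" "eps \<le> 1" and \<rho>: "\<rho> > 0"
begin

abbreviation W :: "real \<Rightarrow> real" where "W k \<equiv> wt (1 + s) (eps * k)"

text \<open>Removes the weight: the transform of the unweighted error on the slow scale.\<close>

definition PW :: "(real \<Rightarrow> complex) \<Rightarrow> real \<Rightarrow> complex"
  where "PW p k = p k / cx (W k)"

text \<open>The quotient of \<open>k\<^sup>2 * W k\<close> by the dispersion relation
  \<open>om k\<close> defined below: one factor \<open>om\<close> is taken out of the nonlinearity,
  to be cancelled in Duhamel's formula.\<close>

definition mul :: "real \<Rightarrow> real" where "mul k = \<bar>k\<bar> * wt s (eps * k)"

definition CL :: real where "CL = 2 powr ((1 + s) / 2) * (K0 * A)"
definition CQ :: real where "CQ = 2 powr (1 + s) * (2 * (K0 / sqrt eps))"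

lemma CL0: "CL \<ge> 0" and CQ0: "CQ \<ge> 0"
  using A eps by (auto simp: CL_def CQ_def)

lemma W_ge_1: "W k \<ge> 1" using s by (intro wt_ge_1) simp

lemma mul_nonneg: "mul k \<ge> 0" by (simp add: mul_def)

lemma mul_le: "mul k \<le> W k / eps"
proof -
  have "mul k \<le> (wt 1 (eps * k) / eps) * wt s (eps * k)"
    unfolding mul_def using abs_le_wt_scaled[OF eps(1)] by (intro mult_right_mono) auto
  then show ?thesis by (simp add: wt_add)
qed

lemma mul_measurable [measurable]: "mul \<in> borel_measurable borel"
  unfolding mul_def[abs_def] by measurable

lemma PW_measurable [measurable]:
  assumes [measurable]: "p \<in> borel_measurable borel"
  shows "PW p \<in> borel_measurable borel"
  unfolding PW_def[abs_def] by measurable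

lemma W_PW: "cx (W k) * PW p k = p k"
  by (simp add: PW_def)

text \<open>The dilation by \<open>eps\<close> of the inverse weight has mean square norm
  \<open>K0 / sqrt eps\<close>; this is the half power of \<open>eps\<close> lost in the quadratic
  term.\<close>

lemma PW_facts:
  assumes p: "L2 p"
  shows "L2 (PW p)" "integrable lborel (PW p)" "(LBINT k. norm (PW p k)) \<le> K0 / sqrt eps * l2norm p"
proof -
  have [measurable]: "p \<in> borel_measurable borel" using p by auto
  have le: "norm (PW p k) \<le> norm (p k)" for k
    using mult_left_mono[OF W_ge_1[of k] norm_ge_zero[of "p k"]] by (simp add: PW_def norm_divide divide_le_eq)
  show sq: "L2 (PW p)"
    by (rule L2_mono(1)[OF p]) (use le in auto)
  have i: "L2 (\<lambda>k. 1 / wt 1 (eps * k))" "l2norm (\<lambda>k. 1 / wt 1 (eps * k)) = K0 / sqrt eps"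
    using L2_affine[OF inverse_weight, of eps 0] eps by (auto simp: K0_def)
  have le2: "norm (PW p k) \<le> norm (1 / wt 1 (eps * k)) * norm (p k)" for k
  proof -
    have "wt 1 (eps * k) \<le> W k" using s by (intro wt_mono) simp
    then have "1 / W k \<le> 1 / wt 1 (eps * k)" by (intro divide_left_mono mult_pos_pos) auto
    from mult_right_mono[OF this norm_ge_zero[of "p k"]] show ?thesis by (simp add: PW_def norm_divide)
  qed
  note cs = cauchy_schwarz[OF i(1) p]
  show I: "integrable lborel (PW p)"
    by (rule Bochner_Integration.integrable_bound[OF cs(1)]) (use le2 in auto)
  have "(LBINT k. norm (PW p k)) \<le> (LBINT k. norm (1 / wt 1 (eps * k)) * norm (p k))"
    using I by (intro integral_mono cs(1) le2 integrable_norm)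
  then show "(LBINT k. norm (PW p k)) \<le> K0 / sqrt eps * l2norm p" using cs(2) i(2) by simp
qed

lemma PW_diff: "PW (\<lambda>k. p k - q k) = (\<lambda>k. PW p k - PW q k)"
  by (auto simp: PW_def diff_divide_distrib)

text \<open>By Peetre's inequality the output weight at \<open>k\<close> is shared between
  \<open>p\<close> at \<open>l\<close>, where it cancels \<open>PW\<close>, and the profile at
  \<open>k - l\<close>, where \<open>eps \<le> 1\<close> allows the unscaled weight. The constant
  \<open>CL\<close> is independent of \<open>eps\<close>; only the multiplier \<open>mul\<close>
  spoils this.\<close>

lemma lin_bound:
  assumes p: "L2 p"
  shows "L2 (\<lambda>k. cx (W k) * conv (V t) (PW p) k)"
    "l2norm (\<lambda>k. cx (W k) * conv (V t) (PW p) k) \<le> CL * l2norm p"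
proof -
  have [measurable]: "p \<in> borel_measurable borel" "V t \<in> borel_measurable borel" using p Vt by auto
  define a where "a = (\<lambda>m. 2 powr ((1 + s) / 2) * (wt (1 + s) m * norm (V t m)))"
  have V1: "integrable lborel (\<lambda>k. wt (1 + s) k * norm (V t k))" "(LBINT k. wt (1 + s) k * norm (V t k)) \<le> K0 * A"
    by (rule V_weighted; simp)+
  have a: "integrable lborel a" "\<And>m. a m \<ge> 0" "(LBINT m. a m) \<le> CL"
    using V1 mult_left_mono[OF V1(2), of "2 powr ((1 + s) / 2)"] by (auto simp: a_def CL_def)
  define G where "G = (\<lambda>k l. cx (W k) * (V t (k - l) * PW p l))"
  have Gm: "jointly_measurable G" unfolding G_def by measurable
  have le: "norm (G k l) \<le> a (k - l) * norm (p l)" for k l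
  proof -
    have "W k = wt (1 + s) (eps * (k - l) + eps * l)" by (simp add: algebra_simps)
    also have "\<dots> \<le> 2 powr ((1 + s) / 2) * (wt (1 + s) (eps * (k - l)) * W l)" using s by (intro wt_submult) simp
    also have "\<dots> \<le> 2 powr ((1 + s) / 2) * (wt (1 + s) (k - l) * W l)"
      using s eps by (intro mult_left_mono mult_right_mono wt_scale_le) auto
    finally have "W k * norm (PW p l) \<le> 2 powr ((1 + s) / 2) * (wt (1 + s) (k - l) * W l) * norm (PW p l)"
      by (intro mult_right_mono) auto
    also have "\<dots> = 2 powr ((1 + s) / 2) * wt (1 + s) (k - l) * norm (p l)"
      using W_PW[of l p] by (metis (no_types, lifting) mult.assoc norm_mult norm_of_real abs_of_nonneg wt_nonneg)
    finally have "W k * norm (PW p l) * norm (V t (k - l)) \<le> 2 powr ((1 + s) / 2) * wt (1 + s) (k - l) * norm (p l) * norm (V t (k - l))"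
      by (intro mult_right_mono) auto
    then show ?thesis by (simp add: G_def a_def norm_mult mult_ac)
  qed
  note Y = young_kernel[OF Gm le a(1,2) L2_norm(1)[OF p]]
  have eq: "(\<lambda>k. cx (W k) * conv (V t) (PW p) k) = (\<lambda>k. LBINT l. G k l)"
    unfolding conv_def G_def by simp
  show "L2 (\<lambda>k. cx (W k) * conv (V t) (PW p) k)" unfolding eq using Y(1) by simp
  have "l2norm (\<lambda>k. LBINT l. G k l) \<le> (LBINT m. a m) * l2norm p"
    using Y(2) by (simp add: L2_norm(2))
  also have "\<dots> \<le> CL * l2norm p" by (intro mult_right_mono a) auto
  finally show "l2norm (\<lambda>k. cx (W k) * conv (V t) (PW p) k) \<le> CL * l2norm p" unfolding eq .
qed

lemma quad_bound:
  assumes p: "L2 p" and q: "L2 q"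
  shows "L2 (\<lambda>k. cx (W k) * conv (PW p) (PW q) k)"
    "l2norm (\<lambda>k. cx (W k) * conv (PW p) (PW q) k) \<le> CQ * (l2norm p * l2norm q)"
proof -
  have Wp: "L2 (\<lambda>k. cx (W k) * PW p k)" "L2 (\<lambda>k. cx (W k) * PW q k)"
    unfolding W_PW using p q by auto
  have Wm: "W \<in> borel_measurable borel" by measurable
  have sum: "W (a + b) \<le> 2 powr (1 + s) * (W a + W b)" for a b
    using wt_sum_le[of "1 + s" "eps * a" "eps * b"] s by (simp add: distrib_left)
  have W0: "W k \<ge> 0" for k by simp
  note C = conv_weighted[where W=W and C="2 powr (1 + s)", OF Wm W0 sum _ PW_facts(2)[OF p] Wp(1) PW_facts(2)[OF q] Wp(2) PW_facts(1)[OF p] PW_facts(1)[OF q]]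
  show "L2 (\<lambda>k. cx (W k) * conv (PW p) (PW q) k)" using C(1) by simp
  have "l2norm (\<lambda>k. cx (W k) * conv (PW p) (PW q) k) \<le>
      2 powr (1 + s) * ((LBINT k. norm (PW p k)) * l2norm q + (LBINT k. norm (PW q k)) * l2norm p)"
    using C(2) unfolding W_PW by simp
  also have "\<dots> \<le> 2 powr (1 + s) * ((K0 / sqrt eps * l2norm p) * l2norm q + (K0 / sqrt eps * l2norm q) * l2norm p)"
    by (intro mult_left_mono add_mono mult_right_mono PW_facts(3) p q) auto
  also have "\<dots> = CQ * (l2norm p * l2norm q)" by (simp add: CQ_def algebra_simps)
  finally show "l2norm (\<lambda>k. cx (W k) * conv (PW p) (PW q) k) \<le> CQ * (l2norm p * l2norm q)" .
qed

lemma mul_bound: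
  assumes f: "L2 (\<lambda>k. cx (W k) * f k)" and [measurable]: "f \<in> borel_measurable borel"
    and c: "norm c \<le> 1"
  shows "L2 (\<lambda>k. - cx (mul k) * (c * f k))"
    "l2norm (\<lambda>k. - cx (mul k) * (c * f k)) \<le> l2norm (\<lambda>k. cx (W k) * f k) / eps"
proof -
  have "norm (- cx (mul k) * (c * f k)) \<le> 1 / eps * norm (cx (W k) * f k)" for k
  proof -
    have "mul k * (norm c * norm (f k)) \<le> (W k / eps) * (1 * norm (f k))"
      using mul_le[of k] c eps by (intro mult_mono) (auto simp: mul_nonneg)
    then show ?thesis by (simp add: norm_mult mul_nonneg)
  qed
  then have AE: "AE k in lborel. norm (- cx (mul k) * (c * f k)) \<le> 1 / eps * norm (cx (W k) * f k)" by blast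
  have m: "(\<lambda>k. - cx (mul k) * (c * f k)) \<in> borel_measurable borel" by measurable
  show "L2 (\<lambda>k. - cx (mul k) * (c * f k))"
    "l2norm (\<lambda>k. - cx (mul k) * (c * f k)) \<le> l2norm (\<lambda>k. cx (W k) * f k) / eps"
    using L2_cmult_mono[OF f m AE] eps by auto
qed

definition Hl :: "real \<Rightarrow> (real \<Rightarrow> complex) \<Rightarrow> real \<Rightarrow> complex"
  where "Hl t p k = - cx (mul k) * (c0 * conv (V t) (PW p) k)"
definition Hq :: "(real \<Rightarrow> complex) \<Rightarrow> real \<Rightarrow> complex"
  where "Hq p k = - cx (mul k) * (c0 * conv (PW (ret \<rho> p)) (PW (ret \<rho> p)) k)"
definition Hs :: "real \<Rightarrow> real \<Rightarrow> complex"
  where "Hs t k = - cx (mul k) * (cx (eps\<^sup>2 * k\<^sup>2) * V t k)"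
definition H :: "real \<Rightarrow> (real \<Rightarrow> complex) \<Rightarrow> real \<Rightarrow> complex"
  where "H t p k = 2 * Hl t p k + Hq p k + Hs t k"

lemma Hl_bound:
  assumes p: "L2 p"
  shows "L2 (Hl t p)" "l2norm (Hl t p) \<le> CL / eps * l2norm p"
proof -
  have m: "conv (V t) (PW p) \<in> borel_measurable borel" using p Vt by (intro conv_measurable PW_measurable) auto
  note M = mul_bound[OF lin_bound(1)[OF p] m norm_c0_le]
  show "L2 (Hl t p)" unfolding Hl_def[abs_def] by (rule M)
  have "l2norm (Hl t p) \<le> l2norm (\<lambda>k. cx (W k) * conv (V t) (PW p) k) / eps" unfolding Hl_def[abs_def] by (rule M)
  also have "\<dots> \<le> CL * l2norm p / eps" using lin_bound(2)[OF p] eps by (intro divide_right_mono) auto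
  finally show "l2norm (Hl t p) \<le> CL / eps * l2norm p" by simp
qed

lemma Hq_general:
  assumes p: "L2 p" and q: "L2 q"
  shows "L2 (\<lambda>k. - cx (mul k) * (c0 * conv (PW p) (PW q) k))"
    "l2norm (\<lambda>k. - cx (mul k) * (c0 * conv (PW p) (PW q) k)) \<le> CQ / eps * (l2norm p * l2norm q)"
proof -
  have m: "conv (PW p) (PW q) \<in> borel_measurable borel" using p q by (intro conv_measurable PW_measurable) auto
  note M = mul_bound[OF quad_bound(1)[OF p q] m norm_c0_le]
  show "L2 (\<lambda>k. - cx (mul k) * (c0 * conv (PW p) (PW q) k))" by (rule M)
  have "l2norm (\<lambda>k. - cx (mul k) * (c0 * conv (PW p) (PW q) k)) \<le> l2norm (\<lambda>k. cx (W k) * conv (PW p) (PW q) k) / eps" by (rule M)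
  also have "\<dots> \<le> CQ * (l2norm p * l2norm q) / eps" using quad_bound(2)[OF p q] eps by (intro divide_right_mono) auto
  finally show "l2norm (\<lambda>k. - cx (mul k) * (c0 * conv (PW p) (PW q) k)) \<le> CQ / eps * (l2norm p * l2norm q)" by simp
qed

lemma Hq_bound:
  assumes p: "L2 p"
  shows "L2 (Hq p)" "l2norm (Hq p) \<le> CQ * \<rho> / eps * l2norm p"
proof -
  note R = ret_props[OF \<rho> p]
  note G = Hq_general[OF R(1) R(1)]
  show "L2 (Hq p)" unfolding Hq_def[abs_def] by (rule G)
  have "l2norm (Hq p) \<le> CQ / eps * (l2norm (ret \<rho> p) * l2norm (ret \<rho> p))" unfolding Hq_def[abs_def] by (rule G)
  also have "\<dots> \<le> CQ / eps * (\<rho> * l2norm p)" using R \<rho> eps CQ0 by (intro mult_left_mono mult_mono) auto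
  finally show "l2norm (Hq p) \<le> CQ * \<rho> / eps * l2norm p" by simp
qed

text \<open>The residual is the term of fourth order missing from the Whitham system. Three
  derivatives fall on the profile here, one from \<open>mul\<close> and two from
  \<open>k\<^sup>2\<close>, besides the order \<open>s\<close>; hence the regularity
  \<open>3 + s\<close>.\<close>

lemma Hs_bound: "L2 (Hs t)" "l2norm (Hs t) \<le> eps\<^sup>2 * A"
proof -
  have [measurable]: "V t \<in> borel_measurable borel" by (rule Vt)
  have "norm (Hs t k) \<le> eps\<^sup>2 * norm (wmul (3 + s) (V t) k)" for k
  proof -
    have "mul k * k\<^sup>2 \<le> (wt 1 k * wt s k) * wt 2 k"
      unfolding mul_def using abs_le_wt_1[of k] wt_scale_le[of eps s k] s eps
      by (intro mult_mono) (auto simp: wt_2)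
    also have "\<dots> = wt (3 + s) k" using wt_add[of "1 + s" 2 k] by (simp add: wt_add[of 1 s] add.commute)
    finally have "eps\<^sup>2 * (mul k * k\<^sup>2) * norm (V t k) \<le> eps\<^sup>2 * wt (3 + s) k * norm (V t k)"
      by (intro mult_right_mono mult_left_mono) auto
    then show ?thesis by (simp add: Hs_def norm_mult norm_power mul_nonneg mult_ac)
  qed
  then have AE: "AE k in lborel. norm (Hs t k) \<le> eps\<^sup>2 * norm (wmul (3 + s) (V t) k)" by blast
  have m: "Hs t \<in> borel_measurable borel" unfolding Hs_def[abs_def] by measurable
  note M = L2_cmult_mono[OF Vs m AE]
  show "L2 (Hs t)" using M by simp
  have "eps\<^sup>2 * l2norm (wmul (3 + s) (V t)) \<le> eps\<^sup>2 * A" by (intro mult_left_mono Vn) auto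
  then show "l2norm (Hs t) \<le> eps\<^sup>2 * A" using M(2) by simp
qed

lemma H_square_integrable:
  assumes p: "L2 p" shows "L2 (H t p)"
  unfolding H_def[abs_def] using Hl_bound(1)[OF p] Hq_bound(1)[OF p] Hs_bound(1)
  by (intro L2_add L2_cmult) auto

text \<open>Good for existence at fixed \<open>eps\<close> only, as the constant blows up. In the
  quadratic part the product difference has two terms, each with a factor \<open>\<rho>\<close> and
  the Lipschitz constant \<open>2\<close> of the retraction.\<close>

lemma H_lipschitz:
  assumes p: "L2 p" and q: "L2 q"
  shows "l2norm (\<lambda>k. H t p k - H t q k) \<le> (2 * CL + 4 * CQ * \<rho>) / eps * l2norm (\<lambda>k. p k - q k)"
proof -
  note d = L2_diff(1)[OF p q]
  note Rp = ret_props[OF \<rho> p] and Rq = ret_props[OF \<rho> q]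
  note rd = L2_diff(1)[OF Rp(1) Rq(1)]
  have l: "2 * Hl t p k - 2 * Hl t q k = 2 * Hl t (\<lambda>k. p k - q k) k" for k
  proof -
    have "conv (V t) (PW p) k - conv (V t) (PW q) k = conv (V t) (PW (\<lambda>k. p k - q k)) k + conv (\<lambda>l. V t l - V t l) (PW q) k"
      unfolding PW_diff by (rule conv_diff[OF V_square_integrable V_square_integrable PW_facts(1)[OF p] PW_facts(1)[OF q]])
    moreover have "conv (\<lambda>l. V t l - V t l) (PW q) k = 0" by (simp add: conv_def)
    ultimately show ?thesis by (simp add: Hl_def algebra_simps)
  qed
  define q1 where "q1 = (\<lambda>k. - cx (mul k) * (c0 * conv (PW (ret \<rho> p)) (PW (\<lambda>k. ret \<rho> p k - ret \<rho> q k)) k))"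
  define q2 where "q2 = (\<lambda>k. - cx (mul k) * (c0 * conv (PW (\<lambda>k. ret \<rho> p k - ret \<rho> q k)) (PW (ret \<rho> q)) k))"
  have qd: "Hq p k - Hq q k = q1 k + q2 k" for k
  proof -
    have "conv (PW (ret \<rho> p)) (PW (ret \<rho> p)) k - conv (PW (ret \<rho> q)) (PW (ret \<rho> q)) k =
      conv (PW (ret \<rho> p)) (PW (\<lambda>k. ret \<rho> p k - ret \<rho> q k)) k + conv (PW (\<lambda>k. ret \<rho> p k - ret \<rho> q k)) (PW (ret \<rho> q)) k"
      unfolding PW_diff by (rule conv_diff; rule PW_facts(1); rule Rp(1) Rq(1))
    then have "- cx (mul k) * (c0 * (conv (PW (ret \<rho> p)) (PW (ret \<rho> p)) k - conv (PW (ret \<rho> q)) (PW (ret \<rho> q)) k)) = q1 k + q2 k"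
      unfolding q1_def q2_def by (simp only: distrib_left)
    then show ?thesis by (simp add: Hq_def right_diff_distrib)
  qed
  note Q1 = Hq_general[OF Rp(1) rd, folded q1_def] and Q2 = Hq_general[OF rd Rq(1), folded q2_def]
  have rl: "l2norm (\<lambda>k. ret \<rho> p k - ret \<rho> q k) \<le> 2 * l2norm (\<lambda>k. p k - q k)" by (rule ret_lipschitz[OF \<rho> p q])
  have b1: "l2norm q1 \<le> CQ / eps * (\<rho> * (2 * l2norm (\<lambda>k. p k - q k)))"
    using Q1(2) by (rule order_trans) (use Rp rl CQ0 eps \<rho> in \<open>intro mult_left_mono mult_mono; auto\<close>)
  have b2: "l2norm q2 \<le> CQ / eps * ((2 * l2norm (\<lambda>k. p k - q k)) * \<rho>)"
    using Q2(2) by (rule order_trans) (use Rq rl CQ0 eps \<rho> in \<open>intro mult_left_mono mult_mono; auto\<close>)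
  note L2 = L2_cmult[OF Hl_bound(1)[OF d, of t], of 2]
  have "(\<lambda>k. H t p k - H t q k) = (\<lambda>k. 2 * Hl t (\<lambda>k. p k - q k) k + (q1 k + q2 k))"
  proof
    fix k show "H t p k - H t q k = 2 * Hl t (\<lambda>k. p k - q k) k + (q1 k + q2 k)"
      unfolding l[symmetric] qd[symmetric] by (simp add: H_def)
  qed
  then have "l2norm (\<lambda>k. H t p k - H t q k) \<le> l2norm (\<lambda>k. 2 * Hl t (\<lambda>k. p k - q k) k) + l2norm (\<lambda>k. q1 k + q2 k)"
    using L2_add(2)[OF L2(1) L2_add(1)[OF Q1(1) Q2(1)]] by simp
  also have "\<dots> \<le> 2 * (CL / eps * l2norm (\<lambda>k. p k - q k)) + (l2norm q1 + l2norm q2)"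
    using L2(2) Hl_bound(2)[OF d, of t] L2_add(2)[OF Q1(1) Q2(1)] by simp
  also have "\<dots> \<le> 2 * (CL / eps * l2norm (\<lambda>k. p k - q k)) + (CQ / eps * (\<rho> * (2 * l2norm (\<lambda>k. p k - q k))) + CQ / eps * ((2 * l2norm (\<lambda>k. p k - q k)) * \<rho>))"
    by (intro add_mono b1 b2 order_refl)
  also have "\<dots> = (2 * CL + 4 * CQ * \<rho>) / eps * l2norm (\<lambda>k. p k - q k)" using eps by (simp add: field_simps)
  finally show ?thesis .
qed

lemma conv_zero: "conv f (\<lambda>k. 0) k = 0"
  by (simp add: conv_def)

lemma H_zero: "l2norm (H t (\<lambda>k. 0)) \<le> eps\<^sup>2 * A"
proof -
  have "PW (\<lambda>k. 0) = (\<lambda>k. 0)" "ret \<rho> (\<lambda>k. 0) = (\<lambda>k. 0)" by (auto simp: PW_def ret_def)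
  then have "H t (\<lambda>k. 0) = Hs t" by (auto simp: H_def Hl_def Hq_def conv_zero)
  then show ?thesis using Hs_bound(2) by simp
qed

lemma H_measurable:
  assumes [measurable]: "jointly_measurable p"
  shows "jointly_measurable (\<lambda>t. H t (p t))"
proof -
  have [measurable]: "jointly_measurable V" by (rule Vm)
  have nm [measurable]: "(\<lambda>t. l2norm (p t)) \<in> borel_measurable borel" unfolding l2norm_def by measurable
  have [measurable]: "jointly_measurable (\<lambda>t. PW (p t))" unfolding PW_def by measurable
  have [measurable]: "jointly_measurable (\<lambda>t. PW (ret \<rho> (p t)))" unfolding PW_def ret_def by measurable
  have [measurable]: "(\<lambda>z. conv (V (fst z)) (PW (p (fst z))) (snd z)) \<in> borel_measurable (borel \<Otimes>\<^sub>M borel)"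
    using conv_jointly_measurable[of V "\<lambda>t. PW (p t)"] by (simp add: case_prod_unfold)
  have [measurable]: "(\<lambda>z. conv (PW (ret \<rho> (p (fst z)))) (PW (ret \<rho> (p (fst z)))) (snd z)) \<in> borel_measurable (borel \<Otimes>\<^sub>M borel)"
    using conv_jointly_measurable[of "\<lambda>t. PW (ret \<rho> (p t))" "\<lambda>t. PW (ret \<rho> (p t))"] by (simp add: case_prod_unfold)
  show ?thesis unfolding H_def Hl_def Hq_def Hs_def case_prod_unfold by measurable
qed

lemma H_cong:
  assumes f: "L2 f" and g: "L2 g" and fg: "AE k in lborel. f k = g k"
  shows "H t f k = H t g k"
proof -
  have m [measurable]: "f \<in> borel_measurable borel" "g \<in> borel_measurable borel" using f g by auto
  have n: "l2norm f = l2norm g" by (rule l2norm_cong_AE) (use fg in \<open>auto elim: eventually_mono\<close>)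
  have 1: "AE k in lborel. PW f k = PW g k" using fg by eventually_elim (simp add: PW_def)
  have 2: "AE k in lborel. PW (ret \<rho> f) k = PW (ret \<rho> g) k" using fg by eventually_elim (simp add: PW_def ret_def n)
  have r: "ret \<rho> f \<in> borel_measurable borel" "ret \<rho> g \<in> borel_measurable borel" unfolding ret_def[abs_def] by measurable
  have "conv (V t) (PW f) k = conv (V t) (PW g) k"
    by (rule conv_cong_AE[OF _ 1]) (auto intro!: Vt PW_measurable m)
  moreover have "conv (PW (ret \<rho> f)) (PW (ret \<rho> f)) k = conv (PW (ret \<rho> g)) (PW (ret \<rho> g)) k"
    by (rule conv_cong_AE[OF 2 2]) (auto intro!: PW_measurable r)
  ultimately show ?thesis by (simp add: H_def Hl_def Hq_def)
qed

lemma H_hermitian: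
  assumes f: "\<And>k. f (- k) = cnj (f k)"
  shows "H t f (- k) = cnj (H t f k)"
proof -
  have P: "PW f (- k) = cnj (PW f k)" for k by (simp add: PW_def f)
  have R: "PW (ret \<rho> f) (- k) = cnj (PW (ret \<rho> f) k)" for k by (simp add: PW_def ret_def f)
  have m: "mul (- k) = mul k" by (simp add: mul_def)
  show ?thesis unfolding H_def Hl_def Hq_def Hs_def m
    using conv_hermitian[of "V t" "PW f" k, OF Vh P] conv_hermitian[of "PW (ret \<rho> f)" "PW (ret \<rho> f)" k, OF R R] Vh
    by simp
qed

text \<open>The dispersion relation of the linear Boussinesq equation on the slow scale.\<close>

definition om :: "real \<Rightarrow> real" where "om k = \<bar>k\<bar> * wt 1 (eps * k)"

lemma om_measurable [measurable]: "om \<in> borel_measurable borel"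
  unfolding om_def[abs_def] by measurable

abbreviation ksin :: "real \<Rightarrow> real \<Rightarrow> complex" where "ksin t k \<equiv> cx (sin (om k * t))"
abbreviation kcos :: "real \<Rightarrow> real \<Rightarrow> complex" where "kcos t k \<equiv> cx (cos (om k * t))"

text \<open>The kernel of the second order problem is \<open>sin (om k * t) / om k\<close>; the
  factor \<open>om\<close> in front of the source cancels the denominator, which leaves a kernel
  bounded by \<open>1\<close>.\<close>

lemma error_solution:
  "\<exists>p h. jointly_measurable p \<and> jointly_measurable h \<and>
    (\<forall>t k. h t (- k) = cnj (h t k)) \<and> (\<forall>t. L2 (p t)) \<and>
    (\<forall>k. set_integrable lborel {0..T} (\<lambda>\<tau>. h \<tau> k)) \<and>
    L2 (\<lambda>k. LBINT \<tau>:{0..T}. norm (h \<tau> k)) \<and>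
    (\<forall>t\<in>{0..T}. \<forall>k. p t k = duhamel ksin h t k) \<and>
    (AE k in lborel. \<forall>t\<in>{0..T}. h t k = H t (p t) k)"
proof (rule picard[where L="(2 * CL + 4 * CQ * \<rho>) / eps" and A="eps\<^sup>2 * A"])
  show "jointly_measurable ksin" by measurable
  show "(2 * CL + 4 * CQ * \<rho>) / eps \<ge> 0" using CL0 CQ0 \<rho> eps by simp
  show "ksin t (- k) = cnj (ksin t k)" for t k by (simp add: om_def)
  show "T > 0" by (rule T)
  show "H t f (- k) = cnj (H t f k)" if "\<And>k. f (- k) = cnj (f k)" for t f k by (rule H_hermitian) (rule that)
  show "l2norm (\<lambda>k. H t f k - H t g k) \<le> (2 * CL + 4 * CQ * \<rho>) / eps * l2norm (\<lambda>k. f k - g k)"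
    if "L2 f" "L2 g" for t f g by (rule H_lipschitz[OF that])
qed (auto intro: H_measurable H_square_integrable H_zero H_cong)

end

subsection \<open>Energy estimate\<close>

text \<open>After division by a power of \<open>a\<close> the claim is
  \<open>1 - r powr s \<le> max 1 s * (1 - r)\<close> for \<open>r = b / a\<close>. For
  \<open>s \<le> 1\<close> it holds because \<open>r \<le> r powr s\<close>, otherwise it is
  Bernoulli's inequality, derived from the weighted mean inequality.\<close>

lemma powr_difference_le:
  fixes a b :: real
  assumes b: "b > 0" and ab: "b \<le> a" and s: "s \<ge> 0"
  shows "a * (a powr s - b powr s) \<le> max 1 s * (a - b) * a powr s"
proof -
  define r where "r = b / a"
  have r: "0 < r" "r \<le> 1" and br: "b = r * a" using b ab by (auto simp: r_def)
  have a: "a > 0" using b ab by simp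
  have "1 - r powr s \<le> max 1 s * (1 - r)"
  proof (cases "s \<le> 1")
    case True
    have "r powr 1 \<le> r powr s" using r s True by (intro powr_mono') auto
    then show ?thesis using r True by (simp add: max_def)
  next
    case False
    have "(r powr s) powr (1 / s) * 1 powr (1 - 1 / s) \<le> (1 / s) * r powr s + (1 - 1 / s) * 1"
      using False r by (intro Youngs_inequality_0) auto
    then have "r \<le> (1 / s) * r powr s + (1 - 1 / s)" using False r by (simp add: powr_powr)
    then have "s * r \<le> s * ((1 / s) * r powr s + (1 - 1 / s))" using False by (intro mult_left_mono) auto
    also have "\<dots> = r powr s + s - 1" using False by (simp add: field_simps)
    finally show ?thesis using False by (simp add: max_def algebra_simps)
  qed
  then have "(a * a powr s) * (1 - r powr s) \<le> (a * a powr s) * (max 1 s * (1 - r))"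
    using a by (intro mult_left_mono) auto
  moreover have "b powr s = r powr s * a powr s" unfolding br using r a by (simp add: powr_mult)
  ultimately show ?thesis unfolding br by (simp add: algebra_simps)
qed

lemma wt_powr: "wt r x = wt 1 x powr r"
  by (simp add: wt_def powr_powr)

lemma wt_1_lipschitz: "\<bar>wt 1 x - wt 1 y\<bar> \<le> \<bar>x - y\<bar>"
proof -
  have sq: "(wt 1 z)\<^sup>2 = 1 + z\<^sup>2" for z using one_plus_square_pos[of z] by (simp add: wt_square)
  have "\<bar>wt 1 x - wt 1 y\<bar> * (wt 1 x + wt 1 y) = \<bar>(wt 1 x - wt 1 y) * (wt 1 x + wt 1 y)\<bar>"
    using wt_nonneg[of 1 x] wt_nonneg[of 1 y] by (simp add: abs_mult)
  also have "(wt 1 x - wt 1 y) * (wt 1 x + wt 1 y) = (wt 1 x)\<^sup>2 - (wt 1 y)\<^sup>2" by (simp add: power2_eq_square algebra_simps)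
  also have "\<dots> = (x - y) * (x + y)" unfolding sq by (simp add: power2_eq_square algebra_simps)
  also have "\<bar>(x - y) * (x + y)\<bar> \<le> \<bar>x - y\<bar> * (wt 1 x + wt 1 y)"
    unfolding abs_mult using abs_le_wt_1[of x] abs_le_wt_1[of y] by (intro mult_left_mono) auto
  finally show ?thesis using wt_pos[of 1 x] wt_pos[of 1 y] by (simp add: mult_le_cancel_right)
qed

text \<open>The estimate that keeps the growth rate independent of \<open>e\<close>: the weight at
  scaled frequencies varies at rate \<open>e\<close>, which compensates the unscaled factor
  \<open>\<bar>k\<bar>\<close> at the cost of one derivative on the profile.\<close>

lemma commutator_kernel:
  assumes e: "e > 0" "e \<le> 1" and s: "s \<ge> 0"
  shows "\<bar>k\<bar> * \<bar>wt s (e * l) - wt s (e * k)\<bar> \<le> (max 1 s * 2 powr (s / 2)) * wt (1 + s) (k - l) * wt s (e * l)"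
proof -
  define a b where "a = max (wt 1 (e * k)) (wt 1 (e * l))" and "b = min (wt 1 (e * k)) (wt 1 (e * l))"
  have b: "b > 0" "b \<le> a" by (auto simp: a_def b_def min_def max_def)
  have diff: "\<bar>wt s (e * l) - wt s (e * k)\<bar> = a powr s - b powr s"
  proof (cases "wt 1 (e * k) \<le> wt 1 (e * l)")
    case True
    then have "wt 1 (e * k) powr s \<le> wt 1 (e * l) powr s" using s by (intro powr_mono2) auto
    then show ?thesis unfolding wt_powr[of s] using True by (simp add: a_def b_def)
  next
    case False
    then have "wt 1 (e * l) powr s \<le> wt 1 (e * k) powr s" using s by (intro powr_mono2) auto
    then show ?thesis unfolding wt_powr[of s] using False by (simp add: a_def b_def)
  qed
  have ab: "a - b \<le> e * \<bar>k - l\<bar>"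
  proof -
    have "a - b = \<bar>wt 1 (e * k) - wt 1 (e * l)\<bar>" by (auto simp: a_def b_def)
    also have "\<dots> \<le> \<bar>e * k - e * l\<bar>" by (rule wt_1_lipschitz)
    also have "\<dots> = e * \<bar>k - l\<bar>" using e by (simp add: abs_mult right_diff_distrib[symmetric])
    finally show ?thesis .
  qed
  have as: "a powr s \<le> 2 powr (s / 2) * (wt s (k - l) * wt s (e * l))"
  proof -
    have 1: "wt s (e * k) \<le> 2 powr (s / 2) * (wt s (k - l) * wt s (e * l))"
    proof -
      have "wt s (e * k) = wt s (e * (k - l) + e * l)" by (simp add: algebra_simps)
      also have "\<dots> \<le> 2 powr (s / 2) * (wt s (e * (k - l)) * wt s (e * l))" by (rule wt_submult[OF s])
      also have "\<dots> \<le> 2 powr (s / 2) * (wt s (k - l) * wt s (e * l))"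
        using e s by (intro mult_left_mono mult_right_mono wt_scale_le) auto
      finally show ?thesis .
    qed
    have 2: "wt s (e * l) \<le> 2 powr (s / 2) * (wt s (k - l) * wt s (e * l))"
    proof -
      have "1 * (1 * wt s (e * l)) \<le> 2 powr (s / 2) * (wt s (k - l) * wt s (e * l))"
        using s by (intro mult_mono wt_ge_1 ge_one_powr_ge_zero) auto
      then show ?thesis by simp
    qed
    show ?thesis using 1 2 unfolding a_def wt_powr[of s] by (simp add: max_def)
  qed
  \<comment> \<open>Replacing \<open>\<bar>k\<bar>\<close> by the larger weight costs
    \<open>1 / e\<close>, exactly the factor gained in the difference of weights.\<close>
  have "e * \<bar>k\<bar> \<le> a" using abs_le_wt_1[of "e * k"] e by (simp add: a_def abs_mult le_max_iff_disj)
  then have "e * \<bar>k\<bar> * (a powr s - b powr s) \<le> a * (a powr s - b powr s)"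
    using b s by (intro mult_right_mono) (auto intro: powr_mono2)
  also have "\<dots> \<le> max 1 s * (a - b) * a powr s" by (rule powr_difference_le[OF b s])
  also have "\<dots> \<le> max 1 s * (e * \<bar>k - l\<bar>) * a powr s" by (intro mult_right_mono mult_left_mono ab) auto
  finally have "e * (\<bar>k\<bar> * (a powr s - b powr s)) \<le> e * (max 1 s * \<bar>k - l\<bar> * a powr s)" by (simp add: mult_ac)
  then have "\<bar>k\<bar> * (a powr s - b powr s) \<le> max 1 s * \<bar>k - l\<bar> * a powr s" using e by simp
  also have "\<dots> \<le> max 1 s * wt 1 (k - l) * (2 powr (s / 2) * (wt s (k - l) * wt s (e * l)))"
    by (intro mult_mono mult_left_mono abs_le_wt_1 as) auto
  also have "\<dots> = (max 1 s * 2 powr (s / 2)) * wt (1 + s) (k - l) * wt s (e * l)" by (simp add: wt_add mult_ac)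
  finally show ?thesis unfolding diff .
qed

text \<open>The energy identity in integrated form. The measure is general because it is applied to
  one frequency variable for the norms and to two for the interaction form.\<close>

lemma time_integral_swap:
  fixes f f' :: "real \<Rightarrow> 'z \<Rightarrow> complex"
  assumes M: "sigma_finite_measure M"
    and d: "AE z in M. \<forall>t\<in>{0..T}. ((\<lambda>t. f t z) has_vector_derivative f' t z) (at t within {0..T})"
    and c: "AE z in M. continuous_on {0..T} (\<lambda>t. f' t z)"
    and z: "\<And>z. f 0 z = 0" and fm: "\<And>t. f t \<in> borel_measurable M"
    and m [measurable]: "(\<lambda>(t, z). f' t z) \<in> borel_measurable (lborel \<Otimes>\<^sub>M M)"
    and b: "\<And>t. t \<in> {0..T} \<Longrightarrow> (\<integral>\<^sup>+ z. ennreal (norm (f' t z)) \<partial>M) \<le> ennreal C"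
    and t: "t \<in> {0..T}"
  shows "(\<integral>z. f t z \<partial>M) = (LBINT \<tau>:{0..t}. (\<integral>z. f' \<tau> z \<partial>M))"
    "set_integrable lborel {0..t} (\<lambda>\<tau>. \<integral>z. f' \<tau> z \<partial>M)"
proof -
  interpret M: sigma_finite_measure M by (rule M)
  interpret P: pair_sigma_finite lborel M ..
  have I: "integrable (lborel \<Otimes>\<^sub>M M) (\<lambda>(\<tau>, z). indicator {0..t} \<tau> *\<^sub>R f' \<tau> z)"
  proof (rule integrableI_bounded)
    show "(\<lambda>(\<tau>, z). indicator {0..t} \<tau> *\<^sub>R f' \<tau> z) \<in> borel_measurable (lborel \<Otimes>\<^sub>M M)" by measurable
    have "(\<integral>\<^sup>+ x. ennreal (norm (case x of (\<tau>, z) \<Rightarrow> indicator {0..t} \<tau> *\<^sub>R f' \<tau> z)) \<partial>(lborel \<Otimes>\<^sub>M M)) =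
      (\<integral>\<^sup>+ \<tau>. \<integral>\<^sup>+ z. ennreal (norm (indicator {0..t} \<tau> *\<^sub>R f' \<tau> z)) \<partial>M \<partial>lborel)"
      by (subst M.nn_integral_fst[symmetric]) auto
    also have "\<dots> \<le> (\<integral>\<^sup>+ \<tau>. ennreal C * indicator {0..t} \<tau> \<partial>lborel)"
    proof (rule nn_integral_mono)
      fix \<tau> :: real
      show "(\<integral>\<^sup>+ z. ennreal (norm (indicator {0..t} \<tau> *\<^sub>R f' \<tau> z)) \<partial>M) \<le> ennreal C * indicator {0..t} \<tau>"
        using b[of \<tau>] t by (cases "\<tau> \<in> {0..t}") auto
    qed
    also have "\<dots> < \<infinity>" using t by (simp add: nn_integral_cmult ennreal_mult_less_top)
    finally show "(\<integral>\<^sup>+ x. ennreal (norm (case x of (\<tau>, z) \<Rightarrow> indicator {0..t} \<tau> *\<^sub>R f' \<tau> z)) \<partial>(lborel \<Otimes>\<^sub>M M)) < \<infinity>" .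
  qed
  have "(\<integral>z. f t z \<partial>M) = (\<integral>z. (LBINT \<tau>. indicator {0..t} \<tau> *\<^sub>R f' \<tau> z) \<partial>M)"
  proof (rule integral_cong_AE)
    show "AE z in M. f t z = (LBINT \<tau>. indicator {0..t} \<tau> *\<^sub>R f' \<tau> z)"
      using d c
    proof eventually_elim
      case (elim x)
      then show ?case using set_integral_FTC2[of T "\<lambda>t. f t x" "\<lambda>t. f' t x" t] t z[of x]
        by (simp add: set_lebesgue_integral_def)
    qed
  qed (use fm in measurable)
  also have "\<dots> = (LBINT \<tau>. (\<integral>z. indicator {0..t} \<tau> *\<^sub>R f' \<tau> z \<partial>M))"
    using P.Fubini_integral[OF I] by simp
  also have "\<dots> = (LBINT \<tau>:{0..t}. (\<integral>z. f' \<tau> z \<partial>M))" unfolding set_lebesgue_integral_def by simp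
  finally show "(\<integral>z. f t z \<partial>M) = (LBINT \<tau>:{0..t}. (\<integral>z. f' \<tau> z \<partial>M))" .
  show "set_integrable lborel {0..t} (\<lambda>\<tau>. \<integral>z. f' \<tau> z \<partial>M)"
    using P.integrable_fst[OF I] by (simp add: set_integrable_def)
qed

text \<open>Gronwall by iteration, starting from an a priori bound. Each pass halves the coefficient
  in front of the exponential and adds \<open>D\<close>, so the coefficient converges to the fixed
  point \<open>2 * D\<close>; no continuity of \<open>y\<close> enters.\<close>

lemma gronwall_contraction:
  fixes y :: "real \<Rightarrow> real"
  assumes M: "\<And>t. t \<in> {0..T} \<Longrightarrow> y t \<le> M" "M \<ge> 0" and K: "K \<ge> 0" and D: "D \<ge> 0"
    and step: "\<And>S t. S \<ge> 0 \<Longrightarrow> (\<And>\<tau>. \<tau> \<in> {0..T} \<Longrightarrow> y \<tau> \<le> S * exp (K * \<tau>)) \<Longrightarrow> t \<in> {0..T} \<Longrightarrow> y t \<le> S * exp (K * t) / 2 + D"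
    and t: "t \<in> {0..T}"
  shows "y t \<le> 2 * D * exp (K * t)"
proof -
  have e1: "exp (K * \<tau>) \<ge> 1" if "\<tau> \<in> {0..T}" for \<tau> using that K by simp
  have "\<forall>t\<in>{0..T}. y t \<le> (2 * D + M * (1/2)^n) * exp (K * t)" for n
  proof (induction n)
    case 0
    show ?case
    proof
      fix t assume t: "t \<in> {0..T}"
      have "y t \<le> M * 1" using M(1)[OF t] by simp
      also have "\<dots> \<le> (2 * D + M) * exp (K * t)" using e1[OF t] M(2) D by (intro mult_mono) auto
      finally show "y t \<le> (2 * D + M * (1/2)^0) * exp (K * t)" by simp
    qed
  next
    case (Suc n)
    show ?case
    proof
      fix t assume t: "t \<in> {0..T}"
      have "y t \<le> (2 * D + M * (1/2)^n) * exp (K * t) / 2 + D"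
        by (rule step) (use Suc M D t in auto)
      moreover have "D \<le> D * exp (K * t)" using mult_left_mono[OF e1[OF t] D] by simp
      moreover have "(2 * D + M * (1/2)^n) * exp (K * t) / 2 + D * exp (K * t) = (2 * D + M * (1/2)^(Suc n)) * exp (K * t)"
        by (simp add: field_simps)
      ultimately show "y t \<le> (2 * D + M * (1/2)^(Suc n)) * exp (K * t)" by linarith
    qed
  qed
  then have b: "y t \<le> (2 * D + M * (1/2)^n) * exp (K * t)" for n using t by blast
  have lim: "(\<lambda>n. (2 * D + M * (1/2::real)^n) * exp (K * t)) \<longlonglongrightarrow> (2 * D + M * 0) * exp (K * t)"
    by (intro tendsto_intros LIMSEQ_realpow_zero) auto
  have "y t \<le> (2 * D + M * 0) * exp (K * t)" by (rule LIMSEQ_le_const[OF lim]) (use b in blast)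
  then show ?thesis by simp
qed

context error_problem
begin

text \<open>The addition theorems separate \<open>t\<close> from \<open>\<tau>\<close> in the
  kernel, which leaves products of smooth functions of \<open>t\<close> with ordinary time
  integrals.\<close>

lemma duhamel_ode:
  assumes h: "continuous_on {0..T} (\<lambda>t. h t k)" and t: "t \<in> {0..T}"
  shows "((\<lambda>t. duhamel ksin h t k) has_vector_derivative om k * duhamel kcos h t k) (at t within {0..T})"
    "((\<lambda>t. duhamel kcos h t k) has_vector_derivative h t k - om k * duhamel ksin h t k) (at t within {0..T})"
proof -
  define S where "S = (\<lambda>t. LBINT \<tau>:{0..t}. cx (sin (om k * \<tau>)) * h \<tau> k)"
  define C where "C = (\<lambda>t. LBINT \<tau>:{0..t}. cx (cos (om k * \<tau>)) * h \<tau> k)"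
  have hs: "continuous_on {0..T} (\<lambda>\<tau>. cx (sin (om k * \<tau>)) * h \<tau> k)"
    and hc: "continuous_on {0..T} (\<lambda>\<tau>. cx (cos (om k * \<tau>)) * h \<tau> k)"
    by (intro continuous_intros h)+
  have Sd: "(S has_vector_derivative cx (sin (om k * t)) * h t k) (at t within {0..T})"
    and Cd: "(C has_vector_derivative cx (cos (om k * t)) * h t k) (at t within {0..T})"
    unfolding S_def C_def by (rule set_integral_FTC1[OF hs t] set_integral_FTC1[OF hc t])+
  have int: "set_integrable lborel {0..x} (\<lambda>\<tau>. cx (sin (om k * \<tau>)) * h \<tau> k)"
    "set_integrable lborel {0..x} (\<lambda>\<tau>. cx (cos (om k * \<tau>)) * h \<tau> k)" if "x \<in> {0..T}" for x
    using that by (auto intro!: borel_integrable_atLeastAtMost' continuous_on_subset[OF hs] continuous_on_subset[OF hc])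
  have s_eq: "duhamel ksin h x k = cx (sin (om k * x)) * C x - cx (cos (om k * x)) * S x" if x: "x \<in> {0..T}" for x
  proof -
    have "duhamel ksin h x k = (LBINT \<tau>. cx (sin (om k * x)) * (indicator {0..x} \<tau> *\<^sub>R (cx (cos (om k * \<tau>)) * h \<tau> k))
       - cx (cos (om k * x)) * (indicator {0..x} \<tau> *\<^sub>R (cx (sin (om k * \<tau>)) * h \<tau> k)))"
      unfolding duhamel_def by (intro Bochner_Integration.integral_cong refl) (auto simp: indicator_def right_diff_distrib sin_diff algebra_simps)
    also have "\<dots> = cx (sin (om k * x)) * C x - cx (cos (om k * x)) * S x"
      using int[OF x] unfolding C_def S_def set_lebesgue_integral_def set_integrable_def by (simp del: mult_scaleR_right)
    finally show ?thesis .
  qed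
  have c_eq: "duhamel kcos h x k = cx (cos (om k * x)) * C x + cx (sin (om k * x)) * S x" if x: "x \<in> {0..T}" for x
  proof -
    have "duhamel kcos h x k = (LBINT \<tau>. cx (cos (om k * x)) * (indicator {0..x} \<tau> *\<^sub>R (cx (cos (om k * \<tau>)) * h \<tau> k))
       + cx (sin (om k * x)) * (indicator {0..x} \<tau> *\<^sub>R (cx (sin (om k * \<tau>)) * h \<tau> k)))"
      unfolding duhamel_def by (intro Bochner_Integration.integral_cong refl) (auto simp: indicator_def right_diff_distrib cos_diff algebra_simps)
    also have "\<dots> = cx (cos (om k * x)) * C x + cx (sin (om k * x)) * S x"
      using int[OF x] unfolding C_def S_def set_lebesgue_integral_def set_integrable_def by (simp del: mult_scaleR_right)
    finally show ?thesis .
  qed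
  have sd: "((\<lambda>x. cx (sin (om k * x))) has_vector_derivative cx (om k * cos (om k * t))) (at t within {0..T})"
    and cd: "((\<lambda>x. cx (cos (om k * x))) has_vector_derivative cx (- om k * sin (om k * t))) (at t within {0..T})"
    by (rule has_vector_derivative_of_real; auto intro!: derivative_eq_intros)+
  have trig: "cx (cos (om k * t)) * cx (cos (om k * t)) + cx (sin (om k * t)) * cx (sin (om k * t)) = 1"
    by (metis of_real_add of_real_mult of_real_1 sin_cos_squared_add3)
  show "((\<lambda>t. duhamel ksin h t k) has_vector_derivative om k * duhamel kcos h t k) (at t within {0..T})"
  proof (rule has_vector_derivative_transform[OF t s_eq])
    show "((\<lambda>x. cx (sin (om k * x)) * C x - cx (cos (om k * x)) * S x) has_vector_derivative om k * duhamel kcos h t k) (at t within {0..T})"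
      by (rule has_vector_derivative_eq_rhs[OF has_vector_derivative_diff[OF has_vector_derivative_mult[OF sd Cd] has_vector_derivative_mult[OF cd Sd]]])
         (unfold c_eq[OF t], simp add: algebra_simps)
  qed
  show "((\<lambda>t. duhamel kcos h t k) has_vector_derivative h t k - om k * duhamel ksin h t k) (at t within {0..T})"
  proof (rule has_vector_derivative_transform[OF t c_eq])
    have "cx (cos (om k * t)) * (cx (cos (om k * t)) * h t k) + cx (sin (om k * t)) * (cx (sin (om k * t)) * h t k) = h t k"
      using trig by (metis distrib_right mult.assoc mult_1)
    then show "((\<lambda>x. cx (cos (om k * x)) * C x + cx (sin (om k * x)) * S x) has_vector_derivative h t k - om k * duhamel ksin h t k) (at t within {0..T})"
      by (intro has_vector_derivative_eq_rhs[OF has_vector_derivative_add[OF has_vector_derivative_mult[OF cd Cd] has_vector_derivative_mult[OF sd Sd]]])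
         (unfold s_eq[OF t], simp add: algebra_simps)
  qed
qed

end

text \<open>A solution of the truncated error equation together with its source. Its companion
  \<open>q\<close> has the cosine kernel, so that \<open>p' = om * q\<close> and
  \<open>q' = h - om * p\<close> form a first order system.\<close>

locale error_flow = error_problem +
  fixes p h :: "real \<Rightarrow> real \<Rightarrow> complex"
  assumes pm: "jointly_measurable p" and hm: "jointly_measurable h"
    and hh: "\<And>t k. h t (- k) = cnj (h t k)" and ps: "\<And>t. L2 (p t)"
    and hi: "\<And>k. set_integrable lborel {0..T} (\<lambda>\<tau>. h \<tau> k)"
    and hb: "L2 (\<lambda>k. LBINT \<tau>:{0..T}. norm (h \<tau> k))"
    and pd: "\<And>t k. t \<in> {0..T} \<Longrightarrow> p t k = duhamel ksin h t k"
    and hH: "AE k in lborel. \<forall>t\<in>{0..T}. h t k = H t (p t) k"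
begin

definition q :: "real \<Rightarrow> real \<Rightarrow> complex" where "q t k = duhamel kcos h t k"
definition Bp :: "real \<Rightarrow> real" where "Bp k = (LBINT \<tau>:{0..T}. norm (h \<tau> k))"

lemma Bp: "L2 Bp" "Bp k \<ge> 0"
  using hb unfolding Bp_def[abs_def] set_lebesgue_integral_def by (auto intro!: Bochner_Integration.integral_nonneg)

lemmas pt = measurable_joint_sections(1)[OF pm]

lemma qm: "jointly_measurable q"
proof -
  have "jointly_measurable (duhamel kcos h)"
    by (rule duhamel_measurable[OF _ hm]) measurable
  then show ?thesis by (simp add: q_def[abs_def])
qed

lemmas qt = measurable_joint_sections(1)[OF qm]

lemma pq_bound:
  assumes t: "t \<in> {0..T}"
  shows "norm (p t k) \<le> Bp k" "norm (q t k) \<le> Bp k"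
proof -
  have tT: "t \<le> T" using t by simp
  note si = set_integrable_Icc_mono[OF hi tT, of k]
  have ks: "jointly_measurable ksin" and kc: "jointly_measurable kcos" by measurable
  show "norm (p t k) \<le> Bp k"
    using duhamel_integrable(2)[OF ks hm _ si(1)] si(2) pd[OF t] unfolding Bp_def by simp
  show "norm (q t k) \<le> Bp k"
    using duhamel_integrable(2)[OF kc hm _ si(1)] si(2) unfolding Bp_def q_def by simp
qed

lemma qs: "t \<in> {0..T} \<Longrightarrow> L2 (q t)"
  by (rule L2_mono(1)[OF Bp(1) qt]) (use pq_bound(2) Bp(2) in simp)

lemma p_hermitian: "t \<in> {0..T} \<Longrightarrow> p t (- k) = cnj (p t k)"
  unfolding pd duhamel_def Bochner_Integration.integral_cnj[symmetric]
  by (intro Bochner_Integration.integral_cong refl) (simp add: hh om_def)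

text \<open>Proved at every frequency and before any regularity of \<open>h\<close>: continuity of
  \<open>p\<close> is what makes the source along \<open>p\<close>, and then \<open>h\<close> at
  almost every frequency, continuous in time.\<close>

lemma p_continuous: "continuous_on {0..T} (\<lambda>t. p t k)"
proof -
  have [measurable]: "(\<lambda>\<tau>. h \<tau> k) \<in> borel_measurable borel" by (rule measurable_joint_sections(2)[OF hm])
  \<comment> \<open>Since the sine vanishes at \<open>0\<close>, truncating its argument extends the
    integrand continuously by zero to a fixed interval. The cosine kernel does not allow
    this.\<close>
  have "continuous_on {0..T} (\<lambda>t. LBINT \<tau>. indicator {0..T} \<tau> *\<^sub>R (cx (sin (om k * max 0 (t - \<tau>))) * h \<tau> k))"
  proof (rule continuous_on_integral_dominated)
    show "integrable lborel (\<lambda>\<tau>. norm (indicator {0..T} \<tau> *\<^sub>R h \<tau> k))"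
      using hi[of k] unfolding set_integrable_def by (rule Bochner_Integration.integrable_norm)
    have "norm (cx (sin x) * z) \<le> norm z" for x z
      using mult_right_mono[OF abs_sin_le_one[of x] norm_ge_zero[of z]] by (simp add: norm_mult)
    then show "AE \<tau> in lborel. \<forall>t\<in>{0..T}. norm (indicator {0..T} \<tau> *\<^sub>R (cx (sin (om k * max 0 (t - \<tau>))) * h \<tau> k)) \<le> norm (indicator {0..T} \<tau> *\<^sub>R h \<tau> k)"
      by (auto simp: indicator_def)
    show "AE \<tau> in lborel. continuous_on {0..T} (\<lambda>t. indicator {0..T} \<tau> *\<^sub>R (cx (sin (om k * max 0 (t - \<tau>))) * h \<tau> k))"
      by (intro AE_I2 continuous_intros)
  qed measurable
  then show ?thesis
  proof (rule continuous_on_eq)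
    fix t assume t: "t \<in> {0..T}"
    show "(LBINT \<tau>. indicator {0..T} \<tau> *\<^sub>R (cx (sin (om k * max 0 (t - \<tau>))) * h \<tau> k)) = p t k"
      unfolding pd[OF t] duhamel_def using t by (intro Bochner_Integration.integral_cong refl) (auto simp: indicator_def max_def)
  qed
qed

lemma norm_p_continuous: "continuous_on {0..T} (\<lambda>t. l2norm (p t))"
proof -
  have "continuous_on {0..T} (\<lambda>t. LBINT k. cx ((norm (p t k))\<^sup>2))"
  proof (rule continuous_on_integral_dominated)
    show "integrable lborel (\<lambda>k. (Bp k)\<^sup>2)" using Bp(1) by (simp add: square_integrable_def)
    show "AE k in lborel. \<forall>t\<in>{0..T}. norm (cx ((norm (p t k))\<^sup>2)) \<le> (Bp k)\<^sup>2"
      using pq_bound(1) by (auto intro!: AE_I2 power_mono simp: norm_power)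
    show "AE k in lborel. continuous_on {0..T} (\<lambda>t. cx ((norm (p t k))\<^sup>2))"
      by (intro AE_I2 continuous_intros p_continuous)
    show "(\<lambda>k. cx ((norm (p t k))\<^sup>2)) \<in> borel_measurable borel" for t using pt[of t] by measurable
  qed
  then have "continuous_on {0..T} (\<lambda>t. Re (LBINT k. cx ((norm (p t k))\<^sup>2)))" by (intro continuous_intros)
  then have "continuous_on {0..T} (\<lambda>t. sqrt (LBINT k. (norm (p t k))\<^sup>2))"
    unfolding integral_complex_of_real by (intro continuous_intros) simp
  then show ?thesis by (simp add: l2norm_def)
qed

lemma V_continuous: "continuous_on {0..T} (\<lambda>t. V t k)"
  using Vd has_vector_derivative_continuous continuous_on_eq_continuous_within by blast

lemma PW_bound: "norm (PW f k) \<le> norm (f k)"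
  using mult_left_mono[OF W_ge_1[of k] norm_ge_zero[of "f k"]] by (simp add: PW_def norm_divide divide_le_eq)

lemma H_continuous: "continuous_on {0..T} (\<lambda>t. H t (p t) k)"
proof -
  have PWc: "continuous_on {0..T} (\<lambda>t. PW (p t) k)" for k
    unfolding PW_def by (intro continuous_intros p_continuous) simp
  have rc: "continuous_on {0..T} (\<lambda>t. PW (ret \<rho> (p t)) k)" for k
    unfolding PW_def ret_def using \<rho> by (intro continuous_intros p_continuous norm_p_continuous) (auto simp: max_def)
  have rb: "norm (PW (ret \<rho> (p t)) k) \<le> Bp k" if "t \<in> {0..T}" for t k
  proof -
    have "norm (ret \<rho> (p t) k) \<le> norm (p t k)"
    proof -
      have "\<bar>1 / max 1 (l2norm (p t) / \<rho>)\<bar> \<le> 1" by (simp add: max_def)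
      from mult_right_mono[OF this norm_ge_zero[of "p t k"]] show ?thesis unfolding ret_def norm_mult norm_of_real by simp
    qed
    then show ?thesis using PW_bound[of "ret \<rho> (p t)" k] pq_bound(1)[OF that, of k] by linarith
  qed
  have pb: "norm (PW (p t) k) \<le> Bp k" if "t \<in> {0..T}" for t k
    using PW_bound[of "p t" k] pq_bound(1)[OF that, of k] by linarith
  have rm: "PW (ret \<rho> (p t)) \<in> borel_measurable borel" for t
    unfolding ret_def[abs_def] PW_def[abs_def] using pt[of t] by measurable
  have 1: "continuous_on {0..T} (\<lambda>t. conv (V t) (PW (p t)) k)"
    by (rule conv_time_continuous[OF Vt PW_measurable[OF pt] _ _ _ _ Bs0(1) Bp(1)]) (use V_continuous PWc Vb pb in auto)
  have 2: "continuous_on {0..T} (\<lambda>t. conv (PW (ret \<rho> (p t))) (PW (ret \<rho> (p t))) k)"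
    by (rule conv_time_continuous[OF rm rm _ _ _ _ Bp(1) Bp(1)]) (use rc rb in auto)
  show ?thesis unfolding H_def Hl_def Hq_def Hs_def by (intro continuous_intros 1 2 V_continuous)
qed

lemma h_continuous: "AE k in lborel. continuous_on {0..T} (\<lambda>t. h t k)"
  using hH by eventually_elim (rule continuous_on_eq[OF H_continuous], simp)

lemma pq_deriv:
  "AE k in lborel. \<forall>t\<in>{0..T}. ((\<lambda>t. p t k) has_vector_derivative om k * q t k) (at t within {0..T}) \<and>
     ((\<lambda>t. q t k) has_vector_derivative h t k - om k * p t k) (at t within {0..T})"
  using h_continuous
proof (eventually_elim, intro ballI conjI)
  fix k t assume h: "continuous_on {0..T} (\<lambda>t. h t k)" and t: "t \<in> {0..T}"
  show "((\<lambda>t. p t k) has_vector_derivative om k * q t k) (at t within {0..T})"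
    by (rule has_vector_derivative_transform[OF t pd]) (use duhamel_ode(1)[where h=h and k=k and t=t, OF h t] in \<open>auto simp: q_def\<close>)
  show "((\<lambda>t. q t k) has_vector_derivative h t k - om k * p t k) (at t within {0..T})"
    unfolding q_def pd[OF t] by (rule duhamel_ode(2)[where h=h and k=k and t=t, OF h t])
qed

end

lemma AE_lborel_pair:
  assumes "AE x in lborel. P (x :: real)"
  shows "AE z in lborel \<Otimes>\<^sub>M (lborel :: real measure). P (fst z)"
    "AE z in (lborel :: real measure) \<Otimes>\<^sub>M lborel. P (snd z)"
proof -
  obtain N where N: "{x \<in> space lborel. \<not> P x} \<subseteq> N" "emeasure lborel N = 0" "N \<in> sets lborel"
    using assms by (rule AE_E)
  have N1: "N \<times> UNIV \<in> null_sets (lborel \<Otimes>\<^sub>M (lborel :: real measure))"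
    "UNIV \<times> N \<in> null_sets ((lborel :: real measure) \<Otimes>\<^sub>M lborel)"
    using N lborel.emeasure_pair_measure_Times[of N lborel UNIV] lborel.emeasure_pair_measure_Times[of UNIV lborel N]
    by (auto simp: null_sets_def)
  show "AE z in lborel \<Otimes>\<^sub>M (lborel :: real measure). P (fst z)"
    by (rule AE_I'[OF N1(1)]) (use N(1) in auto)
  show "AE z in (lborel :: real measure) \<Otimes>\<^sub>M lborel. P (snd z)"
    by (rule AE_I'[OF N1(2)]) (use N(1) in auto)
qed

lemma trilinear_complex:
  fixes G :: "real \<times> real \<Rightarrow> complex"
  assumes Gm [measurable]: "G \<in> borel_measurable (borel \<Otimes>\<^sub>M borel)"
    and le: "\<And>k l. norm (G (k, l)) \<le> u k * a (k - l) * b l"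
    and a: "integrable lborel a" "\<And>x. a x \<ge> 0" and b: "L2 b" "\<And>x. b x \<ge> 0"
    and u: "L2 u" "\<And>x. u x \<ge> 0"
  shows "(\<integral>\<^sup>+ z. ennreal (norm (G z)) \<partial>(lborel \<Otimes>\<^sub>M lborel)) \<le> ennreal (l2norm u * ((LBINT x. a x) * l2norm b))"
    "integrable (lborel \<Otimes>\<^sub>M lborel) G"
    "norm (integral\<^sup>L (lborel \<Otimes>\<^sub>M lborel) G) \<le> l2norm u * ((LBINT x. a x) * l2norm b)"
    "integral\<^sup>L (lborel \<Otimes>\<^sub>M lborel) G = (LBINT k. LBINT l. G (k, l))"
proof -
  have m [measurable]: "G \<in> borel_measurable (lborel \<Otimes>\<^sub>M lborel)" by measurable
  have "(\<integral>\<^sup>+ z. ennreal (norm (G z)) \<partial>(lborel \<Otimes>\<^sub>M lborel)) \<le> (\<integral>\<^sup>+ z. ennreal (u (fst z) * a (fst z - snd z) * b (snd z)) \<partial>(lborel \<Otimes>\<^sub>M lborel))"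
  proof (intro nn_integral_mono ennreal_leI)
    fix z :: "real \<times> real"
    show "norm (G z) \<le> u (fst z) * a (fst z - snd z) * b (snd z)" using le[of "fst z" "snd z"] by simp
  qed
  also note trilinear[OF a b u]
  finally show 1: "(\<integral>\<^sup>+ z. ennreal (norm (G z)) \<partial>(lborel \<Otimes>\<^sub>M lborel)) \<le> ennreal (l2norm u * ((LBINT x. a x) * l2norm b))" .
  show I: "integrable (lborel \<Otimes>\<^sub>M lborel) G"
    by (rule integrableI_bounded[OF m]) (rule le_less_trans[OF 1], simp)
  have "ennreal (\<integral>z. norm (G z) \<partial>(lborel \<Otimes>\<^sub>M lborel)) \<le> ennreal (l2norm u * ((LBINT x. a x) * l2norm b))"
    using 1 nn_integral_eq_integral[OF Bochner_Integration.integrable_norm[OF I]] by simp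
  moreover have "0 \<le> l2norm u * ((LBINT x. a x) * l2norm b)"
    using a by (intro mult_nonneg_nonneg Bochner_Integration.integral_nonneg) auto
  ultimately have "(\<integral>z. norm (G z) \<partial>(lborel \<Otimes>\<^sub>M lborel)) \<le> l2norm u * ((LBINT x. a x) * l2norm b)"
    by (simp add: ennreal_le_iff)
  then show "norm (integral\<^sup>L (lborel \<Otimes>\<^sub>M lborel) G) \<le> l2norm u * ((LBINT x. a x) * l2norm b)"
    using integral_norm_bound[of "lborel \<Otimes>\<^sub>M lborel" G] by linarith
  show "integral\<^sup>L (lborel \<Otimes>\<^sub>M lborel) G = (LBINT k. LBINT l. G (k, l))"
    by (rule lborel_pair.integral_fst'[OF I, symmetric])
qed

lemma wt_1_scale_ge:
  assumes e: "e > 0" "e \<le> 1"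
  shows "wt 1 k \<le> wt 1 (e * k) / e"
proof -
  have sq: "(wt 1 z)\<^sup>2 = 1 + z\<^sup>2" for z using one_plus_square_pos[of z] by (simp add: wt_square)
  have "(e * wt 1 k)\<^sup>2 = e\<^sup>2 + (e * k)\<^sup>2" by (simp add: power_mult_distrib sq algebra_simps)
  also have "\<dots> \<le> (wt 1 (e * k))\<^sup>2" unfolding sq using e by (simp add: power_le_one)
  finally have "e * wt 1 k \<le> wt 1 (e * k)" by (rule power2_le_imp_le) simp
  then show ?thesis using e by (simp add: le_divide_eq mult.commute)
qed

lemma inner_product_nn_bound:
  fixes f g :: "real \<Rightarrow> complex"
  assumes f: "L2 f" and g: "L2 g"
  shows "(\<integral>\<^sup>+ k. ennreal (norm (f k * cnj (g k) + g k * cnj (f k))) \<partial>lborel) \<le> ennreal (2 * (l2norm f * l2norm g))"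
    "integrable lborel (\<lambda>k. f k * cnj (g k))" "norm (LBINT k. f k * cnj (g k)) \<le> l2norm f * l2norm g"
    "(LBINT k. f k * cnj (g k) + g k * cnj (f k)) = (LBINT k. f k * cnj (g k)) + cnj (LBINT k. f k * cnj (g k))"
proof -
  note cs = cauchy_schwarz[OF f g]
  have "norm (f k * cnj (g k) + g k * cnj (f k)) \<le> 2 * (norm (f k) * norm (g k))" for k
    using norm_triangle_ineq[of "f k * cnj (g k)" "g k * cnj (f k)"] by (simp add: norm_mult)
  then have "(\<integral>\<^sup>+ k. ennreal (norm (f k * cnj (g k) + g k * cnj (f k))) \<partial>lborel) \<le> (\<integral>\<^sup>+ k. ennreal (2 * (norm (f k) * norm (g k))) \<partial>lborel)"
    by (intro nn_integral_mono ennreal_leI)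
  also have "\<dots> = ennreal (LBINT k. 2 * (norm (f k) * norm (g k)))"
    by (rule nn_integral_eq_integral) (use cs(1) in auto)
  also have "\<dots> \<le> ennreal (2 * (l2norm f * l2norm g))" using cs(2) by (intro ennreal_leI) simp
  finally show "(\<integral>\<^sup>+ k. ennreal (norm (f k * cnj (g k) + g k * cnj (f k))) \<partial>lborel) \<le> ennreal (2 * (l2norm f * l2norm g))" .
  have g': "L2 (\<lambda>k. cnj (g k))" "l2norm (\<lambda>k. cnj (g k)) = l2norm g"
    using L2_cnj(1)[OF g] by (auto simp: l2norm_def)
  show I: "integrable lborel (\<lambda>k. f k * cnj (g k))" and "norm (LBINT k. f k * cnj (g k)) \<le> l2norm f * l2norm g"
    using cauchy_schwarz_mult[OF f g'(1)] g'(2) by auto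
  have "integrable lborel (\<lambda>k. cnj (f k * cnj (g k)))" using I by (simp only: integrable_cnj)
  then have I2: "integrable lborel (\<lambda>k. g k * cnj (f k))" by (simp add: mult.commute)
  have "(LBINT k. g k * cnj (f k)) = cnj (LBINT k. f k * cnj (g k))"
    unfolding Bochner_Integration.integral_cnj[symmetric] by (simp add: mult.commute)
  then show "(LBINT k. f k * cnj (g k) + g k * cnj (f k)) = (LBINT k. f k * cnj (g k)) + cnj (LBINT k. f k * cnj (g k))"
    using I I2 by simp
qed

context error_flow
begin

text \<open>Dividing by \<open>wt 1 (eps * k)\<close> turns \<open>om\<close> into
  \<open>\<bar>k\<bar>\<close>, so the time derivative of \<open>av\<close> is
  \<open>\<bar>k\<bar> * q\<close>. This is the factor left in the linear term once the remaining
  weight has been commuted past the convolution.\<close>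

definition av :: "real \<Rightarrow> real \<Rightarrow> complex"
  where "av t k = cx (1 / wt 1 (eps * k)) * p t k"

lemma am: "jointly_measurable av"
proof -
  note [measurable] = pm
  show ?thesis unfolding av_def by measurable
qed

lemmas avt = measurable_joint_sections(1)[OF am]

lemma av_le: "norm (av t k) \<le> norm (p t k)"
proof -
  have "1 / wt 1 (eps * k) \<le> 1" using wt_ge_1[of 1 "eps * k"] by (simp add: divide_le_eq)
  then show ?thesis using mult_right_mono[of "1 / wt 1 (eps * k)" 1 "norm (p t k)"] by (simp add: av_def norm_divide)
qed

lemma wt_av_le: "wt 1 k * norm (av t k) \<le> norm (p t k) / eps"
proof -
  have "wt 1 k * norm (av t k) \<le> (wt 1 (eps * k) / eps) * norm (av t k)"
    by (intro mult_right_mono wt_1_scale_ge eps) auto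
  also have "\<dots> = norm (p t k) / eps" by (simp add: av_def norm_divide)
  finally show ?thesis .
qed

lemma av_square_integrable: "L2 (av t)" "l2norm (av t) \<le> l2norm (p t)"
  using L2_mono[OF ps avt] av_le by blast+

lemma av_PW: "cx (wt s (eps * l)) * PW (p t) l = av t l"
  using wt_nonzero[of s "eps * l"] by (simp add: PW_def av_def wt_add)

lemma av_deriv:
  "AE k in lborel. \<forall>t\<in>{0..T}. ((\<lambda>t. av t k) has_vector_derivative cx \<bar>k\<bar> * q t k) (at t within {0..T})"
  using pq_deriv
proof eventually_elim
  case (elim k)
  show ?case
  proof
    fix t assume "t \<in> {0..T}"
    then have "((\<lambda>t. p t k) has_vector_derivative om k * q t k) (at t within {0..T})" using elim by blast
    from bounded_linear.has_vector_derivative[OF bounded_linear_mult_right this, of "cx (1 / wt 1 (eps * k))"]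
    show "((\<lambda>t. av t k) has_vector_derivative cx \<bar>k\<bar> * q t k) (at t within {0..T})"
      unfolding av_def[abs_def] om_def by simp
  qed
qed

lemma q_continuous: "AE k in lborel. continuous_on {0..T} (\<lambda>t. q t k)"
  by (rule AE_derivative_continuous[where f'="\<lambda>t k. h t k - om k * p t k"]) (use pq_deriv in eventually_elim, blast)

lemma duhamel_0: "duhamel \<kappa> h 0 k = 0"
proof -
  have "AE \<tau> in lborel. (if 0 \<le> \<tau> \<and> \<tau> \<le> 0 then \<kappa> (0 - \<tau>) k * h \<tau> k else 0) = 0"
    using AE_lborel_singleton[of 0] by eventually_elim auto
  then show ?thesis unfolding duhamel_def by (rule integral_eq_zero_AE)
qed

lemma q_0: "q 0 k = 0" and p_0: "p 0 k = 0"
proof -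
  show "q 0 k = 0" unfolding q_def by (rule duhamel_0)
  have "p 0 k = duhamel ksin h 0 k" by (rule pd) (use T in auto)
  then show "p 0 k = 0" by (simp only: duhamel_0)
qed

lemma pq_norm_bound:
  assumes t: "t \<in> {0..T}"
  shows "l2norm (p t) \<le> l2norm Bp" "l2norm (q t) \<le> l2norm Bp"
proof -
  have "norm (p t k) \<le> norm (Bp k)" "norm (q t k) \<le> norm (Bp k)" for k
    using pq_bound[OF t, of k] Bp(2)[of k] by auto
  then show "l2norm (p t) \<le> l2norm Bp" "l2norm (q t) \<le> l2norm Bp"
    by (intro L2_mono(2)[OF Bp(1)] pt qt AE_I2; blast)+
qed

lemma H_norm_bound:
  assumes t: "t \<in> {0..T}"
  shows "l2norm (H t (p t)) \<le> 2 * (CL / eps * l2norm Bp) + CQ * \<rho> / eps * l2norm Bp + eps\<^sup>2 * A"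
proof -
  note L = L2_cmult[OF Hl_bound(1)[OF ps[of t], of t], of 2]
  note LQ = L2_add[OF L(1) Hq_bound(1)[OF ps[of t]]]
  have "l2norm (H t (p t)) \<le> 2 * l2norm (Hl t (p t)) + l2norm (Hq (p t)) + l2norm (Hs t)"
    unfolding H_def[abs_def] using L2_add(2)[OF LQ(1) Hs_bound(1)[of t]] LQ(2) unfolding L(2) by simp
  moreover have "CL / eps * l2norm (p t) \<le> CL / eps * l2norm Bp" "CQ * \<rho> / eps * l2norm (p t) \<le> CQ * \<rho> / eps * l2norm Bp"
    using pq_norm_bound(1)[OF t] CL0 CQ0 eps \<rho> by (intro mult_left_mono; simp)+
  ultimately show ?thesis using Hl_bound(2)[OF ps[of t], of t] Hq_bound(2)[OF ps[of t]] Hs_bound(2)[of t] by linarith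
qed

text \<open>The terms with \<open>om\<close> cancel between \<open>p\<close> and \<open>q\<close>,
  so the energy changes only through the source.\<close>

lemma norm_flow:
  assumes t: "t \<in> {0..T}"
  shows "(LBINT k. p t k * cnj (p t k) + q t k * cnj (q t k)) =
      (LBINT \<tau>:{0..t}. (LBINT k. H \<tau> (p \<tau>) k * cnj (q \<tau> k) + q \<tau> k * cnj (H \<tau> (p \<tau>) k)))" (is "?A = ?B")
    "set_integrable lborel {0..t} (\<lambda>\<tau>. LBINT k. H \<tau> (p \<tau>) k * cnj (q \<tau> k) + q \<tau> k * cnj (H \<tau> (p \<tau>) k))" (is ?I)
proof -
  note [measurable] = pt qt pm qm
  have Hm [measurable]: "jointly_measurable (\<lambda>t. H t (p t))" by (rule H_measurable[OF pm])
  define C where "C = 2 * ((2 * (CL / eps * l2norm Bp) + CQ * \<rho> / eps * l2norm Bp + eps\<^sup>2 * A) * l2norm Bp)"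
  have sf: "sigma_finite_measure (lborel :: real measure)" by (rule lborel.sigma_finite_measure_axioms)
  have d: "AE k in lborel. \<forall>t\<in>{0..T}. ((\<lambda>t. p t k * cnj (p t k) + q t k * cnj (q t k)) has_vector_derivative
      H t (p t) k * cnj (q t k) + q t k * cnj (H t (p t) k)) (at t within {0..T})"
    using pq_deriv hH
  proof eventually_elim
    case (elim k)
    show ?case
    proof
      fix t assume t: "t \<in> {0..T}"
      have P: "((\<lambda>t. p t k) has_vector_derivative om k * q t k) (at t within {0..T})"
        and Q: "((\<lambda>t. q t k) has_vector_derivative H t (p t) k - om k * p t k) (at t within {0..T})" using elim t by auto
      note Pc = bounded_linear.has_vector_derivative[OF bounded_linear_cnj P]
        and Qc = bounded_linear.has_vector_derivative[OF bounded_linear_cnj Q]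
      show "((\<lambda>t. p t k * cnj (p t k) + q t k * cnj (q t k)) has_vector_derivative
          H t (p t) k * cnj (q t k) + q t k * cnj (H t (p t) k)) (at t within {0..T})"
        by (rule has_vector_derivative_eq_rhs[OF has_vector_derivative_add[OF has_vector_derivative_mult[OF P Pc] has_vector_derivative_mult[OF Q Qc]]])
          (simp add: algebra_simps)
    qed
  qed
  have c: "AE k in lborel. continuous_on {0..T} (\<lambda>t. H t (p t) k * cnj (q t k) + q t k * cnj (H t (p t) k))"
    using q_continuous by eventually_elim (intro continuous_intros H_continuous)
  have b: "(\<integral>\<^sup>+ k. ennreal (norm (H \<tau> (p \<tau>) k * cnj (q \<tau> k) + q \<tau> k * cnj (H \<tau> (p \<tau>) k))) \<partial>lborel) \<le> ennreal C"
    if t: "\<tau> \<in> {0..T}" for \<tau>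
  proof -
    have "l2norm (H \<tau> (p \<tau>)) * l2norm (q \<tau>) \<le> (2 * (CL / eps * l2norm Bp) + CQ * \<rho> / eps * l2norm Bp + eps\<^sup>2 * A) * l2norm Bp"
      by (intro mult_mono' H_norm_bound pq_norm_bound t) auto
    then have "ennreal (2 * (l2norm (H \<tau> (p \<tau>)) * l2norm (q \<tau>))) \<le> ennreal C" unfolding C_def by (intro ennreal_leI) simp
    with inner_product_nn_bound(1)[OF H_square_integrable[OF ps] qs[OF t]] show ?thesis by (rule order_trans)
  qed
  have m: "(\<lambda>(t, k). H t (p t) k * cnj (q t k) + q t k * cnj (H t (p t) k)) \<in> borel_measurable (lborel \<Otimes>\<^sub>M lborel)" by measurable
  have fm: "(\<lambda>k. p t k * cnj (p t k) + q t k * cnj (q t k)) \<in> borel_measurable lborel" for t by measurable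
  have z: "p 0 k * cnj (p 0 k) + q 0 k * cnj (q 0 k) = 0" for k by (simp add: p_0 q_0)
  show "?A = ?B" by (rule time_integral_swap(1)[OF sf d c z fm m b t])
  show ?I by (rule time_integral_swap(2)[OF sf d c z fm m b t])
qed

text \<open>\<open>G1\<close>, \<open>G2\<close> and \<open>G3\<close> are the three terms of the
  product rule for the interaction form: the derivative falls on the first \<open>av\<close>, on the
  profile, or on the second \<open>av\<close>.\<close>

definition G1 :: "real \<Rightarrow> real \<times> real \<Rightarrow> complex"
  where "G1 t z = cnj (cx \<bar>fst z\<bar> * q t (fst z)) * V t (fst z - snd z) * av t (snd z)"
definition G2 :: "real \<Rightarrow> real \<times> real \<Rightarrow> complex"
  where "G2 t z = cnj (av t (fst z)) * V' t (fst z - snd z) * av t (snd z)"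
definition G3 :: "real \<Rightarrow> real \<times> real \<Rightarrow> complex"
  where "G3 t z = cnj (av t (fst z)) * V t (fst z - snd z) * (cx \<bar>snd z\<bar> * q t (snd z))"

lemma G_measurable:
  "(\<lambda>(t, z). G1 t z) \<in> borel_measurable (borel \<Otimes>\<^sub>M (borel \<Otimes>\<^sub>M borel))"
  "(\<lambda>(t, z). G2 t z) \<in> borel_measurable (borel \<Otimes>\<^sub>M (borel \<Otimes>\<^sub>M borel))"
  "(\<lambda>(t, z). G3 t z) \<in> borel_measurable (borel \<Otimes>\<^sub>M (borel \<Otimes>\<^sub>M borel))"
  "G1 t \<in> borel_measurable (borel \<Otimes>\<^sub>M borel)" "G2 t \<in> borel_measurable (borel \<Otimes>\<^sub>M borel)" "G3 t \<in> borel_measurable (borel \<Otimes>\<^sub>M borel)"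
proof -
  note [measurable] = am qm Vm V'm avt qt Vt V't cnj_measurable
  show "(\<lambda>(t, z). G1 t z) \<in> borel_measurable (borel \<Otimes>\<^sub>M (borel \<Otimes>\<^sub>M borel))"
    "(\<lambda>(t, z). G2 t z) \<in> borel_measurable (borel \<Otimes>\<^sub>M (borel \<Otimes>\<^sub>M borel))"
    "(\<lambda>(t, z). G3 t z) \<in> borel_measurable (borel \<Otimes>\<^sub>M (borel \<Otimes>\<^sub>M borel))"
    unfolding G1_def G2_def G3_def by measurable
  show "G1 t \<in> borel_measurable (borel \<Otimes>\<^sub>M borel)" "G2 t \<in> borel_measurable (borel \<Otimes>\<^sub>M borel)" "G3 t \<in> borel_measurable (borel \<Otimes>\<^sub>M borel)"
    unfolding G1_def[abs_def] G2_def[abs_def] G3_def[abs_def] by measurable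
qed

lemma abs_split: "\<bar>k\<bar> \<le> 2 powr (1 / 2) * (wt 1 (k - l) * wt 1 l)"
  using abs_le_wt_1[of k] wt_submult[of 1 "k - l" l] by simp

text \<open>A majorant for splitting \<open>\<bar>k\<bar>\<close> between the profile and
  \<open>av\<close>, which costs \<open>1 / eps\<close>. Such bounds justify Fubini at fixed
  \<open>eps\<close>; the uniform estimate comes from the cancellation in
  \<open>energy_derivative\<close>.\<close>

definition Vw :: "real \<Rightarrow> real \<Rightarrow> real"
  where "Vw t m = 2 powr (1 / 2) / eps * (wt 1 m * norm (V t m))"

lemma Vw: "integrable lborel (Vw t)" "Vw t m \<ge> 0" "(LBINT m. Vw t m) \<le> 2 powr (1 / 2) / eps * (K0 * A)"
proof -
  have r: "1 \<le> 2 + s" using s by simp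
  note I = V_weighted[OF r, of t]
  show "integrable lborel (Vw t)" unfolding Vw_def[abs_def] using I(1) by simp
  show "Vw t m \<ge> 0" using eps by (simp add: Vw_def)
  show "(LBINT m. Vw t m) \<le> 2 powr (1 / 2) / eps * (K0 * A)"
    unfolding Vw_def[abs_def] using mult_left_mono[OF I(2), of "2 powr (1 / 2) / eps"] eps by simp
qed

lemma G1_bound: "norm (G1 t (k, l)) \<le> norm (q t k) * Vw t (k - l) * norm (p t l)"
proof -
  have "norm (G1 t (k, l)) = norm (q t k) * norm (V t (k - l)) * (\<bar>k\<bar> * norm (av t l))"
    by (simp add: G1_def norm_mult mult_ac)
  moreover have "\<bar>k\<bar> * norm (av t l) \<le> 2 powr (1 / 2) * wt 1 (k - l) * (norm (p t l) / eps)"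
  proof -
    have "\<bar>k\<bar> * norm (av t l) \<le> 2 powr (1 / 2) * (wt 1 (k - l) * wt 1 l) * norm (av t l)"
      by (intro mult_right_mono abs_split) auto
    also have "\<dots> = 2 powr (1 / 2) * wt 1 (k - l) * (wt 1 l * norm (av t l))" by (simp add: mult_ac)
    also have "\<dots> \<le> 2 powr (1 / 2) * wt 1 (k - l) * (norm (p t l) / eps)" by (intro mult_left_mono wt_av_le) auto
    finally show ?thesis .
  qed
  then have "norm (q t k) * norm (V t (k - l)) * (\<bar>k\<bar> * norm (av t l)) \<le>
      norm (q t k) * norm (V t (k - l)) * (2 powr (1 / 2) * wt 1 (k - l) * (norm (p t l) / eps))"
    by (rule mult_left_mono) simp
  ultimately show ?thesis by (simp add: Vw_def mult_ac)
qed

lemma G2_bound: "norm (G2 t (k, l)) \<le> norm (p t k) * B (k - l) * norm (p t l)"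
  unfolding G2_def norm_mult complex_mod_cnj using V'b[of t "k - l"] B0[of "k - l"] by (auto intro!: mult_mono av_le)

lemma G3_bound: "norm (G3 t (k, l)) \<le> norm (p t k) * Vw t (k - l) * norm (q t l)"
proof -
  have Vm: "norm (V t (k - l)) = norm (V t (l - k))" using Vh[of t "l - k"] by simp
  have Vm': "Vw t (k - l) = Vw t (l - k)" using Vm wt_minus[of 1 "l - k"] by (simp add: Vw_def)
  have "norm (G3 t (k, l)) = norm (G1 t (l, k))" unfolding G1_def G3_def using Vm by (simp add: norm_mult mult_ac)
  also have "\<dots> \<le> norm (q t l) * Vw t (l - k) * norm (p t k)" by (rule G1_bound)
  finally show ?thesis using Vm' by (simp add: mult_ac)
qed

lemmas G1_facts = trilinear_complex[OF G_measurable(4) G1_bound Vw(1,2) L2_norm(1)[OF ps] norm_ge_zero L2_norm(1)[OF qs] norm_ge_zero, unfolded L2_norm(2)]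
lemmas G2_facts = trilinear_complex[OF G_measurable(5) G2_bound Bs0(2) B0 L2_norm(1)[OF ps] norm_ge_zero L2_norm(1)[OF ps] norm_ge_zero, unfolded L2_norm(2)]
lemmas G3_facts = trilinear_complex[OF G_measurable(6) G3_bound Vw(1,2) L2_norm(1)[OF qs] norm_ge_zero L2_norm(1)[OF ps] norm_ge_zero, unfolded L2_norm(2)]

lemma interaction_flow:
  assumes t: "t \<in> {0..T}"
  shows "(\<integral>z. cnj (av t (fst z)) * V t (fst z - snd z) * av t (snd z) \<partial>(lborel \<Otimes>\<^sub>M lborel)) =
      (LBINT \<tau>:{0..t}. (\<integral>z. G1 \<tau> z + G2 \<tau> z + G3 \<tau> z \<partial>(lborel \<Otimes>\<^sub>M lborel)))" (is "?A = ?B")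
    "set_integrable lborel {0..t} (\<lambda>\<tau>. \<integral>z. G1 \<tau> z + G2 \<tau> z + G3 \<tau> z \<partial>(lborel \<Otimes>\<^sub>M lborel))" (is ?I)
proof -
  define N where "N = l2norm Bp"
  define X where "X = N * ((2 powr (1 / 2) / eps * (K0 * A)) * N)"
  define Y where "Y = N * ((LBINT x. B x) * N)"
  have KA: "2 powr (1 / 2) / eps * (K0 * A) \<ge> 0" using order_trans[OF _ Vw(3)[of 0]] Vw(2) by (simp add: Bochner_Integration.integral_nonneg)
  have IB: "(LBINT x. B x) \<ge> 0" using B0 by (simp add: Bochner_Integration.integral_nonneg)
  have sf: "sigma_finite_measure ((lborel :: real measure) \<Otimes>\<^sub>M (lborel :: real measure))"
    by (rule lborel_pair.P.sigma_finite_measure_axioms)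
  have d: "AE z in lborel \<Otimes>\<^sub>M lborel. \<forall>t\<in>{0..T}. ((\<lambda>t. cnj (av t (fst z)) * V t (fst z - snd z) * av t (snd z)) has_vector_derivative
      G1 t z + G2 t z + G3 t z) (at t within {0..T})"
    using AE_lborel_pair[OF av_deriv]
  proof eventually_elim
    case (elim z)
    show ?case
    proof
      fix t assume t: "t \<in> {0..T}"
      have P: "((\<lambda>t. av t (fst z)) has_vector_derivative cx \<bar>fst z\<bar> * q t (fst z)) (at t within {0..T})"
        and Q: "((\<lambda>t. av t (snd z)) has_vector_derivative cx \<bar>snd z\<bar> * q t (snd z)) (at t within {0..T})" using elim t by auto
      note Pc = bounded_linear.has_vector_derivative[OF bounded_linear_cnj P]
      show "((\<lambda>t. cnj (av t (fst z)) * V t (fst z - snd z) * av t (snd z)) has_vector_derivative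
          G1 t z + G2 t z + G3 t z) (at t within {0..T})"
        by (rule has_vector_derivative_eq_rhs[OF has_vector_derivative_mult[OF has_vector_derivative_mult[OF Pc Vd[OF t, of "fst z - snd z"]] Q]])
          (simp add: G1_def G2_def G3_def algebra_simps)
    qed
  qed
  have c: "AE z in lborel \<Otimes>\<^sub>M lborel. continuous_on {0..T} (\<lambda>t. G1 t z + G2 t z + G3 t z)"
    using AE_lborel_pair[OF q_continuous] unfolding G1_def G2_def G3_def av_def
    by eventually_elim (intro continuous_intros p_continuous V_continuous V'c)
  have b: "(\<integral>\<^sup>+ z. ennreal (norm (G1 \<tau> z + G2 \<tau> z + G3 \<tau> z)) \<partial>(lborel \<Otimes>\<^sub>M lborel)) \<le> ennreal (X + Y + X)"
    if t: "\<tau> \<in> {0..T}" for \<tau>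
  proof -
    note [measurable] = G_measurable(4,5,6)
    have m: "G1 \<tau> \<in> borel_measurable (lborel \<Otimes>\<^sub>M lborel)" "G2 \<tau> \<in> borel_measurable (lborel \<Otimes>\<^sub>M lborel)" "G3 \<tau> \<in> borel_measurable (lborel \<Otimes>\<^sub>M lborel)"
      by measurable
    have "(\<integral>\<^sup>+ z. ennreal (norm (G1 \<tau> z + G2 \<tau> z + G3 \<tau> z)) \<partial>(lborel \<Otimes>\<^sub>M lborel)) \<le>
       (\<integral>\<^sup>+ z. ennreal (norm (G1 \<tau> z)) + ennreal (norm (G2 \<tau> z)) + ennreal (norm (G3 \<tau> z)) \<partial>(lborel \<Otimes>\<^sub>M lborel))"
    proof (rule nn_integral_mono)
      fix z
      have "norm (G1 \<tau> z + G2 \<tau> z + G3 \<tau> z) \<le> norm (G1 \<tau> z) + norm (G2 \<tau> z) + norm (G3 \<tau> z)"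
        using norm_triangle_ineq[of "G1 \<tau> z + G2 \<tau> z" "G3 \<tau> z"] norm_triangle_ineq[of "G1 \<tau> z" "G2 \<tau> z"] by linarith
      then show "ennreal (norm (G1 \<tau> z + G2 \<tau> z + G3 \<tau> z)) \<le> ennreal (norm (G1 \<tau> z)) + ennreal (norm (G2 \<tau> z)) + ennreal (norm (G3 \<tau> z))"
        by (simp flip: ennreal_plus)
    qed
    also have "\<dots> = (\<integral>\<^sup>+ z. ennreal (norm (G1 \<tau> z)) \<partial>(lborel \<Otimes>\<^sub>M lborel)) + (\<integral>\<^sup>+ z. ennreal (norm (G2 \<tau> z)) \<partial>(lborel \<Otimes>\<^sub>M lborel))
        + (\<integral>\<^sup>+ z. ennreal (norm (G3 \<tau> z)) \<partial>(lborel \<Otimes>\<^sub>M lborel))"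
      using m by (simp add: nn_integral_add)
    also have "\<dots> \<le> ennreal X + ennreal Y + ennreal X"
    proof (intro add_mono)
      note n = pq_norm_bound[OF t, folded N_def]
      have "l2norm (q \<tau>) * ((LBINT x. Vw \<tau> x) * l2norm (p \<tau>)) \<le> X"
        unfolding X_def by (intro mult_mono Vw n) (use KA Vw(2) order_trans[OF l2norm_nonneg n(1)] in \<open>auto intro!: mult_nonneg_nonneg Bochner_Integration.integral_nonneg\<close>)
      with G1_facts(1)[OF t] show "(\<integral>\<^sup>+ z. ennreal (norm (G1 \<tau> z)) \<partial>(lborel \<Otimes>\<^sub>M lborel)) \<le> ennreal X"
        using ennreal_leI order_trans by blast
      have "l2norm (p \<tau>) * ((LBINT x. Vw \<tau> x) * l2norm (q \<tau>)) \<le> X"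
        unfolding X_def by (intro mult_mono Vw n) (use KA Vw(2) order_trans[OF l2norm_nonneg n(1)] in \<open>auto intro!: mult_nonneg_nonneg Bochner_Integration.integral_nonneg\<close>)
      with G3_facts(1)[OF t] show "(\<integral>\<^sup>+ z. ennreal (norm (G3 \<tau> z)) \<partial>(lborel \<Otimes>\<^sub>M lborel)) \<le> ennreal X"
        using ennreal_leI order_trans by blast
      have "l2norm (p \<tau>) * ((LBINT x. B x) * l2norm (p \<tau>)) \<le> Y"
        unfolding Y_def by (intro mult_mono n) (use IB order_trans[OF l2norm_nonneg n(1)] in auto)
      with G2_facts(1) show "(\<integral>\<^sup>+ z. ennreal (norm (G2 \<tau> z)) \<partial>(lborel \<Otimes>\<^sub>M lborel)) \<le> ennreal Y"
        using ennreal_leI order_trans by blast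
    qed
    also have "\<dots> = ennreal (X + Y + X)"
    proof -
      have "X \<ge> 0" unfolding X_def N_def by (rule mult_nonneg_nonneg[OF l2norm_nonneg mult_nonneg_nonneg[OF KA l2norm_nonneg]])
      moreover have "Y \<ge> 0" unfolding Y_def N_def by (rule mult_nonneg_nonneg[OF l2norm_nonneg mult_nonneg_nonneg[OF IB l2norm_nonneg]])
      ultimately show ?thesis by (simp flip: ennreal_plus)
    qed
    finally show ?thesis .
  qed
  have m: "(\<lambda>(t, z). G1 t z + G2 t z + G3 t z) \<in> borel_measurable (lborel \<Otimes>\<^sub>M (lborel \<Otimes>\<^sub>M lborel))"
  proof -
    note [measurable] = G_measurable(1,2,3)
    show ?thesis by measurable
  qed
  have fm: "(\<lambda>z. cnj (av t (fst z)) * V t (fst z - snd z) * av t (snd z)) \<in> borel_measurable (lborel \<Otimes>\<^sub>M lborel)" for t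
  proof -
    note [measurable] = avt[of t] Vt[of t] cnj_measurable
    show ?thesis by measurable
  qed
  have z: "cnj (av 0 (fst z)) * V 0 (fst z - snd z) * av 0 (snd z) = 0" for z by (simp add: av_def p_0)
  show "?A = ?B" by (rule time_integral_swap(1)[OF sf d c z fm m b t])
  show ?I by (rule time_integral_swap(2)[OF sf d c z fm m b t])
qed

text \<open>Exchanging the two frequencies maps \<open>V t (k - l)\<close> to its conjugate because
  \<open>U\<close> is real. The two dangerous terms therefore add up in the real part.\<close>

lemma G3_eq_cnj_G1:
  assumes t: "t \<in> {0..T}"
  shows "integral\<^sup>L (lborel \<Otimes>\<^sub>M lborel) (G3 t) = cnj (integral\<^sup>L (lborel \<Otimes>\<^sub>M lborel) (G1 t))"
proof -
  have "integral\<^sup>L (lborel \<Otimes>\<^sub>M lborel) (G3 t) = (\<integral>(x, y). G3 t (y, x) \<partial>(lborel \<Otimes>\<^sub>M lborel))"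
    using G_measurable(6)[of t] by (intro lborel_pair.integral_product_swap[symmetric]) simp
  also have "\<dots> = (\<integral>z. cnj (G1 t z) \<partial>(lborel \<Otimes>\<^sub>M lborel))"
  proof (intro Bochner_Integration.integral_cong refl)
    fix z :: "real \<times> real"
    have "V t (snd z - fst z) = cnj (V t (fst z - snd z))" using Vh[of t "fst z - snd z"] by simp
    then show "(case z of (x, y) \<Rightarrow> G3 t (y, x)) = cnj (G1 t z)" by (simp add: G1_def G3_def case_prod_unfold)
  qed
  finally show ?thesis by simp
qed

text \<open>The commutator of the weight \<open>wt s\<close> at scaled frequencies with convolution
  by the profile, multiplied by \<open>\<bar>k\<bar>\<close>.\<close>

definition J :: "real \<Rightarrow> real \<Rightarrow> complex"
  where "J t k = (LBINT l. cx (\<bar>k\<bar> * (wt s (eps * l) - wt s (eps * k))) * (V t (k - l) * PW (p t) l))"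

definition Cc :: real where "Cc = max 1 s * 2 powr (s / 2)"

lemma J_bound: "L2 (J t)" "l2norm (J t) \<le> Cc * (K0 * A) * l2norm (p t)"
proof -
  note [measurable] = pt[of t] Vt[of t]
  have Cc: "Cc \<ge> 0" by (simp add: Cc_def)
  define a where "a = (\<lambda>m. Cc * (wt (1 + s) m * norm (V t m)))"
  have V1: "integrable lborel (\<lambda>k. wt (1 + s) k * norm (V t k))" "(LBINT k. wt (1 + s) k * norm (V t k)) \<le> K0 * A"
    by (rule V_weighted; simp)+
  have a: "integrable lborel a" "\<And>m. a m \<ge> 0" "(LBINT m. a m) \<le> Cc * (K0 * A)"
    using V1 Cc mult_left_mono[OF V1(2) Cc] by (auto simp: a_def)
  define G where "G = (\<lambda>k l. cx (\<bar>k\<bar> * (wt s (eps * l) - wt s (eps * k))) * (V t (k - l) * PW (p t) l))"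
  have Gm: "jointly_measurable G" unfolding G_def by measurable
  have le: "norm (G k l) \<le> a (k - l) * norm (p t l)" for k l
  proof -
    have "norm (G k l) = (\<bar>k\<bar> * \<bar>wt s (eps * l) - wt s (eps * k)\<bar>) * (norm (V t (k - l)) * norm (PW (p t) l))"
      by (simp only: G_def norm_mult norm_of_real abs_mult abs_abs)
    also have "\<dots> \<le> (Cc * wt (1 + s) (k - l) * wt s (eps * l)) * (norm (V t (k - l)) * norm (PW (p t) l))"
      unfolding Cc_def by (intro mult_right_mono commutator_kernel eps s) auto
    also have "\<dots> = a (k - l) * norm (cx (wt s (eps * l)) * PW (p t) l)" by (simp add: a_def norm_mult mult_ac)
    also have "\<dots> \<le> a (k - l) * norm (p t l)" unfolding av_PW by (intro mult_left_mono av_le a)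
    finally show ?thesis .
  qed
  note Y = young_kernel[OF Gm le a(1,2) L2_norm(1)[OF ps]]
  have eq: "J t = (\<lambda>k. LBINT l. G k l)" by (simp add: J_def[abs_def] G_def)
  show "L2 (J t)" unfolding eq using Y(1) by simp
  have "l2norm (\<lambda>k. LBINT l. G k l) \<le> (LBINT m. a m) * l2norm (p t)"
    using Y(2) by (simp add: L2_norm(2))
  also have "\<dots> \<le> Cc * (K0 * A) * l2norm (p t)" by (intro mult_right_mono a) auto
  finally show "l2norm (J t) \<le> Cc * (K0 * A) * l2norm (p t)" unfolding eq .
qed

text \<open>Moving the weight of \<open>mul\<close> inside the convolution turns \<open>PW p\<close>
  into \<open>av\<close>. What remains is the bounded commutator and a term of the shape produced by
  \<open>G1\<close>.\<close>

lemma Hl_J: "Hl t (p t) k = c0 * J t k - c0 * (cx \<bar>k\<bar> * conv (V t) (av t) k)"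
proof -
  note I1 = conv_bound(1)[OF V_square_integrable[of t] av_square_integrable(1)[of t], of k]
    and I2 = conv_bound(1)[OF V_square_integrable[of t] PW_facts(1)[OF ps[of t]], of k]
  have "J t k = (LBINT l. cx \<bar>k\<bar> * (V t (k - l) * av t l) - cx (mul k) * (V t (k - l) * PW (p t) l))"
    unfolding J_def av_PW[symmetric] mul_def by (intro Bochner_Integration.integral_cong refl) (simp add: algebra_simps)
  also have "\<dots> = cx \<bar>k\<bar> * conv (V t) (av t) k - cx (mul k) * conv (V t) (PW (p t)) k"
    unfolding conv_def using I1 I2 by simp
  finally have "cx \<bar>k\<bar> * conv (V t) (av t) k = J t k + cx (mul k) * conv (V t) (PW (p t)) k" by simp
  moreover have "- m * (c * v) = c * j - c * (j + m * v)" for m c v j :: complex by (simp add: algebra_simps)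
  ultimately show ?thesis unfolding Hl_def by metis
qed

text \<open>The growth rate: commutator, truncated quadratic term, Young's inequality for the
  residual, and the time derivative of the profile. For \<open>\<rho> = eps powr (3 / 2)\<close> the
  quadratic contribution is free of \<open>eps\<close>.\<close>

definition KE :: real
  where "KE = 2 * Cc * (K0 * A) + CQ * \<rho> / eps + 1 + 2 * (LBINT k. B k)"

text \<open>The linear term, of size \<open>1 / eps\<close>, enters the derivative of the norms
  through \<open>4 * Re Xl\<close>; the correction contributes \<open>4 * Re (c0 * I1)\<close>,
  where \<open>c0 * I1 = c0 * XJ - Xl\<close>. This cancellation dictates the factor
  \<open>2 * c0\<close> in front of the interaction form.\<close>

lemma energy_derivative:
  assumes t: "t \<in> {0..T}"
  shows "Re ((LBINT k. H t (p t) k * cnj (q t k) + q t k * cnj (H t (p t) k))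
      + 2 * c0 * (\<integral>z. G1 t z + G2 t z + G3 t z \<partial>(lborel \<Otimes>\<^sub>M lborel)))
    \<le> KE * ((l2norm (p t))\<^sup>2 + (l2norm (q t))\<^sup>2) + eps ^ 4 * A\<^sup>2"
proof -
  define x y where "x = l2norm (p t)" and "y = l2norm (q t)"
  have xy: "x \<ge> 0" "y \<ge> 0" "2 * (x * y) \<le> x\<^sup>2 + y\<^sup>2" using sum_squares_bound[of x y] by (auto simp: x_def y_def)
  note q = qs[OF t]
  define XH Xl Xq Xs XJ where "XH = (LBINT k. H t (p t) k * cnj (q t k))"
    and "Xl = (LBINT k. Hl t (p t) k * cnj (q t k))" and "Xq = (LBINT k. Hq (p t) k * cnj (q t k))"
    and "Xs = (LBINT k. Hs t k * cnj (q t k))" and "XJ = (LBINT k. J t k * cnj (q t k))"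
  note il = inner_product_nn_bound(2,3)[OF Hl_bound(1)[OF ps] q, of t t]
    and iq = inner_product_nn_bound(2,3)[OF Hq_bound(1)[OF ps] q, of t]
    and is' = inner_product_nn_bound(2,3)[OF Hs_bound(1) q, of t]
    and iJ = inner_product_nn_bound(2,3)[OF J_bound(1) q, of t]
  have XH: "XH = 2 * Xl + Xq + Xs"
    unfolding XH_def H_def Xl_def Xq_def Xs_def using il(1) iq(1) is'(1) by (simp add: distrib_right mult.assoc)
  have IH: "(LBINT k. H t (p t) k * cnj (q t k) + q t k * cnj (H t (p t) k)) = XH + cnj XH"
    unfolding XH_def by (rule inner_product_nn_bound(4)[OF H_square_integrable[OF ps] q])
  define I1 I2 where "I1 = integral\<^sup>L (lborel \<Otimes>\<^sub>M lborel) (G1 t)" and "I2 = integral\<^sup>L (lborel \<Otimes>\<^sub>M lborel) (G2 t)"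
  have I: "(\<integral>z. G1 t z + G2 t z + G3 t z \<partial>(lborel \<Otimes>\<^sub>M lborel)) = I1 + I2 + cnj I1"
    unfolding I1_def I2_def G3_eq_cnj_G1[OF t, symmetric]
    using G1_facts(2)[OF t] G2_facts(2)[of t] G3_facts(2)[OF t] by simp
  have I1: "c0 * I1 = c0 * XJ - Xl"
  proof -
    have "I1 = (LBINT k. LBINT l. G1 t (k, l))" unfolding I1_def by (rule G1_facts(4)[OF t])
    then have "c0 * I1 = (LBINT k. c0 * (LBINT l. G1 t (k, l)))" by simp
    also have "\<dots> = (LBINT k. c0 * (J t k * cnj (q t k)) - Hl t (p t) k * cnj (q t k))"
    proof (intro Bochner_Integration.integral_cong refl)
      fix k
      have "(LBINT l. G1 t (k, l)) = (LBINT l. cnj (cx \<bar>k\<bar> * q t k) * (V t (k - l) * av t l))"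
        by (simp add: G1_def mult.assoc)
      also have "\<dots> = cnj (cx \<bar>k\<bar> * q t k) * conv (V t) (av t) k"
        unfolding conv_def by (rule Bochner_Integration.integral_mult_right) (rule conv_bound(1)[OF V_square_integrable av_square_integrable(1)])
      finally show "c0 * (LBINT l. G1 t (k, l)) = c0 * (J t k * cnj (q t k)) - Hl t (p t) k * cnj (q t k)"
        unfolding Hl_J by (simp add: algebra_simps)
    qed
    also have "\<dots> = c0 * XJ - Xl" unfolding XJ_def Xl_def using il(1) iJ(1) by simp
    finally show ?thesis .
  qed
  have "Re (XH + cnj XH + 2 * c0 * (I1 + I2 + cnj I1)) = 2 * Re XH + 4 * Re (c0 * I1) + 2 * Re (c0 * I2)"
  proof -
    have *: "Re (XH + cnj XH + 2 * c * (I1 + I2 + cnj I1)) = 2 * Re XH + 4 * Re (c * I1) + 2 * Re (c * I2)" if "Im c = 0" for c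
      using that by (simp add: algebra_simps)
    show ?thesis by (rule *) simp
  qed
  \<comment> \<open>The unbounded contribution \<open>Xl\<close> has disappeared; every remaining
    term has a bound that is uniform in \<open>eps\<close> as soon as
    \<open>CQ * \<rho> / eps\<close> is.\<close>
  also have "\<dots> = 4 * Re (c0 * XJ) + 2 * Re Xq + 2 * Re Xs + 2 * Re (c0 * I2)"
    unfolding I1 XH by simp
  also have "\<dots> \<le> 4 * norm XJ + 2 * norm Xq + 2 * norm Xs + 2 * norm I2"
  proof -
    have "Re (c0 * z) \<le> norm z" for z
      using complex_Re_le_cmod[of "c0 * z"] mult_right_mono[OF norm_c0_le norm_ge_zero[of z]] unfolding norm_mult by linarith
    then show ?thesis using complex_Re_le_cmod[of Xq] complex_Re_le_cmod[of Xs] by (intro add_mono mult_left_mono) auto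
  qed
  also have "\<dots> \<le> 4 * (Cc * (K0 * A) * x * y) + 2 * (CQ * \<rho> / eps * x * y) + 2 * (eps\<^sup>2 * A * y) + 2 * (x * ((LBINT k. B k) * x))"
  proof (intro add_mono mult_left_mono)
    show "norm XJ \<le> Cc * (K0 * A) * x * y" using iJ(2) mult_right_mono[OF J_bound(2)[of t] xy(2)] unfolding XJ_def x_def y_def by linarith
    show "norm Xq \<le> CQ * \<rho> / eps * x * y" using iq(2) mult_right_mono[OF Hq_bound(2)[OF ps[of t]] xy(2)] unfolding Xq_def x_def y_def by linarith
    show "norm Xs \<le> eps\<^sup>2 * A * y" using is'(2) mult_right_mono[OF Hs_bound(2)[of t] xy(2)] unfolding Xs_def y_def by linarith
    show "norm I2 \<le> x * ((LBINT k. B k) * x)" unfolding I2_def x_def by (rule G2_facts(3))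
  qed auto
  also have "\<dots> \<le> KE * (x\<^sup>2 + y\<^sup>2) + eps ^ 4 * A\<^sup>2"
  proof -
    have IB: "(LBINT k. B k) \<ge> 0" using B0 by (simp add: Bochner_Integration.integral_nonneg)
    have KA: "K0 * A \<ge> 0" using order_trans[OF _ V_weighted(2)[of 0 0]] s by (simp add: Bochner_Integration.integral_nonneg)
    have "Cc * (K0 * A) * (2 * (x * y)) \<le> Cc * (K0 * A) * (x\<^sup>2 + y\<^sup>2)" using KA xy by (intro mult_left_mono) (auto simp: Cc_def)
    moreover have "CQ * \<rho> / eps * (2 * (x * y)) \<le> CQ * \<rho> / eps * (x\<^sup>2 + y\<^sup>2)" using CQ0 \<rho> eps xy by (intro mult_left_mono) auto
    moreover have "2 * (eps\<^sup>2 * A * y) \<le> eps ^ 4 * A\<^sup>2 + (x\<^sup>2 + y\<^sup>2)"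
    proof -
      have "2 * (eps\<^sup>2 * A) * y \<le> (eps\<^sup>2 * A)\<^sup>2 + y\<^sup>2" by (rule sum_squares_bound)
      moreover have "(eps\<^sup>2 * A)\<^sup>2 = eps ^ 4 * A\<^sup>2" by (simp add: power_mult_distrib flip: power_mult)
      ultimately show ?thesis using zero_le_power2[of x] by linarith
    qed
    moreover have "(LBINT k. B k) * x\<^sup>2 \<le> (LBINT k. B k) * (x\<^sup>2 + y\<^sup>2)" using IB by (intro mult_left_mono) auto
    ultimately show ?thesis by (simp add: KE_def power2_eq_square algebra_simps)
  qed
  finally show ?thesis unfolding IH I x_def y_def .
qed

text \<open>By Young's inequality the interaction form is at most \<open>K0 * A\<close> times the
  squared norm of \<open>p\<close>, so under the smallness condition the correction is at most half
  of the energy.\<close>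

lemma energy_coercive:
  assumes small: "4 * (K0 * A) \<le> 1" and t: "t \<in> {0..T}"
  shows "(l2norm (p t))\<^sup>2 + (l2norm (q t))\<^sup>2 \<le> 2 * Re ((LBINT k. p t k * cnj (p t k) + q t k * cnj (q t k))
      + 2 * c0 * (\<integral>z. cnj (av t (fst z)) * V t (fst z - snd z) * av t (snd z) \<partial>(lborel \<Otimes>\<^sub>M lborel)))"
proof -
  note i = inner_product_nn_bound(2)[OF ps ps, of t t] inner_product_nn_bound(2)[OF qs[OF t] qs[OF t]]
  have sq: "z * cnj z = cx ((norm z)\<^sup>2)" for z :: complex by (simp add: complex_norm_square[symmetric])
  have N: "(LBINT k. p t k * cnj (p t k) + q t k * cnj (q t k)) = cx ((l2norm (p t))\<^sup>2 + (l2norm (q t))\<^sup>2)"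
  proof -
    have "(LBINT k. p t k * cnj (p t k) + q t k * cnj (q t k)) = (LBINT k. p t k * cnj (p t k)) + (LBINT k. q t k * cnj (q t k))"
      using i by simp
    then show ?thesis unfolding sq integral_complex_of_real l2norm_sq by simp
  qed
  define I where "I = (\<integral>z. cnj (av t (fst z)) * V t (fst z - snd z) * av t (snd z) \<partial>(lborel \<Otimes>\<^sub>M lborel))"
  have "norm I \<le> l2norm (p t) * (K0 * A * l2norm (p t))"
  proof -
    note [measurable] = avt[of t] Vt[of t] cnj_measurable
    have V0: "integrable lborel (\<lambda>k. norm (V t k))" "(LBINT k. norm (V t k)) \<le> K0 * A"
    proof -
      have "wt 0 k = 1" for k using one_plus_square_pos[of k] by (simp add: wt_def)
      then show "integrable lborel (\<lambda>k. norm (V t k))" "(LBINT k. norm (V t k)) \<le> K0 * A"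
        using V_weighted[of 0 t] s by simp_all
    qed
    have "norm I \<le> l2norm (\<lambda>k. norm (p t k)) * ((LBINT k. norm (V t k)) * l2norm (\<lambda>k. norm (p t k)))"
      unfolding I_def
    proof (rule trilinear_complex(3))
      show "(\<lambda>z. cnj (av t (fst z)) * V t (fst z - snd z) * av t (snd z)) \<in> borel_measurable (borel \<Otimes>\<^sub>M borel)" by measurable
      show "norm (cnj (av t (fst (k, l))) * V t (fst (k, l) - snd (k, l)) * av t (snd (k, l))) \<le> norm (p t k) * norm (V t (k - l)) * norm (p t l)" for k l
        unfolding norm_mult by (simp, intro mult_mono av_le order_refl) auto
    qed (use V0(1) L2_norm(1)[OF ps] in auto)
    also have "\<dots> \<le> l2norm (p t) * (K0 * A * l2norm (p t))"
      unfolding L2_norm(2) by (intro mult_left_mono mult_right_mono V0) auto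
    finally show ?thesis .
  qed
  also have "\<dots> = K0 * A * (l2norm (p t))\<^sup>2" by (simp add: power2_eq_square mult_ac)
  finally have nI: "4 * norm I \<le> (l2norm (p t))\<^sup>2"
    using mult_right_mono[OF small zero_le_power2[of "l2norm (p t)"]] by linarith
  have "norm (c0 * I) \<le> norm I" unfolding norm_mult using mult_right_mono[OF norm_c0_le norm_ge_zero[of I]] by simp
  then have "- norm I \<le> Re (c0 * I)" using abs_Re_le_cmod[of "c0 * I"] by linarith
  then show ?thesis using nI zero_le_power2[of "l2norm (q t)"] unfolding N I_def[symmetric] by (simp add: mult.assoc)
qed

lemma KE_ge_1: "KE \<ge> 1"
proof -
  have "(LBINT k. B k) \<ge> 0" using B0 by (simp add: Bochner_Integration.integral_nonneg)
  moreover have "K0 * A \<ge> 0" using order_trans[OF _ V_weighted(2)[of 0 0]] s by (simp add: Bochner_Integration.integral_nonneg)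
  ultimately show ?thesis using CQ0 \<rho> eps by (simp add: KE_def Cc_def)
qed

text \<open>This concerns the truncated equation and assumes nothing about the size of
  \<open>p\<close>, so it can afterwards show that the truncation is inactive without a circular
  argument.\<close>

lemma error_bound:
  assumes small: "4 * (K0 * A) \<le> 1" and t: "t \<in> {0..T}"
  shows "(l2norm (p t))\<^sup>2 + (l2norm (q t))\<^sup>2 \<le> 2 * (2 * T * (eps ^ 4 * A\<^sup>2)) * exp (4 * KE * t)"
proof (rule gronwall_contraction[where y="\<lambda>t. (l2norm (p t))\<^sup>2 + (l2norm (q t))\<^sup>2" and M="2 * (l2norm Bp)\<^sup>2" and T=T])
  show "(l2norm (p t))\<^sup>2 + (l2norm (q t))\<^sup>2 \<le> 2 * (l2norm Bp)\<^sup>2" if "t \<in> {0..T}" for t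
    using power_mono[OF pq_norm_bound(1)[OF that] l2norm_nonneg, of 2] power_mono[OF pq_norm_bound(2)[OF that] l2norm_nonneg, of 2] by linarith
  fix S t assume S: "S \<ge> 0" and y: "\<And>\<tau>. \<tau> \<in> {0..T} \<Longrightarrow> (l2norm (p \<tau>))\<^sup>2 + (l2norm (q \<tau>))\<^sup>2 \<le> S * exp (4 * KE * \<tau>)" and t: "t \<in> {0..T}"
  define d where "d = eps ^ 4 * A\<^sup>2"
  have d: "d \<ge> 0" by (simp add: d_def)
  define e where "e = (\<lambda>\<tau>. (LBINT k. H \<tau> (p \<tau>) k * cnj (q \<tau> k) + q \<tau> k * cnj (H \<tau> (p \<tau>) k))
      + 2 * c0 * (\<integral>z. G1 \<tau> z + G2 \<tau> z + G3 \<tau> z \<partial>(lborel \<Otimes>\<^sub>M lborel)))"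
  note n = norm_flow[OF t] and i = interaction_flow[OF t]
  have ei: "integrable lborel (\<lambda>\<tau>. indicator {0..t} \<tau> *\<^sub>R e \<tau>)"
    unfolding e_def scaleR_add_right mult_scaleR_right[symmetric] using n(2) i(2) unfolding set_integrable_def
    by (intro Bochner_Integration.integrable_add Bochner_Integration.integrable_mult_right) auto
  have "(LBINT k. p t k * cnj (p t k) + q t k * cnj (q t k))
      + 2 * c0 * (\<integral>z. cnj (av t (fst z)) * V t (fst z - snd z) * av t (snd z) \<partial>(lborel \<Otimes>\<^sub>M lborel)) = (LBINT \<tau>. indicator {0..t} \<tau> *\<^sub>R e \<tau>)"
    unfolding n(1) i(1) e_def scaleR_add_right mult_scaleR_right[symmetric] set_lebesgue_integral_def
    using n(2) i(2) unfolding set_integrable_def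
    by (subst Bochner_Integration.integral_add) (auto simp del: mult_scaleR_right)
  then have "(l2norm (p t))\<^sup>2 + (l2norm (q t))\<^sup>2 \<le> 2 * Re (LBINT \<tau>. indicator {0..t} \<tau> *\<^sub>R e \<tau>)"
    using energy_coercive[OF small t] by simp
  also have "Re (LBINT \<tau>. indicator {0..t} \<tau> *\<^sub>R e \<tau>) = (LBINT \<tau>. Re (indicator {0..t} \<tau> *\<^sub>R e \<tau>))"
    by (rule integral_Re[OF ei, symmetric])
  also have "\<dots> \<le> (LBINT \<tau>. (KE * S * exp (4 * KE * \<tau>) + d) * indicator {0..t} \<tau>)"
  proof (rule integral_mono)
    show "integrable lborel (\<lambda>\<tau>. Re (indicator {0..t} \<tau> *\<^sub>R e \<tau>))" using ei by (rule integrable_Re)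
    have "continuous_on {0..t} (\<lambda>\<tau>. KE * S * exp (4 * KE * \<tau>) + d)" by (intro continuous_intros)
    from borel_integrable_atLeastAtMost'[OF this]
    show "integrable lborel (\<lambda>\<tau>. (KE * S * exp (4 * KE * \<tau>) + d) * indicator {0..t} \<tau>)"
      by (simp add: set_integrable_def mult.commute)
    fix \<tau>
    show "Re (indicator {0..t} \<tau> *\<^sub>R e \<tau>) \<le> (KE * S * exp (4 * KE * \<tau>) + d) * indicator {0..t} \<tau>"
    proof (cases "\<tau> \<in> {0..t}")
      case True
      then have \<tau>: "\<tau> \<in> {0..T}" using t by auto
      have "Re (e \<tau>) \<le> KE * ((l2norm (p \<tau>))\<^sup>2 + (l2norm (q \<tau>))\<^sup>2) + d"
        unfolding e_def d_def by (rule energy_derivative[OF \<tau>])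
      also have "KE * ((l2norm (p \<tau>))\<^sup>2 + (l2norm (q \<tau>))\<^sup>2) \<le> KE * (S * exp (4 * KE * \<tau>))"
        using KE_ge_1 by (intro mult_left_mono y \<tau>) auto
      finally show ?thesis using True by simp
    qed simp
  qed
  \<comment> \<open>Integrating at the rate \<open>4 * KE\<close> turns \<open>KE * S\<close> into
    \<open>S / 4\<close>; with the coercivity factor \<open>2\<close> this is the half demanded by
    the iteration.\<close>
  also have "\<dots> = (S * exp (4 * KE * t) / 4 + d * t) - (S * exp (4 * KE * 0) / 4 + d * 0)"
    by (rule integral_FTC_Icc_real) (use t in \<open>auto intro!: derivative_eq_intros continuous_intros simp: field_simps\<close>)
  finally have "(l2norm (p t))\<^sup>2 + (l2norm (q t))\<^sup>2 \<le> 2 * ((S * exp (4 * KE * t) / 4 + d * t) - (S * exp (4 * KE * 0) / 4 + d * 0))" by simp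
  moreover have "d * t \<le> d * T" using d t by (intro mult_left_mono) auto
  ultimately have "(l2norm (p t))\<^sup>2 + (l2norm (q t))\<^sup>2 \<le> S * exp (4 * KE * t) / 2 + 2 * (d * T)" using S by simp
  then show "(l2norm (p t))\<^sup>2 + (l2norm (q t))\<^sup>2 \<le> S * exp (4 * KE * t) / 2 + 2 * T * (eps ^ 4 * A\<^sup>2)" by (simp add: d_def mult_ac)
qed (use t KE_ge_1 T in auto)

end

subsection \<open>Back to physical space\<close>

lemma ft_real_on_hermitian:
  assumes h: "\<And>k. p (- k) = cnj (p k)"
  shows "cx (Re (ft p (- x))) = ft p (- x)"
proof -
  have "(LBINT k. cis (x * k) * p k) = (LBINT k. cis (- (x * k)) * cnj (p k))"
    by (subst lborel_integral_real_affine[where c="-1" and t=0]) (auto simp: h)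
  then have "cnj (ft p (- x)) = ft p (- x)"
    unfolding ft_cnj by (simp add: ft_def)
  then show ?thesis by (simp add: complex_eq_iff)
qed

text \<open>Taking the real part only changes the type, since the inverse transform of a Hermitian
  function is already real.\<close>

lemma inverse_transform_sobolev:
  assumes p: "L2 (wmul r p)" and r: "r \<ge> 1" and m: "p \<in> borel_measurable borel"
    and h: "\<And>k. p (- k) = cnj (p k)"
  shows "(\<lambda>x. Re (ft p (- x))) \<in> sobolev r" "AE k in lborel. fourier (\<lambda>x. Re (ft p (- x))) k = p k"
proof -
  note w = weighted_facts[OF p r m]
  have um: "(\<lambda>x. Re (ft p (- x))) \<in> borel_measurable borel" using m by measurable
  have eq: "AE x in lborel. cx (Re (ft p (- x))) = ft p (- x)" by (intro AE_I2 ft_real_on_hermitian h)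
  note F = fourier_inverse[OF w(1,2) um eq]
  show F2: "AE k in lborel. fourier (\<lambda>x. Re (ft p (- x))) k = p k" by (rule F)
  have "L2 (wmul r (fourier (\<lambda>x. Re (ft p (- x)))))"
  proof (rule L2_cong_AE[OF _ _ p])
    show "AE k in lborel. norm (wmul r (fourier (\<lambda>x. Re (ft p (- x)))) k) = norm (wmul r p k)"
      using F2 by eventually_elim simp
    note [measurable] = L2_measurable[OF fourier_L2FT(2)[OF F(1)]]
    show "wmul r (fourier (\<lambda>x. Re (ft p (- x)))) \<in> borel_measurable borel" by measurable
  qed
  then show "(\<lambda>x. Re (ft p (- x))) \<in> sobolev r" using sobolev_iff[OF F(1)] by blast
qed

definition boussinesq_rhs :: "(real \<Rightarrow> complex) \<Rightarrow> real \<Rightarrow> complex"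
  where "boussinesq_rhs v k = - cx (k\<^sup>2) * (v k + cx (k\<^sup>2) * v k + c0 * conv v v k)"

lemma boussinesq_rhs_mult:
  "boussinesq_rhs v k * z = - (cx (k\<^sup>2) * v k * z) - cx (k\<^sup>2) * (cx (k\<^sup>2) * v k) * z
     - cx (k\<^sup>2) * (c0 * conv v v k) * z"
proof -
  have "- a * (x + a * x + w) * z = - (a * x * z) - a * (a * x) * z - a * w * z" for a x w :: complex by (simp add: algebra_simps)
  then show ?thesis unfolding boussinesq_rhs_def .
qed

text \<open>Decay of order four compensates the fourth derivative in the pairing; dropping one power
  for integrability leaves order two for the product term, whose transform is only known to be
  bounded.\<close>

lemma ft_test_decay_4:
  assumes f: "test_function f"
  shows "L2 (\<lambda>k. cx (wt 4 k) * ft (\<lambda>x. cx (f x)) (- k))"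
    "L2 (\<lambda>k. cx (wt 2 k) * ft (\<lambda>x. cx (f x)) (- k))"
    "integrable lborel (\<lambda>k. cx (wt 2 k) * ft (\<lambda>x. cx (f x)) (- k))"
proof -
  let ?F = "ft (\<lambda>x. cx (f x))"
  have [measurable]: "(\<lambda>x. cx (f x)) \<in> borel_measurable borel" using test_function_integrable(3)[OF f] by auto
  have "(\<lambda>k. cx (wt 2 k) * ?F k - cx (wt 2 k) * ft (\<lambda>x. cx ((deriv ^^ 2) f x)) k)
     = (\<lambda>k. cx (wt 4 k) * ?F k)"
  proof
    fix k
    have "cx (wt 4 k) = cx (wt 2 k) * cx (1 + k\<^sup>2)"
      using wt_add[of 2 2 k] by (simp add: wt_2)
    then show "cx (wt 2 k) * ?F k - cx (wt 2 k) * ft (\<lambda>x. cx ((deriv ^^ 2) f x)) k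
       = cx (wt 4 k) * ?F k"
      unfolding ft_deriv_2[OF f] by (simp add: algebra_simps)
  qed
  then have 4: "L2 (\<lambda>k. cx (wt 4 k) * ?F k)"
    using L2_diff(1)[OF ft_test_decay(1)[OF f] ft_test_decay(1)[OF test_function_funpow[OF f, of 2]]] by simp
  from L2_affine(1)[OF 4, of "-1" 0]
  show 4: "L2 (\<lambda>k. cx (wt 4 k) * ?F (- k))" by (simp add: wt_minus)
  from L2_affine(1)[OF ft_test_decay(1)[OF f], of "-1" 0]
  show "L2 (\<lambda>k. cx (wt 2 k) * ?F (- k))" by (simp add: wt_minus)
  have m: "(\<lambda>k. ?F (- k)) \<in> borel_measurable borel" by measurable
  have r: "(3::real) \<le> 4" by simp
  have "cx (wt 3 k) * ?F (- k) = cx (wt 1 k) * (cx (wt 2 k) * ?F (- k))" for k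
    using wt_add[of 1 2 k] by (simp add: mult.assoc)
  then have 1: "L2 (wmul 1 (\<lambda>k. cx (wt 2 k) * ?F (- k)))"
    using weight_square_integrable_mono(1)[OF 4 m r] by (simp only:)
  show "integrable lborel (\<lambda>k. cx (wt 2 k) * ?F (- k))"
    by (rule weighted_facts(1)[OF 1]) auto
qed

text \<open>The interface between the frequency side and the notion of solution: a family of
  ordinary differential equations at almost every frequency, with time-independent envelopes for
  domination. The velocity \<open>yd\<close> may grow like \<open>wt 2\<close>, since it is only
  ever paired with the transform of a test function.\<close>

locale boussinesq_flow =
  fixes r T :: real and y yd :: "real \<Rightarrow> real \<Rightarrow> complex" and d e :: "real \<Rightarrow> real"
  assumes r: "r \<ge> 1" and ym: "jointly_measurable y" and ydm: "jointly_measurable yd"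
    and yh: "\<And>t k. t \<in> {0..T} \<Longrightarrow> y t (- k) = cnj (y t k)"
    and yb: "\<And>t k. t \<in> {0..T} \<Longrightarrow> norm (y t k) \<le> d k" and dm: "d \<in> borel_measurable borel"
    and ds: "L2 (\<lambda>k. wt r k * d k)"
    and ydb: "\<And>t k. t \<in> {0..T} \<Longrightarrow> norm (yd t k) \<le> wt 2 k * e k" and es: "L2 e"
    and D1: "AE k in lborel. \<forall>t\<in>{0..T}. ((\<lambda>t. y t k) has_vector_derivative yd t k) (at t within {0..T})"
    and D2: "AE k in lborel. \<forall>t\<in>{0..T}. ((\<lambda>t. yd t k) has_vector_derivative boussinesq_rhs (y t) k) (at t within {0..T})"
begin

definition u :: "real \<Rightarrow> real \<Rightarrow> real" where "u x t = Re (ft (y t) (- x))"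

lemmas yt = measurable_joint_sections(1)[OF ym]
lemmas ydt = measurable_joint_sections(1)[OF ydm]

lemma weighted: "t \<in> {0..T} \<Longrightarrow> L2 (wmul r (y t))"
proof (rule L2_mono(1)[OF ds])
  assume t: "t \<in> {0..T}"
  note [measurable] = yt[of t]
  show "wmul r (y t) \<in> borel_measurable borel" by measurable
  have "norm (wmul r (y t) k) \<le> norm (wt r k * d k)" for k
    using mult_left_mono[OF yb[OF t, of k], of "wt r k"] order_trans[OF norm_ge_zero yb[OF t, of k]] by (simp add: norm_mult abs_mult)
  then show "AE k in lborel. norm (wmul r (y t) k) \<le> norm (wt r k * d k)" by blast
qed

lemma u_transform:
  assumes t: "t \<in> {0..T}"
  shows uS: "(\<lambda>x. u x t) \<in> sobolev r" and uF: "AE k in lborel. fourier (\<lambda>x. u x t) k = y t k"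
  unfolding u_def by (rule inverse_transform_sobolev[OF weighted[OF t] r yt yh[OF t]])+

lemmas yc = AE_derivative_continuous[OF D1]
lemmas ydc = AE_derivative_continuous[OF D2]

lemma sobolev_norm_difference:
  assumes t: "t \<in> {0..T}" and t': "t' \<in> {0..T}"
  shows "sobolev_norm r (\<lambda>x. u x t' - u x t) = l2norm (\<lambda>k. cx (wt r k) * (y t' k - y t k))"
proof -
  note S = uS[OF t] uS[OF t']
  have sq: "L2 (\<lambda>x. u x t' - u x t)"
    using S by (intro L2_diff) (auto simp: sobolev_def)
  note [measurable] = L2_measurable[OF fourier_L2FT(2)[OF sq]] yt[of t] yt[of t']
  show ?thesis unfolding sobolev_norm_eq[OF sq]
  proof (rule l2norm_cong_AE)
    show "AE k in lborel. norm (cx (wt r k) * fourier (\<lambda>x. u x t' - u x t) k) = norm (cx (wt r k) * (y t' k - y t k))"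
      using fourier_minus[OF S(2,1) r] uF[OF t] uF[OF t'] by eventually_elim simp
  qed measurable
qed

lemma u_continuous: "continuous_in_sobolev r T u"
  unfolding continuous_in_sobolev_def
proof (intro conjI ballI)
  fix t assume t: "t \<in> {0..T}"
  show "(\<lambda>x. u x t) \<in> sobolev r" by (rule uS[OF t])
  have "continuous_on {0..T} (\<lambda>t'. LBINT k. cx ((norm (cx (wt r k) * (y t' k - y t k)))\<^sup>2))"
  proof (rule continuous_on_integral_dominated)
    show "integrable lborel (\<lambda>k. 4 * (norm (wt r k * d k))\<^sup>2)" using ds unfolding square_integrable_def by simp
    show "AE k in lborel. continuous_on {0..T} (\<lambda>t'. cx ((norm (cx (wt r k) * (y t' k - y t k)))\<^sup>2))"
      using yc by eventually_elim (intro continuous_intros)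
    show "AE k in lborel. \<forall>t'\<in>{0..T}. norm (cx ((norm (cx (wt r k) * (y t' k - y t k)))\<^sup>2)) \<le> 4 * (norm (wt r k * d k))\<^sup>2"
    proof (intro AE_I2 ballI)
      fix k t' assume t': "t' \<in> {0..T}"
      have "norm (y t' k - y t k) \<le> 2 * d k" using norm_triangle_ineq4[of "y t' k" "y t k"] yb[OF t, of k] yb[OF t', of k] by linarith
      then have "wt r k * norm (y t' k - y t k) \<le> wt r k * (2 * d k)" by (intro mult_left_mono) auto
      then have "norm (cx (wt r k) * (y t' k - y t k)) \<le> 2 * norm (wt r k * d k)"
        using order_trans[OF norm_ge_zero yb[OF t, of k]] by (simp add: norm_mult abs_mult)
      then have "(norm (cx (wt r k) * (y t' k - y t k)))\<^sup>2 \<le> (2 * norm (wt r k * d k))\<^sup>2" by (rule power_mono) simp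
      then show "norm (cx ((norm (cx (wt r k) * (y t' k - y t k)))\<^sup>2)) \<le> 4 * (norm (wt r k * d k))\<^sup>2"
        by (simp add: norm_power power_mult_distrib del: norm_mult)
    qed
    show "(\<lambda>k. cx ((norm (cx (wt r k) * (y t' k - y t k)))\<^sup>2)) \<in> borel_measurable borel" for t'
    proof -
      note [measurable] = yt[of t] yt[of t']
      show ?thesis by measurable
    qed
  qed
  then have "continuous_on {0..T} (\<lambda>t'. Re (LBINT k. cx ((norm (cx (wt r k) * (y t' k - y t k)))\<^sup>2)))" by (intro continuous_intros)
  then have "continuous_on {0..T} (\<lambda>t'. sqrt (LBINT k. (norm (cx (wt r k) * (y t' k - y t k)))\<^sup>2))"
    unfolding integral_complex_of_real by (intro continuous_intros) simp
  then have "continuous_on {0..T} (\<lambda>t'. l2norm (\<lambda>k. cx (wt r k) * (y t' k - y t k)))" unfolding l2norm_def .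
  then have "((\<lambda>t'. l2norm (\<lambda>k. cx (wt r k) * (y t' k - y t k))) \<longlongrightarrow> l2norm (\<lambda>k. cx (wt r k) * (y t k - y t k))) (at t within {0..T})"
    using t unfolding continuous_on_def by blast
  then have lim: "((\<lambda>t'. l2norm (\<lambda>k. cx (wt r k) * (y t' k - y t k))) \<longlongrightarrow> 0) (at t within {0..T})" by (simp add: l2norm_def)
  have "eventually (\<lambda>t'. l2norm (\<lambda>k. cx (wt r k) * (y t' k - y t k)) = sobolev_norm r (\<lambda>x. u x t' - u x t)) (at t within {0..T})"
    unfolding eventually_at_filter by (intro always_eventually allI impI) (rule sobolev_norm_difference[OF t, symmetric])
  then show "((\<lambda>t'. sobolev_norm r (\<lambda>x. u x t' - u x t)) \<longlongrightarrow> 0) (at t within {0..T})"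
    using lim by (rule Lim_transform_eventually[rotated])
qed

lemma d_square_integrable: "L2 d"
proof (rule L2_mono(1)[OF ds dm])
  have "norm (d k) \<le> norm (wt r k * d k)" for k
    using mult_right_mono[OF wt_ge_1[of r k] norm_ge_zero[of "d k"]] r by (simp add: abs_mult)
  then show "AE k in lborel. norm (d k) \<le> norm (wt r k * d k)" by blast
qed

lemma conv_y_bound: "t \<in> {0..T} \<Longrightarrow> norm (c0 * conv (y t) (y t) k) \<le> (l2norm d)\<^sup>2"
proof -
  assume t: "t \<in> {0..T}"
  have n: "norm (y t k) \<le> norm (d k)" for k using yb[OF t, of k] by simp
  note m = L2_mono[OF d_square_integrable yt AE_I2[OF n]]
  have "norm c0 * norm (conv (y t) (y t) k) \<le> 1 * (l2norm (y t) * l2norm (y t))"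
    using conv_bound(2)[OF m(1) m(1), of k] by (intro mult_mono norm_c0_le) auto
  also have "\<dots> \<le> l2norm d * l2norm d" using m(2) by (simp add: mult_mono)
  finally show ?thesis by (simp only: norm_mult power2_eq_square)
qed

text \<open>The pairing with a test function is moved to frequency space and differentiated twice
  under the integral; the result is translated back term by term.\<close>

lemma u_solution: "boussinesq_solution T u"
  unfolding boussinesq_solution_def
proof (intro allI impI)
  fix \<phi> assume \<phi>: "test_function \<phi>"
  define g where "g = (\<lambda>k. ft (\<lambda>x. cx (\<phi> x)) (- k))"
  have G: "L2 (\<lambda>k. cx (wt 4 k) * g k)" "L2 (\<lambda>k. cx (wt 2 k) * g k)"
    "integrable lborel (\<lambda>k. cx (wt 2 k) * g k)"
    unfolding g_def by (rule ft_test_decay_4[OF \<phi>])+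
  have [measurable]: "(\<lambda>x. cx (\<phi> x)) \<in> borel_measurable borel" using test_function_integrable(3)[OF \<phi>] by auto
  have gm [measurable]: "g \<in> borel_measurable borel" unfolding g_def by measurable
  note [measurable] = ym ydm dm
  \<comment> \<open>A common majorant: the first part controls the terms linear in \<open>y\<close>,
    up to the factor \<open>k\<^sup>4\<close>, the second one the convolution, which is bounded
    uniformly by the square of \<open>l2norm d\<close>.\<close>
  define X where "X = (\<lambda>k. norm (cx (wt 4 k) * g k) * norm (d k) + (l2norm d)\<^sup>2 * norm (cx (wt 2 k) * g k))"
  have X: "integrable lborel X" unfolding X_def
    using cauchy_schwarz(1)[OF G(1) d_square_integrable] G(3) by (intro Bochner_Integration.integrable_add Bochner_Integration.integrable_mult_right integrable_norm)
  have Z: "integrable lborel (\<lambda>k. norm (cx (wt 2 k) * g k) * norm (e k))" by (rule cauchy_schwarz(1)[OF G(2) es])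
  have terms: "norm (cx (k\<^sup>2) * y t k * g k) \<le> X k" "norm (cx (k\<^sup>2) * (cx (k\<^sup>2) * y t k) * g k) \<le> X k"
    "norm (cx (k\<^sup>2) * (c0 * conv (y t) (y t) k) * g k) \<le> X k" "norm (y t k * g k) \<le> X k"
    "norm (boussinesq_rhs (y t) k * g k) \<le> 3 * X k" if t: "t \<in> {0..T}" for t k
  proof -
    have d0: "d k \<ge> 0" using order_trans[OF norm_ge_zero yb[OF t, of k]] .
    have w4: "wt 4 k = (1 + k\<^sup>2) * (1 + k\<^sup>2)" using wt_add[of 2 2 k] by (simp add: wt_2)
    have k: "k\<^sup>2 \<le> wt 4 k" "k\<^sup>2 * k\<^sup>2 \<le> wt 4 k" "k\<^sup>2 \<le> wt 2 k" "1 \<le> wt 4 k"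
      unfolding w4 wt_2 by (auto simp: algebra_simps add_nonneg_nonneg)
    have R: "x * norm (y t k) * norm (g k) \<le> wt 4 k * norm (g k) * norm (d k)" if "0 \<le> x" "x \<le> wt 4 k" for x
    proof -
      have "x * norm (y t k) * norm (g k) \<le> wt 4 k * norm (d k) * norm (g k)"
        using that yb[OF t, of k] by (intro mult_mono) auto
      then show ?thesis by (simp add: mult_ac)
    qed
    have X1: "wt 4 k * norm (g k) * norm (d k) \<le> X k" and X2: "(l2norm d)\<^sup>2 * (wt 2 k * norm (g k)) \<le> X k"
      unfolding X_def by (simp_all add: norm_mult)
    show 1: "norm (cx (k\<^sup>2) * y t k * g k) \<le> X k"
      using R[OF _ k(1)] X1 by (simp add: norm_mult norm_power)
    show 2: "norm (cx (k\<^sup>2) * (cx (k\<^sup>2) * y t k) * g k) \<le> X k"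
      using R[OF _ k(2)] X1 by (simp add: norm_mult norm_power mult.assoc)
    show 3: "norm (cx (k\<^sup>2) * (c0 * conv (y t) (y t) k) * g k) \<le> X k"
    proof -
      have "norm (cx (k\<^sup>2) * (c0 * conv (y t) (y t) k) * g k) = k\<^sup>2 * norm (c0 * conv (y t) (y t) k) * norm (g k)"
        by (simp only: norm_mult norm_of_real abs_power2)
      also have "\<dots> \<le> wt 2 k * (l2norm d)\<^sup>2 * norm (g k)"
        by (intro mult_right_mono mult_mono k conv_y_bound[OF t]) auto
      finally show ?thesis using X2 by (simp add: mult_ac)
    qed
    show "norm (y t k * g k) \<le> X k" using R[OF _ k(4)] X1 by (simp add: norm_mult)
    have "norm (- x - y - z) \<le> norm x + norm y + norm z" for x y z :: complex
      using norm_triangle_ineq4[of "- x - y" z] norm_triangle_ineq4[of "- x" y] by simp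
    then have "norm (boussinesq_rhs (y t) k * g k) \<le> norm (cx (k\<^sup>2) * y t k * g k) + norm (cx (k\<^sup>2) * (cx (k\<^sup>2) * y t k) * g k)
        + norm (cx (k\<^sup>2) * (c0 * conv (y t) (y t) k) * g k)"
      unfolding boussinesq_rhs_mult .
    then show "norm (boussinesq_rhs (y t) k * g k) \<le> 3 * X k" using 1 2 3 by linarith
  qed
  have ints: "integrable lborel (\<lambda>k. cx (k\<^sup>2) * y t k * g k)" "integrable lborel (\<lambda>k. cx (k\<^sup>2) * (cx (k\<^sup>2) * y t k) * g k)"
    "integrable lborel (\<lambda>k. cx (k\<^sup>2) * (c0 * conv (y t) (y t) k) * g k)" "integrable lborel (\<lambda>k. y t k * g k)" if t: "t \<in> {0..T}" for t
  proof -
    note [measurable] = yt[of t]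
    have m: "conv (y t) (y t) \<in> borel_measurable borel" by measurable
    note [measurable] = m
    show "integrable lborel (\<lambda>k. cx (k\<^sup>2) * y t k * g k)"
      by (rule Bochner_Integration.integrable_bound[OF X]) (use terms(1)[OF t] in \<open>auto intro: order_trans[OF _ abs_ge_self]\<close>)
    show "integrable lborel (\<lambda>k. cx (k\<^sup>2) * (cx (k\<^sup>2) * y t k) * g k)"
      by (rule Bochner_Integration.integrable_bound[OF X]) (use terms(2)[OF t] in \<open>auto intro: order_trans[OF _ abs_ge_self]\<close>)
    show "integrable lborel (\<lambda>k. cx (k\<^sup>2) * (c0 * conv (y t) (y t) k) * g k)"
      by (rule Bochner_Integration.integrable_bound[OF X]) (use terms(3)[OF t] in \<open>auto intro: order_trans[OF _ abs_ge_self]\<close>)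
    show "integrable lborel (\<lambda>k. y t k * g k)"
      by (rule Bochner_Integration.integrable_bound[OF X]) (use terms(4)[OF t] in \<open>auto intro: order_trans[OF _ abs_ge_self]\<close>)
  qed
  have d1: "((\<lambda>t. LBINT k. y t k * g k) has_vector_derivative (LBINT k. yd t k * g k)) (at t within {0..T})"
    if t: "t \<in> {0..T}" for t
  proof (rule integral_has_derivative[OF ints(4) _ _ _ _ Z t])
    show "jointly_measurable (\<lambda>t k. yd t k * g k)" by measurable
    show "AE k in lborel. \<forall>t\<in>{0..T}. ((\<lambda>t. y t k * g k) has_vector_derivative yd t k * g k) (at t within {0..T})"
      using D1 by eventually_elim (intro ballI bounded_linear.has_vector_derivative[OF bounded_linear_mult_left], blast)
    show "AE k in lborel. continuous_on {0..T} (\<lambda>t. yd t k * g k)" using ydc by eventually_elim (intro continuous_intros)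
    show "AE k in lborel. \<forall>t\<in>{0..T}. norm (yd t k * g k) \<le> norm (cx (wt 2 k) * g k) * norm (e k)"
    proof (intro AE_I2 ballI)
      fix k t assume t: "t \<in> {0..T}"
      have "norm (yd t k) \<le> wt 2 k * norm (e k)"
        by (rule order_trans[OF ydb[OF t]]) (auto intro!: mult_left_mono)
      then have "norm (yd t k) * norm (g k) \<le> wt 2 k * norm (e k) * norm (g k)" by (intro mult_right_mono) auto
      then show "norm (yd t k * g k) \<le> norm (cx (wt 2 k) * g k) * norm (e k)" by (simp add: norm_mult mult_ac)
    qed
  qed
  have b3: "integrable lborel (\<lambda>k. 3 * X k)" using X by simp
  have d2: "((\<lambda>t. LBINT k. yd t k * g k) has_vector_derivative (LBINT k. boussinesq_rhs (y t) k * g k)) (at t within {0..T})"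
    if t: "t \<in> {0..T}" for t
  proof (rule integral_has_derivative[OF _ _ _ _ _ b3 t])
    show "integrable lborel (\<lambda>k. yd t k * g k)" if t: "t \<in> {0..T}" for t
    proof (rule Bochner_Integration.integrable_bound[OF Z])
      show "(\<lambda>k. yd t k * g k) \<in> borel_measurable lborel" using ydt[of t] by measurable
      have le: "norm (yd t k * g k) \<le> norm (cx (wt 2 k) * g k) * norm (e k)" for k
      proof -
        have "norm (yd t k) \<le> wt 2 k * norm (e k)"
          by (rule order_trans[OF ydb[OF t]]) (auto intro!: mult_left_mono)
        then have "norm (yd t k) * norm (g k) \<le> wt 2 k * norm (e k) * norm (g k)" by (intro mult_right_mono) auto
        then show ?thesis by (simp add: norm_mult mult_ac)
      qed
      show "AE k in lborel. norm (yd t k * g k) \<le> norm (norm (cx (wt 2 k) * g k) * norm (e k))"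
        by (intro AE_I2 order_trans[OF le]) (simp only: real_norm_def abs_ge_self)
    qed
    have cm: "jointly_measurable (\<lambda>t. conv (y t) (y t))"
      using conv_jointly_measurable[OF ym ym] by simp
    note [measurable] = cm
    show "jointly_measurable (\<lambda>t k. boussinesq_rhs (y t) k * g k)" unfolding boussinesq_rhs_def by measurable
    show "AE k in lborel. \<forall>t\<in>{0..T}. ((\<lambda>t. yd t k * g k) has_vector_derivative boussinesq_rhs (y t) k * g k) (at t within {0..T})"
      using D2 by eventually_elim (intro ballI bounded_linear.has_vector_derivative[OF bounded_linear_mult_left], blast)
    have bb: "AE l in lborel. \<forall>t\<in>{0..T}. norm (y t l) \<le> d l" using yb by (auto intro!: AE_I2)
    have cc: "continuous_on {0..T} (\<lambda>t. conv (y t) (y t) k)" for k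
      by (rule conv_time_continuous[OF yt yt yc yc bb bb d_square_integrable d_square_integrable])
    show "AE k in lborel. continuous_on {0..T} (\<lambda>t. boussinesq_rhs (y t) k * g k)"
      using yc unfolding boussinesq_rhs_def by eventually_elim (intro continuous_intros cc)
    show "AE k in lborel. \<forall>t\<in>{0..T}. norm (boussinesq_rhs (y t) k * g k) \<le> 3 * X k" using terms(5) by blast
  qed
  have pair: "cx (LBINT x. u x t * f x) = (LBINT k. y t k * ft (\<lambda>x. cx (f x)) (- k))"
    "cx (LBINT x. (u x t)\<^sup>2 * f x) = (LBINT k. (c0 * conv (y t) (y t) k) * ft (\<lambda>x. cx (f x)) (- k))"
    if t: "t \<in> {0..T}" and f: "test_function f" for t f
  proof -
    note P = pairing_fourier[OF uS[OF t] r f]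
    have sq: "L2 (\<lambda>x. u x t)" using uS[OF t] by (simp add: sobolev_def)
    note fm [measurable] = L2_measurable[OF fourier_L2FT(2)[OF sq]] and [measurable] = yt[of t]
    have [measurable]: "(\<lambda>x. cx (f x)) \<in> borel_measurable borel" using test_function_integrable(3)[OF f] by auto
    show "cx (LBINT x. u x t * f x) = (LBINT k. y t k * ft (\<lambda>x. cx (f x)) (- k))"
      unfolding P(1)
    proof (rule integral_cong_AE)
      show "AE k in lborel. fourier (\<lambda>x. u x t) k * ft (\<lambda>x. cx (f x)) (- k) = y t k * ft (\<lambda>x. cx (f x)) (- k)"
        using uF[OF t] by eventually_elim simp
    qed measurable
    have "conv (fourier (\<lambda>x. u x t)) (fourier (\<lambda>x. u x t)) k = conv (y t) (y t) k" for k
      by (rule conv_cong_AE[OF uF[OF t] uF[OF t] fm fm yt yt])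
    then show "cx (LBINT x. (u x t)\<^sup>2 * f x) = (LBINT k. (c0 * conv (y t) (y t) k) * ft (\<lambda>x. cx (f x)) (- k))"
      unfolding P(2) by simp
  qed
  have lhs: "(LBINT x. u x t * \<phi> x) = Re (LBINT k. y t k * g k)" if t: "t \<in> {0..T}" for t
    using pair(1)[OF t \<phi>] unfolding g_def by (metis Re_complex_of_real)
  have rhs: "(LBINT x. u x t * (deriv ^^ 2) \<phi> x) - (LBINT x. u x t * (deriv ^^ 4) \<phi> x) + (LBINT x. (u x t)\<^sup>2 * (deriv ^^ 2) \<phi> x)
      = Re (LBINT k. boussinesq_rhs (y t) k * g k)" if t: "t \<in> {0..T}" for t
  proof -
    note f2 = test_function_funpow[OF \<phi>, of 2] and f4 = test_function_funpow[OF \<phi>, of 4]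
    note I = ints[OF t]
    have "(LBINT k. boussinesq_rhs (y t) k * g k) = (LBINT k. - (cx (k\<^sup>2) * y t k * g k) - cx (k\<^sup>2) * (cx (k\<^sup>2) * y t k) * g k
        - cx (k\<^sup>2) * (c0 * conv (y t) (y t) k) * g k)"
      unfolding boussinesq_rhs_mult ..
    also have "\<dots> = - (LBINT k. cx (k\<^sup>2) * y t k * g k) - (LBINT k. cx (k\<^sup>2) * (cx (k\<^sup>2) * y t k) * g k)
        - (LBINT k. cx (k\<^sup>2) * (c0 * conv (y t) (y t) k) * g k)"
      using I by (simp only: Bochner_Integration.integral_diff Bochner_Integration.integrable_diff Bochner_Integration.integrable_minus Bochner_Integration.integral_minus)
    also have "- (LBINT k. cx (k\<^sup>2) * y t k * g k) = cx (LBINT x. u x t * (deriv ^^ 2) \<phi> x)"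
      unfolding pair(1)[OF t f2] ft_deriv_2[OF \<phi>] Bochner_Integration.integral_minus[symmetric] g_def
      by (intro Bochner_Integration.integral_cong refl) simp
    also have "(LBINT k. cx (k\<^sup>2) * (cx (k\<^sup>2) * y t k) * g k) = cx (LBINT x. u x t * (deriv ^^ 4) \<phi> x)"
      unfolding pair(1)[OF t f4] ft_deriv_4[OF \<phi>] g_def
      by (intro Bochner_Integration.integral_cong refl) (simp add: power_numeral_reduce)
    also have "(LBINT k. cx (k\<^sup>2) * (c0 * conv (y t) (y t) k) * g k) = - cx (LBINT x. (u x t)\<^sup>2 * (deriv ^^ 2) \<phi> x)"
      unfolding pair(2)[OF t f2] ft_deriv_2[OF \<phi>] Bochner_Integration.integral_minus[symmetric] g_def
      by (intro Bochner_Integration.integral_cong refl) simp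
    finally show ?thesis by simp
  qed
  show "has_second_derivative_on (\<lambda>t. LBINT x. u x t * \<phi> x)
      (\<lambda>t. (LBINT x. u x t * (deriv ^^ 2) \<phi> x) - (LBINT x. u x t * (deriv ^^ 4) \<phi> x)
         + (LBINT x. (u x t)\<^sup>2 * (deriv ^^ 2) \<phi> x)) {0..T}"
    unfolding has_second_derivative_on_def has_real_derivative_iff_has_vector_derivative
  proof (intro exI[of _ "\<lambda>t. Re (LBINT k. yd t k * g k)"] ballI conjI)
    fix t assume t: "t \<in> {0..T}"
    show "((\<lambda>t. LBINT x. u x t * \<phi> x) has_vector_derivative Re (LBINT k. yd t k * g k)) (at t within {0..T})"
      by (rule has_vector_derivative_transform[OF t lhs bounded_linear.has_vector_derivative[OF bounded_linear_Re d1[OF t]]])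
    show "((\<lambda>t. Re (LBINT k. yd t k * g k)) has_vector_derivative
      (LBINT x. u x t * (deriv ^^ 2) \<phi> x) - (LBINT x. u x t * (deriv ^^ 4) \<phi> x) + (LBINT x. (u x t)\<^sup>2 * (deriv ^^ 2) \<phi> x)) (at t within {0..T})"
      unfolding rhs[OF t] by (rule bounded_linear.has_vector_derivative[OF bounded_linear_Re d2[OF t]])
  qed
qed

end

lemma rescaled_transform:
  assumes e: "e > 0"
  shows "ft (\<lambda>k. cx (1 / e) * v (k / e)) (- x) = ft v (- (e * x))"
proof -
  have "(LBINT k. cis (x * k) * (cx (1 / e) * v (k / e))) =
      \<bar>e\<bar> *\<^sub>R (LBINT k. cis (x * (0 + e * k)) * (cx (1 / e) * v ((0 + e * k) / e)))"
    using e by (intro lborel_integral_real_affine) simp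
  also have "\<dots> = (LBINT k. e *\<^sub>R (cx (1 / e) * (cis (e * x * k) * v k)))"
    unfolding integral_scaleR_right using e by (simp add: ac_simps)
  also have "\<dots> = (LBINT k. cis (e * x * k) * v k)"
    using e by (intro Bochner_Integration.integral_cong refl) (simp add: scaleR_conv_of_real)
  finally show ?thesis by (simp add: ft_def)
qed

lemma rescaled_conv:
  assumes e: "e > 0"
  shows "conv (\<lambda>k. cx (1 / e) * v (k / e)) (\<lambda>k. cx (1 / e) * v (k / e)) k
    = cx (1 / e) * conv v v (k / e)"
proof -
  have "conv (\<lambda>k. cx (1 / e) * v (k / e)) (\<lambda>k. cx (1 / e) * v (k / e)) k =
      \<bar>e\<bar> *\<^sub>R (LBINT l. (cx (1 / e) * v ((k - (0 + e * l)) / e)) * (cx (1 / e) * v ((0 + e * l) / e)))"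
    unfolding conv_def using e by (intro lborel_integral_real_affine) simp
  also have "\<dots> = (LBINT l. cx (1 / e) * (v (k / e - l) * v l))"
    unfolding integral_scaleR_right[symmetric] using e
    by (intro Bochner_Integration.integral_cong refl) (simp add: scaleR_conv_of_real diff_divide_distrib)
  finally show ?thesis by (simp add: conv_def)
qed

text \<open>The square root of the Gronwall bound at the final time, with
  \<open>\<rho> = eps powr (3 / 2)\<close> inserted in \<open>KE\<close> and the factor
  \<open>eps\<^sup>2\<close> taken out. It depends on the profile but not on
  \<open>eps\<close>.\<close>

definition err_const :: "real \<Rightarrow> real \<Rightarrow> real \<Rightarrow> (real \<Rightarrow> real) \<Rightarrow> real"
  where "err_const s T A B = sqrt (4 * T * A\<^sup>2 * exp (4 * (2 * (max 1 s * 2 powr (s / 2)) * (K0 * A)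
     + 2 powr (1 + s) * (2 * K0) + 1 + 2 * (LBINT k. B k)) * T))"

context error_flow
begin

lemma error_bound_explicit:
  assumes small: "4 * (K0 * A) \<le> 1" and \<rho>_def: "\<rho> = eps powr (3 / 2)" and t: "t \<in> {0..T}"
  shows "l2norm (p t) \<le> err_const s T A B * eps\<^sup>2"
proof -
  define K where "K = 2 * (max 1 s * 2 powr (s / 2)) * (K0 * A) + 2 powr (1 + s) * (2 * K0) + 1 + 2 * (LBINT k. B k)"
  \<comment> \<open>The radius exactly balances the loss \<open>1 / sqrt eps\<close> of the product
    estimate and the loss \<open>1 / eps\<close> of the multiplier.\<close>
  have R: "\<rho> / (sqrt eps * eps) = 1"
  proof -
    have "eps powr (3 / 2) = eps powr (1 / 2) * eps powr 1" unfolding powr_add[symmetric] by simp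
    then show ?thesis unfolding \<rho>_def using eps by (simp add: powr_half_sqrt)
  qed
  have "CQ * \<rho> / eps = 2 powr (1 + s) * (2 * K0) * (\<rho> / (sqrt eps * eps))" by (simp add: CQ_def)
  then have "CQ * \<rho> / eps = 2 powr (1 + s) * (2 * K0)" unfolding R by simp
  then have KE: "KE = K" by (simp add: KE_def K_def Cc_def)
  have "(l2norm (p t))\<^sup>2 \<le> 2 * (2 * T * (eps ^ 4 * A\<^sup>2)) * exp (4 * KE * t)"
    using error_bound[OF small t] zero_le_power2[of "l2norm (q t)"] by linarith
  also have "\<dots> \<le> 2 * (2 * T * (eps ^ 4 * A\<^sup>2)) * exp (4 * K * T)"
    unfolding KE[symmetric] using t T KE_ge_1 by (intro mult_left_mono) auto
  also have "\<dots> = (err_const s T A B * eps\<^sup>2)\<^sup>2"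
    unfolding err_const_def K_def[symmetric] power_mult_distrib using T by (simp flip: power_mult)
  finally show ?thesis
    by (rule power2_le_imp_le) (use T in \<open>auto simp: err_const_def\<close>)
qed

end

text \<open>Here the retraction acts as the identity, so the truncated equation is the true
  one.\<close>

locale small_error_flow = error_flow +
  assumes p_small: "\<And>t. t \<in> {0..T} \<Longrightarrow> l2norm (p t) \<le> \<rho>"
begin

definition Y :: "real \<Rightarrow> real \<Rightarrow> complex" where "Y t k = V t k + PW (p t) k"
definition Yd :: "real \<Rightarrow> real \<Rightarrow> complex" where "Yd t k = V' t k + cx (om k) * PW (q t) k"

lemma Y_deriv:
  "AE k in lborel. \<forall>t\<in>{0..T}. ((\<lambda>t. Y t k) has_vector_derivative Yd t k) (at t within {0..T})"
  using pq_deriv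
proof eventually_elim
  case (elim k)
  show ?case
  proof
    fix t assume t: "t \<in> {0..T}"
    then have P: "((\<lambda>t. p t k) has_vector_derivative om k * q t k) (at t within {0..T})" using elim by blast
    from has_vector_derivative_add[OF Vd[OF t, of k] bounded_linear.has_vector_derivative[OF bounded_linear_mult_left P, of "1 / cx (W k)"]]
    show "((\<lambda>t. Y t k) has_vector_derivative Yd t k) (at t within {0..T})" by (simp add: Y_def Yd_def PW_def)
  qed
qed

text \<open>The Boussinesq right-hand side on the slow scales, where the fourth derivative carries
  the factor \<open>eps\<^sup>2\<close>.\<close>

definition Y_rhs :: "real \<Rightarrow> real \<Rightarrow> complex"
  where "Y_rhs t k = - cx (k\<^sup>2) * (Y t k + cx (eps\<^sup>2 * k\<^sup>2) * Y t k + c0 * conv (Y t) (Y t) k)"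

lemma om_facts: "om k * om k = k\<^sup>2 * (1 + eps\<^sup>2 * k\<^sup>2)" "om k * mul k = k\<^sup>2 * W k"
proof -
  have a: "\<bar>k\<bar> * \<bar>k\<bar> = k\<^sup>2" by (simp add: power2_eq_square abs_mult_self_eq)
  have "wt 1 (eps * k) * wt 1 (eps * k) = 1 + eps\<^sup>2 * k\<^sup>2" using wt_add[of 1 1 "eps * k"] by (simp add: wt_2 power_mult_distrib)
  moreover have "om k * om k = (\<bar>k\<bar> * \<bar>k\<bar>) * (wt 1 (eps * k) * wt 1 (eps * k))" unfolding om_def by (simp only: mult_ac)
  ultimately show "om k * om k = k\<^sup>2 * (1 + eps\<^sup>2 * k\<^sup>2)" unfolding a by simp
  have "om k * mul k = (\<bar>k\<bar> * \<bar>k\<bar>) * (wt 1 (eps * k) * wt s (eps * k))" unfolding om_def mul_def by (simp only: mult_ac)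
  then show "om k * mul k = k\<^sup>2 * W k" unfolding a wt_add .
qed

lemma conv_Y:
  "conv (Y t) (Y t) k = conv (V t) (V t) k + 2 * conv (V t) (PW (p t)) k + conv (PW (p t)) (PW (p t)) k"
proof -
  note Vq = V_square_integrable[of t] and Pq = PW_facts(1)[OF ps[of t]]
  note I = conv_bound(1)[OF Vq Vq, of k] conv_bound(1)[OF Vq Pq, of k] conv_bound(1)[OF Pq Vq, of k] conv_bound(1)[OF Pq Pq, of k]
  have "conv (Y t) (Y t) k = conv (V t) (V t) k + conv (V t) (PW (p t)) k + (conv (PW (p t)) (V t) k + conv (PW (p t)) (PW (p t)) k)"
    unfolding conv_def Y_def using I by (simp add: distrib_left distrib_right)
  then show ?thesis unfolding conv_commute[of "PW (p t)" "V t"] by simp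
qed

text \<open>The identities for \<open>om * om\<close> and \<open>om * mul\<close> undo the
  weighting. The residual \<open>Hs\<close> supplies the dispersive term of the profile that its own
  equation lacks.\<close>

lemma Yd_deriv:
  "AE k in lborel. \<forall>t\<in>{0..T}. ((\<lambda>t. Yd t k) has_vector_derivative Y_rhs t k) (at t within {0..T})"
  using pq_deriv hH Vdd
proof eventually_elim
  case (elim k)
  show ?case
  proof
    fix t assume t: "t \<in> {0..T}"
    then have Q: "((\<lambda>t. q t k) has_vector_derivative H t (p t) k - om k * p t k) (at t within {0..T})"
      and V2: "((\<lambda>t. V' t k) has_vector_derivative whitham_rhs (V t) k) (at t within {0..T})" using elim by auto
    define w where "w = cx (W k)"
    define P where "P = PW (p t) k"
    have w0: "w \<noteq> 0" using wt_nonzero by (simp add: w_def)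
    have pP: "p t k = w * P" unfolding w_def P_def W_PW ..
    have ret: "ret \<rho> (p t) = p t" by (rule ret_props(4)[OF \<rho> ps p_small[OF t]])
    define o' m where "o' = cx (om k)" and "m = cx (mul k)"
    have oo: "o' * o' = cx (k\<^sup>2) * (1 + cx (eps\<^sup>2 * k\<^sup>2))" and om: "o' * m = cx (k\<^sup>2) * w"
      unfolding o'_def m_def w_def of_real_mult[symmetric] om_facts by simp_all
    define v where "v = 2 * (c0 * conv (V t) (PW (p t)) k) + c0 * conv (PW (p t)) (PW (p t)) k + cx (eps\<^sup>2 * k\<^sup>2) * V t k"
    have H: "H t (p t) k = - m * v"
      unfolding H_def Hl_def Hq_def Hs_def ret m_def[symmetric] v_def by (simp add: algebra_simps)
    have "o' / w * (H t (p t) k - o' * p t k) = - (o' * m) * v / w - (o' * o') * P"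
      unfolding H pP using w0 by (simp add: field_simps)
    also have "\<dots> = - cx (k\<^sup>2) * (v + (1 + cx (eps\<^sup>2 * k\<^sup>2)) * P)"
      unfolding oo om using w0 by (simp add: algebra_simps)
    finally have e: "whitham_rhs (V t) k + o' / w * (H t (p t) k - o' * p t k) = Y_rhs t k"
      unfolding Y_rhs_def conv_Y whitham_rhs_def v_def Y_def P_def[symmetric] by (simp add: algebra_simps)
    have f: "Yd t k = V' t k + o' / w * q t k" for t by (simp add: Yd_def PW_def o'_def w_def)
    show "((\<lambda>t. Yd t k) has_vector_derivative Y_rhs t k) (at t within {0..T})"
      unfolding f e[symmetric] o'_def by (rule has_vector_derivative_add[OF V2 bounded_linear.has_vector_derivative[OF bounded_linear_mult_right Q]])
  qed
qed

text \<open>The transform of the function \<open>(x, t) \<mapsto> f (eps * x, eps * t)\<close> for a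
  slow function \<open>f\<close>. In \<open>yd\<close> the factor \<open>eps\<close> from the time
  derivative cancels the factor \<open>1 / eps\<close>.\<close>

definition y :: "real \<Rightarrow> real \<Rightarrow> complex" where "y t k = cx (1 / eps) * Y (eps * t) (k / eps)"
definition yd :: "real \<Rightarrow> real \<Rightarrow> complex" where "yd t k = Yd (eps * t) (k / eps)"
text \<open>In \<open>d\<close> the envelope of the error keeps the gain of \<open>PW\<close>,
  because \<open>W (k / eps) = wt (1 + s) k\<close>. In \<open>e\<close> that gain has been spent on
  \<open>om\<close>.\<close>

definition d :: "real \<Rightarrow> real" where "d k = 1 / eps * (B (k / eps) + Bp (k / eps) / wt (1 + s) k)"
definition e :: "real \<Rightarrow> real" where "e k = B (k / eps) + 1 / eps * Bp (k / eps)"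

lemma scaled_time: "t \<in> {0..T / eps} \<Longrightarrow> eps * t \<in> {0..T}"
  using eps by (auto simp: field_simps)

lemma scaled_deriv:
  assumes f: "(f has_vector_derivative f') (at (eps * t) within {0..T})"
  shows "((\<lambda>t. f (eps * t)) has_vector_derivative cx eps * f') (at t within {0..T / eps})"
proof -
  have "((\<lambda>t. eps * t) has_vector_derivative eps) (at t within {0..T / eps})" by (auto intro!: derivative_eq_intros)
  moreover have "(f has_vector_derivative f') (at (eps * t) within (\<lambda>t. eps * t) ` {0..T / eps})"
    by (rule has_vector_derivative_within_subset[OF f]) (use scaled_time in auto)
  ultimately show ?thesis using vector_diff_chain_within[of "\<lambda>t. eps * t" eps t "{0..T / eps}" f f']
    by (simp add: o_def scaleR_conv_of_real)
qed

lemma AE_scaled: "AE k in lborel. P k \<Longrightarrow> AE k in lborel. P (k / eps)"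
  using AE_lborel_affine[of P "1 / eps" 0] eps by simp

lemma y_flow: "boussinesq_flow (1 + s) (T / eps) y yd d e"
proof
  note [measurable] = Vm V'm pm qm Bm L2_measurable[OF Bp(1)]
  show "1 + s \<ge> 1" using s by simp
  show "jointly_measurable y" unfolding y_def Y_def PW_def by measurable
  show "jointly_measurable yd" unfolding yd_def Yd_def PW_def by measurable
  show "d \<in> borel_measurable borel" unfolding d_def[abs_def] by measurable
  have WB: "L2 (\<lambda>k. W k * B k)"
  proof (rule L2_mono(1)[OF Bs])
    have "norm (W k * B k) \<le> norm (wt (1 + s) k * B k)" for k
      using mult_right_mono[OF wt_scale_le[of eps "1 + s" k] B0[of k]] eps s B0[of k] by (simp add: abs_mult)
    then show "AE k in lborel. norm (W k * B k) \<le> norm (wt (1 + s) k * B k)" by blast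
  qed measurable
  note ds = L2_affine(1)[OF L2_add(1)[OF WB Bp(1)], of "1 / eps" 0]
  have deq: "wt (1 + s) k * d k = 1 / eps * (W (0 + 1 / eps * k) * B (0 + 1 / eps * k) + Bp (0 + 1 / eps * k))" for k
  proof -
    have g: "w * (1 / eps * (b + c / w)) = 1 / eps * (w * b + c)" if "w \<noteq> 0" for w b c :: real
      using that by (simp add: distrib_left)
    have *: "eps * (0 + 1 / eps * k) = k" "0 + 1 / eps * k = k / eps" "eps * (k / eps) = k" using eps by auto
    show ?thesis unfolding d_def * by (rule g[OF wt_nonzero])
  qed
  show "L2 (\<lambda>k. wt (1 + s) k * d k)"
    unfolding deq using ds eps by (intro L2_cmult(1)) simp
  have "L2 (\<lambda>k. B k + 1 / eps * Bp k)"
    by (intro L2_add(1) L2_cmult(1) Bs0 Bp)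
  from L2_affine(1)[OF this, of "1 / eps" 0] show "L2 e" using eps by (simp add: e_def[abs_def])
  have Wk: "W (k / eps) = wt (1 + s) k" for k using eps by simp
  fix t k assume t': "t \<in> {0..T / eps}"
  note t = scaled_time[OF t']
  show "y t (- k) = cnj (y t k)"
    by (simp add: y_def Y_def PW_def Vh p_hermitian[OF t])
  have "norm (PW (p (eps * t)) (k / eps)) \<le> Bp (k / eps) / wt (1 + s) k"
    unfolding PW_def Wk using pq_bound(1)[OF t, of "k / eps"] by (simp add: norm_divide divide_right_mono)
  then have "norm (Y (eps * t) (k / eps)) \<le> B (k / eps) + Bp (k / eps) / wt (1 + s) k"
    unfolding Y_def using norm_triangle_ineq Vb[of "eps * t" "k / eps"] by (meson add_mono order_trans)
  then show "norm (y t k) \<le> d k"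
    unfolding y_def d_def norm_mult norm_of_real using eps by (simp add: divide_right_mono)
  have "om (k / eps) / wt (1 + s) k \<le> wt 1 k / eps"
  proof -
    have "om (k / eps) \<le> (wt 1 k / eps) * wt 1 k"
      unfolding om_def using abs_le_wt_1[of k] eps by (simp add: abs_divide divide_right_mono mult_right_mono)
    also have "\<dots> \<le> (wt 1 k / eps) * wt (1 + s) k" using s eps by (intro mult_left_mono wt_mono) auto
    finally show ?thesis by (simp add: divide_le_eq)
  qed
  moreover have "0 \<le> om (k / eps)" by (simp add: om_def)
  ultimately have "norm (cx (om (k / eps)) * PW (q (eps * t)) (k / eps)) \<le> (wt 1 k / eps) * Bp (k / eps)"
    unfolding PW_def Wk using mult_mono[of "om (k / eps) / wt (1 + s) k" "wt 1 k / eps" "norm (q (eps * t) (k / eps))" "Bp (k / eps)"] pq_bound(2)[OF t, of "k / eps"] eps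
    by (simp add: norm_mult norm_divide)
  then have "norm (Yd (eps * t) (k / eps)) \<le> B (k / eps) + (wt 1 k / eps) * Bp (k / eps)"
    unfolding Yd_def using norm_triangle_ineq V'b[of "eps * t" "k / eps"] by (meson add_mono order_trans)
  also have "\<dots> \<le> wt 2 k * B (k / eps) + wt 2 k * (1 / eps * Bp (k / eps))"
  proof (rule add_mono)
    show "B (k / eps) \<le> wt 2 k * B (k / eps)" using mult_right_mono[OF wt_ge_1[of 2 k] B0[of "k / eps"]] by simp
    have "wt 1 k * (1 / eps * Bp (k / eps)) \<le> wt 2 k * (1 / eps * Bp (k / eps))" using eps Bp(2) by (intro mult_right_mono wt_mono) auto
    then show "(wt 1 k / eps) * Bp (k / eps) \<le> wt 2 k * (1 / eps * Bp (k / eps))" by simp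
  qed
  finally show "norm (yd t k) \<le> wt 2 k * e k" by (simp add: yd_def e_def distrib_left)
next
  show "AE k in lborel. \<forall>t\<in>{0..T / eps}. ((\<lambda>t. y t k) has_vector_derivative yd t k) (at t within {0..T / eps})"
    using AE_scaled[OF Y_deriv]
  proof eventually_elim
    case (elim k)
    show ?case
    proof
      fix t assume "t \<in> {0..T / eps}"
      then have "((\<lambda>t. Y t (k / eps)) has_vector_derivative Yd (eps * t) (k / eps)) (at (eps * t) within {0..T})" using elim scaled_time by blast
      from bounded_linear.has_vector_derivative[OF bounded_linear_mult_right scaled_deriv[OF this], of "cx (1 / eps)"]
      show "((\<lambda>t. y t k) has_vector_derivative yd t k) (at t within {0..T / eps})" using eps by (simp add: y_def yd_def)
    qed
  qed
  show "AE k in lborel. \<forall>t\<in>{0..T / eps}. ((\<lambda>t. yd t k) has_vector_derivative boussinesq_rhs (y t) k) (at t within {0..T / eps})"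
    using AE_scaled[OF Yd_deriv]
  proof eventually_elim
    case (elim k)
    show ?case
    proof
      fix t assume "t \<in> {0..T / eps}"
      then have "((\<lambda>t. Yd t (k / eps)) has_vector_derivative Y_rhs (eps * t) (k / eps)) (at (eps * t) within {0..T})" using elim scaled_time by blast
      note D = scaled_deriv[OF this]
      have "y t = (\<lambda>k. cx (1 / eps) * Y (eps * t) (k / eps))" by (simp add: y_def[abs_def])
      then have c: "conv (y t) (y t) k = cx (1 / eps) * conv (Y (eps * t)) (Y (eps * t)) (k / eps)"
        using rescaled_conv[OF eps(1), of "Y (eps * t)" k] by simp
      have "cx eps * Y_rhs (eps * t) (k / eps) = boussinesq_rhs (y t) k"
      proof -
        have "a * (- (x / a)\<^sup>2 * (Z + (a\<^sup>2 * (x / a)\<^sup>2) * Z + c * w)) = - x\<^sup>2 * (1 / a * Z + x\<^sup>2 * (1 / a * Z) + c * (1 / a * w))"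
          if "a \<noteq> 0" for a x Z c w :: complex
          using that by (simp add: power_divide power2_eq_square algebra_simps)
        moreover have "cx eps \<noteq> 0" using eps by simp
        ultimately show ?thesis
          unfolding boussinesq_rhs_def Y_rhs_def c y_def of_real_mult of_real_power of_real_divide of_real_1 by blast
      qed
      then show "((\<lambda>t. yd t k) has_vector_derivative boussinesq_rhs (y t) k) (at t within {0..T / eps})"
        using D by (simp add: yd_def)
    qed
  qed
qed

text \<open>The scaled weight becomes the true Sobolev weight at frequency \<open>k\<close>, so the
  error in physical variables is \<open>p\<close> dilated by \<open>1 / eps\<close> with prefactor
  \<open>1 / eps\<close>; its mean square norm carries the factor
  \<open>1 / sqrt eps\<close>.\<close>

lemma y_error:
  assumes t': "t \<in> {0..T / eps}" and U: "U \<in> sobolev r" "r \<ge> 1" and VU: "AE k in lborel. V (eps * t) k = fourier U k"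
  shows "sobolev_norm (1 + s) (\<lambda>x. boussinesq_flow.u y x t - U (eps * x)) = l2norm (p (eps * t)) / sqrt eps"
proof -
  interpret F: boussinesq_flow "1 + s" "T / eps" y yd d e by (rule y_flow)
  note t = scaled_time[OF t']
  define v where "v = (\<lambda>k. cx (1 / eps) * V (eps * t) (k / eps))"
  define P where "P = (\<lambda>k. cx (1 / eps) * PW (p (eps * t)) (k / eps))"
  have yv: "y t k - v k = P k" for k by (simp add: y_def v_def P_def Y_def algebra_simps)
  note PF = PW_facts[OF ps[of "eps * t"]]
  have aff: "integrable lborel f \<Longrightarrow> integrable lborel (\<lambda>k. f (k / eps))" for f :: "real \<Rightarrow> complex"
    using lborel_integrable_real_affine[of f "1 / eps" 0] eps by simp
  have affs: "L2 f \<Longrightarrow> L2 (\<lambda>k. f (k / eps))" for f :: "real \<Rightarrow> complex"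
    using L2_affine(1)[of f "1 / eps" 0] eps by simp
  have Vi: "integrable lborel (V (eps * t))" by (rule weighted_facts(1)[OF Vs _ Vt]) (use s in simp)
  have "integrable lborel P" unfolding P_def by (intro Bochner_Integration.integrable_mult_right aff PF)
  moreover have "L2 P" unfolding P_def by (intro L2_cmult(1) affs PF)
  ultimately have Pi: "integrable lborel P" "L2 P" by blast+
  have vi: "integrable lborel v" unfolding v_def using aff[OF Vi] by simp
  have yi: "integrable lborel (y t)"
  proof -
    have "y t = (\<lambda>k. v k + P k)" using yv by (auto simp: algebra_simps)
    then show ?thesis using vi Pi by simp
  qed
  note Ui = sobolev_inversion[OF U] and Usq = sobolev_square_integrable[OF U(1)]
  have Um [measurable]: "U \<in> borel_measurable borel" using Usq by auto
  have UV: "AE x in lborel. cx (U x) = ft (V (eps * t)) (- x)"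
  proof -
    have "ft (V (eps * t)) k = ft (fourier U) k" for k
      by (rule ft_cong_AE[OF VU Vt]) (use Ui(1) in auto)
    then show ?thesis using Ui(2) by simp
  qed
  have Ue: "AE x in lborel. cx (U (eps * x)) = ft (V (eps * t)) (- (eps * x))"
    using AE_lborel_affine[OF UV, of eps 0] eps by simp
  have um: "(\<lambda>x. F.u x t) \<in> borel_measurable borel"
    using F.uS[OF t'] by (auto simp: sobolev_def square_integrable_def)
  have ur: "cx (F.u x t) = ft (y t) (- x)" for x
    unfolding F.u_def by (rule ft_real_on_hermitian) (rule F.yh[OF t'])
  have eq: "AE x in lborel. cx (F.u x t - U (eps * x)) = ft P (- x)"
    using Ue
  proof eventually_elim
    case (elim x)
    have "ft P (- x) = ft (\<lambda>k. y t k - v k) (- x)" unfolding yv ..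
    also have "\<dots> = ft (y t) (- x) - ft v (- x)" by (rule ft_diff[OF yi vi])
    also have "ft v (- x) = ft (V (eps * t)) (- (eps * x))" unfolding v_def by (rule rescaled_transform[OF eps(1)])
    finally show ?case using elim by (simp add: ur)
  qed
  have dm: "(\<lambda>x. F.u x t - U (eps * x)) \<in> borel_measurable borel" using um by measurable
  note FI = fourier_inverse[OF Pi dm eq]
  have "sobolev_norm (1 + s) (\<lambda>x. F.u x t - U (eps * x)) = l2norm (\<lambda>k. cx (1 / eps) * p (eps * t) (0 + 1 / eps * k))"
    unfolding sobolev_norm_eq[OF FI(1)]
  proof (rule l2norm_cong_AE)
    show "AE k in lborel. norm (cx (wt (1 + s) k) * fourier (\<lambda>x. F.u x t - U (eps * x)) k) = norm (cx (1 / eps) * p (eps * t) (0 + 1 / eps * k))"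
      using FI(2)
    proof eventually_elim
      case (elim k)
      have "cx (wt (1 + s) k) * P k = cx (1 / eps) * (cx (W (k / eps)) * PW (p (eps * t)) (k / eps))"
        using eps by (simp add: P_def)
      then show ?case unfolding elim W_PW by simp
    qed
    note [measurable] = L2_measurable[OF fourier_L2FT(2)[OF FI(1)]] pt[of "eps * t"]
    show "(\<lambda>k. cx (wt (1 + s) k) * fourier (\<lambda>x. F.u x t - U (eps * x)) k) \<in> borel_measurable borel" by measurable
    show "(\<lambda>k. cx (1 / eps) * p (eps * t) (0 + 1 / eps * k)) \<in> borel_measurable borel" by measurable
  qed
  also have "\<dots> = 1 / eps * (l2norm (p (eps * t)) / sqrt (1 / eps))"
    using L2_cmult(2)[OF L2_affine(1)[OF ps[of "eps * t"], of "1 / eps" 0], of "cx (1 / eps)"]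
      L2_affine(2)[OF ps[of "eps * t"], of "1 / eps" 0] eps by (simp add: norm_divide)
  also have "\<dots> = l2norm (p (eps * t)) / sqrt eps"
  proof -
    have "1 / (r * r) * (L / (1 / r)) = L / r" for r L :: real by simp
    from this[of "sqrt eps" "l2norm (p (eps * t))"] show ?thesis using eps by (simp add: real_sqrt_divide)
  qed
  finally show ?thesis .
qed

end

lemma (in error_problem) error_flow_exists: "\<exists>p h. error_flow s T A V V' B eps \<rho> p h"
proof -
  obtain p h where ph: "jointly_measurable p" "jointly_measurable h"
    "\<forall>t k. h t (- k) = cnj (h t k)" "\<forall>t. L2 (p t)" "\<forall>k. set_integrable lborel {0..T} (\<lambda>\<tau>. h \<tau> k)"
    "L2 (\<lambda>k. LBINT \<tau>:{0..T}. norm (h \<tau> k))" "\<forall>t\<in>{0..T}. \<forall>k. p t k = duhamel ksin h t k"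
    "AE k in lborel. \<forall>t\<in>{0..T}. h t k = H t (p t) k"
    using error_solution by (elim exE conjE)
  have "error_flow s T A V V' B eps \<rho> p h" by unfold_locales (fact ph | rule ph[rule_format]; assumption)+
  then show ?thesis by blast
qed

text \<open>The bound on \<open>eps\<close> makes the proved error \<open>C * eps\<^sup>2\<close>
  smaller than the truncation radius \<open>eps powr (3 / 2)\<close> and also ensures
  \<open>eps \<le> 1\<close>. Adding \<open>1\<close> to the constant keeps it positive when the
  error constant is zero.\<close>

lemma (in profile) approximation:
  assumes small: "4 * (K0 * A) \<le> 1" and eps: "eps > 0" "eps < 1 / (err_const s T A B + 1)\<^sup>2"
    and U: "\<And>t. t \<in> {0..T} \<Longrightarrow> (\<lambda>x. U x t) \<in> sobolev (3 + s)"
    and VU: "\<And>t. t \<in> {0..T} \<Longrightarrow> AE k in lborel. V t k = fourier (\<lambda>x. U x t) k"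
  shows "\<exists>u. continuous_in_sobolev (1 + s) (T / eps) u \<and> boussinesq_solution (T / eps) u \<and>
    (\<forall>t\<in>{0..T / eps}. sobolev_norm (1 + s) (\<lambda>x. u x t - U (eps * x) (eps * t)) \<le> (err_const s T A B + 1) * eps powr (3 / 2))"
proof -
  define C where "C = err_const s T A B"
  have C: "C \<ge> 0" using T by (simp add: C_def err_const_def)
  have "1 \<le> (C + 1)\<^sup>2" using C by simp
  then have "1 / (C + 1)\<^sup>2 \<le> 1" by (simp add: divide_le_eq)
  then have eps1: "eps \<le> 1" using eps(2) unfolding C_def by linarith
  have "((C + 1) * sqrt eps)\<^sup>2 \<le> 1"
    using eps C unfolding C_def[symmetric] by (simp add: power_mult_distrib less_divide_eq mult.commute)
  then have Ce: "(C + 1) * sqrt eps \<le> 1" using power2_le_imp_le[of "(C + 1) * sqrt eps" 1] by simp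
  have sq: "eps\<^sup>2 = eps powr (3 / 2) * sqrt eps"
  proof -
    have "eps powr (3 / 2) * eps powr (1 / 2) = eps powr 2" unfolding powr_add[symmetric] by simp
    then show ?thesis using eps by (simp add: powr_half_sqrt)
  qed
  interpret E: error_problem s T A V V' B eps "eps powr (3 / 2)"
    by unfold_locales (use eps eps1 in auto)
  obtain p h where F: "error_flow s T A V V' B eps (eps powr (3 / 2)) p h"
    using E.error_flow_exists by blast
  interpret F: error_flow s T A V V' B eps "eps powr (3 / 2)" p h by (rule F)
  have pb: "l2norm (p t) \<le> C * eps\<^sup>2" if "t \<in> {0..T}" for t
    unfolding C_def by (rule F.error_bound_explicit[OF small refl that])
  have ps: "l2norm (p t) \<le> eps powr (3 / 2)" if t: "t \<in> {0..T}" for t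
  proof -
    have "C * eps\<^sup>2 = eps powr (3 / 2) * (C * sqrt eps)" unfolding sq by simp
    also have "\<dots> \<le> eps powr (3 / 2) * 1"
    proof (rule mult_left_mono)
      have "sqrt eps \<ge> 0" using eps by simp
      then show "C * sqrt eps \<le> 1" using Ce unfolding distrib_right by linarith
    qed simp
    finally show ?thesis using pb[OF t] by simp
  qed
  interpret S: small_error_flow s T A V V' B eps "eps powr (3 / 2)" p h
    by unfold_locales (rule ps)
  interpret Q: boussinesq_flow "1 + s" "T / eps" S.y S.yd S.d S.e by (rule S.y_flow)
  have "sobolev_norm (1 + s) (\<lambda>x. Q.u x t - U (eps * x) (eps * t)) \<le> (C + 1) * eps powr (3 / 2)" if t: "t \<in> {0..T / eps}" for t
  proof -
    note t' = S.scaled_time[OF t]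
    have "sobolev_norm (1 + s) (\<lambda>x. Q.u x t - U (eps * x) (eps * t)) = l2norm (p (eps * t)) / sqrt eps"
      by (rule S.y_error[OF t U[OF t'] _ VU[OF t']]) (use s in simp)
    also have "\<dots> \<le> C * eps\<^sup>2 / sqrt eps" using pb[OF t'] eps by (intro divide_right_mono) auto
    also have "\<dots> = C * eps powr (3 / 2)" unfolding sq using eps by simp
    also have "\<dots> \<le> (C + 1) * eps powr (3 / 2)" by (intro mult_right_mono) auto
    finally show ?thesis .
  qed
  then show ?thesis using Q.u_continuous Q.u_solution unfolding C_def by blast
qed

theorem theorem1p3:
  fixes s :: real
  assumes "s \<ge> 0"
  shows "\<exists>C\<^sub>1>0. \<forall>T\<^sub>0>0. \<forall>U :: real \<Rightarrow> real \<Rightarrow> real.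
    continuous_in_sobolev (3 + s) T\<^sub>0 U \<and>
    whitham_solution T\<^sub>0 U \<and>
    (\<forall>T\<in>{0..T\<^sub>0}. sobolev_norm (3 + s) (\<lambda>X. U X T) \<le> C\<^sub>1) \<longrightarrow>
    (\<exists>\<epsilon>\<^sub>0>0. \<exists>C>0. \<forall>\<epsilon>. 0 < \<epsilon> \<and> \<epsilon> < \<epsilon>\<^sub>0 \<longrightarrow>
      (\<exists>u :: real \<Rightarrow> real \<Rightarrow> real.
        continuous_in_sobolev (1 + s) (T\<^sub>0 / \<epsilon>) u \<and>
        boussinesq_solution (T\<^sub>0 / \<epsilon>) u \<and>
        (\<forall>t\<in>{0..T\<^sub>0 / \<epsilon>}.
          sobolev_norm (1 + s) (\<lambda>x. u x t - U (\<epsilon> * x) (\<epsilon> * t)) \<le> C * \<epsilon> powr (3 / 2))))"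
proof (rule exI[of _ "1 / (4 * (K0 + 1))"], intro conjI allI impI)
  \<comment> \<open>The threshold for the profile comes from coercivity: the integral of its
    transform is at most \<open>K0 * A\<close>, which must not exceed \<open>1 / 4\<close>. With
    \<open>K0 + 1\<close> in the denominator the quotient is defined without knowing that
    \<open>K0\<close> is positive.\<close>
  define A where "A = 1 / (4 * (K0 + 1))"
  have K: "K0 + 1 > 0" using K0_nonneg by linarith
  then show "1 / (4 * (K0 + 1)) > 0" by simp
  have A: "A \<ge> 0" using K by (simp add: A_def)
  have small: "4 * (K0 * A) \<le> 1" using K by (simp add: A_def divide_le_eq)
  fix T :: real and U :: "real \<Rightarrow> real \<Rightarrow> real"
  assume T: "T > 0"
    and "continuous_in_sobolev (3 + s) T U \<and> whitham_solution T U \<and> (\<forall>t\<in>{0..T}. sobolev_norm (3 + s) (\<lambda>x. U x t) \<le> 1 / (4 * (K0 + 1)))"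
  then have U: "continuous_in_sobolev (3 + s) T U" "whitham_solution T U"
    and b: "\<And>t. t \<in> {0..T} \<Longrightarrow> sobolev_norm (3 + s) (\<lambda>x. U x t) \<le> A" by (auto simp: A_def)
  obtain V V' B where P: "profile s T A V V' B" and VU: "\<forall>t\<in>{0..T}. AE k in lborel. V t k = fourier (\<lambda>x. U x t) k"
    by (insert whitham_profile[OF T assms U b A]) blast
  interpret profile s T A V V' B by (rule P)
  have C: "err_const s T A B + 1 > 0" using T by (simp add: err_const_def add_nonneg_pos)
  show "\<exists>\<epsilon>\<^sub>0>0. \<exists>C>0. \<forall>\<epsilon>. 0 < \<epsilon> \<and> \<epsilon> < \<epsilon>\<^sub>0 \<longrightarrow>
      (\<exists>u :: real \<Rightarrow> real \<Rightarrow> real.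
        continuous_in_sobolev (1 + s) (T / \<epsilon>) u \<and>
        boussinesq_solution (T / \<epsilon>) u \<and>
        (\<forall>t\<in>{0..T / \<epsilon>}.
          sobolev_norm (1 + s) (\<lambda>x. u x t - U (\<epsilon> * x) (\<epsilon> * t)) \<le> C * \<epsilon> powr (3 / 2)))"
  proof (rule exI[of _ "1 / (err_const s T A B + 1)\<^sup>2"], intro exI[of _ "err_const s T A B + 1"] conjI allI impI)
    fix \<epsilon> :: real assume \<epsilon>: "0 < \<epsilon> \<and> \<epsilon> < 1 / (err_const s T A B + 1)\<^sup>2"
    show "\<exists>u :: real \<Rightarrow> real \<Rightarrow> real.
        continuous_in_sobolev (1 + s) (T / \<epsilon>) u \<and>
        boussinesq_solution (T / \<epsilon>) u \<and>
        (\<forall>t\<in>{0..T / \<epsilon>}.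
          sobolev_norm (1 + s) (\<lambda>x. u x t - U (\<epsilon> * x) (\<epsilon> * t)) \<le> (err_const s T A B + 1) * \<epsilon> powr (3 / 2))"
      by (rule approximation[OF small]) (use \<epsilon> VU U(1) in \<open>auto simp: continuous_in_sobolev_def\<close>)
  qed (use C in auto)
qed

end
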